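(* Let $0<\alpha<1$ and $n_0\ge1$. Let $(Z^i)_{i\ge0}$ be independent $Q_\alpha$-Markov chains with $Z^0(0)=n_0$ and $Z^i(0)=1$ for $i\ge1$, with absorption times $\zeta_i=\inf\{s\ge0\colon Z^i(s)=0\}$, and let $(J_t)_{t\ge0}$ be an independent Poisson process of rate $\alpha$. Let $X_t=-t+\sum_{i=0}^{J_t}\zeta_i$, $t\ge0$. Then, as $n\to\infty$, $$\left(\frac{X_{2n^{1+\alpha}t}}{2n}\right)_{t\ge0}\stackrel{D}{\longrightarrow}{\tt Stable}(1+\alpha)$$ in distribution on $\mathbb{D}([0,\infty),\mathbb{R})$ with the Skorokhod topology, where ${\tt Stable}(1+\alpha)$ is the law of a spectrally positive stable Lévy process $(\overline X_t)_{t\ge 0}$ started at $0$ with Laplace exponent $\psi(\lambda)=\lambda^{1+\alpha}/(2^\alpha\Gamma(1+\alpha))$, i.e.\ $\mathbb{E}[e^{-\lambda\overline X_t}]=e^{t\psi(\lambda)}$ for $\lambda\ge 0$.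
   Context: A $Q_\alpha$-Markov chain is a continuous-time Markov chain on $\mathbb{N}_0$ whose only nonzero off-diagonal rates are $q_\alpha(m,m+1)=m-\alpha$ and $q_\alpha(m,m-1)=m$ for $m\ge1$. *)

theory Defs
  imports "HOL-Probability.Probability"
begin

definition qa :: "real \<Rightarrow> nat \<Rightarrow> nat \<Rightarrow> real" where
  "qa \<alpha> m k =
     (if 1 \<le> m \<and> k = m + 1 then real m - \<alpha>
      else if 1 \<le> m \<and> k = m - 1 then real m
      else if k = m then (if 1 \<le> m then - (2 * real m - \<alpha>) else 0)
      else 0)"

text \<open>Transition function of the Q_alpha-chain: a non-negative, sub-stochastic solution of
  Kolmogorov's backward equations with P_0 = identity.  (Since the chain is non-explosive,
  the minimal solution is honest and hence this solution is unique.)\<close>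
definition Qa_transition :: "real \<Rightarrow> (real \<Rightarrow> nat \<Rightarrow> nat \<Rightarrow> real) \<Rightarrow> bool" where
  "Qa_transition \<alpha> P \<longleftrightarrow>
     (\<forall>t\<ge>0. \<forall>i j. 0 \<le> P t i j) \<and>
     (\<forall>t\<ge>0. \<forall>i. summable (P t i) \<and> suminf (P t i) \<le> 1) \<and>
     (\<forall>i j. P 0 i j = (if i = j then 1 else 0)) \<and>
     (\<forall>t\<ge>0. \<forall>i j. ((\<lambda>s. P s i j) has_real_derivative
          (\<Sum>k\<in>{i - 1..i + 1}. qa \<alpha> i k * P t k j)) (at t within {0..}))"

definition Qa_chain :: "real \<Rightarrow> 'a measure \<Rightarrow> nat \<Rightarrow> (real \<Rightarrow> 'a \<Rightarrow> nat) \<Rightarrow> bool" where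
  "Qa_chain \<alpha> M n0 Z \<longleftrightarrow>
     (\<forall>t. Z t \<in> measurable M (count_space UNIV)) \<and>
     (\<forall>\<omega>. \<forall>t\<ge>0. continuous (at_right t) (\<lambda>s. real (Z s \<omega>))) \<and>
     (\<exists>P. Qa_transition \<alpha> P \<and>
        (\<forall>(k::nat) (ts::nat \<Rightarrow> real) (js::nat \<Rightarrow> nat).
           ts 0 = 0 \<longrightarrow> (\<forall>i<k. ts i < ts (Suc i)) \<longrightarrow>
           measure M {\<omega>\<in>space M. \<forall>i\<le>k. Z (ts i) \<omega> = js i} =
             (if js 0 = n0 then 1 else 0) *
             (\<Prod>i<k. P (ts (Suc i) - ts i) (js i) (js (Suc i)))))"

definition poisson_process :: "'a measure \<Rightarrow> real \<Rightarrow> (real \<Rightarrow> 'a \<Rightarrow> nat) \<Rightarrow> bool" where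
  "poisson_process M r J \<longleftrightarrow>
     (\<forall>t. J t \<in> measurable M (count_space UNIV)) \<and>
     (\<forall>\<omega>. J 0 \<omega> = 0 \<and> mono_on {0..} (\<lambda>t. J t \<omega>) \<and>
          (\<forall>t\<ge>0. continuous (at_right t) (\<lambda>s. real (J s \<omega>)))) \<and>
     (\<forall>(k::nat) (ts::nat \<Rightarrow> real). 0 \<le> ts 0 \<longrightarrow> (\<forall>i<k. ts i < ts (Suc i)) \<longrightarrow>
        prob_space.indep_vars M (\<lambda>_. count_space UNIV)
          (\<lambda>i \<omega>. J (ts (Suc i)) \<omega> - J (ts i) \<omega>) {..<k}) \<and>
     (\<forall>s t (n::nat). 0 \<le> s \<longrightarrow> s \<le> t \<longrightarrow>
        measure M {\<omega>\<in>space M. J t \<omega> - J s \<omega> = n} =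
          exp (- (r * (t - s))) * (r * (t - s)) ^ n / fact n)"

definition cadlag :: "(real \<Rightarrow> real) \<Rightarrow> bool" where
  "cadlag x \<longleftrightarrow> (\<forall>t\<ge>0. continuous (at_right t) x \<and>
                     (0 < t \<longrightarrow> (\<exists>l. (x \<longlongrightarrow> l) (at_left t))))"

text \<open>Skorokhod J1 convergence in D([0,oo),R) (Billingsley, Convergence of Probability Measures,
  Thm 16.2): there are continuous strictly increasing bijections lam_n of [0,oo) with
  sup_t |lam_n t - t| -> 0 and sup_{t<=T} |x_n (lam_n t) - x t| -> 0 for every T.\<close>
definition skorokhod_conv :: "(nat \<Rightarrow> real \<Rightarrow> real) \<Rightarrow> (real \<Rightarrow> real) \<Rightarrow> bool" where
  "skorokhod_conv xs x \<longleftrightarrow>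
     (\<exists>lam :: nat \<Rightarrow> real \<Rightarrow> real.
        (\<forall>n. continuous_on {0..} (lam n) \<and> strict_mono_on {0..} (lam n) \<and>
             lam n ` {0..} = {0..}) \<and>
        (\<forall>e>0. eventually (\<lambda>n. \<forall>t\<ge>0. \<bar>lam n t - t\<bar> \<le> e) sequentially) \<and>
        (\<forall>T\<ge>0. \<forall>e>0. eventually (\<lambda>n. \<forall>t\<in>{0..T}. \<bar>xs n (lam n t) - x t\<bar> \<le> e) sequentially))"

text \<open>Continuity of a functional on D w.r.t. the (metrizable) Skorokhod topology,
  expressed sequentially.\<close>
definition skorokhod_continuous :: "((real \<Rightarrow> real) \<Rightarrow> real) \<Rightarrow> bool" where
  "skorokhod_continuous F \<longleftrightarrow>
     (\<forall>xs x. (\<forall>n. cadlag (xs n)) \<longrightarrow> cadlag x \<longrightarrow> skorokhod_conv xs x \<longrightarrow>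
        (\<lambda>n. F (xs n)) \<longlonglongrightarrow> F x)"

definition stable_psi :: "real \<Rightarrow> real \<Rightarrow> real" where
  "stable_psi \<alpha> l = l powr (1 + \<alpha>) / (2 powr \<alpha> * Gamma (1 + \<alpha>))"

definition stable_levy :: "real \<Rightarrow> 'b measure \<Rightarrow> (real \<Rightarrow> 'b \<Rightarrow> real) \<Rightarrow> bool" where
  "stable_levy \<alpha> N Xb \<longleftrightarrow>
     prob_space N \<and>
     (\<forall>t. Xb t \<in> borel_measurable N) \<and>
     (\<forall>\<omega>. cadlag (\<lambda>t. Xb t \<omega>)) \<and>
     (AE \<omega> in N. Xb 0 \<omega> = 0) \<and>
     (\<forall>(k::nat) (ts::nat \<Rightarrow> real). 0 \<le> ts 0 \<longrightarrow> (\<forall>i<k. ts i < ts (Suc i)) \<longrightarrow>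
        prob_space.indep_vars N (\<lambda>_. borel)
          (\<lambda>i \<omega>. Xb (ts (Suc i)) \<omega> - Xb (ts i) \<omega>) {..<k}) \<and>
     (\<forall>s t. 0 \<le> s \<longrightarrow> s \<le> t \<longrightarrow>
        distr N borel (\<lambda>\<omega>. Xb t \<omega> - Xb s \<omega>) = distr N borel (Xb (t - s))) \<and>
     (\<forall>t\<ge>0. \<forall>l\<ge>0. (\<integral>\<omega>. exp (- l * Xb t \<omega>) \<partial>N) = exp (t * stable_psi \<alpha> l))"

end

theory Submission
  imports Defs "HOL-Real_Asymp.Real_Asymp" "HOL-Complex_Analysis.Complex_Analysis"
begin

text \<open>The law of a path in D is determined by the joint Laplace transforms of its initial value and
  increments, and tightness is avoided by a coupling. Laplace transforms of Kolmogorov's backward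
  equations give E exp(-l zeta) = 1 - (l - psi l) / alpha for the lifetime zeta started at 1, with
  1 / psi l = int_0^oo exp(-l t) (1 + t)^alpha dt, so apart from its initial value X is a Levy process
  with exponent psi, and 2 n^(1+alpha) psi (l / 2n) tends to the stable exponent. All rescaled processes
  and the limit are then realised on a single Poisson random measure on the quadrant with
  points (s, u), as compensated sums of the jumps g_n u over s <= t, where the g_n are decreasing.
  Convergence of the exponents forces g_n u --> g u with g u proportional to u^(-1/(1+alpha)), and
  int min(|g_n - g|, |g_n - g|^2) --> 0. An exponential maximal inequality for the differences yields
  almost surely locally uniform convergence along subsequences, hence Skorokhod convergence.\<close>

section \<open>Skorokhod convergence and discretised paths\<close>

text \<open>Two restrictions shape the proof. The limiting jumps are positive with infinite
  variance, so laws are accessible only through E exp(-l X) with l \<ge> 0, and uniform bounds must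
  treat small jumps (by exponential martingales) and large jumps (by their integrable size)
  separately. Moreover the path space carries no sigma-algebra: a functional is known only through
  sequential continuity, hence through its values on step paths, which depend on finitely many
  increments. The function (1 + t)^\<alpha> is the scale function of X. The transforms of t^m (1 +
  t)^(\<alpha>-m) satisfy, for m \<ge> 1, the same recursion over the starting state m as those of
  the extinction probabilities, and the row m = 0 produces the formula for the lifetime. The mean
  lifetime is 1/\<alpha>, so the drift -1 exactly compensates the jumps; this is why compensated
  sums represent X. The limiting constant comes from psi l ~ l^(1+\<alpha>) / Gamma (1+\<alpha>) at
  0 and 2 n^(1+\<alpha>) (l/(2n))^(1+\<alpha>) = l^(1+\<alpha>) / 2^\<alpha>. The stable process is
  not constructed beforehand: it arises as a limit of compensated sums, which also settles
  existence.\<close>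

lemma skorokhod_conv_uniform:
  assumes "\<And>T e. 0 \<le> T \<Longrightarrow> 0 < e \<Longrightarrow> eventually (\<lambda>n. \<forall>t\<in>{0..T}. \<bar>xs n t - x t\<bar> \<le> e) sequentially"
  shows "skorokhod_conv xs x"
  unfolding skorokhod_conv_def
proof (intro exI[of _ "\<lambda>n t. t"] conjI allI impI)
  fix n show "strict_mono_on {0..} (\<lambda>t::real. t)" by (simp add: strict_mono_on_def)
qed (use assms in auto)

text \<open>Bolzano's subdivision principle applies: the property is additive over adjacent
  intervals, and near each point it follows from the one-sided limits there. The condition on
  \<open>S \<inter> {s<..t}\<close> says that s and t lie in one half-open cell.\<close>

lemma cadlag_partition:
  assumes x: "cadlag x" and "0 < \<epsilon>" "0 \<le> T"
  shows "\<exists>S. finite S \<and> S \<subseteq> {0..T} \<and> 0 \<in> S \<and>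
    (\<forall>s t. 0 \<le> s \<longrightarrow> s \<le> t \<longrightarrow> t < T \<longrightarrow> S \<inter> {s<..t} = {} \<longrightarrow> \<bar>x s - x t\<bar> \<le> \<epsilon>)"
proof -
  define P where "P a b \<longleftrightarrow> (0 \<le> a \<longrightarrow> a \<le> b \<longrightarrow> (\<exists>S. finite S \<and> S \<subseteq> {a..b} \<and> a \<in> S \<and>
    (\<forall>s t. a \<le> s \<longrightarrow> s \<le> t \<longrightarrow> t < b \<longrightarrow> S \<inter> {s<..t} = {} \<longrightarrow> \<bar>x s - x t\<bar> \<le> \<epsilon>)))" for a b
  have "P 0 T"
  proof (rule Bolzano[OF \<open>0 \<le> T\<close>])
    fix a b c assume P: "P a b" "P b c" and ab: "a \<le> b" "b \<le> c"
    show "P a c" unfolding P_def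
    proof (intro impI)
      assume "0 \<le> a"
      with P ab obtain S S' where S: "finite S" "S \<subseteq> {a..b}" "a \<in> S"
        "\<And>s t. a \<le> s \<Longrightarrow> s \<le> t \<Longrightarrow> t < b \<Longrightarrow> S \<inter> {s<..t} = {} \<Longrightarrow> \<bar>x s - x t\<bar> \<le> \<epsilon>"
        and S': "finite S'" "S' \<subseteq> {b..c}" "b \<in> S'"
        "\<And>s t. b \<le> s \<Longrightarrow> s \<le> t \<Longrightarrow> t < c \<Longrightarrow> S' \<inter> {s<..t} = {} \<Longrightarrow> \<bar>x s - x t\<bar> \<le> \<epsilon>"
        unfolding P_def by force
      show "\<exists>S. finite S \<and> S \<subseteq> {a..c} \<and> a \<in> S \<and>
        (\<forall>s t. a \<le> s \<longrightarrow> s \<le> t \<longrightarrow> t < c \<longrightarrow> S \<inter> {s<..t} = {} \<longrightarrow> \<bar>x s - x t\<bar> \<le> \<epsilon>)"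
      proof (intro exI[of _ "S \<union> S'"] conjI allI impI)
        fix s t assume st: "a \<le> s" "s \<le> t" "t < c" "(S \<union> S') \<inter> {s<..t} = {}"
        consider "t < b" | "b \<le> s" | "s < b" "b \<le> t" by linarith
        then show "\<bar>x s - x t\<bar> \<le> \<epsilon>"
        proof cases
          case 1 then show ?thesis using S(4)[of s t] st by blast
        next
          case 2 then show ?thesis using S'(4)[of s t] st by blast
        next
          case 3 then show ?thesis using S'(3) st by auto
        qed
      qed (use S S' ab in auto)
    qed
  next
    fix y assume y: "0 \<le> y" "y \<le> T"
    have "(x \<longlongrightarrow> x y) (at_right y)"
      using x y by (simp add: cadlag_def continuous_within)
    from tendstoD[OF this, of "\<epsilon>/2"] \<open>0 < \<epsilon>\<close>
    obtain d1 where d1: "d1 > y" "\<And>t. y < t \<Longrightarrow> t < d1 \<Longrightarrow> \<bar>x t - x y\<bar> < \<epsilon>/2"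
      by (auto simp: eventually_at_right_field dist_real_def)
    have "\<exists>d2 l. d2 < y \<and> (\<forall>t\<ge>0. d2 < t \<longrightarrow> t < y \<longrightarrow> \<bar>x t - l\<bar> < \<epsilon>/2)"
    proof (cases "0 < y")
      case True
      then obtain l where l: "(x \<longlongrightarrow> l) (at_left y)" using x y unfolding cadlag_def by blast
      from tendstoD[OF this, of "\<epsilon>/2"] \<open>0 < \<epsilon>\<close> show ?thesis
        by (auto simp: eventually_at_left_field dist_real_def)
    next
      \<comment> \<open>At 0 there is no left limit; the claim is vacuous for any d2 below
        0.\<close>
      case False
      then show ?thesis by (intro exI[of _ "y-1"]) auto
    qed
    then obtain d2 l where d2: "d2 < y" "\<And>t. 0 \<le> t \<Longrightarrow> d2 < t \<Longrightarrow> t < y \<Longrightarrow> \<bar>x t - l\<bar> < \<epsilon>/2" by blast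
    \<comment> \<open>The point y itself becomes a partition point because x may jump there: s and t
      are then both below y or both at or above y.\<close>
    have "P a b" if ab: "a \<le> y" "y \<le> b" "b - a < min (d1 - y) (y - d2)" for a b
      unfolding P_def
    proof (intro impI exI[of _ "{a, y, b}"] conjI allI)
      fix s t assume a: "0 \<le> a" and st: "a \<le> s" "s \<le> t" "t < b" "{a, y, b} \<inter> {s<..t} = {}"
      consider "t < y" | "y \<le> s" using st by force
      then show "\<bar>x s - x t\<bar> \<le> \<epsilon>"
      proof cases
        case 1
        then have "\<bar>x s - l\<bar> < \<epsilon>/2" "\<bar>x t - l\<bar> < \<epsilon>/2" using a st ab by (auto intro!: d2(2) simp del: less_divide_eq_numeral1)
        then show ?thesis by linarith
      next
        case 2
        have *: "\<bar>x r - x y\<bar> < \<epsilon>/2" if "y \<le> r" "r < b" for r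
          using d1(2)[of r] that ab \<open>0 < \<epsilon>\<close> by (cases "r = y") auto
        show ?thesis using *[of s] *[of t] 2 st by linarith
      qed
    qed (use ab in auto)
    then show "\<exists>d>0. \<forall>a b. a \<le> y \<and> y \<le> b \<and> b - a < d \<longrightarrow> P a b"
      using d1(1) d2(1) by (intro exI[of _ "min (d1 - y) (y - d2)"]) auto
  qed
  then show ?thesis using \<open>0 \<le> T\<close> unfolding P_def by simp
qed

text \<open>The McShane extension of the shifts d p from S to a 1/2-Lipschitz e makes id + e a time change.\<close>

lemma time_change_exists:
  fixes d :: "real \<Rightarrow> real"
  assumes S: "finite S" "S \<subseteq> {0..}" "0 \<in> S"
    and d: "\<And>p. p \<in> S \<Longrightarrow> 0 \<le> d p" "\<And>p. p \<in> S \<Longrightarrow> d p \<le> h" "d 0 = 0"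
    and gap: "\<And>p q. p \<in> S \<Longrightarrow> q \<in> S \<Longrightarrow> p \<noteq> q \<Longrightarrow> 2 * h \<le> \<bar>p - q\<bar>"
  shows "\<exists>lam. continuous_on {0..} lam \<and> strict_mono_on {0..} lam \<and> lam ` {0..} = {0..} \<and>
    (\<forall>t\<ge>0. \<bar>lam t - t\<bar> \<le> h) \<and> (\<forall>p\<in>S. lam p = p + d p)"
proof -
  have h: "0 \<le> h" using d(1,2)[OF S(3)] by linarith
  \<comment> \<open>The candidate h in the minimum caps the extension, so that the displacement
    stays at most h far from S as well.\<close>
  define e where "e t = Min (insert h ((\<lambda>p. d p + \<bar>t - p\<bar>/2) ` S))" for t
  have fin: "finite (insert h ((\<lambda>p. d p + \<bar>t - p\<bar>/2) ` S))" for t using S by simp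
  have e_nonneg: "0 \<le> e t" for t
    unfolding e_def using fin h d(1) by (subst Min_ge_iff) (auto intro!: add_nonneg_nonneg)
  have e_le: "e t \<le> h" for t unfolding e_def using fin by (intro Min_le) auto
  have e_S: "e p = d p" if p: "p \<in> S" for p
  proof (rule antisym)
    have "e p \<le> d p + \<bar>p - p\<bar>/2" unfolding e_def by (intro Min_le fin insertI2 imageI p)
    then show "e p \<le> d p" by simp
    show "d p \<le> e p" unfolding e_def
    proof (subst Min_ge_iff)
      show "finite (insert h ((\<lambda>pa. d pa + \<bar>p - pa\<bar> / 2) ` S))" by (rule fin)
      \<comment> \<open>Two points of S are at least 2 h apart, so the candidate from q has value at
        least h at p and cannot undercut d p.\<close>
      have "d p \<le> d q + \<bar>p - q\<bar> / 2" if q: "q \<in> S" for q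
      proof (cases "p = q")
        case False
        define g where "g = \<bar>p - q\<bar>"
        show ?thesis using gap[OF p q False] d(2)[OF p] d(1)[OF q] unfolding g_def[symmetric] by linarith
      qed simp
      then show "\<forall>a\<in>insert h ((\<lambda>pa. d pa + \<bar>p - pa\<bar> / 2) ` S). d p \<le> a" using d(2) p by auto
    qed simp
  qed
  have lip0: "e s \<le> e t + \<bar>s - t\<bar>/2" for s t
  proof -
    have "e t \<in> insert h ((\<lambda>p. d p + \<bar>t - p\<bar>/2) ` S)" unfolding e_def using fin by (intro Min_in) auto
    then consider "e t = h" | p where "p \<in> S" "e t = d p + \<bar>t - p\<bar>/2" by auto
    then show ?thesis
    proof cases
      case 1 then show ?thesis using e_le[of s] by (simp add: add_increasing2)
    next
      case 2
      have "e s \<le> d p + \<bar>s - p\<bar>/2" unfolding e_def using fin 2 by (intro Min_le) auto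
      moreover have "\<bar>s - p\<bar> \<le> \<bar>t - p\<bar> + \<bar>s - t\<bar>" by linarith
      ultimately show ?thesis using 2 by (simp add: field_simps)
    qed
  qed
  have lip: "\<bar>e s - e t\<bar> \<le> \<bar>s - t\<bar>/2" for s t using lip0[of s t] lip0[of t s] abs_minus_commute[of s t]
    by (auto simp only: abs_le_iff)
  define lam where "lam t = t + e t" for t
  have cont_e: "continuous_on A e" for A
    unfolding continuous_on_iff
  proof (intro ballI allI impI)
    fix x r assume r: "(0::real) < r"
    show "\<exists>b>0. \<forall>y\<in>A. dist y x < b \<longrightarrow> dist (e y) (e x) < r"
    proof (intro exI[of _ r] conjI ballI impI r)
      fix y assume "dist y x < r"
      then show "dist (e y) (e x) < r" using lip[of y x] abs_ge_zero[of "e y - e x"] unfolding dist_real_def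
        by (simp add: field_simps del: abs_ge_zero)
    qed
  qed
  have cont: "continuous_on A lam" for A unfolding lam_def by (intro continuous_intros cont_e)
  have mono: "lam s < lam t" if "s < t" for s t
  proof -
    have "\<bar>s - t\<bar> = t - s" using that by simp
    then show ?thesis using lip0[of s t] that unfolding lam_def by (simp add: field_simps)
  qed
  have lam0: "lam 0 = 0" using e_S[OF S(3)] d(3) unfolding lam_def by simp
  have "lam ` {0..} = {0..}"
  proof (intro equalityI subsetI)
    fix y assume "y \<in> lam ` {0..}" then show "y \<in> {0..}" using e_nonneg by (auto simp: lam_def intro: add_nonneg_nonneg)
  next
    fix y :: real assume y: "y \<in> {0..}"
    have "\<exists>t\<ge>0. t \<le> y \<and> lam t = y"
      using y lam0 e_nonneg[of y] by (intro IVT') (auto simp: lam_def[of y] intro: cont)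
    then show "y \<in> lam ` {0..}" by auto
  qed
  moreover have "strict_mono_on {0..} lam" using mono by (auto simp: strict_mono_on_def)
  ultimately show ?thesis using cont e_nonneg e_le e_S
    by (intro exI[of _ lam]) (auto simp: lam_def)
qed

text \<open>A diagonal argument: time changes for each fixed precision p are merged into one
  sequence by using, at index n, the best precision already available there.\<close>

lemma skorokhod_convI:
  assumes "\<And>p::nat. eventually (\<lambda>n. \<exists>lam. continuous_on {0..} lam \<and> strict_mono_on {0..} lam \<and>
      lam ` {0..} = {0..} \<and> (\<forall>t\<ge>0. \<bar>lam t - t\<bar> \<le> 1 / Suc p) \<and>
      (\<forall>t\<in>{0..real p}. \<bar>xs n (lam t) - x t\<bar> \<le> 1 / Suc p)) sequentially"
  shows "skorokhod_conv xs x"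
proof -
  define good where "good p n lam \<longleftrightarrow> continuous_on {0..} lam \<and> strict_mono_on {0..} lam \<and>
      lam ` {0..} = {0..} \<and> (\<forall>t\<ge>0. \<bar>lam t - t\<bar> \<le> 1 / Suc p) \<and>
      (\<forall>t\<in>{0..real p}. \<bar>xs n (lam t) - x t\<bar> \<le> 1 / Suc p)" for p n lam
  define Q where "Q n p \<longleftrightarrow> (\<exists>lam. good p n lam)" for n p
  \<comment> \<open>The bound p \<le> n keeps the set of candidates finite, so the greatest element
    exists as soon as one candidate does; otherwise \<open>lam n\<close> is the identity.\<close>
  define r where "r n = (GREATEST p. p \<le> n \<and> Q n p)" for n
  define lam where "lam n = (if \<exists>p\<le>n. Q n p then SOME l. good (r n) n l else (\<lambda>t. t))" for n
  have ev: "eventually (\<lambda>n. Q n p) sequentially" for p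
    using assms unfolding Q_def good_def by simp
  have r: "r n \<le> n \<and> Q n (r n)" if "\<exists>p\<le>n. Q n p" for n
    unfolding r_def using that by (metis (mono_tags, lifting) GreatestI_nat)
  have lamgood: "good (r n) n (lam n)" if "\<exists>p\<le>n. Q n p" for n
    using someI_ex[of "good (r n) n"] r[OF that] that unfolding lam_def Q_def by presburger
  have big: "eventually (\<lambda>n. p \<le> r n \<and> good (r n) n (lam n)) sequentially" for p
    using ev[of p] eventually_ge_at_top[of p]
  proof eventually_elim
    case (elim n)
    then have "p \<le> r n" unfolding r_def by (intro Greatest_le_nat[where b=n]) auto
    then show ?case using lamgood elim by blast
  qed
  show ?thesis unfolding skorokhod_conv_def
  proof (intro exI[of _ lam] conjI allI impI)
    fix n
    have "continuous_on {0..} (lam n) \<and> strict_mono_on {0..} (lam n) \<and> lam n ` {0..} = {0..}"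
    proof (cases "\<exists>p\<le>n. Q n p")
      case True then show ?thesis using lamgood[OF True] unfolding good_def by blast
    next
      case False then have "lam n = (\<lambda>t. t)" unfolding lam_def by (simp only: if_False)
      then show ?thesis by (auto simp: strict_mono_on_def)
    qed
    then show "continuous_on {0..} (lam n)" "strict_mono_on {0..} (lam n)" "lam n ` {0..} = {0..}" by auto
  next
    fix e :: real assume "0 < e"
    then obtain p where p: "1 / Suc p < e" using reals_Archimedean[of e] by (auto simp: inverse_eq_divide)
    show "eventually (\<lambda>n. \<forall>t\<ge>0. \<bar>lam n t - t\<bar> \<le> e) sequentially"
      using big[of p]
    proof eventually_elim
      case (elim n)
      have "1 / real (Suc (r n)) \<le> 1 / Suc p" using elim by (intro divide_left_mono) auto
      then show ?case using elim p unfolding good_def by force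
    qed
  next
    fix T e :: real assume "0 \<le> T" "0 < e"
    then obtain p where p: "1 / Suc p < e" using reals_Archimedean[of e] by (auto simp: inverse_eq_divide)
    obtain q where q: "T \<le> real q" using real_arch_simple by blast
    show "eventually (\<lambda>n. \<forall>t\<in>{0..T}. \<bar>xs n (lam n t) - x t\<bar> \<le> e) sequentially"
      using big[of "max p q"]
    proof eventually_elim
      case (elim n)
      have "1 / real (Suc (r n)) \<le> 1 / Suc p" using elim by (intro divide_left_mono) auto
      moreover have "T \<le> real (r n)" using elim q by (meson le_trans max.cobounded2 of_nat_mono order_trans)
      ultimately show ?case using elim p unfolding good_def by force
    qed
  qed
qed

text \<open>Sampling at left grid points of mesh 1/(m+1), frozen from time m+1 on: a step path that
  depends on finitely many values of x and agrees with the grid on a growing horizon.\<close>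

definition disc :: "nat \<Rightarrow> (real \<Rightarrow> real) \<Rightarrow> real \<Rightarrow> real" where
  "disc m x t = x (real (min (nat \<lfloor>real (Suc m) * t\<rfloor>) ((Suc m)\<^sup>2)) / real (Suc m))"

text \<open>The time change carries each partition point of x to the next grid point. Then the grid
  point sampled at time \<open>lam t\<close> lies in the same partition cell as t, where x
  oscillates little.\<close>

lemma skorokhod_conv_disc:
  assumes x: "cadlag x"
  shows "skorokhod_conv (\<lambda>m. disc m x) x"
proof (rule skorokhod_convI)
  fix p :: nat
  obtain S where S: "finite S" "S \<subseteq> {0..real p + 1}" "0 \<in> S"
    and osc: "\<And>s t. 0 \<le> s \<Longrightarrow> s \<le> t \<Longrightarrow> t < real p + 1 \<Longrightarrow> S \<inter> {s<..t} = {} \<Longrightarrow> \<bar>x s - x t\<bar> \<le> 1 / Suc p"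
    using cadlag_partition[OF x, of "1 / Suc p" "real p + 1"]
    by (metis add_nonneg_nonneg of_nat_0_le_iff of_nat_0_less_iff zero_less_Suc zero_le_one zero_less_divide_1_iff)
  have "\<exists>\<delta>>0. \<forall>u\<in>S. \<forall>v\<in>S. u \<noteq> v \<longrightarrow> \<delta> \<le> \<bar>u - v\<bar>"
  proof -
    define D where "D = (\<lambda>(u,v). \<bar>u - v\<bar>) ` {(u,v). u \<in> S \<and> v \<in> S \<and> u \<noteq> v}"
    have "finite {(u,v). u \<in> S \<and> v \<in> S \<and> u \<noteq> v}" by (rule finite_subset[of _ "S \<times> S"]) (use S in auto)
    then have D: "finite (insert 1 D)" unfolding D_def by simp
    have "0 < Min (insert 1 D)" using D by (subst Min_gr_iff) (auto simp: D_def)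
    moreover have "Min (insert 1 D) \<le> \<bar>u - v\<bar>" if "u \<in> S" "v \<in> S" "u \<noteq> v" for u v
      using D that by (intro Min_le) (auto simp: D_def)
    ultimately show ?thesis by blast
  qed
  then obtain \<delta> where \<delta>: "\<delta> > 0" "\<And>u v. u \<in> S \<Longrightarrow> v \<in> S \<Longrightarrow> u \<noteq> v \<Longrightarrow> \<delta> \<le> \<bar>u - v\<bar>" by blast
  \<comment> \<open>The first condition is the gap condition of the time change with h = 1/(m+1);
    the second keeps the horizon p + 1 below the cap in the sampling index.\<close>
  have "eventually (\<lambda>m. 2 / real (Suc m) < \<delta>) sequentially"
    using \<delta>(1) by real_asymp
  moreover have "eventually (\<lambda>m. p + 2 \<le> m) sequentially" by (rule eventually_ge_at_top)
  ultimately show "eventually (\<lambda>n. \<exists>lam. continuous_on {0..} lam \<and> strict_mono_on {0..} lam \<and>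
      lam ` {0..} = {0..} \<and> (\<forall>t\<ge>0. \<bar>lam t - t\<bar> \<le> 1 / Suc p) \<and>
      (\<forall>t\<in>{0..real p}. \<bar>disc n x (lam t) - x t\<bar> \<le> 1 / Suc p)) sequentially"
  proof eventually_elim
    case (elim n)
    define c where "c = real (Suc n)"
    have c: "c > 0" "c \<ge> real p + 3" using elim by (auto simp: c_def)
    \<comment> \<open>The distance from q up to the next grid point, hence between 0 and
      1/c.\<close>
    define d where "d q = real_of_int \<lceil>c * q\<rceil> / c - q" for q
    have dlam: "q + d q = real_of_int \<lceil>c * q\<rceil> / c" for q by (simp add: d_def)
    have "\<exists>lam. continuous_on {0..} lam \<and> strict_mono_on {0..} lam \<and> lam ` {0..} = {0..} \<and>
      (\<forall>t\<ge>0. \<bar>lam t - t\<bar> \<le> 1 / c) \<and> (\<forall>q\<in>S. lam q = q + d q)"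
    proof (rule time_change_exists)
      fix q assume "q \<in> S"
      have "c * q \<le> real_of_int \<lceil>c * q\<rceil>" by simp
      then have "q \<le> real_of_int \<lceil>c * q\<rceil> / c" using c by (simp add: pos_le_divide_eq mult.commute)
      then show "0 \<le> d q" by (simp add: d_def)
      have "real_of_int \<lceil>c * q\<rceil> \<le> c * q + 1" by linarith
      then have "real_of_int \<lceil>c * q\<rceil> / c \<le> (c * q + 1) / c" using c by (intro divide_right_mono) auto
      then show "d q \<le> 1 / c" using c by (simp add: d_def add_divide_distrib)
    next
      fix u v assume "u \<in> S" "v \<in> S" "u \<noteq> v"
      from \<delta>(2)[OF this] elim show "2 * (1 / c) \<le> \<bar>u - v\<bar>" by (simp add: c_def)
    qed (use S in \<open>auto simp: d_def\<close>)
    then obtain lam where lam: "continuous_on {0..} lam" "strict_mono_on {0..} lam" "lam ` {0..} = {0..}"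
      "\<And>t. t \<ge> 0 \<Longrightarrow> \<bar>lam t - t\<bar> \<le> 1 / c" "\<And>q. q \<in> S \<Longrightarrow> lam q = q + d q" by blast
    have cp: "1 / c \<le> 1 / Suc p" using c by (intro divide_left_mono) auto
    have close: "\<bar>disc n x (lam t) - x t\<bar> \<le> 1 / Suc p" if t: "t \<in> {0..real p}" for t
    proof -
      have lt0: "lam t \<ge> 0" using lam(3) t by auto
      define k where "k = \<lfloor>c * lam t\<rfloor>"
      define s where "s = real_of_int k / c"
      have k0: "0 \<le> k" using lt0 c unfolding k_def by simp
      have s0: "0 \<le> s" using k0 c by (simp add: s_def)
      have ltp: "lam t \<le> real p + 1" using lam(4)[of t] t cp
      proof -
        have "1 / c \<le> 1" using c by simp
        then show ?thesis using lam(4)[of t] t by auto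
      qed
      have s_le: "s \<le> lam t" using c unfolding s_def k_def by (simp add: pos_divide_le_eq mult.commute)
      have "real_of_int k \<le> c * (real p + 1)" 
        using mult_left_mono[OF order_trans[OF s_le ltp], of c] c unfolding s_def by simp
      also have "\<dots> \<le> c * c" using c by (intro mult_left_mono) auto
      finally have "nat k \<le> (Suc n)\<^sup>2"
        using k0 unfolding c_def power2_eq_square by (metis nat_le_iff of_int_le_iff of_int_of_nat_eq of_nat_mult)
      then have disc: "disc n x (lam t) = x s"
        unfolding disc_def s_def k_def c_def[symmetric] using k0 by (simp add: min_absorb1 k_def)
      \<comment> \<open>The image of q under the time change is a grid point; it lies below
        \<open>lam t\<close> iff it lies below the sampled grid point s, and that iff q itself is at
        most s.\<close>
      have *: "q \<le> s \<longleftrightarrow> q \<le> t" if q: "q \<in> S" for q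
      proof -
        have q0: "0 \<le> q" using q S by auto
        have "q \<le> t \<longleftrightarrow> lam q \<le> lam t"
          using lam(2) q0 t by (simp add: strict_mono_on_leD strict_mono_on_less_eq)
        also have "\<dots> \<longleftrightarrow> real_of_int \<lceil>c * q\<rceil> \<le> c * lam t"
          using c unfolding lam(5)[OF q] dlam by (simp add: pos_divide_le_eq mult.commute)
        also have "\<dots> \<longleftrightarrow> \<lceil>c * q\<rceil> \<le> k" unfolding k_def by (simp add: le_floor_iff)
        also have "\<dots> \<longleftrightarrow> q \<le> s" using c unfolding s_def by (simp add: ceiling_le_iff pos_le_divide_eq mult.commute)
        finally show ?thesis ..
      qed
      have "s < real p + 1"
      proof -
        have "s \<le> lam t" by fact
        also have "\<dots> \<le> t + 1/c" using lam(4)[of t] t by auto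
        also have "\<dots> < real p + 1" using t c by (auto intro!: add_le_less_mono)
        finally show ?thesis .
      qed
      moreover have "S \<inter> {s<..t} = {}" "S \<inter> {t<..s} = {}" using * by force+
      ultimately have "\<bar>x s - x t\<bar> \<le> 1 / Suc p"
        using osc[of s t] osc[of t s] s0 t by (cases "s \<le> t") (auto simp: abs_minus_commute)
      then show ?thesis unfolding disc .
    qed
    show ?case using lam cp close by (intro exI[of _ lam]) (auto intro: order_trans)
  qed
qed

section \<open>Closure properties of cadlag functions\<close>

lemma cadlagI:
  assumes "\<And>t. 0 \<le> t \<Longrightarrow> (x \<longlongrightarrow> x t) (at_right t)"
    and "\<And>t. 0 < t \<Longrightarrow> \<exists>l. (x \<longlongrightarrow> l) (at_left t)"
  shows "cadlag x"
  using assms by (simp add: cadlag_def continuous_within)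

lemma cadlag_right: "cadlag x \<Longrightarrow> 0 \<le> t \<Longrightarrow> (x \<longlongrightarrow> x t) (at_right t)"
  by (simp add: cadlag_def continuous_within)

lemma cadlag_left: "cadlag x \<Longrightarrow> 0 < t \<Longrightarrow> \<exists>l. (x \<longlongrightarrow> l) (at_left t)"
  unfolding cadlag_def by force

lemma cadlag_continuous: "continuous_on UNIV x \<Longrightarrow> cadlag x"
  by (intro cadlagI) (auto simp: continuous_on_def intro!: exI elim!: filterlim_at_split[THEN iffD1, THEN conjunct1, rotated]
      intro: tendsto_within_subset)

lemma cadlag_add: "cadlag x \<Longrightarrow> cadlag y \<Longrightarrow> cadlag (\<lambda>t. x t + y t)"
  by (rule cadlagI) (blast dest: cadlag_right cadlag_left intro: tendsto_add)+

lemma cadlag_sum: "(\<And>i. i \<in> I \<Longrightarrow> cadlag (x i)) \<Longrightarrow> cadlag (\<lambda>t. \<Sum>i\<in>I. x i t)"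
  by (induction I rule: infinite_finite_induct) (auto intro: cadlag_add intro!: cadlag_continuous[of "\<lambda>_. 0"])

lemma cadlag_step: "cadlag (\<lambda>t. if a \<le> t then c else 0)"
proof (rule cadlagI)
  fix t :: real assume "0 \<le> t"
  show "((\<lambda>t. if a \<le> t then c else 0) \<longlongrightarrow> (if a \<le> t then c else 0)) (at_right t)"
  proof (rule tendsto_eventually, cases "a \<le> t")
    case True
    then show "\<forall>\<^sub>F x in at_right t. (if a \<le> x then c else 0) = (if a \<le> t then c else 0)"
      by (auto simp: eventually_at_right_field intro!: exI[of _ "t+1"])
  next
    case False
    then show "\<forall>\<^sub>F x in at_right t. (if a \<le> x then c else 0) = (if a \<le> t then c else 0)"
      by (auto simp: eventually_at_right_field intro!: exI[of _ a])
  qed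
next
  fix t :: real assume "0 < t"
  show "\<exists>l. ((\<lambda>t. if a \<le> t then c else 0) \<longlongrightarrow> l) (at_left t)"
  proof (intro exI tendsto_eventually, cases "a < t")
    case True
    then show "\<forall>\<^sub>F x in at_left t. (if a \<le> x then c else 0) = (if a < t then c else 0)"
      by (auto simp: eventually_at_left_field intro!: exI[of _ a])
  next
    case False
    then show "\<forall>\<^sub>F x in at_left t. (if a \<le> x then c else 0) = (if a < t then c else 0)"
      by (auto simp: eventually_at_left_field intro!: exI[of _ "t - 1"])
  qed
qed

lemma cadlag_cong:
  assumes "cadlag x" "\<And>t. 0 \<le> t \<Longrightarrow> x t = y t"
  shows "cadlag y"
proof (rule cadlagI)
  fix t :: real assume t: "0 \<le> t"
  have "eventually (\<lambda>s. x s = y s) (at_right t)" using t assms(2)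
    by (auto simp: eventually_at_right_field intro!: exI[of _ "t + 1"])
  then show "(y \<longlongrightarrow> y t) (at_right t)"
    using cadlag_right[OF assms(1) t] assms(2)[OF t] by (auto dest: tendsto_cong)
next
  fix t :: real assume t: "0 < t"
  have "eventually (\<lambda>s. x s = y s) (at_left t)" using t assms(2)
    by (auto simp: eventually_at_left_field intro!: exI[of _ 0])
  then show "\<exists>l. (y \<longlongrightarrow> l) (at_left t)"
    using cadlag_left[OF assms(1) t] by (auto dest: tendsto_cong)
qed

lemma cadlag_local:
  assumes "\<And>n::nat. \<exists>y. cadlag y \<and> (\<forall>t. 0 \<le> t \<longrightarrow> t < real n \<longrightarrow> x t = y t)"
  shows "cadlag x"
proof (rule cadlagI)
  fix t :: real assume t: "0 \<le> t"
  obtain n :: nat where n: "t < real n" using reals_Archimedean2 by blast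
  obtain y where y: "cadlag y" "\<And>s. 0 \<le> s \<Longrightarrow> s < real n \<Longrightarrow> x s = y s" using assms by blast
  have "eventually (\<lambda>s. x s = y s) (at_right t)" using t n y(2)
    by (auto simp: eventually_at_right_field intro!: exI[of _ "real n"])
  then show "(x \<longlongrightarrow> x t) (at_right t)"
    using cadlag_right[OF y(1) t] y(2)[OF t n] by (auto dest: tendsto_cong)
next
  fix t :: real assume t: "0 < t"
  obtain n :: nat where n: "t < real n" using reals_Archimedean2 by blast
  obtain y where y: "cadlag y" "\<And>s. 0 \<le> s \<Longrightarrow> s < real n \<Longrightarrow> x s = y s" using assms by blast
  have "eventually (\<lambda>s. x s = y s) (at_left t)" using t n y(2)
    by (auto simp: eventually_at_left_field intro!: exI[of _ 0])
  then show "\<exists>l. (x \<longlongrightarrow> l) (at_left t)"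
    using cadlag_left[OF y(1) t] by (auto dest: tendsto_cong)
qed

text \<open>For the left limit at t, the left limits of the approximating paths form a Cauchy
  sequence by uniformity on [0,t], and its limit is the left limit of x.\<close>

lemma cadlag_uniform_limit:
  assumes xs: "\<And>n. cadlag (xs n)"
    and lim: "\<And>T e. 0 \<le> T \<Longrightarrow> 0 < e \<Longrightarrow> eventually (\<lambda>n. \<forall>t\<in>{0..T}. \<bar>xs n t - x t\<bar> \<le> e) sequentially"
  shows "cadlag x"
proof (rule cadlagI)
  fix t :: real assume t: "0 \<le> t"
  show "(x \<longlongrightarrow> x t) (at_right t)"
  proof (rule tendstoI)
    fix e :: real assume e: "0 < e"
    have "eventually (\<lambda>n. \<forall>s\<in>{0..t+1}. \<bar>xs n s - x s\<bar> \<le> e/4) sequentially" using lim[of "t+1" "e/4"] t e by simp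
    then obtain n where "\<forall>s\<in>{0..t+1}. \<bar>xs n s - x s\<bar> \<le> e/4"
      unfolding eventually_sequentially by blast
    then have n: "\<And>s. 0 \<le> s \<Longrightarrow> s \<le> t + 1 \<Longrightarrow> \<bar>xs n s - x s\<bar> \<le> e/4" by auto
    have "eventually (\<lambda>s. dist (xs n s) (xs n t) < e/4) (at_right t)"
      using cadlag_right[OF xs t] e by (intro tendstoD) auto
    moreover have "eventually (\<lambda>s. t < s \<and> s < t + 1) (at_right t)"
      by (auto simp: eventually_at_right_field intro!: exI[of _ "t + 1"])
    ultimately show "eventually (\<lambda>s. dist (x s) (x t) < e) (at_right t)"
    proof eventually_elim
      case (elim s)
      then show ?case using n[of s] n[of t] t e unfolding dist_real_def by linarith
    qed
  qed
next
  fix t :: real assume t: "0 < t"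
  have "\<exists>l. \<forall>n. (xs n \<longlongrightarrow> l n) (at_left t)" using cadlag_left[OF xs t] by (intro choice) blast
  then obtain l where l: "\<And>n. (xs n \<longlongrightarrow> l n) (at_left t)" by blast
  have nt: "at_left t \<noteq> bot" by simp
  have ev: "eventually (\<lambda>s. 0 \<le> s \<and> s \<le> t) (at_left t)" using t
    by (auto simp: eventually_at_left_field intro!: exI[of _ 0])
  have bound: "\<bar>l n - l m\<bar> \<le> 2 * e" if "\<forall>s\<in>{0..t}. \<bar>xs n s - x s\<bar> \<le> e" "\<forall>s\<in>{0..t}. \<bar>xs m s - x s\<bar> \<le> e" for n m e
  proof (rule tendsto_upperbound[OF tendsto_rabs[OF tendsto_diff[OF l l]] _ nt])
    show "eventually (\<lambda>s. \<bar>xs n s - xs m s\<bar> \<le> 2 * e) (at_left t)"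
      using ev
    proof eventually_elim
      case (elim s)
      with that have "\<bar>xs n s - x s\<bar> \<le> e" "\<bar>xs m s - x s\<bar> \<le> e" by auto
      then show ?case by linarith
    qed
  qed
  have "Cauchy l"
  proof (rule metric_CauchyI)
    fix e :: real assume e: "0 < e"
    from lim[of t "e/4"] t e obtain N where N: "\<And>n. n \<ge> N \<Longrightarrow> \<forall>s\<in>{0..t}. \<bar>xs n s - x s\<bar> \<le> e/4"
      by (auto simp: eventually_sequentially)
    show "\<exists>M. \<forall>m\<ge>M. \<forall>n\<ge>M. dist (l m) (l n) < e"
      using bound[OF N N] e by (intro exI[of _ N]) (force simp: dist_real_def)
  qed
  then obtain L where L: "l \<longlonglongrightarrow> L" using real_Cauchy_convergent by (auto simp: convergent_def)
  have "(x \<longlongrightarrow> L) (at_left t)"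
  proof (rule tendstoI)
    fix e :: real assume e: "0 < e"
    have "eventually (\<lambda>n. (\<forall>s\<in>{0..t}. \<bar>xs n s - x s\<bar> \<le> e/4) \<and> dist (l n) L < e/4) sequentially"
      using lim[of t "e/4"] tendstoD[OF L, of "e/4"] t e by (intro eventually_conj) auto
    then obtain n where "\<forall>s\<in>{0..t}. \<bar>xs n s - x s\<bar> \<le> e/4" and n2: "dist (l n) L < e/4"
      unfolding eventually_sequentially by blast
    then have n: "\<And>s. 0 \<le> s \<Longrightarrow> s \<le> t \<Longrightarrow> \<bar>xs n s - x s\<bar> \<le> e/4" "dist (l n) L < e/4" by auto
    have "eventually (\<lambda>s. dist (xs n s) (l n) < e/4) (at_left t)"
      using l e by (intro tendstoD) auto
    then show "eventually (\<lambda>s. dist (x s) L < e) (at_left t)"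
      using ev
    proof eventually_elim
      case (elim s)
      then show ?case using n(1)[of s] n(2) e unfolding dist_real_def by linarith
    qed
  qed
  then show "\<exists>l. (x \<longlongrightarrow> l) (at_left t)" ..
qed

section \<open>Path functionals expressed through finitely many increments\<close>

definition stepfun :: "nat \<Rightarrow> (nat \<Rightarrow> real) \<Rightarrow> real \<Rightarrow> real" where
  "stepfun m a t = a (min (nat \<lfloor>real (Suc m) * t\<rfloor>) ((Suc m)\<^sup>2))"

lemma disc_eq_stepfun: "disc m x = stepfun m (\<lambda>j. x (real j / real (Suc m)))"
  by (simp add: disc_def stepfun_def fun_eq_iff)

lemma cadlag_stepfun: "cadlag (stepfun m a)"
proof (rule cadlag_cong)
  show "cadlag (\<lambda>t. a 0 + (\<Sum>j<(Suc m)\<^sup>2. if real (Suc j) / real (Suc m) \<le> t then a (Suc j) - a j else 0))"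
    by (intro cadlag_add cadlag_sum cadlag_step cadlag_continuous continuous_intros)
  fix t :: real assume t: "0 \<le> t"
  define k where "k = min (nat \<lfloor>real (Suc m) * t\<rfloor>) ((Suc m)\<^sup>2)"
  have "real (Suc j) / real (Suc m) \<le> t \<longleftrightarrow> j < k" if "j < (Suc m)\<^sup>2" for j
  proof -
    have "real (Suc j) / real (Suc m) \<le> t \<longleftrightarrow> real (Suc j) \<le> real (Suc m) * t"
      by (simp add: pos_divide_le_eq mult.commute)
    also have "\<dots> \<longleftrightarrow> Suc j \<le> nat \<lfloor>real (Suc m) * t\<rfloor>" by (metis le_nat_floor of_nat_floor order_trans of_nat_mono t mult_nonneg_nonneg of_nat_0_le_iff)
    also have "\<dots> \<longleftrightarrow> j < k" using that by (auto simp: k_def)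
    finally show ?thesis .
  qed
  then have "(\<Sum>j<(Suc m)\<^sup>2. if real (Suc j) / real (Suc m) \<le> t then a (Suc j) - a j else 0)
     = (\<Sum>j<(Suc m)\<^sup>2. if j < k then a (Suc j) - a j else 0)" by (intro sum.cong) auto
  also have "\<dots> = (\<Sum>j<k. a (Suc j) - a j)"
    by (rule sum.mono_neutral_cong_right) (auto simp: k_def)
  also have "\<dots> = a k - a 0" by (rule sum_lessThan_telescope)
  finally show "a 0 + (\<Sum>j<(Suc m)\<^sup>2. if real (Suc j) / real (Suc m) \<le> t then a (Suc j) - a j else 0) = stepfun m a t"
    by (simp add: stepfun_def k_def)
qed

text \<open>Only the coordinates up to (m+1)^2 are read, so coordinatewise convergence makes the
  step paths converge uniformly, and the identity serves as time change.\<close>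

lemma continuous_stepfun:
  assumes F: "skorokhod_continuous F"
  shows "continuous_on UNIV (\<lambda>a. F (stepfun m a))"
proof (rule continuous_on_sequentiallyI)
  fix u :: "nat \<Rightarrow> nat \<Rightarrow> real" and a assume "u \<longlonglongrightarrow> a"
  then have u: "(\<lambda>n. u n j) \<longlonglongrightarrow> a j" for j
    using continuous_on_tendsto_compose[OF continuous_on_product_then_coordinatewise[OF continuous_on_id, of UNIV j], of u a sequentially]
    by simp
  have "skorokhod_conv (\<lambda>n. stepfun m (u n)) (stepfun m a)"
  proof (rule skorokhod_conv_uniform)
    fix T e :: real assume "0 < e"
    then have "eventually (\<lambda>n. \<forall>j\<in>{..(Suc m)\<^sup>2}. dist (u n j) (a j) < e) sequentially"
      using u by (intro eventually_ball_finite ballI tendstoD) auto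
    then show "eventually (\<lambda>n. \<forall>t\<in>{0..T}. \<bar>stepfun m (u n) t - stepfun m a t\<bar> \<le> e) sequentially"
      by eventually_elim (auto simp: stepfun_def dist_real_def intro!: less_imp_le)
  qed
  then show "(\<lambda>n. F (stepfun m (u n))) \<longlonglongrightarrow> F (stepfun m a)"
    using F[unfolded skorokhod_continuous_def, rule_format, of "\<lambda>n. stepfun m (u n)" "stepfun m a"]
      cadlag_stepfun by simp
qed

text \<open>With countably many coordinates the product sigma-algebra is the Borel sigma-algebra of
  the product topology, so continuity suffices.\<close>

lemma borel_measurable_stepfun:
  assumes "skorokhod_continuous F"
  shows "(\<lambda>a. F (stepfun m a)) \<in> borel_measurable (PiM UNIV (\<lambda>_. borel))"
  using borel_measurable_continuous_onI[OF continuous_stepfun[OF assms]]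
  by (simp cong: measurable_cong_sets add: sets_PiM_equal_borel)

text \<open>Initial value followed by grid increments: the coordinates in which the laws of
  processes with independent increments are described.\<close>

definition grid_vec :: "nat \<Rightarrow> (real \<Rightarrow> real) \<Rightarrow> nat \<Rightarrow> real" where
  "grid_vec m x i = (case i of 0 \<Rightarrow> x 0 | Suc j \<Rightarrow> x (real (Suc j) / real (Suc m)) - x (real j / real (Suc m)))"

lemma grid_vec_sum: "(\<Sum>i\<le>j. grid_vec m x i) = x (real j / real (Suc m))"
  by (induction j) (auto simp: grid_vec_def)

lemma disc_eq_grid_vec:
  "disc m x = stepfun m (\<lambda>j. \<Sum>i\<le>min j ((Suc m)\<^sup>2). (\<lambda>i\<in>{..(Suc m)\<^sup>2}. grid_vec m x i) i)"
proof -
  have "(\<Sum>i\<le>min j ((Suc m)\<^sup>2). (\<lambda>i\<in>{..(Suc m)\<^sup>2}. grid_vec m x i) i) = x (real (min j ((Suc m)\<^sup>2)) / real (Suc m))" for j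
    unfolding grid_vec_sum[symmetric] by (intro sum.cong) auto
  then show ?thesis by (simp add: disc_def stepfun_def fun_eq_iff)
qed

lemma measurable_grid_vec:
  assumes "\<And>t. 0 \<le> t \<Longrightarrow> X t \<in> borel_measurable M"
  shows "(\<lambda>\<omega>. \<lambda>i\<in>I. grid_vec m (\<lambda>t. X t \<omega>) i) \<in> measurable M (PiM I (\<lambda>_. borel))"
proof (rule measurable_restrict)
  fix i
  show "(\<lambda>\<omega>. grid_vec m (\<lambda>t. X t \<omega>) i) \<in> borel_measurable M"
    unfolding grid_vec_def using assms by (cases i) (auto intro!: borel_measurable_diff)
qed

lemma borel_measurable_disc_fun:
  assumes "skorokhod_continuous F"
  shows "(\<lambda>v. F (stepfun m (\<lambda>j. \<Sum>i\<le>min j ((Suc m)\<^sup>2). v i)))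
    \<in> borel_measurable (PiM {..(Suc m)\<^sup>2} (\<lambda>_. borel))"
  by (rule measurable_compose[OF _ borel_measurable_stepfun[OF assms]])
     (intro measurable_PiM_single' borel_measurable_sum measurable_component_singleton; auto)

lemma skorokhod_tendsto_disc:
  assumes "skorokhod_continuous F" "cadlag x"
  shows "(\<lambda>m. F (disc m x)) \<longlonglongrightarrow> F x"
proof -
  have "cadlag (disc m x)" for m unfolding disc_eq_stepfun by (rule cadlag_stepfun)
  then show ?thesis
    using assms(1)[unfolded skorokhod_continuous_def, rule_format, of "\<lambda>m. disc m x" x] assms(2)
      skorokhod_conv_disc[OF assms(2)] by simp
qed

text \<open>The functional is a pointwise limit of its values on discretised paths, each a
  measurable function of a finite increment vector.\<close>

lemma borel_measurable_skorokhod: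
  assumes F: "skorokhod_continuous F"
    and X: "\<And>t. 0 \<le> t \<Longrightarrow> X t \<in> borel_measurable M" "\<And>\<omega>. cadlag (\<lambda>t. X t \<omega>)"
  shows "(\<lambda>\<omega>. F (\<lambda>t. X t \<omega>)) \<in> borel_measurable M"
proof (rule borel_measurable_LIMSEQ_real)
  show "(\<lambda>\<omega>. F (disc m (\<lambda>t. X t \<omega>))) \<in> borel_measurable M" for m
    unfolding disc_eq_grid_vec
    by (rule measurable_compose[OF measurable_grid_vec[OF X(1)] borel_measurable_disc_fun[OF F]])
  show "(\<lambda>m. F (disc m (\<lambda>t. X t \<omega>))) \<longlonglongrightarrow> F (\<lambda>t. X t \<omega>)" for \<omega>
    by (rule skorokhod_tendsto_disc[OF F X(2)])
qed

text \<open>By dominated convergence both sides are limits of integrals over discretised paths, and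
  these depend only on the laws of the increment vectors. The processes may live on different
  probability spaces.\<close>

lemma integral_skorokhod_eq:
  fixes M :: "'a measure" and N :: "'b measure"
  assumes F: "skorokhod_continuous F" "\<And>x. \<bar>F x\<bar> \<le> B"
    and M: "prob_space M" and N: "prob_space N"
    and X: "\<And>t. 0 \<le> t \<Longrightarrow> X t \<in> borel_measurable M" "\<And>\<omega>. cadlag (\<lambda>t. X t \<omega>)"
    and Y: "\<And>t. 0 \<le> t \<Longrightarrow> Y t \<in> borel_measurable N" "\<And>\<omega>. cadlag (\<lambda>t. Y t \<omega>)"
    and eq: "\<And>m. distr M (PiM {..(Suc m)\<^sup>2} (\<lambda>_. borel)) (\<lambda>\<omega>. \<lambda>i\<in>{..(Suc m)\<^sup>2}. grid_vec m (\<lambda>t. X t \<omega>) i)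
        = distr N (PiM {..(Suc m)\<^sup>2} (\<lambda>_. borel)) (\<lambda>\<omega>. \<lambda>i\<in>{..(Suc m)\<^sup>2}. grid_vec m (\<lambda>t. Y t \<omega>) i)"
  shows "(\<integral>\<omega>. F (\<lambda>t. X t \<omega>) \<partial>M) = (\<integral>\<omega>. F (\<lambda>t. Y t \<omega>) \<partial>N)"
proof -
  interpret M: prob_space M by fact
  interpret N: prob_space N by fact
  have lim: "(\<lambda>m. \<integral>\<omega>. F (disc m (\<lambda>t. Z t \<omega>)) \<partial>L) \<longlonglongrightarrow> (\<integral>\<omega>. F (\<lambda>t. Z t \<omega>) \<partial>L)"
    if "prob_space L" and Z: "\<And>t. 0 \<le> t \<Longrightarrow> Z t \<in> borel_measurable L" "\<And>\<omega>. cadlag (\<lambda>t. Z t \<omega>)"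
    for L :: "'c measure" and Z
  proof (rule integral_dominated_convergence[where w="\<lambda>_. B"])
    interpret L: prob_space L by fact
    show "(\<lambda>\<omega>. F (disc m (\<lambda>t. Z t \<omega>))) \<in> borel_measurable L" for m
      unfolding disc_eq_grid_vec
      by (rule measurable_compose[OF measurable_grid_vec[OF Z(1)] borel_measurable_disc_fun[OF F(1)]])
    show "(\<lambda>\<omega>. F (\<lambda>t. Z t \<omega>)) \<in> borel_measurable L" by (rule borel_measurable_skorokhod[OF F(1) Z])
    show "AE \<omega> in L. (\<lambda>m. F (disc m (\<lambda>t. Z t \<omega>))) \<longlonglongrightarrow> F (\<lambda>t. Z t \<omega>)"
      by (intro AE_I2 skorokhod_tendsto_disc[OF F(1) Z(2)])
    show "integrable L (\<lambda>_. B)" by simp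
  qed (use F(2) in auto)
  have int: "(\<integral>\<omega>. F (disc m (\<lambda>t. Z t \<omega>)) \<partial>L) =
    (\<integral>v. F (stepfun m (\<lambda>j. \<Sum>i\<le>min j ((Suc m)\<^sup>2). v i))
       \<partial>distr L (PiM {..(Suc m)\<^sup>2} (\<lambda>_. borel)) (\<lambda>\<omega>. \<lambda>i\<in>{..(Suc m)\<^sup>2}. grid_vec m (\<lambda>t. Z t \<omega>) i))"
    if Z: "\<And>t. 0 \<le> t \<Longrightarrow> Z t \<in> borel_measurable L" for L :: "'c measure" and Z m
    unfolding disc_eq_grid_vec
    by (rule integral_distr[symmetric, OF measurable_grid_vec[OF Z] borel_measurable_disc_fun[OF F(1)]])
  have "(\<lambda>m. \<integral>\<omega>. F (disc m (\<lambda>t. X t \<omega>)) \<partial>M) = (\<lambda>m. \<integral>\<omega>. F (disc m (\<lambda>t. Y t \<omega>)) \<partial>N)"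
    by (simp only: int[OF X(1)] int[OF Y(1)] eq)
  with lim[OF M X] lim[OF N Y] show ?thesis by (auto intro: LIMSEQ_unique)
qed

section \<open>Uniqueness of Laplace transforms\<close>

text \<open>Around a real point a > 0 the exponential series can be integrated termwise on the disc
  of radius a. These discs, over all a, exhaust the right half-plane. The measure may charge both
  half-lines.\<close>

lemma integral_exp_holomorphic:
  fixes \<mu> :: "real measure"
  assumes [measurable_cong]: "sets \<mu> = sets borel"
    and int: "\<And>l. 0 \<le> l \<Longrightarrow> integrable \<mu> (\<lambda>x. exp (- l * x))"
  shows "(\<lambda>z. \<integral>x. exp (- z * complex_of_real x) \<partial>\<mu>) holomorphic_on {z. 0 < Re z}"
proof -
  let ?f = "\<lambda>z. \<integral>x. exp (- z * complex_of_real x) \<partial>\<mu>"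
  have hol: "?f holomorphic_on ball (of_real a) a" if a: "0 < a" for a :: real
  proof (rule power_series_holomorphic)
    fix w assume w: "w \<in> ball (complex_of_real a) a"
    define h where "h = complex_of_real a - w"
    define \<rho> where "\<rho> = cmod h"
    have \<rho>: "0 \<le> \<rho>" "\<rho> < a" using w by (auto simp: \<rho>_def h_def dist_norm)
    define g where "g n x = (h * complex_of_real x) ^ n /\<^sub>R fact n * of_real (exp (- a * x))" for n and x :: real
    \<comment> \<open>Dominates exp(\<rho>|x|) exp(-a x), and hence the whole series, on both
      half-lines; it is integrable since both exponents a - \<rho> and a + \<rho> are
      nonnegative.\<close>
    define D where "D x = exp (- (a - \<rho>) * x) + exp (- (a + \<rho>) * x)" for x :: real
    have D: "integrable \<mu> D" unfolding D_def using \<rho> by (intro Bochner_Integration.integrable_add int) auto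
    have normg: "norm (g n x) = (\<rho> * \<bar>x\<bar>) ^ n /\<^sub>R fact n * exp (- a * x)" for n x
      by (simp add: g_def norm_mult norm_power \<rho>_def divide_inverse mult_ac power_mult_distrib)
    have sumsn: "(\<lambda>n. norm (g n x)) sums (exp (\<rho> * \<bar>x\<bar>) * exp (- a * x))" for x
      unfolding normg by (intro sums_mult2 exp_converges)
    have expD: "exp (\<rho> * \<bar>x\<bar>) * exp (- a * x) \<le> D x" for x
      unfolding D_def by (cases "0 \<le> x") (auto simp: exp_add[symmetric] algebra_simps)
    have sumsg: "(\<lambda>n. g n x) sums exp (- w * complex_of_real x)" for x
    proof -
      have "(\<lambda>n. g n x) sums (exp (h * of_real x) * of_real (exp (- a * x)))"
        unfolding g_def by (intro sums_mult2 exp_converges)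
      also have "exp (h * of_real x) * of_real (exp (- a * x)) = exp (- w * complex_of_real x)"
        by (simp add: h_def exp_of_real[symmetric] exp_add[symmetric] algebra_simps)
      finally show ?thesis .
    qed
    have g_le: "norm (g n x) \<le> D x" for n x
    proof -
      have "norm (g n x) \<le> (\<Sum>n. norm (g n x))"
        using sum_le_suminf[OF sums_summable[OF sumsn[of x]], of "{n}"] by simp
      also have "\<dots> \<le> D x" using sums_unique[OF sumsn[of x]] expD[of x] by simp
      finally show ?thesis .
    qed
    have mg[measurable]: "g n \<in> borel_measurable \<mu>" for n unfolding g_def by measurable
    have intg: "integrable \<mu> (g n)" for n
      by (rule Bochner_Integration.integrable_bound[OF D]) (use g_le D_def in \<open>auto intro: order_trans[OF _ abs_ge_self]\<close>)
    have "(\<lambda>n. \<integral>x. g n x \<partial>\<mu>) sums (\<integral>x. (\<Sum>n. g n x) \<partial>\<mu>)"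
    proof (rule sums_integral)
      show "AE x in \<mu>. summable (\<lambda>n. norm (g n x))" using sumsn sums_summable by blast
      show "summable (\<lambda>n. \<integral>x. norm (g n x) \<partial>\<mu>)"
      proof (rule bounded_imp_summable)
        fix n
        have "(\<Sum>k\<le>n. \<integral>x. norm (g k x) \<partial>\<mu>) = (\<integral>x. (\<Sum>k\<le>n. norm (g k x)) \<partial>\<mu>)"
          using intg by (subst Bochner_Integration.integral_sum) auto
        also have "\<dots> \<le> (\<integral>x. D x \<partial>\<mu>)"
        proof (rule integral_mono)
          fix x
          have "(\<Sum>k\<le>n. norm (g k x)) \<le> (\<Sum>k. norm (g k x))"
            using sum_le_suminf[OF sums_summable[OF sumsn[of x]], of "{..n}"] by simp
          also have "\<dots> \<le> D x" using sums_unique[OF sumsn[of x]] expD[of x] by simp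
          finally show "(\<Sum>k\<le>n. norm (g k x)) \<le> D x" .
        qed (use intg D in auto)
        finally show "(\<Sum>k\<le>n. \<integral>x. norm (g k x) \<partial>\<mu>) \<le> (\<integral>x. D x \<partial>\<mu>)" .
      qed auto
    qed (rule intg)
    also have "(\<lambda>x. \<Sum>n. g n x) = (\<lambda>x. exp (- w * complex_of_real x))"
      using sums_unique[OF sumsg] by (simp add: fun_eq_iff)
    also have "(\<lambda>n. \<integral>x. g n x \<partial>\<mu>) =
      (\<lambda>n. ((-1) ^ n * (\<integral>x. (complex_of_real x) ^ n /\<^sub>R fact n * of_real (exp (- a * x)) \<partial>\<mu>)) * (w - of_real a) ^ n)"
    proof
      fix n
      have "g n x = ((-1) ^ n * (w - of_real a) ^ n) * ((complex_of_real x) ^ n /\<^sub>R fact n * of_real (exp (- a * x)))" for x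
      proof -
        have "h = (-1) * (w - of_real a)" by (simp add: h_def)
        then have "(h * complex_of_real x) ^ n = ((-1) ^ n * (w - of_real a) ^ n) * complex_of_real x ^ n"
          by (simp only: power_mult_distrib)
        then show ?thesis unfolding g_def by (simp add: scaleR_conv_of_real mult_ac)
      qed
      then show "(\<integral>x. g n x \<partial>\<mu>) = ((-1) ^ n * (\<integral>x. (complex_of_real x) ^ n /\<^sub>R fact n * of_real (exp (- a * x)) \<partial>\<mu>)) * (w - of_real a) ^ n"
        by (simp only: integral_mult_right_zero) (simp only: mult_ac)
    qed
    finally show "(\<lambda>n. ((-1) ^ n * (\<integral>x. (complex_of_real x) ^ n /\<^sub>R fact n * of_real (exp (- a * x)) \<partial>\<mu>)) * (w - of_real a) ^ n)
       sums ?f w" .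
  qed
  have "?f field_differentiable at z" if z: "0 < Re z" for z
  proof -
    \<comment> \<open>Chosen so that the squared distance from a to z equals a^2 - 2 Re z, which is
      less than a^2.\<close>
    define a where "a = (cmod z)\<^sup>2 / (2 * Re z) + 1"
    have a: "0 < a" using z by (auto simp: a_def intro!: add_nonneg_pos divide_nonneg_pos)
    have "(cmod (of_real a - z))\<^sup>2 = (cmod z)\<^sup>2 - 2 * a * Re z + a\<^sup>2"
      unfolding cmod_power2 by (simp add: power2_eq_square algebra_simps)
    also have "\<dots> = a\<^sup>2 - 2 * Re z" using z by (simp add: a_def field_simps)
    also have "\<dots> < a\<^sup>2" using z by simp
    finally have "z \<in> ball (of_real a) a" using a by (simp add: dist_norm power2_less_imp_less)
    then show ?thesis using hol[OF a] by (intro holomorphic_on_imp_differentiable_at) auto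
  qed
  then show ?thesis
    by (auto simp: holomorphic_on_def field_differentiable_at_within)
qed

text \<open>The identity theorem extends equality from the positive axis to the right half-plane,
  dominated convergence carries it to the imaginary axis, and Levy's theorem for characteristic
  functions concludes. General finite measures are allowed because weighted laws occur in the
  multivariate version.\<close>

lemma laplace_uniqueness:
  fixes \<mu> \<nu> :: "real measure"
  assumes sets[measurable_cong]: "sets \<mu> = sets borel" "sets \<nu> = sets borel"
    and eq: "\<And>l. 0 \<le> l \<Longrightarrow> (\<integral>\<^sup>+x. exp (- l * x) \<partial>\<mu>) = (\<integral>\<^sup>+x. exp (- l * x) \<partial>\<nu>)"
    and fin: "\<And>l. 0 \<le> l \<Longrightarrow> (\<integral>\<^sup>+x. exp (- l * x) \<partial>\<mu>) < \<infinity>"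
  shows "\<mu> = \<nu>"
proof -
  have int: "integrable \<mu> (\<lambda>x. exp (- l * x))" "integrable \<nu> (\<lambda>x. exp (- l * x))" if "0 \<le> l" for l
    using fin[OF that] eq[OF that] by (auto intro!: integrableI_nonneg)
  have lint: "(\<integral>x. exp (- l * x) \<partial>\<mu>) = (\<integral>x. exp (- l * x) \<partial>\<nu>)" if "0 \<le> l" for l
    using eq[OF that] by (simp add: integral_eq_nn_integral)
  have half: "(\<integral>x. exp (- z * complex_of_real x) \<partial>\<mu>) = (\<integral>x. exp (- z * complex_of_real x) \<partial>\<nu>)" if z: "0 < Re z" for z
  proof -
    let ?d = "\<lambda>z. (\<integral>x. exp (- z * complex_of_real x) \<partial>\<mu>) - (\<integral>x. exp (- z * complex_of_real x) \<partial>\<nu>)"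
    have "?d z = 0"
    proof (rule analytic_continuation[where S="{z. 0 < Re z}" and U="complex_of_real ` {0<..}" and \<xi>=1 and f="?d"])
      show "?d holomorphic_on {z. 0 < Re z}"
        by (intro holomorphic_on_diff integral_exp_holomorphic int sets)
      show "open {z. 0 < Re z}" by (rule open_halfspace_Re_gt)
      show "connected {z. 0 < Re z}" by (intro convex_connected convex_halfspace_Re_gt)
      have "(1::real) islimpt {0<..}" by (rule open_imp_islimpt) auto
      then show "1 islimpt complex_of_real ` {0<..}"
        unfolding islimpt_approachable
        by (metis dist_of_real image_eqI of_real_1 of_real_eq_1_iff imageE)
      fix w assume "w \<in> complex_of_real ` {0<..}"
      then obtain l where l: "w = of_real l" "0 < l" by auto
      have "exp (- w * complex_of_real x) = of_real (exp (- l * x))" for x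
        unfolding l(1) by (simp add: exp_of_real[symmetric])
      then show "?d w = 0" using lint[of l] l by simp
    qed (use z in auto)
    then show ?thesis by simp
  qed
  have chareq: "(\<integral>x. iexp (t * x) \<partial>\<mu>) = (\<integral>x. iexp (t * x) \<partial>\<nu>)" for t
  proof -
    \<comment> \<open>Approaches the point -i t of the imaginary axis from inside the half-plane;
      the integrands are dominated by 1 + exp(-x).\<close>
    define e where "e n = Complex (1 / Suc n) (- t)" for n
    have lim: "(\<lambda>n. \<integral>x. exp (- e n * complex_of_real x) \<partial>\<kappa>) \<longlonglongrightarrow> (\<integral>x. iexp (t * x) \<partial>\<kappa>)"
      if [measurable_cong]: "sets \<kappa> = sets borel" and i: "\<And>l. 0 \<le> l \<Longrightarrow> integrable \<kappa> (\<lambda>x. exp (- l * x))" for \<kappa> :: "real measure"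
    proof (rule integral_dominated_convergence[where w="\<lambda>x. exp (- 0 * x) + exp (- 1 * x)"])
      show "integrable \<kappa> (\<lambda>x. exp (- 0 * x) + exp (- 1 * x))" by (intro Bochner_Integration.integrable_add i) auto
      have "(\<lambda>n. exp (- e n * complex_of_real x)) \<longlonglongrightarrow> iexp (t * x)" for x
      proof -
        have "e \<longlonglongrightarrow> Complex 0 (- t)" unfolding e_def
          by (intro tendsto_Complex tendsto_const) (use LIMSEQ_inverse_real_of_nat in \<open>simp add: inverse_eq_divide\<close>)
        then have "(\<lambda>n. exp (- e n * complex_of_real x)) \<longlonglongrightarrow> exp (- Complex 0 (- t) * complex_of_real x)"
          by (intro tendsto_intros)
        also have "- Complex 0 (- t) * complex_of_real x = \<i> * complex_of_real (t * x)"
          by (simp add: complex_eq_iff)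
        finally show ?thesis .
      qed
      then show "AE x in \<kappa>. (\<lambda>n. exp (- e n * complex_of_real x)) \<longlonglongrightarrow> iexp (t * x)" by simp
      show "AE x in \<kappa>. norm (exp (- e n * complex_of_real x)) \<le> exp (- 0 * x) + exp (- 1 * x)" for n
      proof (rule AE_I2)
        fix x :: real
        have "norm (exp (- e n * complex_of_real x)) = exp (- x / Suc n)"
          by (simp add: e_def)
        also have "\<dots> \<le> exp (max 0 (- x))" by (cases "0 \<le> x") (auto simp: field_simps mult_nonneg_nonpos2)
        also have "\<dots> \<le> exp (- 0 * x) + exp (- 1 * x)" by (auto simp: max_def)
        finally show "norm (exp (- e n * complex_of_real x)) \<le> exp (- 0 * x) + exp (- 1 * x)" .
      qed
    qed measurable
    have "(\<lambda>n. \<integral>x. exp (- e n * complex_of_real x) \<partial>\<mu>) = (\<lambda>n. \<integral>x. exp (- e n * complex_of_real x) \<partial>\<nu>)"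
      by (intro ext half) (simp add: e_def)
    with lim[OF sets(1) int(1)] lim[OF sets(2) int(2)] show ?thesis by (metis LIMSEQ_unique)
  qed
  have em: "emeasure \<mu> UNIV = emeasure \<nu> UNIV" "emeasure \<mu> UNIV < \<infinity>"
    using eq[of 0] fin[of 0] sets[THEN sets_eq_imp_space_eq] by simp_all
  show ?thesis
  proof (cases "emeasure \<mu> UNIV = 0")
    case True
    have "emeasure \<mu> A = 0" "emeasure \<nu> A = 0" if "A \<in> sets \<mu>" for A
      using True em emeasure_space[of \<mu> A] emeasure_space[of \<nu> A] sets[THEN sets_eq_imp_space_eq] by simp_all
    then show ?thesis using sets by (intro measure_eqI) auto
  next
    case False
    \<comment> \<open>Levy's theorem speaks of probability measures; the value at l = 0 gives both
      measures the same mass m, so both are normalised by it.\<close>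
    define m where "m = measure \<mu> UNIV"
    have emm: "emeasure \<mu> UNIV = ennreal m" unfolding m_def using em(2) by (intro emeasure_eq_ennreal_measure) auto
    have m: "0 < m" using emm False by (metis ennreal_0 m_def measure_nonneg order_less_le)
    let ?n = "\<lambda>\<kappa>. density \<kappa> (\<lambda>_. ennreal (1 / m))"
    have rd: "real_distribution (?n \<kappa>)" if "sets \<kappa> = sets borel" "emeasure \<kappa> UNIV = ennreal m" for \<kappa> :: "real measure"
    proof (intro real_distribution.intro real_distribution_axioms.intro prob_spaceI)
      have sp: "space \<kappa> = UNIV" using sets_eq_imp_space_eq[OF that(1)] by simp
      have "emeasure (?n \<kappa>) (space \<kappa>) = ennreal (1/m) * ennreal m" using that sp
        by (subst emeasure_density_const) (auto simp: that)
      then show "emeasure (?n \<kappa>) (space (?n \<kappa>)) = 1" using m by (simp flip: ennreal_mult)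
    qed (use that in auto)
    have ch: "char (?n \<kappa>) t = (1 / m) *\<^sub>R (\<integral>x. iexp (t * x) \<partial>\<kappa>)" if [measurable_cong]: "sets \<kappa> = sets borel" for \<kappa> :: "real measure" and t
      unfolding char_def using m by (subst integral_density) auto
    have "?n \<mu> = ?n \<nu>"
      by (rule Levy_uniqueness) (use rd sets emm em ch chareq in \<open>auto simp: fun_eq_iff\<close>)
    moreover have "density (?n \<kappa>) (\<lambda>_. ennreal m) = \<kappa>" for \<kappa> :: "real measure"
      using m by (subst density_density_eq) (auto simp: ennreal_mult[symmetric] density_1)
    ultimately show ?thesis by metis
  qed
qed

lemma borel_measurable_laplace_weight:
  fixes V :: "'i \<Rightarrow> 'a \<Rightarrow> real"
  assumes V: "\<And>i. i \<in> K \<union> J \<Longrightarrow> V i \<in> borel_measurable L" and A: "\<And>i. i \<in> J \<Longrightarrow> A i \<in> sets borel"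
  shows "(\<lambda>\<omega>. ennreal (exp (- (\<Sum>i\<in>K. l i * V i \<omega>))) * (\<Prod>i\<in>J. indicator (A i) (V i \<omega>))) \<in> borel_measurable L"
proof -
  have [measurable]: "(\<lambda>\<omega>. \<Sum>i\<in>K. l i * V i \<omega>) \<in> borel_measurable L"
    by (intro borel_measurable_sum borel_measurable_times borel_measurable_const V) auto
  have "(\<lambda>\<omega>. indicator (A i) (V i \<omega>) :: ennreal) \<in> borel_measurable L" if "i \<in> J" for i
    using that by (intro measurable_compose[OF V borel_measurable_indicator] A) auto
  then have [measurable]: "(\<lambda>\<omega>. \<Prod>i\<in>J. indicator (A i) (V i \<omega>) :: ennreal) \<in> borel_measurable L"
    by (rule borel_measurable_prod_ennreal)
  show ?thesis by measurable
qed

text \<open>Coordinates are converted one at a time from exponential weights to indicators: the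
  induction runs over the set J of converted coordinates. With J = I the integrals are the
  probabilities of boxes.\<close>

lemma laplace_uniqueness_PiM:
  fixes M :: "'a measure" and N :: "'b measure" and I :: "'i set"
  assumes I: "finite I"
    and X[measurable]: "\<And>i. i \<in> I \<Longrightarrow> X i \<in> borel_measurable M"
    and Y[measurable]: "\<And>i. i \<in> I \<Longrightarrow> Y i \<in> borel_measurable N"
    and eq: "\<And>l. (\<And>i. i \<in> I \<Longrightarrow> 0 \<le> l i) \<Longrightarrow>
       (\<integral>\<^sup>+\<omega>. ennreal (exp (- (\<Sum>i\<in>I. l i * X i \<omega>))) \<partial>M) = (\<integral>\<^sup>+\<omega>. ennreal (exp (- (\<Sum>i\<in>I. l i * Y i \<omega>))) \<partial>N)"
    and fin: "\<And>l. (\<And>i. i \<in> I \<Longrightarrow> 0 \<le> l i) \<Longrightarrow>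
       (\<integral>\<^sup>+\<omega>. ennreal (exp (- (\<Sum>i\<in>I. l i * X i \<omega>))) \<partial>M) < \<infinity>"
  shows "distr M (PiM I (\<lambda>_. borel)) (\<lambda>\<omega>. \<lambda>i\<in>I. X i \<omega>) = distr N (PiM I (\<lambda>_. borel)) (\<lambda>\<omega>. \<lambda>i\<in>I. Y i \<omega>)"
proof -
  let ?w = "\<lambda>J l A X \<omega>. ennreal (exp (- (\<Sum>i\<in>I - J. l i * X i \<omega>))) * (\<Prod>i\<in>J. indicator (A i) (X i \<omega>))"
  have main: "\<forall>l A. (\<forall>i\<in>I. 0 \<le> l i) \<longrightarrow> (\<forall>i\<in>J. A i \<in> sets borel) \<longrightarrow>
      (\<integral>\<^sup>+\<omega>. ?w J l A X \<omega> \<partial>M) = (\<integral>\<^sup>+\<omega>. ?w J l A Y \<omega> \<partial>N)" if "J \<subseteq> I" for J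
    using finite_subset[OF that I] that
  proof (induction J rule: finite_induct)
    case empty
    then show ?case using eq by simp
  next
    case (insert j J)
    then have J: "j \<in> I" "J \<subseteq> I" "j \<notin> J" "finite J" by auto
    show ?case
    proof (intro allI impI)
      fix l :: "'i \<Rightarrow> real" and A :: "'i \<Rightarrow> real set"
      assume l: "\<forall>i\<in>I. 0 \<le> l i" and A: "\<forall>i\<in>insert j J. A i \<in> sets borel"
      have [measurable]: "i \<in> J \<Longrightarrow> A i \<in> sets borel" for i using A by auto
      have [measurable]: "A j \<in> sets borel" using A by auto
      have IJ: "i \<in> I - insert j J \<Longrightarrow> i \<in> I" "i \<in> J \<Longrightarrow> i \<in> I" for i using J by auto
      define wX where "wX \<omega> = ennreal (exp (- (\<Sum>i\<in>I - insert j J. l i * X i \<omega>))) * (\<Prod>i\<in>J. indicator (A i) (X i \<omega>))" for \<omega>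
      define wY where "wY \<omega> = ennreal (exp (- (\<Sum>i\<in>I - insert j J. l i * Y i \<omega>))) * (\<Prod>i\<in>J. indicator (A i) (Y i \<omega>))" for \<omega>
      have [measurable]: "wX \<in> borel_measurable M" unfolding wX_def using J A by (intro borel_measurable_laplace_weight X) auto
      have [measurable]: "wY \<in> borel_measurable N" unfolding wY_def using J A by (intro borel_measurable_laplace_weight Y) auto
      have [measurable]: "X j \<in> borel_measurable M" "Y j \<in> borel_measurable N" using J by auto
      have split: "ennreal (exp (- s * V j \<omega>)) * (ennreal (exp (- (\<Sum>i\<in>I - insert j J. l i * V i \<omega>))) * P)
        = ennreal (exp (- (\<Sum>i\<in>I - J. (l(j := s)) i * V i \<omega>))) * P" for s and V :: "'i \<Rightarrow> 'c \<Rightarrow> real" and \<omega> P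
      proof -
        have ins: "I - J = insert j (I - insert j J)" using J by auto
        have "(\<Sum>i\<in>I - J. (l(j := s)) i * V i \<omega>) = s * V j \<omega> + (\<Sum>i\<in>I - insert j J. (l(j := s)) i * V i \<omega>)"
          unfolding ins by (subst sum.insert) (use I in auto)
        also have "(\<Sum>i\<in>I - insert j J. (l(j := s)) i * V i \<omega>) = (\<Sum>i\<in>I - insert j J. l i * V i \<omega>)"
          by (intro sum.cong) auto
        finally show ?thesis by (simp add: mult.assoc[symmetric] ennreal_mult[symmetric] exp_add[symmetric])
      qed
      \<comment> \<open>The law of coordinate j under M weighted by all other factors. Its transform
        at s is the induction hypothesis with the weight of j set to s, so one-dimensional
        uniqueness applies.\<close>
      define \<mu> where "\<mu> = distr (density M wX) borel (X j)"
      define \<nu> where "\<nu> = distr (density N wY) borel (Y j)"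
      have lapX: "(\<integral>\<^sup>+x. ennreal (exp (- s * x)) \<partial>\<mu>) = (\<integral>\<^sup>+\<omega>. ?w J (l(j := s)) A X \<omega> \<partial>M)" for s
      proof -
        have "(\<integral>\<^sup>+x. ennreal (exp (- s * x)) \<partial>\<mu>) = (\<integral>\<^sup>+\<omega>. wX \<omega> * ennreal (exp (- s * X j \<omega>)) \<partial>M)"
          unfolding \<mu>_def by (subst nn_integral_distr) (auto simp: nn_integral_density)
        also have "\<dots> = (\<integral>\<^sup>+\<omega>. ?w J (l(j := s)) A X \<omega> \<partial>M)"
          unfolding wX_def by (intro nn_integral_cong) (subst mult.commute, rule split)
        finally show ?thesis .
      qed
      have lapY: "(\<integral>\<^sup>+x. ennreal (exp (- s * x)) \<partial>\<nu>) = (\<integral>\<^sup>+\<omega>. ?w J (l(j := s)) A Y \<omega> \<partial>N)" for s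
      proof -
        have "(\<integral>\<^sup>+x. ennreal (exp (- s * x)) \<partial>\<nu>) = (\<integral>\<^sup>+\<omega>. wY \<omega> * ennreal (exp (- s * Y j \<omega>)) \<partial>N)"
          unfolding \<nu>_def by (subst nn_integral_distr) (auto simp: nn_integral_density)
        also have "\<dots> = (\<integral>\<^sup>+\<omega>. ?w J (l(j := s)) A Y \<omega> \<partial>N)"
          unfolding wY_def by (intro nn_integral_cong) (subst mult.commute, rule split)
        finally show ?thesis .
      qed
      have "\<mu> = \<nu>"
      proof (rule laplace_uniqueness)
        fix s :: real assume s: "0 \<le> s"
        have ls: "\<forall>i\<in>I. 0 \<le> (l(j := s)) i" using l s by auto
        then show "(\<integral>\<^sup>+x. ennreal (exp (- s * x)) \<partial>\<mu>) = (\<integral>\<^sup>+x. ennreal (exp (- s * x)) \<partial>\<nu>)"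
          unfolding lapX lapY using insert.IH[OF J(2)] A by blast
        have "(\<integral>\<^sup>+\<omega>. ?w J (l(j := s)) A X \<omega> \<partial>M) \<le>
          (\<integral>\<^sup>+\<omega>. ennreal (exp (- (\<Sum>i\<in>I. (if i \<in> J then 0 else (l(j := s)) i) * X i \<omega>))) \<partial>M)"
        proof (rule nn_integral_mono)
          fix \<omega>
          have s1: "(\<Sum>i\<in>I. (if i \<in> J then 0 else (l(j := s)) i) * X i \<omega>) = (\<Sum>i\<in>I - J. (l(j := s)) i * X i \<omega>)"
            using I by (intro sum.mono_neutral_cong_right) auto
          have s2: "(\<Prod>i\<in>J. indicator (A i) (X i \<omega>)) \<le> (1::ennreal)"
            by (intro prod_le_1) (auto simp: indicator_def)
          show "?w J (l(j := s)) A X \<omega> \<le> ennreal (exp (- (\<Sum>i\<in>I. (if i \<in> J then 0 else (l(j := s)) i) * X i \<omega>)))"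
            unfolding s1
            using mult_left_mono[OF s2 zero_le, of "ennreal (exp (- (\<Sum>i\<in>I - J. (l(j := s)) i * X i \<omega>)))"]
            unfolding mult_1_right .
        qed
        also have "\<dots> < \<infinity>" using ls by (intro fin) auto
        finally show "(\<integral>\<^sup>+x. ennreal (exp (- s * x)) \<partial>\<mu>) < \<infinity>" unfolding lapX .
      qed (auto simp: \<mu>_def \<nu>_def)
      then have "emeasure \<mu> (A j) = emeasure \<nu> (A j)" by simp
      moreover have "emeasure \<mu> (A j) = (\<integral>\<^sup>+\<omega>. ?w (insert j J) l A X \<omega> \<partial>M)"
        unfolding \<mu>_def
        by (subst emeasure_distr) (auto simp: emeasure_density wX_def J indicator_def mult_ac intro!: nn_integral_cong)
      moreover have "emeasure \<nu> (A j) = (\<integral>\<^sup>+\<omega>. ?w (insert j J) l A Y \<omega> \<partial>N)"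
        unfolding \<nu>_def
        by (subst emeasure_distr) (auto simp: emeasure_density wY_def J indicator_def mult_ac intro!: nn_integral_cong)
      ultimately show "(\<integral>\<^sup>+\<omega>. ?w (insert j J) l A X \<omega> \<partial>M) = (\<integral>\<^sup>+\<omega>. ?w (insert j J) l A Y \<omega> \<partial>N)" by simp
    qed
  qed
  have mX[measurable]: "(\<lambda>\<omega>. \<lambda>i\<in>I. X i \<omega>) \<in> measurable M (PiM I (\<lambda>_. borel))"
    and mY[measurable]: "(\<lambda>\<omega>. \<lambda>i\<in>I. Y i \<omega>) \<in> measurable N (PiM I (\<lambda>_. borel))"
    by (auto intro!: measurable_restrict X Y)
  have box: "emeasure (distr L (PiM I (\<lambda>_. borel)) (\<lambda>\<omega>. \<lambda>i\<in>I. V i \<omega>)) (PiE I A) = (\<integral>\<^sup>+\<omega>. ?w I (\<lambda>_. 0) A V \<omega> \<partial>L)"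
    if V: "\<And>i. i \<in> I \<Longrightarrow> V i \<in> borel_measurable L" and A: "\<And>i. i \<in> I \<Longrightarrow> A i \<in> sets borel"
    for L :: "'c measure" and V A
  proof -
    have mV: "(\<lambda>\<omega>. \<lambda>i\<in>I. V i \<omega>) \<in> measurable L (PiM I (\<lambda>_. borel))" by (intro measurable_restrict V)
    have sA: "PiE I A \<in> sets (PiM I (\<lambda>_. borel))" using I A by (intro sets_PiM_I_finite) auto
    have "(\<Prod>i\<in>I. indicator (A i) (V i \<omega>)) = (indicator ((\<lambda>\<omega>. \<lambda>i\<in>I. V i \<omega>) -` PiE I A \<inter> space L) \<omega> :: ennreal)"
      if "\<omega> \<in> space L" for \<omega>
      using that I by (auto simp: indicator_def PiE_iff prod_zero_iff)
    then have "(\<integral>\<^sup>+\<omega>. ?w I (\<lambda>_. 0) A V \<omega> \<partial>L) = (\<integral>\<^sup>+\<omega>. indicator ((\<lambda>\<omega>. \<lambda>i\<in>I. V i \<omega>) -` PiE I A \<inter> space L) \<omega> \<partial>L)"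
      by (intro nn_integral_cong) auto
    also have "\<dots> = emeasure L ((\<lambda>\<omega>. \<lambda>i\<in>I. V i \<omega>) -` PiE I A \<inter> space L)"
      by (intro nn_integral_indicator measurable_sets[OF mV sA])
    finally show ?thesis by (subst emeasure_distr[OF mV sA]) simp
  qed
  show ?thesis
  proof (rule measure_eqI_PiM_finite[OF I])
    fix A :: "'i \<Rightarrow> real set" assume A: "\<And>i. i \<in> I \<Longrightarrow> A i \<in> sets borel"
    show "emeasure (distr M (PiM I (\<lambda>_. borel)) (\<lambda>\<omega>. \<lambda>i\<in>I. X i \<omega>)) (PiE I A)
        = emeasure (distr N (PiM I (\<lambda>_. borel)) (\<lambda>\<omega>. \<lambda>i\<in>I. Y i \<omega>)) (PiE I A)"
    proof -
      have "(\<integral>\<^sup>+\<omega>. ?w I (\<lambda>_. 0) A X \<omega> \<partial>M) = (\<integral>\<^sup>+\<omega>. ?w I (\<lambda>_. 0) A Y \<omega> \<partial>N)"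
        using main[OF order_refl, rule_format, of "\<lambda>_. 0" A] A by simp
      with box[of X M A, OF X A] box[of Y N A, OF Y A] show ?thesis by (simp only:)
    qed
  next
    show "range (\<lambda>_::nat. PiE I (\<lambda>_. UNIV)) \<subseteq> prod_algebra I (\<lambda>_. borel)"
      using I by (auto intro!: prod_algebraI_finite)
    show "(\<Union>i::nat. PiE I (\<lambda>_. UNIV)) = space (PiM I (\<lambda>_. borel))" by (simp add: space_PiM)
    fix i :: nat
    have "emeasure (distr M (PiM I (\<lambda>_. borel)) (\<lambda>\<omega>. \<lambda>i\<in>I. X i \<omega>)) (PiE I (\<lambda>_. UNIV)) = (\<integral>\<^sup>+\<omega>. ennreal (exp (- (\<Sum>i\<in>I. 0 * X i \<omega>))) \<partial>M)"
      by (subst box[of X M "\<lambda>_. UNIV", OF X]) auto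
    also have "\<dots> < \<infinity>" using fin[of "\<lambda>_. 0"] by simp
    finally show "emeasure (distr M (PiM I (\<lambda>_. borel)) (\<lambda>\<omega>. \<lambda>i\<in>I. X i \<omega>)) (PiE I (\<lambda>_. UNIV)) \<noteq> \<infinity>" by simp
  qed auto
qed

text \<open>The joint law is compared with the product of the marginals: both have the product of
  the marginal transforms as their joint transform.\<close>

lemma (in prob_space) indep_vars_laplace:
  fixes X :: "'i \<Rightarrow> 'a \<Rightarrow> real"
  assumes I: "finite I"
    and X[measurable]: "\<And>i. i \<in> I \<Longrightarrow> X i \<in> borel_measurable M"
    and eq: "\<And>l. (\<And>i. i \<in> I \<Longrightarrow> 0 \<le> l i) \<Longrightarrow>
       (\<integral>\<^sup>+\<omega>. ennreal (exp (- (\<Sum>i\<in>I. l i * X i \<omega>))) \<partial>M) = (\<Prod>i\<in>I. \<integral>\<^sup>+\<omega>. ennreal (exp (- l i * X i \<omega>)) \<partial>M)"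
    and fin: "\<And>i l. i \<in> I \<Longrightarrow> 0 \<le> l \<Longrightarrow> (\<integral>\<^sup>+\<omega>. ennreal (exp (- l * X i \<omega>)) \<partial>M) < \<infinity>"
  shows "indep_vars (\<lambda>_. borel) X I"
proof (cases "I = {}")
  case True
  then show ?thesis by (simp add: indep_vars_def indep_sets_def)
next
  case False
  \<comment> \<open>A unit mass outside I, because the product construction wants a probability
    measure at every index.\<close>
  let ?D = "\<lambda>i. if i \<in> I then distr M borel (X i) else return borel 0"
  interpret D: product_prob_space ?D I
    by (intro product_prob_spaceI) (auto intro!: prob_space_distr prob_space_return X)
  show ?thesis
  proof (subst indep_vars_iff_distr_eq_PiM'[OF False X])
    have "distr M (PiM I (\<lambda>_. borel)) (\<lambda>\<omega>. \<lambda>i\<in>I. X i \<omega>)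
        = distr (PiM I ?D) (PiM I (\<lambda>_. borel)) (\<lambda>\<omega>. \<lambda>i\<in>I. \<omega> i)"
    proof (rule laplace_uniqueness_PiM[OF I X])
      show "(\<lambda>\<omega>. \<omega> i) \<in> borel_measurable (PiM I ?D)" if "i \<in> I" for i
      proof -
        have "(\<lambda>\<omega>. \<omega> i) \<in> measurable (PiM I ?D) (?D i)" using that by (rule measurable_component_singleton)
        moreover have "sets (?D i) = sets borel" by simp
        ultimately show ?thesis using measurable_cong_sets[OF refl, of "?D i" borel] by blast
      qed
      fix l :: "'i \<Rightarrow> real" assume l: "\<And>i. i \<in> I \<Longrightarrow> 0 \<le> l i"
      have "(\<integral>\<^sup>+\<omega>. ennreal (exp (- (\<Sum>i\<in>I. l i * \<omega> i))) \<partial>PiM I ?D)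
        = (\<integral>\<^sup>+\<omega>. (\<Prod>i\<in>I. ennreal (exp (- l i * \<omega> i))) \<partial>PiM I ?D)"
        using I by (simp add: prod_ennreal exp_sum[symmetric] sum_negf)
      also have "\<dots> = (\<Prod>i\<in>I. \<integral>\<^sup>+x. ennreal (exp (- l i * x)) \<partial>?D i)"
        by (rule D.product_nn_integral_prod[OF I]) auto
      also have "\<dots> = (\<Prod>i\<in>I. \<integral>\<^sup>+\<omega>. ennreal (exp (- l i * X i \<omega>)) \<partial>M)"
        by (intro prod.cong refl) (simp add: nn_integral_distr)
      finally show "(\<integral>\<^sup>+\<omega>. ennreal (exp (- (\<Sum>i\<in>I. l i * X i \<omega>))) \<partial>M)
         = (\<integral>\<^sup>+\<omega>. ennreal (exp (- (\<Sum>i\<in>I. l i * \<omega> i))) \<partial>PiM I ?D)" using eq[OF l] by simp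
      show "(\<integral>\<^sup>+\<omega>. ennreal (exp (- (\<Sum>i\<in>I. l i * X i \<omega>))) \<partial>M) < \<infinity>"
        using fin l unfolding eq[of l, OF l, simplified] less_top[symmetric] infinity_ennreal_def
        by (auto simp: ennreal_prod_eq_top)
    qed
    also have "\<dots> = distr (PiM I ?D) (PiM I ?D) (\<lambda>\<omega>. \<omega>)"
      by (intro distr_cong sets_PiM_cong refl) (auto simp: space_PiM PiE_iff extensional_def restrict_def)
    also have "\<dots> = PiM I ?D" by (rule distr_id)
    also have "\<dots> = PiM I (\<lambda>i. distr M borel (X i))" by (intro PiM_cong) auto
    finally show "distr M (PiM I (\<lambda>_. borel)) (\<lambda>x. \<lambda>i\<in>I. X i x) = PiM I (\<lambda>i. distr M borel (X i))" .
  qed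
qed

section \<open>Laplace transform of the absorption time\<close>

definition Lap :: "real \<Rightarrow> (real \<Rightarrow> real) \<Rightarrow> real" where
  "Lap l f = (\<integral>t. indicator {0..} t * (exp (- l * t) * f t) \<partial>lborel)"

lemma Lap_integrable:
  fixes f :: "real \<Rightarrow> real"
  assumes l: "0 < l" and f: "continuous_on {0..} f" and bound: "\<And>t. 0 \<le> t \<Longrightarrow> \<bar>f t\<bar> \<le> C * (1 + t)"
  shows "integrable lborel (\<lambda>t. indicator {0..} t * (exp (- l * t) * f t))"
proof -
  have C: "0 \<le> C" using bound[of 0] abs_ge_zero[of "f 0"] by simp
  have "integrable lborel (\<lambda>t. indicator {0..} t * (exp (- l * t) * (1 + t)))"
  proof (rule integrableI_nonneg)
    have "(\<integral>\<^sup>+t. ennreal (exp (- l * t) * (1 + t)) * indicator {0..} t \<partial>lborel)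
        = 0 - (- (exp (- l * 0) * (1 + 0) / l) - exp (- l * 0) / l\<^sup>2)"
    proof (rule nn_integral_FTC_atLeast)
      show "((\<lambda>t. - (exp (- l * t) * (1 + t) / l) - exp (- l * t) / l\<^sup>2) \<longlongrightarrow> 0) at_top"
        using l by real_asymp
      fix x :: real
      show "DERIV (\<lambda>t. - (exp (- l * t) * (1 + t) / l) - exp (- l * t) / l\<^sup>2) x :> exp (- l * x) * (1 + x)"
        using l by (auto intro!: derivative_eq_intros simp: field_simps power2_eq_square)
    qed auto
    then show "(\<integral>\<^sup>+t. ennreal (indicator {0..} t * (exp (- l * t) * (1 + t))) \<partial>lborel) < \<infinity>"
      by (subst nn_integral_cong[of _ _ "\<lambda>t. ennreal (exp (- l * t) * (1 + t)) * indicator {0..} t"])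
         (auto simp: indicator_def)
  qed (auto simp: indicator_def)
  then have int: "integrable lborel (\<lambda>t. C * (indicator {0..} t * (exp (- l * t) * (1 + t))))" by (rule integrable_mult_right)
  have "(\<lambda>t. indicator {0..} t *\<^sub>R (exp (- l * t) * f t)) \<in> borel_measurable borel"
    by (intro borel_measurable_continuous_on_indicator continuous_intros f) auto
  then have meas: "(\<lambda>t. indicator {0..} t * (exp (- l * t) * f t)) \<in> borel_measurable lborel" by simp
  show ?thesis
  proof (rule Bochner_Integration.integrable_bound[OF int meas], rule AE_I2)
    fix t :: real
    show "norm (indicator {0..} t * (exp (- l * t) * f t)) \<le> norm (C * (indicator {0..} t * (exp (- l * t) * (1 + t))))"
      using bound[of t] C by (auto simp: indicator_def abs_mult mult.left_commute[of C])
  qed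
qed

lemma Lap_nonneg: "(\<And>t. 0 \<le> t \<Longrightarrow> 0 \<le> f t) \<Longrightarrow> 0 \<le> Lap l f"
  unfolding Lap_def by (intro integral_nonneg_AE AE_I2) (auto simp: indicator_def)

lemma Lap_mono:
  assumes "0 < l" "continuous_on {0..} f" "continuous_on {0..} g"
    and "\<And>t. 0 \<le> t \<Longrightarrow> \<bar>f t\<bar> \<le> C * (1 + t)" "\<And>t. 0 \<le> t \<Longrightarrow> \<bar>g t\<bar> \<le> D * (1 + t)"
    and "\<And>t. 0 \<le> t \<Longrightarrow> f t \<le> g t"
  shows "Lap l f \<le> Lap l g"
  unfolding Lap_def
  by (intro integral_mono Lap_integrable[where C=C] Lap_integrable[where C=D]) (use assms in \<open>auto simp: indicator_def\<close>)

lemma Lap_lincomb3: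
  assumes "0 < l" and c: "continuous_on {0..} f" "continuous_on {0..} g" "continuous_on {0..} h"
    and b: "\<And>t. 0 \<le> t \<Longrightarrow> \<bar>f t\<bar> \<le> 1 + t" "\<And>t. 0 \<le> t \<Longrightarrow> \<bar>g t\<bar> \<le> 1 + t" "\<And>t. 0 \<le> t \<Longrightarrow> \<bar>h t\<bar> \<le> 1 + t"
  shows "Lap l (\<lambda>t. p * f t + q * g t + r * h t) = p * Lap l f + q * Lap l g + r * Lap l h"
proof -
  have i: "integrable lborel (\<lambda>t. indicator {0..} t * (exp (- l * t) * f t))"
    "integrable lborel (\<lambda>t. indicator {0..} t * (exp (- l * t) * g t))"
    "integrable lborel (\<lambda>t. indicator {0..} t * (exp (- l * t) * h t))"
    by (intro Lap_integrable[where C=1]; use assms in simp)+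
  have "Lap l (\<lambda>t. p * f t + q * g t + r * h t) = (\<integral>t. p * (indicator {0..} t * (exp (- l * t) * f t))
     + q * (indicator {0..} t * (exp (- l * t) * g t)) + r * (indicator {0..} t * (exp (- l * t) * h t)) \<partial>lborel)"
    unfolding Lap_def by (intro Bochner_Integration.integral_cong refl) (simp add: algebra_simps)
  also have "\<dots> = p * Lap l f + q * Lap l g + r * Lap l h"
    unfolding Lap_def using i by simp
  finally show ?thesis .
qed

text \<open>Integration by parts, via the fundamental theorem for exp(-l t) f t on [0,n]; linear
  growth of f kills the boundary term as n tends to infinity.\<close>

lemma Lap_deriv:
  assumes l: "0 < l"
    and der: "\<And>t. 0 \<le> t \<Longrightarrow> (f has_real_derivative f' t) (at t within {0..})"
    and cont: "continuous_on {0..} f'"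
    and bound: "\<And>t. 0 \<le> t \<Longrightarrow> \<bar>f t\<bar> \<le> C * (1 + t)" "\<And>t. 0 \<le> t \<Longrightarrow> \<bar>f' t\<bar> \<le> D * (1 + t)"
  shows "l * Lap l f = f 0 + Lap l f'"
proof -
  have contf: "continuous_on {0..} f"
    using der by (meson atLeast_iff continuous_on_eq_continuous_within DERIV_continuous)
  have int: "integrable lborel (\<lambda>t. indicator {0..} t * (exp (- l * t) * f t))"
    "integrable lborel (\<lambda>t. indicator {0..} t * (exp (- l * t) * f' t))"
    by (rule Lap_integrable[OF l contf bound(1)] Lap_integrable[OF l cont bound(2)]; assumption)+
  define h where "h t = indicator {0..} t * (exp (- l * t) * (f' t - l * f t))" for t
  have h_eq: "h = (\<lambda>t. indicator {0..} t * (exp (- l * t) * f' t) - l * (indicator {0..} t * (exp (- l * t) * f t)))"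
    by (simp add: h_def fun_eq_iff algebra_simps)
  have inth: "integrable lborel h" unfolding h_eq using int by simp
  have Ih: "integral\<^sup>L lborel h = Lap l f' - l * Lap l f"
    unfolding h_eq Lap_def using int by simp
  have "((\<lambda>y. \<integral>x. indicator {..y} x *\<^sub>R h x \<partial>lborel) \<longlongrightarrow> integral\<^sup>L lborel h) at_top"
    by (rule tendsto_integral_at_top) (use inth in auto)
  then have lim1: "(\<lambda>n. \<integral>x. indicator {..real n} x *\<^sub>R h x \<partial>lborel) \<longlonglongrightarrow> integral\<^sup>L lborel h"
    by (rule filterlim_compose) (rule filterlim_real_sequentially)
  have FTC: "(\<integral>x. indicator {..real n} x *\<^sub>R h x \<partial>lborel) = exp (- l * real n) * f (real n) - f 0" for n
  proof -
    have "(\<integral>x. indicator {..real n} x *\<^sub>R h x \<partial>lborel) = (\<integral>x. indicator {0..real n} x *\<^sub>R (exp (- l * x) * (f' x - l * f x)) \<partial>lborel)"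
      by (intro Bochner_Integration.integral_cong refl) (auto simp: h_def indicator_def)
    also have "\<dots> = exp (- l * real n) * f (real n) - exp (- l * 0) * f 0"
    proof (rule integral_FTC_atLeastAtMost)
      show "continuous_on {0..real n} (\<lambda>x. exp (- l * x) * (f' x - l * f x))"
        by (intro continuous_intros continuous_on_subset[OF cont] continuous_on_subset[OF contf]) auto
      fix x :: real assume x: "0 \<le> x" "x \<le> real n"
      have "(f has_real_derivative f' x) (at x within {0..real n})"
        using der[OF x(1)] by (rule DERIV_subset) auto
      then have "((\<lambda>x. exp (- l * x) * f x) has_real_derivative (exp (- l * x) * (f' x - l * f x))) (at x within {0..real n})"
        by (auto intro!: derivative_eq_intros simp: algebra_simps)
      then show "((\<lambda>x. exp (- l * x) * f x) has_vector_derivative (exp (- l * x) * (f' x - l * f x))) (at x within {0..real n})"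
        by (simp add: has_real_derivative_iff_has_vector_derivative)
    qed simp
    finally show ?thesis by simp
  qed
  have "(\<lambda>n. exp (- l * real n) * f (real n)) \<longlonglongrightarrow> 0"
  proof (rule tendsto_rabs_zero_cancel, rule tendsto_sandwich[of "\<lambda>_. 0" _ _ "\<lambda>n. C * (exp (- l * real n) * (1 + real n))"])
    show "(\<lambda>n. C * (exp (- l * real n) * (1 + real n))) \<longlonglongrightarrow> 0"
      by (rule tendsto_mult_right_zero) (use l in real_asymp)
    show "eventually (\<lambda>n. \<bar>exp (- l * real n) * f (real n)\<bar> \<le> C * (exp (- l * real n) * (1 + real n))) sequentially"
      using bound(1) by (intro always_eventually allI) (simp add: abs_mult mult.left_commute)
  qed auto
  then have "(\<lambda>n. exp (- l * real n) * f (real n) - f 0) \<longlonglongrightarrow> 0 - f 0" by (intro tendsto_diff tendsto_const)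
  with lim1 have "integral\<^sup>L lborel h = - f 0" unfolding FTC by (auto intro: LIMSEQ_unique)
  then show ?thesis using Ih by simp
qed

text \<open>The factor (t/(1+t))^m is the probability that m independent critical linear birth-death
  processes are extinct by time t. Multiplied by (1+t)^\<alpha> it solves the backward equations of
  the chain for m \<ge> 1, and for m = 0 the equation with formal row \<alpha> (f_0 - f_1) instead
  of the absorbing one.\<close>

definition bernstein_fun :: "real \<Rightarrow> nat \<Rightarrow> real \<Rightarrow> real" where
  "bernstein_fun \<alpha> m t = t ^ m * (1 + t) powr (\<alpha> - real m)"

lemma bernstein_fun_diff:
  assumes "0 \<le> t"
  shows "bernstein_fun \<alpha> m t - bernstein_fun \<alpha> (Suc m) t = t ^ m * (1 + t) powr (\<alpha> - real m - 1)"
proof -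
  have "(1 + t) powr (\<alpha> - real m) = (1 + t) * (1 + t) powr (\<alpha> - real m - 1)"
    using assms by (simp add: powr_mult_base)
  then show ?thesis by (simp add: bernstein_fun_def algebra_simps)
qed

lemma bernstein_fun_bounds:
  assumes \<alpha>: "0 < \<alpha>" "\<alpha> < 1" and t: "0 \<le> t"
  shows "0 \<le> bernstein_fun \<alpha> m t" "bernstein_fun \<alpha> m t \<le> (1 + t) powr \<alpha>" "bernstein_fun \<alpha> m t \<le> 1 + t"
proof -
  show "0 \<le> bernstein_fun \<alpha> m t" using t by (simp add: bernstein_fun_def)
  show *: "bernstein_fun \<alpha> m t \<le> (1 + t) powr \<alpha>"
  proof (induction m)
    case 0 then show ?case by (simp add: bernstein_fun_def)
  next
    case (Suc m)
    have "0 \<le> bernstein_fun \<alpha> m t - bernstein_fun \<alpha> (Suc m) t" unfolding bernstein_fun_diff[OF t] using t by simp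
    then show ?case using Suc by simp
  qed
  have "(1 + t) powr \<alpha> \<le> (1 + t) powr 1" using \<alpha> t by (intro powr_mono) auto
  then show "bernstein_fun \<alpha> m t \<le> 1 + t" using * t by simp
qed

lemma bernstein_fun_deriv:
  assumes t: "0 \<le> t"
  shows "(bernstein_fun \<alpha> m has_real_derivative
     (real m * bernstein_fun \<alpha> (m - 1) t + (\<alpha> - 2 * real m) * bernstein_fun \<alpha> m t + (real m - \<alpha>) * bernstein_fun \<alpha> (Suc m) t))
     (at t within {0..})"
proof -
  have "(bernstein_fun \<alpha> m has_real_derivative
     (real m * t ^ (m - 1) * (1 + t) powr (\<alpha> - real m) + t ^ m * ((\<alpha> - real m) * (1 + t) powr (\<alpha> - real m - 1)))) (at t within {0..})"
    unfolding bernstein_fun_def[abs_def] using t by (auto intro!: derivative_eq_intros)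
  moreover have "real m * t ^ (m - 1) * (1 + t) powr (\<alpha> - real m) = real m * (bernstein_fun \<alpha> (m - 1) t - bernstein_fun \<alpha> m t)"
    using bernstein_fun_diff[OF t, of \<alpha> "m - 1"] by (cases m) (auto simp: algebra_simps)
  moreover have "t ^ m * ((\<alpha> - real m) * (1 + t) powr (\<alpha> - real m - 1)) = (\<alpha> - real m) * (bernstein_fun \<alpha> m t - bernstein_fun \<alpha> (Suc m) t)"
    unfolding bernstein_fun_diff[OF t] by simp
  ultimately have "(bernstein_fun \<alpha> m has_real_derivative
     (real m * (bernstein_fun \<alpha> (m - 1) t - bernstein_fun \<alpha> m t) + (\<alpha> - real m) * (bernstein_fun \<alpha> m t - bernstein_fun \<alpha> (Suc m) t))) (at t within {0..})"
    by (simp only:)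
  then show ?thesis by (rule back_subst[of "\<lambda>D. (bernstein_fun \<alpha> m has_real_derivative D) (at t within {0..})"])
     (simp add: algebra_simps)
qed

lemma continuous_bernstein_fun: "continuous_on {0..} (bernstein_fun \<alpha> m)"
  using bernstein_fun_deriv by (meson atLeast_iff continuous_on_eq_continuous_within DERIV_continuous)

lemma Lap_bernstein_fun:
  assumes \<alpha>: "0 < \<alpha>" "\<alpha> < 1" and l: "0 < l"
  shows "l * Lap l (bernstein_fun \<alpha> m) = of_bool (m = 0) + real m * Lap l (bernstein_fun \<alpha> (m - 1))
     + (\<alpha> - 2 * real m) * Lap l (bernstein_fun \<alpha> m) + (real m - \<alpha>) * Lap l (bernstein_fun \<alpha> (Suc m))"
proof -
  note b = bernstein_fun_bounds[OF \<alpha>]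
  have b': "\<bar>bernstein_fun \<alpha> k t\<bar> \<le> 1 + t" if "0 \<le> t" for k t using b[OF that, of k] by simp
  have "l * Lap l (bernstein_fun \<alpha> m) = bernstein_fun \<alpha> m 0 + Lap l (\<lambda>t. real m * bernstein_fun \<alpha> (m - 1) t + (\<alpha> - 2 * real m) * bernstein_fun \<alpha> m t + (real m - \<alpha>) * bernstein_fun \<alpha> (Suc m) t)"
  proof (rule Lap_deriv[OF l bernstein_fun_deriv])
    show "continuous_on {0..} (\<lambda>t. real m * bernstein_fun \<alpha> (m - 1) t + (\<alpha> - 2 * real m) * bernstein_fun \<alpha> m t + (real m - \<alpha>) * bernstein_fun \<alpha> (Suc m) t)"
      by (intro continuous_intros continuous_bernstein_fun)
    fix t :: real assume t: "0 \<le> t"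
    show "\<bar>bernstein_fun \<alpha> m t\<bar> \<le> 1 * (1 + t)" using b'[OF t] by simp
    have "\<bar>real m * bernstein_fun \<alpha> (m - 1) t + (\<alpha> - 2 * real m) * bernstein_fun \<alpha> m t + (real m - \<alpha>) * bernstein_fun \<alpha> (Suc m) t\<bar>
       \<le> real m * (1 + t) + \<bar>\<alpha> - 2 * real m\<bar> * (1 + t) + \<bar>real m - \<alpha>\<bar> * (1 + t)"
      by (intro abs_triangle_ineq[THEN order_trans] add_mono) (auto simp: abs_mult intro!: mult_left_mono b' t)
    also have "\<dots> = (real m + \<bar>\<alpha> - 2 * real m\<bar> + \<bar>real m - \<alpha>\<bar>) * (1 + t)" by (simp add: algebra_simps)
    finally show "\<bar>real m * bernstein_fun \<alpha> (m - 1) t + (\<alpha> - 2 * real m) * bernstein_fun \<alpha> m t + (real m - \<alpha>) * bernstein_fun \<alpha> (Suc m) t\<bar>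
       \<le> (real m + \<bar>\<alpha> - 2 * real m\<bar> + \<bar>real m - \<alpha>\<bar>) * (1 + t)" .
  qed
  also have "bernstein_fun \<alpha> m 0 = of_bool (m = 0)" by (auto simp: bernstein_fun_def)
  also have "Lap l (\<lambda>t. real m * bernstein_fun \<alpha> (m - 1) t + (\<alpha> - 2 * real m) * bernstein_fun \<alpha> m t + (real m - \<alpha>) * bernstein_fun \<alpha> (Suc m) t)
    = real m * Lap l (bernstein_fun \<alpha> (m - 1)) + (\<alpha> - 2 * real m) * Lap l (bernstein_fun \<alpha> m) + (real m - \<alpha>) * Lap l (bernstein_fun \<alpha> (Suc m))"
    by (rule Lap_lincomb3[OF l continuous_bernstein_fun continuous_bernstein_fun continuous_bernstein_fun b' b' b'])
  finally show ?thesis by simp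
qed

lemma Lap_const: "0 < l \<Longrightarrow> Lap l (\<lambda>_. 1) = 1 / l"
  using Lap_deriv[of l "\<lambda>_. 1" "\<lambda>_. 0" 1 0] by (simp add: Lap_def field_simps)

text \<open>A bounded solution of the recursion vanishing at 0 cannot have positive slope there:
  its increments would be bounded below.\<close>

lemma bounded_recursion_le_0:
  fixes d :: "nat \<Rightarrow> real"
  assumes \<alpha>: "0 < \<alpha>" "\<alpha> < 1" and l: "0 < l" and d0: "d 0 = 0" and bound: "\<And>m. \<bar>d m\<bar> \<le> C"
    and rec: "\<And>m. 1 \<le> m \<Longrightarrow> l * d m = real m * d (m - 1) + (\<alpha> - 2 * real m) * d m + (real m - \<alpha>) * d (Suc m)"
  shows "d 1 \<le> 0"
proof (rule ccontr)
  assume "\<not> d 1 \<le> 0"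
  then have pos: "0 < d 1" by simp
  \<comment> \<open>Both parts are carried through the induction: the second makes l d nonnegative,
    so this term only helps the increments.\<close>
  have *: "d (Suc m) - d m \<ge> d 1 \<and> real (Suc m) * d 1 \<le> d (Suc m)" for m
  proof (induction m)
    case 0 then show ?case using d0 by simp
  next
    case (Suc m)
    let ?n = "Suc m"
    have "(real ?n - \<alpha>) * (d (Suc ?n) - d ?n) = real ?n * (d ?n - d m) + l * d ?n"
      using rec[of ?n] by (simp add: algebra_simps)
    also have "\<dots> \<ge> real ?n * d 1 + 0"
    proof (intro add_mono mult_left_mono mult_nonneg_nonneg)
      show "0 \<le> d ?n" using Suc pos by (metis of_nat_0_le_iff mult_nonneg_nonneg less_imp_le order_trans)
    qed (use Suc l in auto)
    also have "real ?n * d 1 + 0 \<ge> (real ?n - \<alpha>) * d 1" using pos \<alpha> by (simp add: algebra_simps)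
    finally have "(real ?n - \<alpha>) * d 1 \<le> (real ?n - \<alpha>) * (d (Suc ?n) - d ?n)" .
    then have "d 1 \<le> d (Suc ?n) - d ?n" using \<alpha> by (subst (asm) mult_le_cancel_left_pos) auto
    then show ?case using Suc by (simp add: algebra_simps)
  qed
  obtain n :: nat where n: "C / d 1 < real n" using reals_Archimedean2 by blast
  then have "C < real n * d 1" using pos by (simp add: field_simps)
  also have "\<dots> \<le> real (Suc n) * d 1" using pos by simp
  also have "\<dots> \<le> d (Suc n)" using * by blast
  finally show False using bound[of "Suc n"] by simp
qed

text \<open>The Laplace exponent of X, given as the reciprocal of the transform of its scale
  function (1 + t)^\<alpha>.\<close>

definition psi_X :: "real \<Rightarrow> real \<Rightarrow> real" where
  "psi_X \<alpha> l = 1 / Lap l (\<lambda>t. (1 + t) powr \<alpha>)"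

lemma Lap_powr_ge:
  assumes \<alpha>: "0 < \<alpha>" "\<alpha> < 1" and l: "0 < l"
  shows "1 / l \<le> Lap l (\<lambda>t. (1 + t) powr \<alpha>)"
proof -
  have "Lap l (\<lambda>_. 1) \<le> Lap l (\<lambda>t. (1 + t) powr \<alpha>)"
  proof (rule Lap_mono[OF l, where C=1 and D=1])
    fix t :: real assume t: "0 \<le> t"
    show "1 \<le> (1 + t) powr \<alpha>" using t \<alpha> by (simp add: ge_one_powr_ge_zero)
    show "\<bar>(1 + t) powr \<alpha>\<bar> \<le> 1 * (1 + t)" using bernstein_fun_bounds[OF \<alpha> t, of 0] by (simp add: bernstein_fun_def)
  qed (auto intro!: continuous_intros)
  then show ?thesis using Lap_const[OF l] by simp
qed

lemma psi_X_bounds: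
  assumes "0 < \<alpha>" "\<alpha> < 1" "0 < l"
  shows "0 < psi_X \<alpha> l" "psi_X \<alpha> l \<le> l"
proof -
  have "0 < 1 / l" using assms by simp
  also note Lap_powr_ge[OF assms]
  finally have pos: "0 < Lap l (\<lambda>t. (1 + t) powr \<alpha>)" .
  then show "0 < psi_X \<alpha> l" by (simp add: psi_X_def)
  show "psi_X \<alpha> l \<le> l" using Lap_powr_ge[OF assms] pos assms by (simp add: psi_X_def field_simps)
qed

text \<open>The transformed extinction probabilities and the normalised transforms of
  \<open>bernstein_fun\<close> are two bounded solutions of one recursion with the same value at 0,
  so they agree at 1. The row m = 0, available only for the explicit solution, then evaluates the
  value at 1.\<close>

lemma Lap_transition:
  assumes \<alpha>: "0 < \<alpha>" "\<alpha> < 1" and l: "0 < l" and P: "Qa_transition \<alpha> P"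
  shows "l * Lap l (\<lambda>t. P t 1 0) = 1 - (l - psi_X \<alpha> l) / \<alpha>"
proof -
  define u where "u m t = P t m 0" for m t
  define u' where "u' m t = real m * u (m - 1) t + (\<alpha> - 2 * real m) * u m t + (real m - \<alpha>) * u (Suc m) t" for m t
  have u0: "0 \<le> u m t" "u m t \<le> 1" if t: "0 \<le> t" for m t
  proof -
    have nn: "\<And>j. 0 \<le> P t m j" and su: "summable (P t m)" "suminf (P t m) \<le> 1"
      using P t unfolding Qa_transition_def by auto
    show "0 \<le> u m t" using nn by (simp add: u_def)
    have "sum (P t m) {0} \<le> suminf (P t m)" by (rule sum_le_suminf) (use nn su in auto)
    then show "u m t \<le> 1" using su by (simp add: u_def)
  qed
  have der_raw: "(u m has_real_derivative (\<Sum>k\<in>{m - 1..m + 1}. qa \<alpha> m k * u k t)) (at t within {0..})" if "0 \<le> t" for m t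
    using P that unfolding Qa_transition_def u_def by simp
  have der: "(u m has_real_derivative u' m t) (at t within {0..})" if t: "0 \<le> t" and m: "1 \<le> m" for m t
  proof -
    obtain k where k: "m = Suc k" using m by (cases m) auto
    have "{m - 1..m + 1} = {k, Suc k, Suc (Suc k)}" using k by auto
    then have "(\<Sum>k\<in>{m - 1..m + 1}. qa \<alpha> m k * u k t) = u' m t"
      using k by (simp add: qa_def u'_def algebra_simps)
    then show ?thesis using der_raw[OF t, of m] by simp
  qed
  have u_0: "u 0 t = 1" if t: "0 \<le> t" for t
  proof -
    have "(u 0 has_real_derivative 0) (at s within {0..})" if s: "0 \<le> s" for s
    proof -
      have "(\<Sum>k\<in>{0 - 1..0 + 1}. qa \<alpha> 0 k * u k s) = 0" by (intro sum.neutral) (auto simp: qa_def)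
      then show ?thesis using der_raw[OF s, of 0] by simp
    qed
    then have "u 0 t = u 0 0"
      using t has_field_derivative_zero_constant[of "{0..}" "u 0"] convex_real_interval(1) by (metis atLeast_iff order_refl)
    also have "\<dots> = 1" using P by (simp add: u_def Qa_transition_def)
    finally show ?thesis .
  qed
  have cont: "continuous_on {0..} (u m)" for m
    using der_raw by (meson atLeast_iff continuous_on_eq_continuous_within DERIV_continuous)
  have ub: "\<bar>u m t\<bar> \<le> 1 + t" if "0 \<le> t" for m t using u0[OF that, of m] that by simp
  have v0: "Lap l (u 0) = 1 / l"
  proof -
    have "Lap l (u 0) = Lap l (\<lambda>_. 1)" unfolding Lap_def by (intro Bochner_Integration.integral_cong refl) (auto simp: indicator_def u_0)
    then show ?thesis using Lap_const[OF l] by simp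
  qed
  have vrec: "l * Lap l (u m) = real m * Lap l (u (m - 1)) + (\<alpha> - 2 * real m) * Lap l (u m) + (real m - \<alpha>) * Lap l (u (Suc m))" if m: "1 \<le> m" for m
  proof -
    have "l * Lap l (u m) = u m 0 + Lap l (u' m)"
    proof (rule Lap_deriv[OF l der[OF _ m]])
      show "continuous_on {0..} (u' m)" unfolding u'_def by (intro continuous_intros cont)
      fix t :: real assume t: "0 \<le> t"
      show "\<bar>u m t\<bar> \<le> 1 * (1 + t)" using ub[OF t] by simp
      have "\<bar>u' m t\<bar> \<le> real m * (1 + t) + \<bar>\<alpha> - 2 * real m\<bar> * (1 + t) + \<bar>real m - \<alpha>\<bar> * (1 + t)"
        unfolding u'_def
        by (intro abs_triangle_ineq[THEN order_trans] add_mono) (auto simp: abs_mult intro!: mult_left_mono ub t)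
      also have "\<dots> = (real m + \<bar>\<alpha> - 2 * real m\<bar> + \<bar>real m - \<alpha>\<bar>) * (1 + t)" by (simp add: algebra_simps)
      finally show "\<bar>u' m t\<bar> \<le> (real m + \<bar>\<alpha> - 2 * real m\<bar> + \<bar>real m - \<alpha>\<bar>) * (1 + t)" .
    qed
    also have "u m 0 = 0" using P m by (simp add: u_def Qa_transition_def)
    also have "Lap l (u' m) = real m * Lap l (u (m - 1)) + (\<alpha> - 2 * real m) * Lap l (u m) + (real m - \<alpha>) * Lap l (u (Suc m))"
      unfolding u'_def by (rule Lap_lincomb3[OF l cont cont cont ub ub ub])
    finally show ?thesis by simp
  qed
  have vb: "0 \<le> Lap l (u m)" "Lap l (u m) \<le> 1 / l" for m
  proof -
    show "0 \<le> Lap l (u m)" by (intro Lap_nonneg u0)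
    have "Lap l (u m) \<le> Lap l (\<lambda>_. 1)"
      by (rule Lap_mono[OF l cont, where C=1 and D=1]) (use u0 ub in auto)
    then show "Lap l (u m) \<le> 1 / l" using Lap_const[OF l] by simp
  qed
  define I where "I m = Lap l (bernstein_fun \<alpha> m)" for m
  have Irec: "l * I m = of_bool (m = 0) + real m * I (m - 1) + (\<alpha> - 2 * real m) * I m + (real m - \<alpha>) * I (Suc m)" for m
    unfolding I_def by (rule Lap_bernstein_fun[OF \<alpha> l])
  have psi: "psi_X \<alpha> l = 1 / I 0" by (simp add: psi_X_def I_def bernstein_fun_def[abs_def])
  have I0: "0 < I 0" using psi_X_bounds(1)[OF \<alpha> l] psi by simp
  have Ib: "0 \<le> I m" "I m \<le> I 0" for m
  proof -
    show "0 \<le> I m" unfolding I_def by (intro Lap_nonneg bernstein_fun_bounds[OF \<alpha>])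
    show "I m \<le> I 0" unfolding I_def
      by (rule Lap_mono[OF l continuous_bernstein_fun continuous_bernstein_fun, where C=1 and D=1])
         (use bernstein_fun_bounds[OF \<alpha>] in \<open>auto simp: bernstein_fun_def[of _ 0] intro: bernstein_fun_bounds(3)[OF \<alpha>, of _ 0, unfolded bernstein_fun_def, simplified]\<close>)
  qed
  \<comment> \<open>Dividing by l I 0 matches the value 1/l at the absorbing state; the difference
    is still bounded by 1/l.\<close>
  define d where "d m = Lap l (u m) - I m / (l * I 0)" for m
  have d0: "d 0 = 0" using I0 v0 by (simp add: d_def)
  have db: "\<bar>d m\<bar> \<le> 1 / l" for m
  proof -
    have "0 \<le> I m / (l * I 0)" "I m / (l * I 0) \<le> 1 / l" using Ib[of m] I0 l by (auto simp: field_simps)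
    then show ?thesis unfolding d_def using vb[of m] by linarith
  qed
  have drec: "l * d m = real m * d (m - 1) + (\<alpha> - 2 * real m) * d m + (real m - \<alpha>) * d (Suc m)" if m: "1 \<le> m" for m
  proof -
    have "l * (I m / (l * I 0)) = (l * I m) / (l * I 0)" by simp
    also have "\<dots> = real m * (I (m-1) / (l * I 0)) + (\<alpha> - 2 * real m) * (I m / (l * I 0)) + (real m - \<alpha>) * (I (Suc m) / (l * I 0))"
      using m by (subst Irec) (simp add: add_divide_distrib)
    finally show ?thesis unfolding d_def using vrec[OF m] by (simp add: algebra_simps)
  qed
  have "d 1 \<le> 0" by (rule bounded_recursion_le_0[OF \<alpha> l d0 db drec])
  moreover have "- d 1 \<le> 0"
  proof (rule bounded_recursion_le_0[OF \<alpha> l, of "\<lambda>m. - d m" "1 / l"])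
    fix m :: nat assume m: "1 \<le> m"
    show "l * - d m = real m * - d (m - 1) + (\<alpha> - 2 * real m) * - d m + (real m - \<alpha>) * - d (Suc m)"
      using drec[OF m] by (simp add: algebra_simps)
  qed (use d0 db in auto)
  ultimately have "Lap l (u 1) = I 1 / (l * I 0)" by (simp add: d_def)
  then have "l * Lap l (u 1) = I 1 / I 0" using l by simp
  \<comment> \<open>The row m = 0 of the recursion, l I 0 = 1 + \<alpha> I 0 - \<alpha> I 1, solved
    for the quotient.\<close>
  moreover have "I 1 / I 0 = 1 - (l - 1 / I 0) / \<alpha>" using Irec[of 0] I0 \<alpha> by (simp add: field_simps)
  ultimately show ?thesis using psi by (simp add: u_def[abs_def])
qed

text \<open>Restricting to rational times makes the hitting time measurable; for right-continuous paths it
  agrees with the infimum over all times. On paths that never hit 0 it is the unspecified real Inf {}.\<close>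

definition hit_time :: "(real \<Rightarrow> nat) \<Rightarrow> real" where
  "hit_time z = Inf {s. s \<in> \<rat> \<and> 0 \<le> s \<and> z s = 0}"

lemma bdd_below_hit: "bdd_below {s::real. s \<in> A \<and> 0 \<le> s \<and> Q s}" "bdd_below {s::real. 0 \<le> s \<and> Q s}"
  by (auto intro: bdd_belowI[of _ 0])

text \<open>Reduces measurability to countably many coordinates: a strict inequality for an infimum
  is an existential over rational times, and paths without a rational zero contribute the constant
  case Inf {}.\<close>

lemma hit_time_less_iff:
  "hit_time z < c \<longleftrightarrow> (if \<exists>q\<in>\<rat>. 0 \<le> q \<and> z q = 0 then \<exists>q\<in>\<rat>. 0 \<le> q \<and> q < c \<and> z q = 0 else Inf {} < c)"
proof (cases "\<exists>q\<in>\<rat>. 0 \<le> q \<and> z q = 0")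
  case True
  then have "{s. s \<in> \<rat> \<and> 0 \<le> s \<and> z s = 0} \<noteq> {}" by blast
  then have "hit_time z < c \<longleftrightarrow> (\<exists>q\<in>{s. s \<in> \<rat> \<and> 0 \<le> s \<and> z s = 0}. q < c)"
    unfolding hit_time_def by (rule cInf_less_iff[OF _ bdd_below_hit(1)])
  then show ?thesis using True by auto
next
  case False
  then have "{s. s \<in> \<rat> \<and> 0 \<le> s \<and> z s = 0} = {}" by blast
  then have "hit_time z = Inf {}" unfolding hit_time_def by (rule arg_cong)
  then show ?thesis using False by (simp only: if_False)
qed

lemma borel_measurable_hit_time: "hit_time \<in> borel_measurable (PiM UNIV (\<lambda>_. count_space UNIV))"
  unfolding borel_measurable_iff_less hit_time_less_iff
proof
  fix c :: real
  let ?P = "PiM UNIV (\<lambda>_::real. count_space (UNIV :: nat set))"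
  have [measurable]: "countable (\<rat> :: real set)" by (rule countable_rat)
  have m: "Measurable.pred ?P (\<lambda>z. z q = 0)" for q by measurable
  have "Measurable.pred ?P (\<lambda>z. if \<exists>q\<in>\<rat>. 0 \<le> q \<and> z q = 0 then \<exists>q\<in>\<rat>. 0 \<le> q \<and> q < c \<and> z q = 0 else Inf {} < c)"
    using countable_rat[where 'a=real]
    by (intro measurable_If pred_intros_countable_bounded pred_intros_logic m) auto
  then show "{w \<in> space ?P. if \<exists>q\<in>\<rat>. 0 \<le> q \<and> w q = 0 then \<exists>q\<in>\<rat>. 0 \<le> q \<and> q < c \<and> w q = 0 else Inf {} < c} \<in> sets ?P"
    by (simp add: pred_def)
qed

lemma nat_right_continuousD:
  fixes z :: "real \<Rightarrow> nat"
  assumes "continuous (at_right t) (\<lambda>s. real (z s))"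
  shows "\<exists>b>t. \<forall>s. t \<le> s \<longrightarrow> s < b \<longrightarrow> z s = z t"
proof -
  have "((\<lambda>s. real (z s)) \<longlongrightarrow> real (z t)) (at_right t)" using assms by (simp add: continuous_within)
  from tendstoD[OF this, of 1] obtain b where b: "b > t" "\<And>s. t < s \<Longrightarrow> s < b \<Longrightarrow> dist (real (z s)) (real (z t)) < 1"
    by (auto simp: eventually_at_right_field)
  have "z s = z t" if "t \<le> s" "s < b" for s
    using b(2)[of s] that by (cases "s = t") (auto simp: dist_real_def abs_if split: if_splits)
  then show ?thesis using b(1) by blast
qed

lemma rational_after_zero:
  fixes z :: "real \<Rightarrow> nat"
  assumes rc: "\<And>t. 0 \<le> t \<Longrightarrow> continuous (at_right t) (\<lambda>s. real (z s))" and s: "0 \<le> s" "z s = 0" "s < c"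
  shows "\<exists>q\<in>\<rat>. s < q \<and> q < c \<and> z q = 0"
proof -
  obtain b where b: "b > s" "\<And>u. s \<le> u \<Longrightarrow> u < b \<Longrightarrow> z u = z s" using nat_right_continuousD[OF rc[OF s(1)]] by blast
  obtain q where "q \<in> \<rat>" "s < q" "q < min b c" using Rats_dense_in_real[of s "min b c"] b(1) s(3) by auto
  then show ?thesis using b(2)[of q] s by auto
qed

lemma hit_time_eq:
  fixes z :: "real \<Rightarrow> nat"
  assumes rc: "\<And>t. 0 \<le> t \<Longrightarrow> continuous (at_right t) (\<lambda>s. real (z s))"
  shows "Inf {s. 0 \<le> s \<and> z s = 0} = hit_time z"
proof (cases "\<exists>s\<ge>0. z s = 0")
  case True
  then obtain s0 where s0: "0 \<le> s0" "z s0 = 0" by blast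
  obtain q0 where q0: "q0 \<in> \<rat>" "s0 < q0" "z q0 = 0" using rational_after_zero[OF rc s0, of "s0 + 1"] by auto
  show ?thesis
  proof (rule antisym)
    show "Inf {s. 0 \<le> s \<and> z s = 0} \<le> hit_time z"
      unfolding hit_time_def using q0 s0 by (intro cInf_superset_mono bdd_below_hit) (auto intro!: exI[of _ q0])
    show "hit_time z \<le> Inf {s. 0 \<le> s \<and> z s = 0}"
    proof (rule cInf_greatest)
      fix s assume s: "s \<in> {s. 0 \<le> s \<and> z s = 0}"
      show "hit_time z \<le> s"
      proof (rule field_le_epsilon)
        fix e :: real assume "0 < e"
        then obtain q where "q \<in> \<rat>" "s < q" "q < s + e" "z q = 0" using rational_after_zero[OF rc, of s "s + e"] s by auto
        then show "hit_time z \<le> s + e"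
          unfolding hit_time_def using s by (intro cInf_lower2[of q] bdd_below_hit) auto
      qed
    qed (use s0 in auto)
  qed
next
  case False
  then have "{s. 0 \<le> s \<and> z s = 0} = {}" "{s. s \<in> \<rat> \<and> 0 \<le> s \<and> z s = 0} = {}" by auto
  then show ?thesis unfolding hit_time_def by (simp only:)
qed

text \<open>State 0 is absorbing, so up to null sets the event that the lifetime is at most t is {Z
  t = 0}, with probability P t 1 0. Fubini turns this distribution function into the transform
  computed before, and letting l tend to 0 shows that 0 is reached almost surely.\<close>

lemma (in prob_space) hit_time_law:
  assumes \<alpha>: "0 < \<alpha>" "\<alpha> < 1" and Z: "Qa_chain \<alpha> M 1 Z"
  shows "AE \<omega> in M. 0 \<le> hit_time (\<lambda>t. Z t \<omega>)"
    and "0 < l \<Longrightarrow> (\<integral>\<^sup>+\<omega>. ennreal (exp (- l * hit_time (\<lambda>t. Z t \<omega>))) \<partial>M) = ennreal (1 - (l - psi_X \<alpha> l) / \<alpha>)"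
proof -
  have Zm[measurable]: "\<And>t. Z t \<in> measurable M (count_space UNIV)"
    and rc: "\<And>\<omega> t. 0 \<le> t \<Longrightarrow> continuous (at_right t) (\<lambda>s. real (Z s \<omega>))"
    using Z unfolding Qa_chain_def by auto
  obtain P where P: "Qa_transition \<alpha> P"
    and fdd: "\<And>(k::nat) (ts::nat \<Rightarrow> real) (js::nat \<Rightarrow> nat). ts 0 = 0 \<Longrightarrow> (\<forall>i<k. ts i < ts (Suc i)) \<Longrightarrow>
       prob {\<omega>\<in>space M. \<forall>i\<le>k. Z (ts i) \<omega> = js i} =
         (if js 0 = 1 then 1 else 0) * (\<Prod>i<k. P (ts (Suc i) - ts i) (js i) (js (Suc i)))"
    using Z unfolding Qa_chain_def by blast
  \<comment> \<open>The row of rates at 0 vanishes, so the backward equation makes P t 0 j constant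
    in t.\<close>
  have P01: "P t 0 j = 0" if t: "0 \<le> t" and j: "j \<noteq> 0" for t j
  proof -
    have "((\<lambda>s. P s 0 j) has_real_derivative 0) (at s within {0..})" if s: "0 \<le> s" for s
    proof -
      have "(\<Sum>k\<in>{0 - 1..0 + 1}. qa \<alpha> 0 k * P s k j) = 0" by (intro sum.neutral) (auto simp: qa_def)
      moreover have "((\<lambda>s. P s 0 j) has_real_derivative (\<Sum>k\<in>{0 - 1..0 + 1}. qa \<alpha> 0 k * P s k j)) (at s within {0..})"
        using P s unfolding Qa_transition_def by blast
      ultimately show ?thesis by simp
    qed
    then have "P t 0 j = P 0 0 j"
      using t has_field_derivative_zero_constant[of "{0..}" "\<lambda>s. P s 0 j"] convex_real_interval(1) by (metis atLeast_iff order_refl)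
    then show ?thesis using P j by (simp add: Qa_transition_def)
  qed
  have "prob {\<omega>\<in>space M. \<forall>i\<le>(0::nat). Z 0 \<omega> = 1} = 1" using fdd[of "\<lambda>_. 0" 0 "\<lambda>_. 1"] by simp
  then have "prob {\<omega>\<in>space M. Z 0 \<omega> = 1} = 1" by simp
  then have "AE \<omega> in M. \<omega> \<in> {\<omega>\<in>space M. Z 0 \<omega> = 1}" by (rule AE_prob_1)
  then have Z0: "AE \<omega> in M. Z 0 \<omega> = 1" by eventually_elim auto
  have Pt: "prob {\<omega>\<in>space M. Z t \<omega> = 0} = P t 1 0" if t: "0 < t" for t
  proof -
    have "prob {\<omega>\<in>space M. \<forall>i\<le>(1::nat). Z (if i = 0 then 0 else t) \<omega> = (if i = 0 then 1 else (0::nat))} = P t 1 0"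
      using fdd[of "\<lambda>i. if i = 0 then 0 else t" 1 "\<lambda>i. if i = 0 then 1 else 0"] t by simp
    moreover have "prob {\<omega>\<in>space M. \<forall>i\<le>(1::nat). Z (if i = 0 then 0 else t) \<omega> = (if i = 0 then 1 else (0::nat))} = prob {\<omega>\<in>space M. Z t \<omega> = 0}"
    proof (rule finite_measure_eq_AE)
      show "AE \<omega> in M. \<omega> \<in> {\<omega>\<in>space M. \<forall>i\<le>(1::nat). Z (if i = 0 then 0 else t) \<omega> = (if i = 0 then 1 else (0::nat))} \<longleftrightarrow> \<omega> \<in> {\<omega>\<in>space M. Z t \<omega> = 0}"
        using Z0 by eventually_elim (auto simp: le_Suc_eq)
    qed measurable
    ultimately show ?thesis by simp
  qed
  have absorb2: "AE \<omega> in M. Z s \<omega> = 0 \<longrightarrow> Z t \<omega> = 0" if st: "0 < s" "s < t" for s t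
  proof -
    have "AE \<omega> in M. \<forall>j. j \<noteq> 0 \<longrightarrow> \<not> (Z 0 \<omega> = 1 \<and> Z s \<omega> = 0 \<and> Z t \<omega> = j)"
    proof (subst AE_all_countable, intro allI)
      fix j :: nat
      show "AE \<omega> in M. j \<noteq> 0 \<longrightarrow> \<not> (Z 0 \<omega> = 1 \<and> Z s \<omega> = 0 \<and> Z t \<omega> = j)"
      proof (cases "j = 0")
        case False
        define ts where "ts i = (if i = 0 then 0 else if i = 1 then s else t)" for i :: nat
        define js where "js i = (if i = 0 then 1 else if i = 1 then 0 else j)" for i :: nat
        have "prob {\<omega>\<in>space M. \<forall>i\<le>2. Z (ts i) \<omega> = js i} = P s 1 0 * P (t - s) 0 j"
          by (subst fdd) (use st in \<open>auto simp: ts_def js_def numeral_2_eq_2 less_Suc_eq\<close>)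
        also have "\<dots> = 0" using P01 st False by simp
        also have "{\<omega>\<in>space M. \<forall>i\<le>2. Z (ts i) \<omega> = js i} = {\<omega>\<in>space M. Z 0 \<omega> = 1 \<and> Z s \<omega> = 0 \<and> Z t \<omega> = j}"
          by (auto simp: ts_def js_def numeral_2_eq_2 le_Suc_eq all_conj_distrib imp_conjR disj_imp)
        finally have "AE \<omega> in M. \<not> (Z 0 \<omega> = 1 \<and> Z s \<omega> = 0 \<and> Z t \<omega> = j)"
          by (subst AE_iff_measurable[OF _ refl]) (auto simp: emeasure_eq_measure)
        then show ?thesis by simp
      qed simp
    qed
    then show ?thesis using Z0 by eventually_elim auto
  qed
  \<comment> \<open>Absorption holds almost surely for each pair of times; rationals give one null
    set for all pairs, and right-continuity later extends it to real times.\<close>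
  have "AE \<omega> in M. \<forall>q\<in>\<rat>. \<forall>r\<in>\<rat>. 0 < q \<longrightarrow> q < r \<longrightarrow> Z q \<omega> = 0 \<longrightarrow> Z r \<omega> = 0"
    by (intro AE_ball_countable[THEN iffD2] countable_rat ballI) (use absorb2 in auto)
  then have good: "AE \<omega> in M. Z 0 \<omega> = 1 \<and> (\<forall>q\<in>\<rat>. \<forall>r\<in>\<rat>. 0 < q \<longrightarrow> q < r \<longrightarrow> Z q \<omega> = 0 \<longrightarrow> Z r \<omega> = 0)"
    using Z0 by eventually_elim auto
  define h where "h \<omega> = hit_time (\<lambda>t. Z t \<omega>)" for \<omega>
  \<comment> \<open>Keeps apart the paths that never reach 0, on which the hitting time is an
    unspecified real. This event is shown to have probability 1 only at the end.\<close>
  define HIT where "HIT \<omega> \<longleftrightarrow> (\<exists>q\<in>\<rat>. 0 \<le> q \<and> Z q \<omega> = 0)" for \<omega>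
  have h_m[measurable]: "h \<in> borel_measurable M"
    unfolding h_def by (rule measurable_compose[OF _ borel_measurable_hit_time]) (auto intro: measurable_PiM_single')
  have HIT_m[measurable]: "Measurable.pred M HIT"
    unfolding HIT_def pred_def by (intro sets.sets_Collect_countable_Ex' countable_rat) measurable
  have h_nonneg: "0 \<le> h \<omega>" if "HIT \<omega>" for \<omega>
    using that unfolding h_def hit_time_def HIT_def by (intro cInf_greatest) auto
  have zero_hit: "HIT \<omega> \<and> h \<omega> \<le> t" if "0 \<le> t" "Z t \<omega> = 0" for \<omega> t
  proof
    show "HIT \<omega>" using rational_after_zero[of "\<lambda>t. Z t \<omega>" t "t + 1", OF rc] that unfolding HIT_def by force
    have "h \<omega> = Inf {s. 0 \<le> s \<and> Z s \<omega> = 0}" unfolding h_def by (rule hit_time_eq[OF rc, symmetric])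
    also have "\<dots> \<le> t" using that by (intro cInf_lower bdd_below_hit) auto
    finally show "h \<omega> \<le> t" .
  qed
  have hit_zero: "Z t \<omega> = 0"
    if g: "Z 0 \<omega> = 1 \<and> (\<forall>q\<in>\<rat>. \<forall>r\<in>\<rat>. 0 < q \<longrightarrow> q < r \<longrightarrow> Z q \<omega> = 0 \<longrightarrow> Z r \<omega> = 0)"
    and H: "HIT \<omega>" "h \<omega> < t" for \<omega> t
  proof -
    obtain q where q: "q \<in> \<rat>" "0 \<le> q" "q < t" "Z q \<omega> = 0"
      using H hit_time_less_iff[of "\<lambda>t. Z t \<omega>" t] unfolding h_def HIT_def by auto
    have q0: "0 < q" using q g by (cases "q = 0") auto
    obtain b where b: "b > t" "\<And>u. t \<le> u \<Longrightarrow> u < b \<Longrightarrow> Z u \<omega> = Z t \<omega>"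
      using nat_right_continuousD[OF rc[of t \<omega>]] q by auto
    obtain r where r: "r \<in> \<rat>" "t < r" "r < b" using Rats_dense_in_real[OF b(1)] by auto
    then have "Z r \<omega> = 0" using g q q0 by auto
    then show ?thesis using b(2)[of r] r by simp
  qed
  have D: "prob {\<omega>\<in>space M. HIT \<omega> \<and> h \<omega> \<le> t} = P t 1 0" if t: "0 < t" for t
  proof (rule antisym)
    have "prob {\<omega>\<in>space M. Z t \<omega> = 0} \<le> prob {\<omega>\<in>space M. HIT \<omega> \<and> h \<omega> \<le> t}"
      using zero_hit[OF less_imp_le[OF t]] by (intro finite_measure_mono) auto
    then show "P t 1 0 \<le> prob {\<omega>\<in>space M. HIT \<omega> \<and> h \<omega> \<le> t}" using Pt[OF t] by simp
    \<comment> \<open>Being hit by time t forces Z t' = 0 for later t' via a rational zero strictly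
      before t'. Continuity of P in time then lets t' decrease to t.\<close>
    have le: "prob {\<omega>\<in>space M. HIT \<omega> \<and> h \<omega> \<le> t} \<le> P t' 1 0" if "t < t'" for t'
    proof -
      have "prob {\<omega>\<in>space M. HIT \<omega> \<and> h \<omega> \<le> t} \<le> prob {\<omega>\<in>space M. Z t' \<omega> = 0}"
      proof (rule finite_measure_mono_AE)
        show "AE \<omega> in M. \<omega> \<in> {\<omega>\<in>space M. HIT \<omega> \<and> h \<omega> \<le> t} \<longrightarrow> \<omega> \<in> {\<omega>\<in>space M. Z t' \<omega> = 0}"
          using good
        proof eventually_elim
          case (elim \<omega>)
          have "Z t' \<omega> = 0" if "HIT \<omega>" "h \<omega> \<le> t" using hit_zero[OF elim that(1), of t'] that(2) \<open>t < t'\<close> by linarith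
          moreover have "\<omega> \<in> space M" if "\<omega> \<in> {\<omega>\<in>space M. HIT \<omega> \<and> h \<omega> \<le> t}" using that by simp
          ultimately show ?case by blast
        qed
      qed measurable
      then show ?thesis using Pt[of t'] that t by simp
    qed
    have "((\<lambda>s. P s 1 0) has_real_derivative (\<Sum>k\<in>{1 - 1..1 + 1}. qa \<alpha> 1 k * P t k 0)) (at t within {0..})"
      using P t unfolding Qa_transition_def by (meson less_imp_le)
    then have "continuous (at t within {0..}) (\<lambda>s. P s 1 0)" by (rule DERIV_continuous)
    then have "((\<lambda>s. P s 1 0) \<longlongrightarrow> P t 1 0) (at t within {0..})" by (simp add: continuous_within)
    then have "((\<lambda>s. P s 1 0) \<longlongrightarrow> P t 1 0) (at_right t)"
      by (rule tendsto_within_subset) (use t in auto)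
    then show "prob {\<omega>\<in>space M. HIT \<omega> \<and> h \<omega> \<le> t} \<le> P t 1 0"
    proof (rule tendsto_lowerbound)
      show "eventually (\<lambda>s. prob {\<omega>\<in>space M. HIT \<omega> \<and> h \<omega> \<le> t} \<le> P s 1 0) (at_right t)"
        using eventually_at_right_less[of t] by eventually_elim (rule le)
    qed simp
  qed
  have lap: "(\<integral>\<^sup>+\<omega>. ennreal (exp (- l * h \<omega>)) * indicator {\<omega>. HIT \<omega>} \<omega> \<partial>M) = ennreal (1 - (l - psi_X \<alpha> l) / \<alpha>)" if l: "0 < l" for l
  proof -
    \<comment> \<open>Writes exp(-l a) as an integral over t \<ge> a, which exposes the distribution
      function after exchanging integrals.\<close>
    have inner: "(\<integral>\<^sup>+t. ennreal (l * exp (- l * t)) * indicator {a..} t \<partial>lborel) = ennreal (exp (- l * a))" for a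
    proof -
      have "(\<integral>\<^sup>+t. ennreal (l * exp (- l * t)) * indicator {a..} t \<partial>lborel) = 0 - (- exp (- l * a))"
      proof (rule nn_integral_FTC_atLeast)
        show "((\<lambda>t. - exp (- l * t)) \<longlongrightarrow> 0) at_top" using l by real_asymp
      qed (use l in \<open>auto intro!: derivative_eq_intros\<close>)
      then show ?thesis by simp
    qed
    interpret pair_sigma_finite M lborel by unfold_locales
    have "(\<integral>\<^sup>+\<omega>. ennreal (exp (- l * h \<omega>)) * indicator {\<omega>. HIT \<omega>} \<omega> \<partial>M)
      = (\<integral>\<^sup>+\<omega>. (\<integral>\<^sup>+t. (ennreal (l * exp (- l * t)) * of_bool (h \<omega> \<le> t)) * of_bool (HIT \<omega>) \<partial>lborel) \<partial>M)"
    proof (rule nn_integral_cong)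
      fix \<omega>
      have "(\<integral>\<^sup>+t. (ennreal (l * exp (- l * t)) * of_bool (h \<omega> \<le> t)) * of_bool (HIT \<omega>) \<partial>lborel)
         = (\<integral>\<^sup>+t. ennreal (l * exp (- l * t)) * indicator {h \<omega>..} t \<partial>lborel) * of_bool (HIT \<omega>)"
        by (subst nn_integral_multc[symmetric]) (auto intro!: nn_integral_cong simp: indicator_def)
      then show "ennreal (exp (- l * h \<omega>)) * indicator {\<omega>. HIT \<omega>} \<omega> = (\<integral>\<^sup>+t. (ennreal (l * exp (- l * t)) * of_bool (h \<omega> \<le> t)) * of_bool (HIT \<omega>) \<partial>lborel)"
        unfolding inner by (simp add: indicator_def)
    qed
    also have "\<dots> = (\<integral>\<^sup>+t. (\<integral>\<^sup>+\<omega>. (ennreal (l * exp (- l * t)) * of_bool (h \<omega> \<le> t)) * of_bool (HIT \<omega>) \<partial>M) \<partial>lborel)"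
      by (rule Fubini'[symmetric]) measurable
    also have "\<dots> = (\<integral>\<^sup>+t. ennreal (indicator {0..} t * (exp (- l * t) * (l * P t 1 0))) \<partial>lborel)"
    proof (rule nn_integral_cong_AE)
      \<comment> \<open>The distribution function was identified only for t > 0; the single point 0
        is negligible.\<close>
      have "AE t in lborel. t \<noteq> (0::real)" by (rule AE_lborel_singleton)
      then show "AE t in lborel. (\<integral>\<^sup>+\<omega>. (ennreal (l * exp (- l * t)) * of_bool (h \<omega> \<le> t)) * of_bool (HIT \<omega>) \<partial>M)
         = ennreal (indicator {0..} t * (exp (- l * t) * (l * P t 1 0)))"
      proof eventually_elim
        case (elim t)
        have "(\<integral>\<^sup>+\<omega>. (ennreal (l * exp (- l * t)) * of_bool (h \<omega> \<le> t)) * of_bool (HIT \<omega>) \<partial>M)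
          = (\<integral>\<^sup>+\<omega>. ennreal (l * exp (- l * t)) * indicator {\<omega>\<in>space M. HIT \<omega> \<and> h \<omega> \<le> t} \<omega> \<partial>M)"
          by (intro nn_integral_cong) (auto simp: indicator_def)
        also have "\<dots> = ennreal (l * exp (- l * t)) * ennreal (prob {\<omega>\<in>space M. HIT \<omega> \<and> h \<omega> \<le> t})"
          by (subst nn_integral_cmult_indicator) (auto simp: emeasure_eq_measure)
        also have "\<dots> = ennreal (indicator {0..} t * (exp (- l * t) * (l * P t 1 0)))"
        proof (cases "0 < t")
          case True
          have "ennreal (l * exp (- l * t)) * ennreal (prob {\<omega>\<in>space M. HIT \<omega> \<and> h \<omega> \<le> t})
            = ennreal ((l * exp (- l * t)) * prob {\<omega>\<in>space M. HIT \<omega> \<and> h \<omega> \<le> t})"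
            using l by (intro ennreal_mult'[symmetric]) simp
          then show ?thesis unfolding D[OF True] using True by (simp add: mult_ac)
        next
          case False
          then have t: "t < 0" using elim by simp
          have e: "{\<omega>\<in>space M. HIT \<omega> \<and> h \<omega> \<le> t} = {}" using h_nonneg t by fastforce
          show ?thesis unfolding e using t by simp
        qed
        finally show ?case .
      qed
    qed
    also have "\<dots> = ennreal (\<integral>t. indicator {0..} t * (exp (- l * t) * (l * P t 1 0)) \<partial>lborel)"
    proof (rule nn_integral_eq_integral)
      have nn: "0 \<le> P t 1 0 \<and> P t 1 0 \<le> 1" if "0 < t" for t using Pt[OF that] by (metis measure_nonneg prob_le_1)
      have nn0: "P 0 1 0 = 0" using P by (simp add: Qa_transition_def)
      have nn': "0 \<le> P t 1 0 \<and> P t 1 0 \<le> 1" if "0 \<le> t" for t using nn[of t] nn0 that by (cases "t = 0") auto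
      show "AE t in lborel. 0 \<le> indicator {0..} t * (exp (- l * t) * (l * P t 1 0))"
        using l nn' by (intro AE_I2) (auto simp: indicator_def)
      show "integrable lborel (\<lambda>t. indicator {0..} t * (exp (- l * t) * (l * P t 1 0)))"
      proof (rule Lap_integrable[OF l, where C=l])
        have "continuous_on {0..} (\<lambda>t. P t 1 0)"
          using P unfolding Qa_transition_def by (meson atLeast_iff continuous_on_eq_continuous_within DERIV_continuous)
        then show "continuous_on {0..} (\<lambda>t. l * P t 1 0)" by (intro continuous_intros)
        fix t :: real assume "0 \<le> t"
        then show "\<bar>l * P t 1 0\<bar> \<le> l * (1 + t)" using nn'[of t] l by (simp add: abs_mult)
      qed
    qed
    also have "(\<integral>t. indicator {0..} t * (exp (- l * t) * (l * P t 1 0)) \<partial>lborel) = l * Lap l (\<lambda>t. P t 1 0)"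
      unfolding Lap_def by (subst integral_mult_right_zero[symmetric]) (auto simp: mult_ac intro!: Bochner_Integration.integral_cong)
    also have "\<dots> = 1 - (l - psi_X \<alpha> l) / \<alpha>" by (rule Lap_transition[OF \<alpha> l P])
    finally show ?thesis .
  qed
  have "1 \<le> prob {\<omega>\<in>space M. HIT \<omega>}"
  proof (rule field_le_epsilon)
    fix e :: real assume e: "0 < e"
    \<comment> \<open>With this l the transform is at least 1 - l/\<alpha> = 1 - e, and it is a
      lower bound for the probability of reaching 0.\<close>
    define l where "l = \<alpha> * e"
    have l: "0 < l" using e \<alpha> by (simp add: l_def)
    have "ennreal (1 - (l - psi_X \<alpha> l) / \<alpha>) \<le> (\<integral>\<^sup>+\<omega>. indicator {\<omega>\<in>space M. HIT \<omega>} \<omega> \<partial>M)"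
      unfolding lap[OF l, symmetric]
    proof (rule nn_integral_mono)
      fix \<omega> assume "\<omega> \<in> space M"
      then show "ennreal (exp (- l * h \<omega>)) * indicator {\<omega>. HIT \<omega>} \<omega> \<le> indicator {\<omega>\<in>space M. HIT \<omega>} \<omega>"
        using h_nonneg[of \<omega>] l by (auto simp: indicator_def)
    qed
    also have "\<dots> = ennreal (prob {\<omega>\<in>space M. HIT \<omega>})" by (simp add: emeasure_eq_measure)
    finally have "1 - (l - psi_X \<alpha> l) / \<alpha> \<le> prob {\<omega>\<in>space M. HIT \<omega>}" by (simp add: ennreal_le_iff)
    moreover have "(l - psi_X \<alpha> l) / \<alpha> \<le> l / \<alpha>" using psi_X_bounds(1)[OF \<alpha> l] \<alpha> by (intro divide_right_mono) auto
    moreover have "l / \<alpha> = e" using \<alpha> by (simp add: l_def)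
    ultimately show "1 \<le> prob {\<omega>\<in>space M. HIT \<omega>} + e" by linarith
  qed
  then have "prob {\<omega>\<in>space M. HIT \<omega>} = 1" by (simp add: antisym)
  then have AEH: "AE \<omega> in M. HIT \<omega>" using AE_prob_1 by fastforce
  show "AE \<omega> in M. 0 \<le> hit_time (\<lambda>t. Z t \<omega>)" using AEH by eventually_elim (use h_nonneg h_def in auto)
  assume l: "0 < l"
  have "(\<integral>\<^sup>+\<omega>. ennreal (exp (- l * h \<omega>)) \<partial>M) = (\<integral>\<^sup>+\<omega>. ennreal (exp (- l * h \<omega>)) * indicator {\<omega>. HIT \<omega>} \<omega> \<partial>M)"
    using AEH by (intro nn_integral_cong_AE) (auto elim!: eventually_mono)
  then show "(\<integral>\<^sup>+\<omega>. ennreal (exp (- l * hit_time (\<lambda>t. Z t \<omega>))) \<partial>M) = ennreal (1 - (l - psi_X \<alpha> l) / \<alpha>)"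
    using lap[OF l] by (simp add: h_def)
qed

section \<open>Joint Laplace transform of the compound Poisson process\<close>

text \<open>Serves to condition on the vector of Poisson counts without conditional expectations: an
  integral is the sum of its parts over the values of a countable-valued variable.\<close>

lemma nn_integral_countable_split:
  fixes K :: "'a \<Rightarrow> 'c::countable"
  assumes "sigma_finite_measure M" and K[measurable]: "K \<in> measurable M (count_space UNIV)" and [measurable]: "f \<in> borel_measurable M"
  shows "(\<integral>\<^sup>+\<omega>. f \<omega> \<partial>M) = (\<integral>\<^sup>+x. (\<integral>\<^sup>+\<omega>. f \<omega> * indicator {\<omega>. K \<omega> = x} \<omega> \<partial>M) \<partial>count_space UNIV)"
proof -
  interpret M: sigma_finite_measure M by fact
  interpret C: sigma_finite_measure "count_space (UNIV :: 'c set)" by (rule sigma_finite_measure_count_space)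
  interpret pair_sigma_finite M "count_space (UNIV :: 'c set)" ..
  have "(\<integral>\<^sup>+x. (\<integral>\<^sup>+\<omega>. f \<omega> * indicator {\<omega>. K \<omega> = x} \<omega> \<partial>M) \<partial>count_space UNIV)
     = (\<integral>\<^sup>+\<omega>. (\<integral>\<^sup>+x. f \<omega> * indicator {\<omega>. K \<omega> = x} \<omega> \<partial>count_space UNIV) \<partial>M)"
  proof (rule Fubini')
    have "(\<lambda>p. f (fst p) * indicator {p. K (fst p) = snd p} p) \<in> borel_measurable (M \<Otimes>\<^sub>M count_space (UNIV :: 'c set))"
      by measurable
    also have "(\<lambda>p. f (fst p) * indicator {p. K (fst p) = snd p} p) = (\<lambda>(\<omega>, x). f \<omega> * indicator {\<omega>. K \<omega> = x} \<omega>)"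
      by (auto simp: fun_eq_iff indicator_def)
    finally show "(\<lambda>(\<omega>, x). f \<omega> * indicator {\<omega>. K \<omega> = x} \<omega>) \<in> borel_measurable (M \<Otimes>\<^sub>M count_space (UNIV :: 'c set))" .
  qed
  also have "\<dots> = (\<integral>\<^sup>+\<omega>. f \<omega> \<partial>M)"
  proof (rule nn_integral_cong)
    fix \<omega>
    have "(\<integral>\<^sup>+x. f \<omega> * indicator {\<omega>. K \<omega> = x} \<omega> \<partial>count_space UNIV) = (\<integral>\<^sup>+x. f \<omega> * indicator {K \<omega>} x \<partial>count_space UNIV)"
      by (intro nn_integral_cong) (auto simp: indicator_def)
    also have "\<dots> = f \<omega>" by (subst nn_integral_cmult_indicator) auto
    finally show "(\<integral>\<^sup>+x. f \<omega> * indicator {\<omega>. K \<omega> = x} \<omega> \<partial>count_space UNIV) = f \<omega>" .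
  qed
  finally show ?thesis ..
qed

lemma (in prob_space) nn_integral_nat_rv:
  fixes N :: "'a \<Rightarrow> nat"
  assumes [measurable]: "N \<in> measurable M (count_space UNIV)"
  shows "(\<integral>\<^sup>+\<omega>. g (N \<omega>) \<partial>M) = (\<Sum>n. g n * emeasure M {\<omega>\<in>space M. N \<omega> = n})"
proof -
  have "(\<integral>\<^sup>+\<omega>. g (N \<omega>) \<partial>M) = (\<integral>\<^sup>+x. (\<integral>\<^sup>+\<omega>. g (N \<omega>) * indicator {\<omega>. N \<omega> = x} \<omega> \<partial>M) \<partial>count_space UNIV)"
    by (rule nn_integral_countable_split) (auto intro: sigma_finite_measure_axioms)
  also have "\<dots> = (\<integral>\<^sup>+x. g x * emeasure M {\<omega>\<in>space M. N \<omega> = x} \<partial>count_space UNIV)"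
  proof (rule nn_integral_cong)
    fix x
    have "(\<integral>\<^sup>+\<omega>. g (N \<omega>) * indicator {\<omega>. N \<omega> = x} \<omega> \<partial>M) = (\<integral>\<^sup>+\<omega>. g x * indicator {\<omega>\<in>space M. N \<omega> = x} \<omega> \<partial>M)"
      by (intro nn_integral_cong) (auto simp: indicator_def)
    then show "(\<integral>\<^sup>+\<omega>. g (N \<omega>) * indicator {\<omega>. N \<omega> = x} \<omega> \<partial>M) = g x * emeasure M {\<omega>\<in>space M. N \<omega> = x}"
      by (simp add: nn_integral_cmult_indicator)
  qed
  finally show ?thesis by (simp add: nn_integral_count_space_nat)
qed

lemma (in prob_space) nn_integral_poisson_power:
  fixes N :: "'a \<Rightarrow> nat"
  assumes [measurable]: "N \<in> measurable M (count_space UNIV)" and r: "0 \<le> r" and \<phi>: "0 \<le> \<phi>"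
    and N: "\<And>n. prob {\<omega>\<in>space M. N \<omega> = n} = exp (- r) * r ^ n / fact n"
  shows "(\<integral>\<^sup>+\<omega>. ennreal (\<phi> ^ N \<omega>) \<partial>M) = ennreal (exp (r * (\<phi> - 1)))"
proof -
  have "(\<lambda>n. exp (- r) * ((\<phi> * r) ^ n /\<^sub>R fact n)) sums (exp (- r) * exp (\<phi> * r))"
    by (intro sums_mult exp_converges)
  then have s: "(\<lambda>n. \<phi> ^ n * (exp (- r) * r ^ n / fact n)) sums (exp (r * (\<phi> - 1)))"
    by (simp add: exp_add[symmetric] algebra_simps power_mult_distrib divide_inverse)
  have "(\<integral>\<^sup>+\<omega>. ennreal (\<phi> ^ N \<omega>) \<partial>M) = (\<Sum>n. ennreal (\<phi> ^ n * (exp (- r) * r ^ n / fact n)))"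
    using r \<phi> by (subst nn_integral_nat_rv) (auto simp: emeasure_eq_measure N ennreal_mult'[symmetric] intro!: suminf_cong)
  also have "\<dots> = ennreal (\<Sum>n. \<phi> ^ n * (exp (- r) * r ^ n / fact n))"
    using r \<phi> s by (intro suminf_ennreal2) (auto simp: sums_iff)
  finally show ?thesis using s by (simp add: sums_iff)
qed

lemma borel_measurable_sum_upto_rv:
  assumes [measurable]: "N \<in> measurable M (count_space (UNIV :: nat set))" and Y: "\<And>i. Y i \<in> borel_measurable M"
  shows "(\<lambda>\<omega>. \<Sum>i\<in>{0..N \<omega>}. Y i \<omega> :: real) \<in> borel_measurable M"
  by (rule measurable_compose_countable[where g=N and f="\<lambda>n \<omega>. \<Sum>i\<in>{0..n}. Y i \<omega>"]) (auto intro!: borel_measurable_sum Y)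

text \<open>Sorts the lifetimes by the time interval in which they are added: block i holds the
  indices in (x i, x (i+1)].\<close>

lemma prod_blocks:
  fixes x :: "nat \<Rightarrow> nat" and H :: "nat \<Rightarrow> 'b::comm_monoid_mult"
  assumes "x 0 = 0" "\<And>i. i < k \<Longrightarrow> x i \<le> x (Suc i)"
  shows "(\<Prod>m\<in>{0<..x k}. H m) = (\<Prod>i<k. \<Prod>m\<in>{x i<..x (Suc i)}. H m)"
  using assms(2)
proof (induction k)
  case 0 then show ?case using assms(1) by simp
next
  case (Suc k)
  have "{0<..x (Suc k)} = {0<..x k} \<union> {x k<..x (Suc k)}" using Suc.prems[of k] by auto
  then have "(\<Prod>m\<in>{0<..x (Suc k)}. H m) = (\<Prod>m\<in>{0<..x k}. H m) * (\<Prod>m\<in>{x k<..x (Suc k)}. H m)"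
    by (simp add: prod.union_disjoint ivl_disj_int)
  then show ?case using Suc by simp
qed

text \<open>At l = 0 the integral behind \<open>psi_X\<close> diverges; the value 0 is the one that
  keeps the exponent formulas valid there.\<close>

definition psi0 :: "real \<Rightarrow> real \<Rightarrow> real" where "psi0 \<alpha> l = (if l = 0 then 0 else psi_X \<alpha> l)"

text \<open>Given the Poisson counts at the times ts, the exponent is a deterministic drift plus a
  weighted sum of independent lifetimes, so the transform factorises. Averaging over the independent
  Poisson increments restores the exponent. The weight l k is reserved for the initial
  value.\<close>

lemma (in prob_space) laplace_compound:
  fixes Z :: "nat \<Rightarrow> real \<Rightarrow> 'a \<Rightarrow> nat" and J :: "real \<Rightarrow> 'a \<Rightarrow> nat"
  assumes \<alpha>: "0 < \<alpha>" "\<alpha> < 1"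
    and Z0: "\<And>t. Z 0 t \<in> measurable M (count_space UNIV)"
    and Z: "\<And>i. 1 \<le> i \<Longrightarrow> Qa_chain \<alpha> M 1 (Z i)"
    and J: "poisson_process M \<alpha> J"
    and ind: "indep_vars (\<lambda>_. Pi\<^sub>M UNIV (\<lambda>_. count_space UNIV))
           (\<lambda>i \<omega> t. case i of Some k \<Rightarrow> Z k t \<omega> | None \<Rightarrow> J t \<omega>) (UNIV :: nat option set)"
    and X: "\<And>t \<omega>. X t \<omega> = - t + (\<Sum>i\<in>{0..J t \<omega>}. hit_time (\<lambda>t. Z i t \<omega>))"
    and ts: "ts 0 = 0" "\<And>i. i < k \<Longrightarrow> ts i < ts (Suc i)"
    and l: "\<And>i. i \<le> k \<Longrightarrow> 0 \<le> l i"
  shows "(\<integral>\<^sup>+\<omega>. ennreal (exp (- (l k * X 0 \<omega> + (\<Sum>i<k. l i * (X (ts (Suc i)) \<omega> - X (ts i) \<omega>))))) \<partial>M)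
    = (\<integral>\<^sup>+\<omega>. ennreal (exp (- (l k * X 0 \<omega>))) \<partial>M) * (\<Prod>i<k. ennreal (exp ((ts (Suc i) - ts i) * psi0 \<alpha> (l i))))"
proof -
  define \<zeta> where "\<zeta> i \<omega> = hit_time (\<lambda>t. Z i t \<omega>)" for i \<omega>
  have Zm: "Z i t \<in> measurable M (count_space UNIV)" for i t
    using Z0 Z[of i] unfolding Qa_chain_def by (cases "i = 0") auto
  have Jm[measurable]: "J t \<in> measurable M (count_space UNIV)" for t using J by (simp add: poisson_process_def)
  have \<zeta>m[measurable]: "\<zeta> i \<in> borel_measurable M" for i unfolding \<zeta>_def
    by (rule measurable_compose[OF _ borel_measurable_hit_time]) (auto intro: measurable_PiM_single' Zm)
  have X\<zeta>: "X t \<omega> = - t + (\<Sum>i\<in>{0..J t \<omega>}. \<zeta> i \<omega>)" for t \<omega> by (simp add: X \<zeta>_def)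
  have Xm[measurable]: "X t \<in> borel_measurable M" for t
    unfolding X\<zeta>[abs_def] by (intro borel_measurable_add borel_measurable_sum_upto_rv) auto
  have J0: "J 0 \<omega> = 0" for \<omega> using J by (simp add: poisson_process_def)
  have X0: "X 0 \<omega> = \<zeta> 0 \<omega>" for \<omega> by (simp add: X\<zeta> J0)
  have ts_nonneg: "0 \<le> ts i" if "i \<le> k" for i
    using that
  proof (induction i)
    case (Suc i) then show ?case using ts(2)[of i] by simp
  qed (simp add: ts)
  have Jmono: "J (ts i) \<omega> \<le> J (ts (Suc i)) \<omega>" if "i < k" for i \<omega>
    using J that ts(2)[OF that] ts_nonneg[of i] by (auto simp: poisson_process_def mono_on_def)
  \<comment> \<open>The transform of a lifetime started at 1, valid at s = 0 as well.\<close>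
  define \<phi> where "\<phi> s = 1 - (s - psi0 \<alpha> s) / \<alpha>" for s
  have E\<zeta>: "(\<integral>\<^sup>+\<omega>. ennreal (exp (- s * \<zeta> i \<omega>)) \<partial>M) = ennreal (\<phi> s)" if "1 \<le> i" "0 \<le> s" for i s
    using hit_time_law(2)[OF \<alpha> Z[OF that(1)], of s] that(2)
    by (cases "s = 0") (auto simp: \<zeta>_def \<phi>_def psi0_def emeasure_space_1)
  \<comment> \<open>A negative value would become 0 under \<open>ennreal\<close>, but a strictly
    positive function has positive integral on a probability space.\<close>
  have \<phi>0: "0 \<le> \<phi> s" if "0 \<le> s" for s
  proof (rule ccontr)
    assume "\<not> 0 \<le> \<phi> s"
    then have "(\<integral>\<^sup>+\<omega>. ennreal (exp (- s * \<zeta> 1 \<omega>)) \<partial>M) = 0" using E\<zeta>[of 1 s] that by (simp add: ennreal_neg)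
    then have "AE \<omega> in M. False" by (subst (asm) nn_integral_0_iff_AE) auto
    then show False using emeasure_space_1 by (simp add: AE_False)
  qed
  \<comment> \<open>The counts are gathered in a list because lists of naturals form a countable
    type.\<close>
  define K where "K \<omega> = map (\<lambda>i. J (ts i) \<omega>) [0..<Suc k]" for \<omega>
  have K_nth: "K \<omega> ! i = J (ts i) \<omega>" if "i \<le> k" for i \<omega> using that by (simp add: K_def del: upt_Suc)
  have Keq: "K \<omega> = x \<longleftrightarrow> length x = Suc k \<and> (\<forall>i\<le>k. J (ts i) \<omega> = x ! i)" for \<omega> x
    by (auto simp: list_eq_iff_nth_eq K_def less_Suc_eq_le simp del: upt_Suc)
  have Km[measurable]: "K \<in> measurable M (count_space UNIV)"
  proof (rule measurable_count_space_eq2_countable[THEN iffD2], safe)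
    fix x :: "nat list"
    have "K -` {x} \<inter> space M = {\<omega>\<in>space M. length x = Suc k \<and> (\<forall>i\<le>k. J (ts i) \<omega> = x ! i)}" using Keq by blast
    then show "K -` {x} \<inter> space M \<in> sets M" by simp
  qed auto
  let ?f = "\<lambda>\<omega>. ennreal (exp (- (l k * X 0 \<omega> + (\<Sum>i<k. l i * (X (ts (Suc i)) \<omega> - X (ts i) \<omega>)))))"
  define L where "L = (\<integral>\<^sup>+\<omega>. ennreal (exp (- (l k * X 0 \<omega>))) \<partial>M)"
  \<comment> \<open>The contribution of the drift -t to the increments.\<close>
  define C where "C = ennreal (exp (\<Sum>i<k. l i * (ts (Suc i) - ts i)))"
  let ?g = "\<lambda>\<omega>. C * L * (\<Prod>i<k. ennreal (\<phi> (l i) ^ (J (ts (Suc i)) \<omega> - J (ts i) \<omega>)))"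
  have cell: "(\<integral>\<^sup>+\<omega>. ?f \<omega> * indicator {\<omega>. K \<omega> = x} \<omega> \<partial>M) = (\<integral>\<^sup>+\<omega>. ?g \<omega> * indicator {\<omega>. K \<omega> = x} \<omega> \<partial>M)" for x
  proof (cases "\<exists>\<omega>. K \<omega> = x")
    case False
    then show ?thesis by simp
  next
    case True
    then obtain \<omega>0 where \<omega>0: "K \<omega>0 = x" by blast
    have x0: "x ! 0 = 0" using K_nth[of 0 \<omega>0] \<omega>0 ts J0 by simp
    have xmono: "x ! i \<le> x ! Suc i" if "i < k" for i using Jmono[OF that, of \<omega>0] K_nth[of i \<omega>0] K_nth[of "Suc i" \<omega>0] that \<omega>0 by simp
    have xmono': "x ! i \<le> x ! j" if "i \<le> j" "j \<le> k" for i j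
      using that by (induction j) (auto simp: le_Suc_eq intro: order_trans[OF _ xmono])
    \<comment> \<open>The weight attached to lifetime m: the l of the block that contains m, and l k
      for the initial lifetime. The least index picks the block.\<close>
    define w where "w m = (if m = 0 then l k else l (LEAST i. m \<le> x ! Suc i))" for m
    have w: "w m = l i" if "i < k" "x ! i < m" "m \<le> x ! Suc i" for i m
    proof -
      have "(LEAST i. m \<le> x ! Suc i) = i"
      proof (rule Least_equality)
        fix j assume "m \<le> x ! Suc j"
        show "i \<le> j"
        proof (rule ccontr)
          assume "\<not> i \<le> j"
          then have "x ! Suc j \<le> x ! i" using that by (intro xmono') auto
          then show False using \<open>m \<le> x ! Suc j\<close> that by simp
        qed
      qed (use that in auto)
      then show ?thesis using that by (simp add: w_def)
    qed
    have w0: "0 \<le> w m" if "m \<le> x ! k" for m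
    proof (cases "m = 0")
      case False
      have "\<exists>i<k. x ! i < m \<and> m \<le> x ! Suc i"
      proof -
        define i where "i = (LEAST i. m \<le> x ! i)"
        have i: "m \<le> x ! i" "i \<le> k" unfolding i_def using that by (auto intro: LeastI Least_le)
        have "i \<noteq> 0"
        proof
          assume "i = 0"
          then show False using i(1) x0 False by simp
        qed
        then obtain j where j: "i = Suc j" by (cases i) auto
        have "\<not> m \<le> x ! j" using not_less_Least[of j "\<lambda>i. m \<le> x ! i"] j unfolding i_def by simp
        then show ?thesis using i j by (intro exI[of _ j]) auto
      qed
      then show ?thesis using w l by force
    qed (simp add: w_def l)
    \<comment> \<open>Index None carries the event {K = x}, index Some m the exponential factor of
      lifetime m, mirroring the index set of the independence assumption.\<close>
    define V where "V i \<omega> = (case i of None \<Rightarrow> indicator {\<omega>. K \<omega> = x} \<omega> | Some m \<Rightarrow> exp (- w m * \<zeta> m \<omega>))" for i :: "nat option" and \<omega>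
    let ?P = "Pi\<^sub>M UNIV (\<lambda>_::real. count_space (UNIV::nat set))"
    define G :: "nat option \<Rightarrow> (real \<Rightarrow> nat) \<Rightarrow> real" where "G i z = (case i of None \<Rightarrow> indicator {z. length x = Suc k \<and> (\<forall>i\<le>k. z (ts i) = x ! i)} z | Some m \<Rightarrow> exp (- w m * hit_time z))"
      for i z
    have Gm: "G i \<in> borel_measurable ?P" for i
    proof (cases i)
      case None
      have "(\<lambda>z. indicator {z. length x = Suc k \<and> (\<forall>i\<le>k. z (ts i) = x ! i)} z :: real) \<in> borel_measurable ?P" by measurable
      then show ?thesis using None by (simp add: G_def[abs_def])
    next
      case (Some m)
      have [measurable]: "hit_time \<in> borel_measurable ?P" by (rule borel_measurable_hit_time)
      show ?thesis unfolding Some G_def[abs_def] by simp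
    qed
    have VG: "V i \<omega> = G i (\<lambda>t. case i of Some k \<Rightarrow> Z k t \<omega> | None \<Rightarrow> J t \<omega>)" for i \<omega>
      by (cases i) (auto simp: V_def G_def \<zeta>_def Keq indicator_def)
    let ?I = "insert None (Some ` {..x ! k})"
    \<comment> \<open>Each V i is a measurable function G i of one whole path, so independence is
      inherited from that of J and the chains.\<close>
    have "indep_vars (\<lambda>_. borel) V UNIV"
      unfolding VG[abs_def] by (rule indep_vars_compose2[OF ind Gm])
    then have "indep_vars (\<lambda>_. borel) V ?I" by (rule indep_vars_subset) auto
    then have prodV: "(\<integral>\<^sup>+\<omega>. (\<Prod>i\<in>?I. ennreal (V i \<omega>)) \<partial>M) = (\<Prod>i\<in>?I. \<integral>\<^sup>+\<omega>. ennreal (V i \<omega>) \<partial>M)"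
      by (intro indep_vars_nn_integral indep_vars_compose2[where Y="\<lambda>_. ennreal" and N="\<lambda>_. borel"]) auto
    have range: "{..x ! k} = insert 0 {0<..x ! k}" by auto
    have prodI: "(\<Prod>i\<in>?I. h i) = h None * (h (Some 0) * (\<Prod>i<k. \<Prod>m\<in>{x ! i<..x ! Suc i}. h (Some m)))" for h :: "nat option \<Rightarrow> ennreal"
    proof -
      have "(\<Prod>i\<in>?I. h i) = h None * (\<Prod>m\<in>{..x ! k}. h (Some m))"
        by (subst prod.insert) (auto simp: prod.reindex)
      also have "(\<Prod>m\<in>{..x ! k}. h (Some m)) = h (Some 0) * (\<Prod>m\<in>{0<..x ! k}. h (Some m))"
        unfolding range by (subst prod.insert) auto
      finally show ?thesis using prod_blocks[of "\<lambda>i. x ! i" k "\<lambda>m. h (Some m)", OF x0 xmono] by simp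
    qed
    have "(\<integral>\<^sup>+\<omega>. ?f \<omega> * indicator {\<omega>. K \<omega> = x} \<omega> \<partial>M) = (\<integral>\<^sup>+\<omega>. C * (\<Prod>i\<in>?I. ennreal (V i \<omega>)) \<partial>M)"
    proof (rule nn_integral_cong)
      fix \<omega>
      show "?f \<omega> * indicator {\<omega>. K \<omega> = x} \<omega> = C * (\<Prod>i\<in>?I. ennreal (V i \<omega>))"
      proof (cases "K \<omega> = x")
        case True
        have Jx: "J (ts i) \<omega> = x ! i" if "i \<le> k" for i using K_nth[OF that, of \<omega>] True by simp
        have dX: "X (ts (Suc i)) \<omega> - X (ts i) \<omega> = - (ts (Suc i) - ts i) + (\<Sum>m\<in>{x ! i<..x ! Suc i}. \<zeta> m \<omega>)" if "i < k" for i
        proof -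
          have "{0..x ! Suc i} = {0..x ! i} \<union> {x ! i<..x ! Suc i}" using xmono[OF that] by auto
          then have "(\<Sum>m\<in>{0..x ! Suc i}. \<zeta> m \<omega>) = (\<Sum>m\<in>{0..x ! i}. \<zeta> m \<omega>) + (\<Sum>m\<in>{x ! i<..x ! Suc i}. \<zeta> m \<omega>)"
            by (simp add: sum.union_disjoint ivl_disj_int)
          then show ?thesis using that by (simp add: X\<zeta> Jx)
        qed
        have "(\<Sum>i<k. l i * (X (ts (Suc i)) \<omega> - X (ts i) \<omega>))
          = - (\<Sum>i<k. l i * (ts (Suc i) - ts i)) + (\<Sum>i<k. \<Sum>m\<in>{x ! i<..x ! Suc i}. w m * \<zeta> m \<omega>)"
          by (simp add: dX w sum_distrib_left sum.distrib[symmetric] sum_negf[symmetric] algebra_simps)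
        then have "?f \<omega> = ennreal (exp (\<Sum>i<k. l i * (ts (Suc i) - ts i)) * (exp (- w 0 * \<zeta> 0 \<omega>) * (\<Prod>i<k. \<Prod>m\<in>{x ! i<..x ! Suc i}. exp (- w m * \<zeta> m \<omega>))))"
          by (simp add: X0 w_def[of 0] exp_add[symmetric] exp_sum[symmetric] sum_negf[symmetric] algebra_simps)
        also have "\<dots> = C * (\<Prod>i\<in>?I. ennreal (V i \<omega>))"
          unfolding prodI C_def using True by (simp add: V_def ennreal_mult' prod_ennreal prod_nonneg)
        finally show ?thesis using True by simp
      next
        case False
        then show ?thesis unfolding prodI by (simp add: V_def)
      qed
    qed
    also have "\<dots> = C * (\<Prod>i\<in>?I. \<integral>\<^sup>+\<omega>. ennreal (V i \<omega>) \<partial>M)"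
    proof -
      have Vm: "V i \<in> borel_measurable M" for i by (cases i) (auto simp: V_def[abs_def])
      show ?thesis unfolding prodV[symmetric]
        by (rule nn_integral_cmult) (intro borel_measurable_prod_ennreal measurable_compose[OF Vm measurable_ennreal])
    qed
    also have "\<dots> = C * ((\<integral>\<^sup>+\<omega>. indicator {\<omega>. K \<omega> = x} \<omega> \<partial>M) * (L * (\<Prod>i<k. \<Prod>m\<in>{x ! i<..x ! Suc i}. ennreal (\<phi> (l i)))))"
    proof -
      have "(\<integral>\<^sup>+\<omega>. ennreal (V (Some m) \<omega>) \<partial>M) = ennreal (\<phi> (l i))" if "i < k" "m \<in> {x ! i<..x ! Suc i}" for i m
        using E\<zeta>[of m "l i"] w[of i m] that l[of i] by (simp add: V_def)
      moreover have "(\<integral>\<^sup>+\<omega>. ennreal (V (Some 0) \<omega>) \<partial>M) = L" by (simp add: V_def w_def L_def X0)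
      moreover have "(\<integral>\<^sup>+\<omega>. ennreal (V None \<omega>) \<partial>M) = (\<integral>\<^sup>+\<omega>. indicator {\<omega>. K \<omega> = x} \<omega> \<partial>M)"
        by (intro nn_integral_cong) (simp add: V_def indicator_def)
      ultimately show ?thesis unfolding prodI by simp
    qed
    also have "\<dots> = (\<integral>\<^sup>+\<omega>. C * L * (\<Prod>i<k. ennreal (\<phi> (l i) ^ (x ! Suc i - x ! i))) * indicator {\<omega>. K \<omega> = x} \<omega> \<partial>M)"
      by (subst nn_integral_cmult) (use \<phi>0 l in \<open>auto simp: mult_ac ennreal_power\<close>)
    also have "\<dots> = (\<integral>\<^sup>+\<omega>. ?g \<omega> * indicator {\<omega>. K \<omega> = x} \<omega> \<partial>M)"
      by (intro nn_integral_cong) (auto simp: indicator_def K_nth)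
    finally show ?thesis .
  qed
  have "(\<integral>\<^sup>+\<omega>. ?f \<omega> \<partial>M) = (\<integral>\<^sup>+\<omega>. ?g \<omega> \<partial>M)"
    using nn_integral_countable_split[OF sigma_finite_measure_axioms Km, of ?f] nn_integral_countable_split[OF sigma_finite_measure_axioms Km, of ?g] cell
    by simp
  also have "\<dots> = C * L * (\<integral>\<^sup>+\<omega>. (\<Prod>i<k. ennreal (\<phi> (l i) ^ (J (ts (Suc i)) \<omega> - J (ts i) \<omega>))) \<partial>M)"
    by (rule nn_integral_cmult) measurable
  also have "(\<integral>\<^sup>+\<omega>. (\<Prod>i<k. ennreal (\<phi> (l i) ^ (J (ts (Suc i)) \<omega> - J (ts i) \<omega>))) \<partial>M)
     = (\<Prod>i<k. \<integral>\<^sup>+\<omega>. ennreal (\<phi> (l i) ^ (J (ts (Suc i)) \<omega> - J (ts i) \<omega>)) \<partial>M)"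
  proof -
    have "indep_vars (\<lambda>_. count_space UNIV) (\<lambda>i \<omega>. J (ts (Suc i)) \<omega> - J (ts i) \<omega>) {..<k}"
      using J ts unfolding poisson_process_def by simp
    then have "indep_vars (\<lambda>_. borel) (\<lambda>i \<omega>. ennreal (\<phi> (l i) ^ (J (ts (Suc i)) \<omega> - J (ts i) \<omega>))) {..<k}"
      by (rule indep_vars_compose2) auto
    then show ?thesis by (intro indep_vars_nn_integral) auto
  qed
  also have "\<dots> = (\<Prod>i<k. ennreal (exp (\<alpha> * (ts (Suc i) - ts i) * (\<phi> (l i) - 1))))"
  proof (rule prod.cong[OF refl])
    fix i assume i: "i \<in> {..<k}"
    show "(\<integral>\<^sup>+\<omega>. ennreal (\<phi> (l i) ^ (J (ts (Suc i)) \<omega> - J (ts i) \<omega>)) \<partial>M) = ennreal (exp (\<alpha> * (ts (Suc i) - ts i) * (\<phi> (l i) - 1)))"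
    proof (rule nn_integral_poisson_power)
      show "prob {\<omega> \<in> space M. J (ts (Suc i)) \<omega> - J (ts i) \<omega> = n} = exp (- (\<alpha> * (ts (Suc i) - ts i))) * (\<alpha> * (ts (Suc i) - ts i)) ^ n / fact n" for n
        using J ts(2)[of i] ts_nonneg[of i] i unfolding poisson_process_def by (auto simp: less_imp_le)
    qed (use i \<alpha> ts(2)[of i] \<phi>0 l in auto)
  qed
  also have "C * L * \<dots> = L * (\<Prod>i<k. ennreal (exp ((ts (Suc i) - ts i) * psi0 \<alpha> (l i))))"
  proof -
    \<comment> \<open>Drift and compound Poisson part combine: l + \<alpha> (\<phi> l - 1) = psi0
      l.\<close>
    have "l i * (ts (Suc i) - ts i) + \<alpha> * (ts (Suc i) - ts i) * (\<phi> (l i) - 1) = (ts (Suc i) - ts i) * psi0 \<alpha> (l i)" for i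
      using \<alpha> by (simp add: \<phi>_def field_simps)
    then have "C * (\<Prod>i<k. ennreal (exp (\<alpha> * (ts (Suc i) - ts i) * (\<phi> (l i) - 1)))) = (\<Prod>i<k. ennreal (exp ((ts (Suc i) - ts i) * psi0 \<alpha> (l i))))"
    proof -
      assume e: "\<And>i. l i * (ts (Suc i) - ts i) + \<alpha> * (ts (Suc i) - ts i) * (\<phi> (l i) - 1) = (ts (Suc i) - ts i) * psi0 \<alpha> (l i)"
      have "C = (\<Prod>i<k. ennreal (exp (l i * (ts (Suc i) - ts i))))"
        unfolding C_def by (simp add: exp_sum prod_ennreal)
      then show ?thesis
        by (simp only: prod.distrib[symmetric] ennreal_mult'[OF exp_ge_zero, symmetric] exp_add[symmetric] e)
    qed
    moreover have "C * L * Q = L * (C * Q)" for Q by (simp only: ac_simps)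
    ultimately show ?thesis by (simp only:)
  qed
  finally show ?thesis unfolding L_def .
qed

section \<open>Compensated jump processes on a Poisson random measure\<close>

lemma expectation_poisson_power:
  fixes a :: real
  assumes "0 \<le> a"
  shows "(\<integral>\<^sup>+n. ennreal (a ^ n) \<partial>measure_pmf (poisson_pmf 1)) = ennreal (exp (a - 1))"
proof -
  have "(\<lambda>n. exp (- 1) * (a ^ n /\<^sub>R fact n)) sums (exp (- 1) * exp a)"
    by (intro sums_mult exp_converges)
  then have s: "(\<lambda>n. 1 ^ n / fact n * exp (- 1) * a ^ n) sums exp (a - 1)"
    by (simp add: exp_add[symmetric] algebra_simps divide_inverse)
  have "(\<integral>\<^sup>+n. ennreal (a ^ n) \<partial>measure_pmf (poisson_pmf 1)) = (\<Sum>n. ennreal (1 ^ n / fact n * exp (- 1) * a ^ n))"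
    using assms by (simp add: nn_integral_measure_pmf nn_integral_count_space_nat ennreal_mult'[symmetric])
  also have "\<dots> = ennreal (\<Sum>n. 1 ^ n / fact n * exp (- 1) * a ^ n)"
    using assms s by (intro suminf_ennreal2) (auto simp: sums_iff)
  finally show ?thesis using s by (simp add: sums_iff)
qed

definition unif :: "nat \<Rightarrow> real measure" where
  "unif i = density lborel (\<lambda>x. ennreal (indicator {real i..<real i + 1} x))"

lemma prob_space_unif: "prob_space (unif i)"
  by (rule prob_spaceI) (simp add: unif_def emeasure_density ennreal_indicator)

lemma sets_unif[measurable_cong, simp]: "sets (unif i) = sets borel" by (simp add: unif_def)

lemma integral_unif: "f \<in> borel_measurable borel \<Longrightarrow> (\<integral>x. f x \<partial>unif i) = (\<integral>x. indicator {real i..<real i + 1} x * f x \<partial>lborel)"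
  for f :: "real \<Rightarrow> real"
  unfolding unif_def by (subst integral_density) auto

definition pt_measure :: "nat \<times> nat \<Rightarrow> (real \<times> real) measure" where
  "pt_measure c = unif (fst c) \<Otimes>\<^sub>M unif (snd c)"

lemma prob_space_pt: "prob_space (pt_measure c)"
  unfolding pt_measure_def by (intro prob_space_pair prob_space_unif)

lemma sets_pt[measurable_cong, simp]: "sets (pt_measure c) = sets (borel \<Otimes>\<^sub>M borel)"
  unfolding pt_measure_def by (intro sets_pair_measure_cong) auto

text \<open>A sample (N, p) of the cell measure for c = (i, k) encodes the points p 0, ..., p (N - 1) of a rate-one Poisson
  random measure in the unit square [i, i + 1) x [k, k + 1).\<close>

definition cell_measure :: "nat \<times> nat \<Rightarrow> (nat \<times> (nat \<Rightarrow> real \<times> real)) measure" where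
  "cell_measure c = measure_pmf (poisson_pmf 1) \<Otimes>\<^sub>M PiM UNIV (\<lambda>_. pt_measure c)"

lemma prob_space_cell: "prob_space (cell_measure c)"
  unfolding cell_measure_def by (intro prob_space_pair measure_pmf.prob_space_axioms prob_space_PiM prob_space_pt)

definition cell_sum :: "(real \<times> real \<Rightarrow> real) \<Rightarrow> nat \<times> (nat \<Rightarrow> real \<times> real) \<Rightarrow> real" where
  "cell_sum \<phi> w = (\<Sum>j<fst w. \<phi> (snd w j))"

lemma sets_cell[measurable_cong]:
  "sets (cell_measure c) = sets (count_space UNIV \<Otimes>\<^sub>M PiM UNIV (\<lambda>_. borel \<Otimes>\<^sub>M borel))"
  unfolding cell_measure_def by (intro sets_pair_measure_cong sets_PiM_cong) auto

lemma borel_measurable_cell_sum: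
  assumes [measurable]: "\<phi> \<in> borel_measurable (borel \<Otimes>\<^sub>M borel)"
  shows "cell_sum \<phi> \<in> borel_measurable (cell_measure c)"
proof -
  have "(\<lambda>w :: nat \<times> (nat \<Rightarrow> real \<times> real). \<Sum>j<fst w. \<phi> (snd w j)) \<in> borel_measurable (count_space UNIV \<Otimes>\<^sub>M PiM UNIV (\<lambda>_. borel \<Otimes>\<^sub>M borel))"
    by (rule measurable_compose_countable[where g=fst and f="\<lambda>n (w :: nat \<times> (nat \<Rightarrow> real \<times> real)). \<Sum>j<n. \<phi> (snd w j)"]) measurable
  then show ?thesis unfolding cell_sum_def[abs_def] by (simp cong: measurable_cong_sets add: sets_cell)
qed

text \<open>Campbell's formula in one cell: given the Poisson number of points these are
  independent, and the generating function of the Poisson law does the rest. The upper bound on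
  \<phi> makes exp \<phi> integrable.\<close>

lemma laplace_cell_sum:
  assumes [measurable]: "\<phi> \<in> borel_measurable (borel \<Otimes>\<^sub>M borel)" and bound: "\<And>p. \<phi> p \<le> B"
  shows "(\<integral>\<^sup>+w. ennreal (exp (cell_sum \<phi> w)) \<partial>cell_measure c) = ennreal (exp (\<integral>p. exp (\<phi> p) - 1 \<partial>pt_measure c))"
proof -
  interpret P: prob_space "pt_measure c" by (rule prob_space_pt)
  interpret PP: product_prob_space "\<lambda>_::nat. pt_measure c" UNIV by (intro product_prob_spaceI prob_space_pt)
  have Q: "prob_space (PiM (UNIV::nat set) (\<lambda>_. pt_measure c))" by (intro prob_space_PiM prob_space_pt)
  have int: "integrable (pt_measure c) (\<lambda>p. exp (\<phi> p))"
    by (rule P.integrable_const_bound[where B="exp B"]) (use bound in auto)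
  define a where "a = (\<integral>p. exp (\<phi> p) \<partial>pt_measure c)"
  have a: "(\<integral>\<^sup>+p. ennreal (exp (\<phi> p)) \<partial>pt_measure c) = ennreal a" "0 \<le> a"
    unfolding a_def using int by (auto intro!: nn_integral_eq_integral integral_nonneg_AE)
  have m: "(\<lambda>w. ennreal (exp (cell_sum \<phi> w))) \<in> borel_measurable (measure_pmf (poisson_pmf 1) \<Otimes>\<^sub>M PiM UNIV (\<lambda>_. pt_measure c))"
    using borel_measurable_cell_sum[of \<phi> c] unfolding cell_measure_def by measurable
  have "(\<integral>\<^sup>+w. ennreal (exp (cell_sum \<phi> w)) \<partial>cell_measure c)
    = (\<integral>\<^sup>+n. (\<integral>\<^sup>+x. ennreal (exp (cell_sum \<phi> (n, x))) \<partial>PiM UNIV (\<lambda>_. pt_measure c)) \<partial>measure_pmf (poisson_pmf 1))"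
    unfolding cell_measure_def by (subst sigma_finite_measure.nn_integral_fst[OF prob_space_imp_sigma_finite m]) (simp_all add: Q)
  also have "\<dots> = (\<integral>\<^sup>+n. ennreal (a ^ n) \<partial>measure_pmf (poisson_pmf 1))"
  proof (rule nn_integral_cong)
    fix n
    have "(\<integral>\<^sup>+x. ennreal (exp (cell_sum \<phi> (n, x))) \<partial>PiM UNIV (\<lambda>_. pt_measure c))
       = (\<integral>\<^sup>+x. (\<Prod>j<n. ennreal (exp (\<phi> (restrict x {..<n} j)))) \<partial>PiM UNIV (\<lambda>_. pt_measure c))"
      by (intro nn_integral_cong) (simp add: cell_sum_def exp_sum prod_ennreal)
    also have "\<dots> = (\<integral>\<^sup>+x. (\<Prod>j<n. ennreal (exp (\<phi> (x j)))) \<partial>distr (PiM UNIV (\<lambda>_. pt_measure c)) (PiM {..<n} (\<lambda>_. pt_measure c)) (\<lambda>x. restrict x {..<n}))"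
      by (subst nn_integral_distr) (auto intro!: measurable_restrict_subset)
    also have "\<dots> = (\<integral>\<^sup>+x. (\<Prod>j<n. ennreal (exp (\<phi> (x j)))) \<partial>PiM {..<n} (\<lambda>_. pt_measure c))"
      by (subst PP.distr_PiM_restrict_finite) auto
    also have "\<dots> = (\<Prod>j<n. \<integral>\<^sup>+p. ennreal (exp (\<phi> p)) \<partial>pt_measure c)"
      by (rule PP.product_nn_integral_prod) auto
    also have "\<dots> = ennreal (a ^ n)" using a by (simp add: ennreal_power)
    finally show "(\<integral>\<^sup>+x. ennreal (exp (cell_sum \<phi> (n, x))) \<partial>PiM UNIV (\<lambda>_. pt_measure c)) = ennreal (a ^ n)" .
  qed
  also have "\<dots> = ennreal (exp (a - 1))" by (rule expectation_poisson_power[OF a(2)])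
  also have "a - 1 = (\<integral>p. exp (\<phi> p) - 1 \<partial>pt_measure c)" unfolding a_def using int P.prob_space by simp
  finally show ?thesis .
qed

text \<open>By superposition over unit cells, a Poisson random measure with Lebesgue intensity on
  the quadrant.\<close>

definition prm :: "(nat \<times> nat \<Rightarrow> nat \<times> (nat \<Rightarrow> real \<times> real)) measure" where
  "prm = PiM UNIV cell_measure"

lemma prob_space_prm: "prob_space prm"
  unfolding prm_def by (intro prob_space_PiM prob_space_cell)

text \<open>Cells are independent, so Campbell's formula multiplies. The integrand may vary with the
  cell, as it does for \<open>jmp\<close>.\<close>

lemma laplace_prm:
  assumes C: "finite C" and [measurable]: "\<And>c. c \<in> C \<Longrightarrow> \<phi> c \<in> borel_measurable (borel \<Otimes>\<^sub>M borel)"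
    and bound: "\<And>c p. c \<in> C \<Longrightarrow> \<phi> c p \<le> B"
  shows "(\<integral>\<^sup>+\<omega>. ennreal (exp (\<Sum>c\<in>C. cell_sum (\<phi> c) (\<omega> c))) \<partial>prm) = ennreal (exp (\<Sum>c\<in>C. \<integral>p. exp (\<phi> c p) - 1 \<partial>pt_measure c))"
proof -
  interpret PP: product_prob_space cell_measure UNIV by (intro product_prob_spaceI prob_space_cell)
  have m: "(\<lambda>w. ennreal (exp (cell_sum (\<phi> c) w))) \<in> borel_measurable (cell_measure c)" if "c \<in> C" for c
    using borel_measurable_cell_sum[OF assms(2)[OF that], of c] by measurable
  have m': "(\<lambda>\<omega>. ennreal (exp (cell_sum (\<phi> c) (\<omega> c)))) \<in> borel_measurable (PiM C cell_measure)" if "c \<in> C" for c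
    by (rule measurable_compose[where f="\<lambda>\<omega>. \<omega> c" and N="cell_measure c" and g="\<lambda>w. ennreal (exp (cell_sum (\<phi> c) w))"])
       (rule measurable_component_singleton, rule that, rule m, rule that)
  have "(\<integral>\<^sup>+\<omega>. ennreal (exp (\<Sum>c\<in>C. cell_sum (\<phi> c) (\<omega> c))) \<partial>prm)
     = (\<integral>\<^sup>+\<omega>. (\<Prod>c\<in>C. ennreal (exp (cell_sum (\<phi> c) (restrict \<omega> C c)))) \<partial>PiM UNIV cell_measure)"
    unfolding prm_def by (intro nn_integral_cong) (simp add: exp_sum C prod_ennreal)
  also have "\<dots> = (\<integral>\<^sup>+\<omega>. (\<Prod>c\<in>C. ennreal (exp (cell_sum (\<phi> c) (\<omega> c)))) \<partial>distr (PiM UNIV cell_measure) (PiM C cell_measure) (\<lambda>x. restrict x C))"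
    by (subst nn_integral_distr)
       (auto intro!: measurable_restrict_subset borel_measurable_prod_ennreal m')
  also have "\<dots> = (\<integral>\<^sup>+\<omega>. (\<Prod>c\<in>C. ennreal (exp (cell_sum (\<phi> c) (\<omega> c)))) \<partial>PiM C cell_measure)"
    using C by (subst PP.distr_PiM_restrict_finite) auto
  also have "\<dots> = (\<Prod>c\<in>C. \<integral>\<^sup>+w. ennreal (exp (cell_sum (\<phi> c) w)) \<partial>cell_measure c)"
    by (rule PP.product_nn_integral_prod[OF C m])
  also have "\<dots> = (\<Prod>c\<in>C. ennreal (exp (\<integral>p. exp (\<phi> c p) - 1 \<partial>pt_measure c)))"
    by (intro prod.cong refl laplace_cell_sum[where B=B]) (use bound in auto)
  finally show ?thesis by (simp add: prod_ennreal exp_sum C)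
qed

text \<open>Clamping the jump time to the cell and discarding jumps at time 0 only changes a null set of points,
  but makes paths cadlag and started at 0 for every sample, not just almost surely.\<close>

definition jmp :: "(real \<Rightarrow> real) \<Rightarrow> nat \<times> nat \<Rightarrow> real \<Rightarrow> real \<times> real \<Rightarrow> real" where
  "jmp f c t p = (if max (real (fst c)) (fst p) \<le> t then
     indicator {0<..} (max (real (fst c)) (fst p)) * (indicator {real (snd c)..<real (snd c) + 1} (snd p) * f (snd p)) else 0)"

text \<open>A point (s, u) of the random measure is a jump of size f u at time s. Only K rows of
  cells are used because f vanishes from K on, so every sum is finite.\<close>

definition S_proc :: "nat \<Rightarrow> (real \<Rightarrow> real) \<Rightarrow> real \<Rightarrow> (nat \<times> nat \<Rightarrow> nat \<times> (nat \<Rightarrow> real \<times> real)) \<Rightarrow> real" where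
  "S_proc K f t \<omega> = (\<Sum>c\<in>{..nat \<lfloor>t\<rfloor>} \<times> {..<K}. cell_sum (jmp f c t) (\<omega> c))"

definition M_proc :: "nat \<Rightarrow> (real \<Rightarrow> real) \<Rightarrow> real \<Rightarrow> (nat \<times> nat \<Rightarrow> nat \<times> (nat \<Rightarrow> real \<times> real)) \<Rightarrow> real" where
  "M_proc K f t \<omega> = S_proc K f t \<omega> - t * (\<integral>u. f u \<partial>lborel)"

text \<open>Integrable profiles with support in [0, K): finitely many jumps on bounded times and a
  finite compensator.\<close>

definition adm :: "nat \<Rightarrow> (real \<Rightarrow> real) \<Rightarrow> bool" where
  "adm K f \<longleftrightarrow> f \<in> borel_measurable borel \<and> integrable lborel f \<and> (\<forall>u. u < 0 \<or> real K \<le> u \<longrightarrow> f u = 0)"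

text \<open>The exponent of the compensated process with jumps f: the Levy-Khintchine integral whose
  Levy measure is the image of Lebesgue measure under f.\<close>

definition kap :: "(real \<Rightarrow> real) \<Rightarrow> real \<Rightarrow> real" where
  "kap f l = (\<integral>u. exp (- l * f u) - 1 + l * f u \<partial>lborel)"

lemma borel_measurable_jmp[measurable]:
  assumes [measurable]: "f \<in> borel_measurable borel"
  shows "jmp f c t \<in> borel_measurable (borel \<Otimes>\<^sub>M borel)"
  unfolding jmp_def[abs_def] by measurable

text \<open>Cells that start after time t contribute 0, so one index set serves all times before n.
  Increments and path regularity can then be read off term by term.\<close>

lemma S_proc_eq:
  assumes "0 \<le> t" "t < real n"
  shows "S_proc K f t \<omega> = (\<Sum>c\<in>{..<n} \<times> {..<K}. cell_sum (jmp f c t) (\<omega> c))"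
  unfolding S_proc_def
proof (rule sum.mono_neutral_left)
  show "{..nat \<lfloor>t\<rfloor>} \<times> {..<K} \<subseteq> {..<n} \<times> {..<K}" using assms by (auto simp: nat_less_iff floor_less_iff le_nat_iff) linarith
  show "\<forall>c\<in>{..<n} \<times> {..<K} - {..nat \<lfloor>t\<rfloor>} \<times> {..<K}. cell_sum (jmp f c t) (\<omega> c) = 0"
  proof
    fix c assume "c \<in> {..<n} \<times> {..<K} - {..nat \<lfloor>t\<rfloor>} \<times> {..<K}"
    then have "nat \<lfloor>t\<rfloor> < fst c" by auto
    then have "t < real (fst c)" using assms by linarith
    then show "cell_sum (jmp f c t) (\<omega> c) = 0" by (simp add: cell_sum_def jmp_def)
  qed
qed auto

text \<open>Lets profiles with different supports be compared under a common cutoff.\<close>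

lemma S_proc_cutoff:
  assumes "adm K f" "K \<le> K'"
  shows "S_proc K' f t \<omega> = S_proc K f t \<omega>"
  unfolding S_proc_def
proof (rule sum.mono_neutral_right)
  show "\<forall>c\<in>{..nat \<lfloor>t\<rfloor>} \<times> {..<K'} - {..nat \<lfloor>t\<rfloor>} \<times> {..<K}. cell_sum (jmp f c t) (\<omega> c) = 0"
  proof
    fix c assume "c \<in> {..nat \<lfloor>t\<rfloor>} \<times> {..<K'} - {..nat \<lfloor>t\<rfloor>} \<times> {..<K}"
    then have "K \<le> snd c" by auto
    then have "indicator {real (snd c)..<real (snd c) + 1} u * f u = 0" for u
      using assms(1) unfolding adm_def indicator_def by auto
    then have "jmp f c t p = 0" for p by (simp add: jmp_def)
    then show "cell_sum (jmp f c t) (\<omega> c) = 0" by (simp add: cell_sum_def)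
  qed
qed (use assms(2) in auto)

lemma M_proc_cutoff: "adm K f \<Longrightarrow> K \<le> K' \<Longrightarrow> M_proc K' f t \<omega> = M_proc K f t \<omega>"
  unfolding M_proc_def by (simp only: S_proc_cutoff[of K f K'])

lemma adm_mono: "adm K f \<Longrightarrow> K \<le> K' \<Longrightarrow> adm K' f"
  by (auto simp: adm_def)

lemma adm_diff: "adm K f \<Longrightarrow> adm K g \<Longrightarrow> adm K (\<lambda>u. f u - g u)"
  by (auto simp: adm_def)

lemma adm_uminus: "adm K f \<Longrightarrow> adm K (\<lambda>u. - f u)"
  by (auto simp: adm_def)

lemma S_proc_add: "S_proc K (\<lambda>u. f u + g u) t \<omega> = S_proc K f t \<omega> + S_proc K g t \<omega>"
proof -
  have "jmp (\<lambda>u. f u + g u) c t p = jmp f c t p + jmp g c t p" for c p by (simp add: jmp_def algebra_simps)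
  then show ?thesis by (simp add: S_proc_def cell_sum_def sum.distrib)
qed

lemma S_proc_uminus: "S_proc K (\<lambda>u. - f u) t \<omega> = - S_proc K f t \<omega>"
proof -
  have "jmp (\<lambda>u. - f u) c t p = - jmp f c t p" for c p by (simp add: jmp_def)
  then show ?thesis by (simp add: S_proc_def cell_sum_def sum_negf)
qed

lemma S_proc_diff: "S_proc K (\<lambda>u. f u - g u) t \<omega> = S_proc K f t \<omega> - S_proc K g t \<omega>"
  using S_proc_add[of K f "\<lambda>u. - g u"] by (simp add: S_proc_uminus)

lemma M_proc_add: "adm K f \<Longrightarrow> adm K g \<Longrightarrow> M_proc K (\<lambda>u. f u + g u) t \<omega> = M_proc K f t \<omega> + M_proc K g t \<omega>"
  by (simp add: M_proc_def S_proc_add adm_def algebra_simps)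

lemma M_proc_uminus: "M_proc K (\<lambda>u. - f u) t \<omega> = - M_proc K f t \<omega>"
  by (simp add: M_proc_def S_proc_uminus)

lemma M_proc_diff: "adm K f \<Longrightarrow> adm K g \<Longrightarrow> M_proc K (\<lambda>u. f u - g u) t \<omega> = M_proc K f t \<omega> - M_proc K g t \<omega>"
  by (simp add: M_proc_def S_proc_diff adm_def algebra_simps)

lemma borel_measurable_prm_cell_sum:
  assumes "\<phi> \<in> borel_measurable (borel \<Otimes>\<^sub>M borel)"
  shows "(\<lambda>\<omega>. cell_sum \<phi> (\<omega> c)) \<in> borel_measurable prm"
  unfolding prm_def
  by (rule measurable_compose[where f="\<lambda>\<omega>. \<omega> c" and N="cell_measure c" and g="cell_sum \<phi>"])
     (rule measurable_component_singleton, simp, rule borel_measurable_cell_sum[OF assms])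

lemma borel_measurable_S_proc: "f \<in> borel_measurable borel \<Longrightarrow> S_proc K f t \<in> borel_measurable prm"
  unfolding S_proc_def[abs_def]
  by (intro borel_measurable_sum borel_measurable_prm_cell_sum borel_measurable_jmp)

lemma borel_measurable_M_proc: "adm K f \<Longrightarrow> M_proc K f t \<in> borel_measurable prm"
  unfolding M_proc_def[abs_def] by (auto simp: adm_def intro!: borel_measurable_diff borel_measurable_S_proc)


lemma cadlag_M_proc: "cadlag (\<lambda>t. M_proc K f t \<omega>)"
proof -
  have "cadlag (\<lambda>t. S_proc K f t \<omega>)"
  proof (rule cadlag_local)
    fix n :: nat
    let ?y = "\<lambda>t. \<Sum>c\<in>{..<n} \<times> {..<K}. cell_sum (jmp f c t) (\<omega> c)"
    have "cadlag ?y"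
      unfolding cell_sum_def jmp_def by (intro cadlag_sum cadlag_step)
    then show "\<exists>y. cadlag y \<and> (\<forall>t. 0 \<le> t \<longrightarrow> t < real n \<longrightarrow> S_proc K f t \<omega> = y t)"
      by (intro exI[of _ ?y]) (simp add: S_proc_eq)
  qed
  then have "cadlag (\<lambda>t. S_proc K f t \<omega> + - (t * (\<integral>u. f u \<partial>lborel)))"
    by (rule cadlag_add) (intro cadlag_continuous continuous_intros)
  then show ?thesis by (simp add: M_proc_def)
qed

lemma M_proc_0: "M_proc K f 0 \<omega> = 0"
proof -
  have "jmp f c 0 p = 0" for c p by (simp add: jmp_def indicator_def)
  then show ?thesis by (simp add: M_proc_def S_proc_def cell_sum_def)
qed

text \<open>At most one of the half-open intervals contains s, so exp(.) - 1 acts on each summand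
  separately.\<close>

lemma exp_sum_disjoint_indicators:
  fixes b ts :: "nat \<Rightarrow> real"
  assumes mono: "\<And>j. j < k \<Longrightarrow> ts j \<le> ts (Suc j)"
  shows "exp (\<Sum>j<k. indicator {ts j<..ts (Suc j)} s * b j) - 1 = (\<Sum>j<k. indicator {ts j<..ts (Suc j)} s * (exp (b j) - 1))"
proof (cases "\<exists>j<k. s \<in> {ts j<..ts (Suc j)}")
  case False
  then have "(indicator {ts j<..ts (Suc j)} s :: real) = 0" if "j < k" for j using that by (auto simp: indicator_def)
  then show ?thesis by simp
next
  case True
  then obtain j where j: "j < k" "ts j < s" "s \<le> ts (Suc j)" by auto
  have mono': "ts a \<le> ts b" if "a \<le> b" "b \<le> k" for a b
    using that by (induction b) (auto simp: le_Suc_eq intro: order_trans[OF _ mono])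
  have ind: "(indicator {ts i<..ts (Suc i)} s :: real) = (if i = j then 1 else 0)" if "i < k" for i
  proof (cases "i = j")
    case False
    then consider "Suc i \<le> j" | "Suc j \<le> i" by linarith
    then show ?thesis
    proof cases
      case 1 then show ?thesis using mono'[of "Suc i" j] j by auto
    next
      case 2 then show ?thesis using mono'[of "Suc j" i] j that by auto
    qed
  qed (use j in auto)
  have "(\<Sum>i<k. indicator {ts i<..ts (Suc i)} s * h i) = (\<Sum>i<k. if i = j then h i else 0)" for h :: "nat \<Rightarrow> real"
    by (intro sum.cong refl) (simp add: ind)
  then show ?thesis using j by simp
qed

lemma integrable_exp_adm:
  assumes f: "adm K f" and b: "\<And>u. - l * f u \<le> B"
  shows "integrable lborel (\<lambda>u. exp (- l * f u) - 1)"
proof -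
  have [measurable]: "f \<in> borel_measurable borel" using f by (simp add: adm_def)
  have "integrable lborel (\<lambda>u. (1 + exp B) * indicator {0..real K} u)" by simp
  then show ?thesis
  proof (rule Bochner_Integration.integrable_bound)
    show "AE u in lborel. norm (exp (- l * f u) - 1) \<le> norm ((1 + exp B) * indicator {0..real K} u)"
    proof (rule AE_I2)
      fix u
      show "norm (exp (- l * f u) - 1) \<le> norm ((1 + exp B) * indicator {0..real K} u)"
      proof (cases "u < 0 \<or> real K \<le> u")
        case True
        then show ?thesis using f by (auto simp: adm_def)
      next
        case False
        have "exp (- l * f u) \<le> exp B" using b[of u] by simp
        then have "\<bar>exp (- l * f u) - 1\<bar> \<le> 1 + exp B" using exp_gt_zero[of "- l * f u"] unfolding abs_le_iff by linarith
        then show ?thesis using False by simp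
      qed
    qed
  qed measurable
qed

text \<open>Campbell's formula applied to the weighted sum of increments, viewed as one integral
  over the random measure. The exponent splits over the time intervals, factorises into time and
  jump size in each cell, and the cells add up to interval lengths times the integral over
  u.\<close>

lemma laplace_S_proc:
  assumes f: "adm K f" and ts: "0 \<le> ts 0" "\<And>j. j < k \<Longrightarrow> ts j < ts (Suc j)"
    and b: "\<And>j u. j < k \<Longrightarrow> - l j * f u \<le> B"
  shows "(\<integral>\<^sup>+\<omega>. ennreal (exp (- (\<Sum>j<k. l j * (S_proc K f (ts (Suc j)) \<omega> - S_proc K f (ts j) \<omega>)))) \<partial>prm)
    = (\<Prod>j<k. ennreal (exp ((ts (Suc j) - ts j) * (\<integral>u. exp (- l j * f u) - 1 \<partial>lborel))))"
proof -
  have [measurable]: "f \<in> borel_measurable borel" using f by (simp add: adm_def)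
  have f0: "f u = 0" if "u < 0 \<or> real K \<le> u" for u using f that unfolding adm_def by blast
  have mono: "ts a \<le> ts b" if "a \<le> b" "b \<le> k" for a b
    using that by (induction b) (auto simp: le_Suc_eq intro: order_trans[OF _ less_imp_le[OF ts(2)]])
  have ts0: "0 \<le> ts j" if "j \<le> k" for j using mono[of 0 j] ts that by simp
  obtain n :: nat where "ts k < real n" using reals_Archimedean2 by blast
  then have n: "ts j < real n" if "j \<le> k" for j using mono[of j k] that by simp
  define C where "C = {..<n} \<times> {..<K}"
  let ?I = "\<lambda>k::nat. indicator {real k..<real k + 1} :: real \<Rightarrow> real"
  let ?T = "\<lambda>j. indicator {ts j<..ts (Suc j)} :: real \<Rightarrow> real"
  \<comment> \<open>The total contribution of one point p of cell c: the negative weight of the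
    interval that contains its clamped time, times its jump.\<close>
  define \<phi> where "\<phi> c p = (\<Sum>j<k. ?T j (max (real (fst c)) (fst p)) * (- l j * (?I (snd c) (snd p) * f (snd p))))"
    for c :: "nat \<times> nat" and p :: "real \<times> real"
  have \<phi>m: "\<phi> c \<in> borel_measurable (borel \<Otimes>\<^sub>M borel)" for c unfolding \<phi>_def[abs_def] by measurable
  \<comment> \<open>The indicator may annihilate the jump, so the bound also has to cover the
    exponent 0.\<close>
  define B' where "B' = max 0 B"
  have bI: "- l j * (?I q u * f u) \<le> B'" if "j < k" for j q u
    using b[OF that, of u] unfolding B'_def by (auto simp: indicator_def)
  have expm1: "exp (\<phi> c p) - 1 = (\<Sum>j<k. ?T j (max (real (fst c)) (fst p)) * (exp (- l j * (?I (snd c) (snd p) * f (snd p))) - 1))" for c p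
    unfolding \<phi>_def by (rule exp_sum_disjoint_indicators) (use ts(2) in \<open>auto intro: less_imp_le\<close>)
  have "exp (\<phi> c p) - 1 \<le> real k * exp B'" for c p
  proof -
    have "(\<Sum>j<k. ?T j (max (real (fst c)) (fst p)) * (exp (- l j * (?I (snd c) (snd p) * f (snd p))) - 1)) \<le> (\<Sum>j<k. exp B')"
    proof (rule sum_mono)
      fix j assume "j \<in> {..<k}"
      then have "exp (- l j * (?I (snd c) (snd p) * f (snd p))) \<le> exp B'" using bI by simp
      then have e: "exp (- l j * (?I (snd c) (snd p) * f (snd p))) - 1 \<le> exp B'" by linarith
      show "?T j (max (real (fst c)) (fst p)) * (exp (- l j * (?I (snd c) (snd p) * f (snd p))) - 1) \<le> exp B'"
        by (cases "max (real (fst c)) (fst p) \<in> {ts j<..ts (Suc j)}")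
           (use e in \<open>simp_all only: indicator_simps mult_1 mult_zero_left exp_ge_zero if_False not_False_eq_True\<close>)
    qed
    then show ?thesis unfolding expm1 by simp
  qed
  \<comment> \<open>From 1 + \<phi> \<le> exp \<phi>, a bound on exp \<phi> - 1 bounds \<phi>
    itself.\<close>
  then have \<phi>b: "\<phi> c p \<le> real k * exp B'" for c p
    using exp_ge_add_one_self[of "\<phi> c p"] by (smt (verit))
  have "- (\<Sum>j<k. l j * (S_proc K f (ts (Suc j)) \<omega> - S_proc K f (ts j) \<omega>)) = (\<Sum>c\<in>C. cell_sum (\<phi> c) (\<omega> c))" for \<omega>
  proof -
    have j: "?T j (max (real (fst c)) (fst p)) * (- l j * (?I (snd c) (snd p) * f (snd p)))
       = - l j * (jmp f c (ts (Suc j)) p - jmp f c (ts j) p)" if "j < k" for j c p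
      using ts(2)[OF that] ts0[of j] that by (auto simp: jmp_def indicator_def)
    have "(\<Sum>c\<in>C. cell_sum (\<phi> c) (\<omega> c)) = (\<Sum>c\<in>C. \<Sum>i<fst (\<omega> c). \<Sum>j<k. - l j * (jmp f c (ts (Suc j)) (snd (\<omega> c) i) - jmp f c (ts j) (snd (\<omega> c) i)))"
      unfolding cell_sum_def \<phi>_def by (intro sum.cong refl j) auto
    also have "\<dots> = (\<Sum>c\<in>C. \<Sum>j<k. \<Sum>i<fst (\<omega> c). - l j * (jmp f c (ts (Suc j)) (snd (\<omega> c) i) - jmp f c (ts j) (snd (\<omega> c) i)))"
      by (intro sum.cong refl sum.swap)
    also have "\<dots> = (\<Sum>j<k. \<Sum>c\<in>C. \<Sum>i<fst (\<omega> c). - l j * (jmp f c (ts (Suc j)) (snd (\<omega> c) i) - jmp f c (ts j) (snd (\<omega> c) i)))"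
      by (rule sum.swap)
    also have "\<dots> = (\<Sum>j<k. - l j * (S_proc K f (ts (Suc j)) \<omega> - S_proc K f (ts j) \<omega>))"
    proof (rule sum.cong[OF refl])
      fix j assume "j \<in> {..<k}"
      then have "S_proc K f (ts (Suc j)) \<omega> = (\<Sum>c\<in>C. cell_sum (jmp f c (ts (Suc j))) (\<omega> c))"
        "S_proc K f (ts j) \<omega> = (\<Sum>c\<in>C. cell_sum (jmp f c (ts j)) (\<omega> c))"
        using S_proc_eq[OF ts0 n] by (auto simp: C_def)
      then show "(\<Sum>c\<in>C. \<Sum>i<fst (\<omega> c). - l j * (jmp f c (ts (Suc j)) (snd (\<omega> c) i) - jmp f c (ts j) (snd (\<omega> c) i)))
         = - l j * (S_proc K f (ts (Suc j)) \<omega> - S_proc K f (ts j) \<omega>)"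
        by (simp add: cell_sum_def sum_distrib_left[symmetric] sum_subtractf sum_negf algebra_simps)
    qed
    finally show ?thesis by (simp add: sum_negf)
  qed
  then have "(\<integral>\<^sup>+\<omega>. ennreal (exp (- (\<Sum>j<k. l j * (S_proc K f (ts (Suc j)) \<omega> - S_proc K f (ts j) \<omega>)))) \<partial>prm)
    = ennreal (exp (\<Sum>c\<in>C. \<integral>p. exp (\<phi> c p) - 1 \<partial>pt_measure c))"
    using laplace_prm[of C \<phi>, OF _ \<phi>m \<phi>b] by (simp add: C_def)
  also have "(\<Sum>c\<in>C. \<integral>p. exp (\<phi> c p) - 1 \<partial>pt_measure c) = (\<Sum>j<k. (ts (Suc j) - ts j) * (\<integral>u. exp (- l j * f u) - 1 \<partial>lborel))"
  proof -
    \<comment> \<open>A is the length of time interval j inside row i of cells, D the part of the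
      jump integral inside column q.\<close>
    define A where "A j i = (\<integral>s. ?I i s * ?T j s \<partial>lborel)" for j i
    define D where "D j q = (\<integral>u. ?I q u * (exp (- l j * f u) - 1) \<partial>lborel)" for j q
    have cellint: "(\<integral>p. exp (\<phi> c p) - 1 \<partial>pt_measure c) = (\<Sum>j<k. A j (fst c) * D j (snd c))" for c
    proof -
      interpret U1: prob_space "unif (fst c)" by (rule prob_space_unif)
      interpret U2: prob_space "unif (snd c)" by (rule prob_space_unif)
      interpret pair_prob_space "unif (fst c)" "unif (snd c)" ..
      let ?a = "\<lambda>j s. ?T j (max (real (fst c)) s)"
      let ?b = "\<lambda>j u. exp (- l j * (?I (snd c) u * f u)) - 1"
      have bb: "\<bar>?b j u\<bar> \<le> 1 + exp B'" if "j < k" for j u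
      proof -
        have "exp (- l j * (?I (snd c) u * f u)) \<le> exp B'" using bI[OF that] by simp
        then show ?thesis unfolding abs_le_iff by (simp add: add_increasing2 add_increasing)
      qed
      have i1: "integrable (unif (fst c)) (?a j)" for j
        by (rule U1.integrable_const_bound[where B=1]) (auto simp: indicator_def)
      have i2: "integrable (unif (snd c)) (?b j)" if "j < k" for j
        by (rule U2.integrable_const_bound[where B="1 + exp B'"]) (use bb[OF that] in auto)
      have ip: "integrable (unif (fst c) \<Otimes>\<^sub>M unif (snd c)) (\<lambda>p. ?a j (fst p) * ?b j (snd p))" if "j < k" for j
      proof (rule P.integrable_const_bound[where B="1 + exp B'"])
        show "AE p in unif (fst c) \<Otimes>\<^sub>M unif (snd c). norm (?a j (fst p) * ?b j (snd p)) \<le> 1 + exp B'"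
        proof (rule AE_I2)
          fix p :: "real \<times> real"
          show "norm (?a j (fst p) * ?b j (snd p)) \<le> 1 + exp B'"
            using bb[OF that, of "snd p"] by (auto simp: indicator_def)
        qed
      qed measurable
      have a_int: "(\<integral>s. ?a j s \<partial>unif (fst c)) = A j (fst c)" for j
        unfolding A_def by (subst integral_unif) (auto intro!: Bochner_Integration.integral_cong simp: indicator_def)
      have b_int: "(\<integral>u. ?b j u \<partial>unif (snd c)) = D j (snd c)" for j
        unfolding D_def by (subst integral_unif) (auto intro!: Bochner_Integration.integral_cong simp: indicator_def)
      have "(\<integral>p. exp (\<phi> c p) - 1 \<partial>pt_measure c) = (\<Sum>j<k. \<integral>p. ?a j (fst p) * ?b j (snd p) \<partial>(unif (fst c) \<Otimes>\<^sub>M unif (snd c)))"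
        unfolding expm1 pt_measure_def using ip by (intro Bochner_Integration.integral_sum) auto
      also have "\<dots> = (\<Sum>j<k. A j (fst c) * D j (snd c))"
      proof (rule sum.cong[OF refl])
        fix j assume j: "j \<in> {..<k}"
        have "(\<integral>p. ?a j (fst p) * ?b j (snd p) \<partial>(unif (fst c) \<Otimes>\<^sub>M unif (snd c))) = (\<integral>s. \<integral>u. ?a j s * ?b j u \<partial>unif (snd c) \<partial>unif (fst c))"
          using integral_fst'[OF ip[of j]] j by simp
        also have "\<dots> = A j (fst c) * D j (snd c)" by (simp only: integral_mult_right_zero integral_mult_left_zero b_int a_int)
        finally show "(\<integral>p. ?a j (fst p) * ?b j (snd p) \<partial>(unif (fst c) \<Otimes>\<^sub>M unif (snd c))) = A j (fst c) * D j (snd c)" .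
      qed
      finally show ?thesis .
    qed
    have sumI: "(\<Sum>i<m. ?I i s) = indicator {0..<real m} s" for m s
      by (induction m) (auto simp: indicator_def)
    have sumA: "(\<Sum>i<n. A j i) = ts (Suc j) - ts j" if "j < k" for j
    proof -
      have "(\<Sum>i<n. A j i) = (\<integral>s. (\<Sum>i<n. ?I i s * ?T j s) \<partial>lborel)"
        unfolding A_def
      proof (rule Bochner_Integration.integral_sum[symmetric])
        fix i
        have "integrable lborel (\<lambda>s. indicator ({real i..<real i + 1} \<inter> {ts j<..ts (Suc j)}) s :: real)"
          using emeasure_mono[of "{real i..<real i + 1} \<inter> {ts j<..ts (Suc j)}" "{real i..<real i + 1}" lborel]
          by (intro integrable_real_indicator) (auto intro: le_less_trans)
        then show "integrable lborel (\<lambda>s. ?I i s * ?T j s)" by (simp add: indicator_inter_arith)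
      qed
      also have "\<dots> = (\<integral>s. indicator {ts j<..ts (Suc j)} s \<partial>lborel)"
        unfolding sum_distrib_right[symmetric] sumI
        using ts0[of j] n[of "Suc j"] that by (intro Bochner_Integration.integral_cong refl) (auto simp: indicator_def)
      finally show ?thesis using ts(2)[OF that] by simp
    qed
    have sumD: "(\<Sum>q<K. D j q) = (\<integral>u. exp (- l j * f u) - 1 \<partial>lborel)" if "j < k" for j
    proof -
      have "(\<Sum>q<K. D j q) = (\<integral>u. (\<Sum>q<K. ?I q u * (exp (- l j * f u) - 1)) \<partial>lborel)"
        unfolding D_def
      proof (rule Bochner_Integration.integral_sum[symmetric])
        fix q
        show "integrable lborel (\<lambda>u. ?I q u * (exp (- l j * f u) - 1))"
          using integrable_mult_indicator[OF _ integrable_exp_adm[OF f b[OF that]], of "{real q..<real q + 1}"] by simp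
      qed
      also have "\<dots> = (\<integral>u. exp (- l j * f u) - 1 \<partial>lborel)"
        unfolding sum_distrib_right[symmetric] sumI
      proof (rule Bochner_Integration.integral_cong[OF refl])
        fix u
        show "indicator {0..<real K} u * (exp (- l j * f u) - 1) = exp (- l j * f u) - 1"
          using f0[of u] by (cases "u < 0 \<or> real K \<le> u") (auto simp: indicator_def)
      qed
      finally show ?thesis .
    qed
    have "(\<Sum>c\<in>C. \<integral>p. exp (\<phi> c p) - 1 \<partial>pt_measure c) = (\<Sum>j<k. \<Sum>c\<in>C. A j (fst c) * D j (snd c))"
      unfolding cellint by (rule sum.swap)
    also have "\<dots> = (\<Sum>j<k. (\<Sum>i<n. A j i) * (\<Sum>q<K. D j q))"
      unfolding C_def by (simp add: sum_product sum.cartesian_product case_prod_beta)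
    also have "\<dots> = (\<Sum>j<k. (ts (Suc j) - ts j) * (\<integral>u. exp (- l j * f u) - 1 \<partial>lborel))"
      by (intro sum.cong refl) (simp add: sumA sumD)
    finally show ?thesis .
  qed
  finally show ?thesis by (simp add: exp_sum prod_ennreal)
qed

lemma laplace_M_proc:
  assumes f: "adm K f" and ts: "0 \<le> ts 0" "\<And>j. j < k \<Longrightarrow> ts j < ts (Suc j)"
    and b: "\<And>j u. j < k \<Longrightarrow> - l j * f u \<le> B"
  shows "(\<integral>\<^sup>+\<omega>. ennreal (exp (- (\<Sum>j<k. l j * (M_proc K f (ts (Suc j)) \<omega> - M_proc K f (ts j) \<omega>)))) \<partial>prm)
    = (\<Prod>j<k. ennreal (exp ((ts (Suc j) - ts j) * kap f (l j))))"
proof -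
  have [measurable]: "f \<in> borel_measurable borel" and intf: "integrable lborel f" using f by (simp_all add: adm_def)
  have [measurable]: "S_proc K f t \<in> borel_measurable prm" for t by (intro borel_measurable_S_proc) measurable
  define d where "d = (\<Sum>j<k. (ts (Suc j) - ts j) * (l j * (\<integral>u. f u \<partial>lborel)))"
  have "- (\<Sum>j<k. l j * (M_proc K f (ts (Suc j)) \<omega> - M_proc K f (ts j) \<omega>))
    = d + - (\<Sum>j<k. l j * (S_proc K f (ts (Suc j)) \<omega> - S_proc K f (ts j) \<omega>))" for \<omega>
    unfolding d_def M_proc_def sum_negf[symmetric] sum.distrib[symmetric] by (intro sum.cong refl) (simp add: algebra_simps)
  then have "(\<integral>\<^sup>+\<omega>. ennreal (exp (- (\<Sum>j<k. l j * (M_proc K f (ts (Suc j)) \<omega> - M_proc K f (ts j) \<omega>)))) \<partial>prm)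
    = (\<integral>\<^sup>+\<omega>. ennreal (exp d) * ennreal (exp (- (\<Sum>j<k. l j * (S_proc K f (ts (Suc j)) \<omega> - S_proc K f (ts j) \<omega>)))) \<partial>prm)"
    by (intro nn_integral_cong) (simp only: exp_add ennreal_mult'[OF exp_ge_zero])
  also have "\<dots> = ennreal (exp d) * (\<Prod>j<k. ennreal (exp ((ts (Suc j) - ts j) * (\<integral>u. exp (- l j * f u) - 1 \<partial>lborel))))"
    by (subst nn_integral_cmult) (auto simp only: laplace_S_proc[OF f ts b], measurable)
  also have "\<dots> = (\<Prod>j<k. ennreal (exp ((ts (Suc j) - ts j) * (l j * (\<integral>u. f u \<partial>lborel))) * exp ((ts (Suc j) - ts j) * (\<integral>u. exp (- l j * f u) - 1 \<partial>lborel))))"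
    unfolding d_def by (simp add: exp_sum prod_ennreal ennreal_mult'[symmetric] prod.distrib prod_nonneg)
  also have "\<dots> = (\<Prod>j<k. ennreal (exp ((ts (Suc j) - ts j) * kap f (l j))))"
  proof (rule prod.cong[OF refl])
    fix j assume j: "j \<in> {..<k}"
    have "kap f (l j) = (\<integral>u. exp (- l j * f u) - 1 \<partial>lborel) + l j * (\<integral>u. f u \<partial>lborel)"
      unfolding kap_def using integrable_exp_adm[OF f b] intf j by (subst Bochner_Integration.integral_add) auto
    then show "ennreal (exp ((ts (Suc j) - ts j) * (l j * (\<integral>u. f u \<partial>lborel))) * exp ((ts (Suc j) - ts j) * (\<integral>u. exp (- l j * f u) - 1 \<partial>lborel)))
      = ennreal (exp ((ts (Suc j) - ts j) * kap f (l j)))"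
      by (simp add: exp_add[symmetric] algebra_simps)
  qed
  finally show ?thesis .
qed

section \<open>Maximal inequality and almost sure limits\<close>

text \<open>Doob's inequality for the mean-one martingale exp(S j), by decomposition according to
  the first index at which S reaches a: on each piece the later increments are independent of the
  past and have exponential mean 1.\<close>

lemma (in prob_space) exp_maximal_inequality:
  fixes X :: "nat \<Rightarrow> 'a \<Rightarrow> real"
  assumes ind: "indep_vars (\<lambda>_. borel) X {..<k}"
    and one: "\<And>i. i < k \<Longrightarrow> (\<integral>\<^sup>+\<omega>. ennreal (exp (X i \<omega>)) \<partial>M) = 1"
  shows "prob {\<omega>\<in>space M. \<exists>j\<le>k. a \<le> (\<Sum>i<j. X i \<omega>)} \<le> exp (- a)"
proof -
  have [measurable]: "X i \<in> borel_measurable M" if "i < k" for i using ind that by (auto simp: indep_vars_def)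
  define S where "S j \<omega> = (\<Sum>i<j. X i \<omega>)" for j \<omega>
  have [measurable]: "S j \<in> borel_measurable M" if "j \<le> k" for j
    unfolding S_def[abs_def] using that by (intro borel_measurable_sum) auto
  define A where "A j = {\<omega>\<in>space M. a \<le> S j \<omega> \<and> (\<forall>i<j. S i \<omega> < a)}" for j
  have A[measurable]: "A j \<in> sets M" if "j \<le> k" for j
  proof -
    have [measurable]: "S i \<in> borel_measurable M" if "i < j" for i using that \<open>j \<le> k\<close> by simp
    have [measurable]: "S j \<in> borel_measurable M" using that by simp
    have "A j = {\<omega>\<in>space M. a \<le> S j \<omega>} \<inter> (space M - (\<Union>i<j. {\<omega>\<in>space M. a \<le> S i \<omega>}))" unfolding A_def by auto
    moreover have "{\<omega>\<in>space M. a \<le> S i \<omega>} \<in> sets M" if "i < j" for i using that by measurable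
    ultimately show ?thesis by auto
  qed
  have step: "ennreal (exp a) * emeasure M (A j) \<le> (\<integral>\<^sup>+\<omega>. ennreal (exp (S k \<omega>)) * indicator (A j) \<omega> \<partial>M)" if j: "j \<le> k" for j
  proof -
    have "ennreal (exp a) * emeasure M (A j) = (\<integral>\<^sup>+\<omega>. ennreal (exp a) * indicator (A j) \<omega> \<partial>M)"
      using A[OF j] by (simp add: nn_integral_cmult_indicator)
    also have "\<dots> \<le> (\<integral>\<^sup>+\<omega>. ennreal (exp (S j \<omega>)) * indicator (A j) \<omega> \<partial>M)"
      by (intro nn_integral_mono) (auto simp: indicator_def A_def intro!: ennreal_leI)
    also have "\<dots> = (\<integral>\<^sup>+\<omega>. ennreal (exp (S k \<omega>)) * indicator (A j) \<omega> \<partial>M)"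
    proof -
      \<comment> \<open>True selects the increments before j, on which both the event A j and S j
        depend; False selects the remaining ones.\<close>
      define L where "L b = (if b then {..<j} else {j..<k})" for b
      define R where "R b \<omega> = (\<lambda>i\<in>L b. X i \<omega>)" for b \<omega>
      have "indep_vars (\<lambda>b. PiM (L b) (\<lambda>_. borel)) R UNIV"
        unfolding R_def by (rule indep_vars_restrict[OF ind]) (use j in \<open>auto simp: L_def disjoint_family_on_def\<close>)
      define G where "G b w = (if b then ennreal (exp (\<Sum>i<j. w i)) * indicator {w. a \<le> (\<Sum>i<j. w i) \<and> (\<forall>m\<in>{..<j}. (\<Sum>i<m. w i) < a)} w
         else ennreal (exp (\<Sum>i\<in>{j..<k}. w i)))" for b and w :: "nat \<Rightarrow> real"
      have GT: "G True \<in> borel_measurable (PiM {..<j} (\<lambda>_. borel))"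
      proof -
        have [measurable]: "(\<lambda>w. \<Sum>i<m. w i) \<in> borel_measurable (PiM {..<j} (\<lambda>_. borel :: real measure))" if "m \<le> j" for m
          using that by (intro borel_measurable_sum measurable_component_singleton) auto
        have [measurable]: "Measurable.pred (PiM {..<j} (\<lambda>_. borel :: real measure)) (\<lambda>w. a \<le> (\<Sum>i<j. w i) \<and> (\<forall>m\<in>{..<j}. (\<Sum>i<m. w i) < a))"
          by (intro pred_intros_logic pred_intros_finite) measurable
        have "(\<lambda>w. ennreal (exp (\<Sum>i<j. w i)) * indicator {w. a \<le> (\<Sum>i<j. w i) \<and> (\<forall>m\<in>{..<j}. (\<Sum>i<m. w i) < a)} w) \<in> borel_measurable (PiM {..<j} (\<lambda>_. borel :: real measure))"
          by measurable
        also have "(\<lambda>w. ennreal (exp (\<Sum>i<j. w i)) * indicator {w. a \<le> (\<Sum>i<j. w i) \<and> (\<forall>m\<in>{..<j}. (\<Sum>i<m. w i) < a)} w) = G True"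
          by (simp add: G_def[abs_def])
        finally show ?thesis .
      qed
      have GF: "G False \<in> borel_measurable (PiM {j..<k} (\<lambda>_. borel))"
      proof -
        have [measurable]: "(\<lambda>w. \<Sum>i\<in>{j..<k}. w i) \<in> borel_measurable (PiM {j..<k} (\<lambda>_. borel :: real measure))"
          by (intro borel_measurable_sum measurable_component_singleton) auto
        have "(\<lambda>w. ennreal (exp (\<Sum>i\<in>{j..<k}. w i))) \<in> borel_measurable (PiM {j..<k} (\<lambda>_. borel :: real measure))"
          by measurable
        also have "(\<lambda>w. ennreal (exp (\<Sum>i\<in>{j..<k}. w i))) = G False"
          by (simp add: G_def[abs_def])
        finally show ?thesis .
      qed
      have "indep_vars (\<lambda>_. borel) (\<lambda>b \<omega>. G b (R b \<omega>)) UNIV"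
        by (rule indep_vars_compose2[OF \<open>indep_vars _ R UNIV\<close>]) (use GT GF in \<open>auto simp: L_def\<close>)
      from indep_vars_nn_integral[OF _ this]
      have prod: "(\<integral>\<^sup>+\<omega>. G True (R True \<omega>) * G False (R False \<omega>) \<partial>M) = (\<integral>\<^sup>+\<omega>. G True (R True \<omega>) \<partial>M) * (\<integral>\<^sup>+\<omega>. G False (R False \<omega>) \<partial>M)"
        by (simp add: UNIV_bool mult.commute)
      have RT: "G True (R True \<omega>) = ennreal (exp (S j \<omega>)) * indicator (A j) \<omega>" if "\<omega> \<in> space M" for \<omega>
      proof -
        have "(\<Sum>i<m. R True \<omega> i) = S m \<omega>" if "m \<le> j" for m
          unfolding S_def R_def L_def using that by (intro sum.cong) auto
        then show ?thesis using that by (auto simp: G_def A_def indicator_def)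
      qed
      have RF: "G False (R False \<omega>) = ennreal (exp (\<Sum>i\<in>{j..<k}. X i \<omega>))" for \<omega>
        by (simp add: G_def R_def L_def)
      have "(\<integral>\<^sup>+\<omega>. G False (R False \<omega>) \<partial>M) = (\<integral>\<^sup>+\<omega>. (\<Prod>i\<in>{j..<k}. ennreal (exp (X i \<omega>))) \<partial>M)"
        unfolding RF by (simp add: exp_sum prod_ennreal)
      also have "\<dots> = (\<Prod>i\<in>{j..<k}. \<integral>\<^sup>+\<omega>. ennreal (exp (X i \<omega>)) \<partial>M)"
      proof (rule indep_vars_nn_integral)
        have "indep_vars (\<lambda>_. borel) X {j..<k}" by (rule indep_vars_subset[OF ind]) auto
        then show "indep_vars (\<lambda>_. borel) (\<lambda>i \<omega>. ennreal (exp (X i \<omega>))) {j..<k}"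
          by (rule indep_vars_compose2) auto
      qed auto
      also have "\<dots> = 1" using one by simp
      finally have F1: "(\<integral>\<^sup>+\<omega>. G False (R False \<omega>) \<partial>M) = 1" .
      have "(\<integral>\<^sup>+\<omega>. ennreal (exp (S j \<omega>)) * indicator (A j) \<omega> \<partial>M) = (\<integral>\<^sup>+\<omega>. G True (R True \<omega>) \<partial>M)"
        by (intro nn_integral_cong) (simp add: RT)
      also have "\<dots> = (\<integral>\<^sup>+\<omega>. G True (R True \<omega>) * G False (R False \<omega>) \<partial>M)" unfolding prod F1 by simp
      also have "\<dots> = (\<integral>\<^sup>+\<omega>. ennreal (exp (S k \<omega>)) * indicator (A j) \<omega> \<partial>M)"
      proof (rule nn_integral_cong)
        fix \<omega> assume \<omega>: "\<omega> \<in> space M"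
        have "{..<k} = {..<j} \<union> {j..<k}" using j by auto
        then have "S k \<omega> = S j \<omega> + (\<Sum>i\<in>{j..<k}. X i \<omega>)" unfolding S_def by (simp add: sum.union_disjoint ivl_disj_int)
        then show "G True (R True \<omega>) * G False (R False \<omega>) = ennreal (exp (S k \<omega>)) * indicator (A j) \<omega>"
          unfolding RT[OF \<omega>] RF by (simp add: exp_add ennreal_mult' indicator_def)
      qed
      finally show ?thesis .
    qed
    finally show ?thesis .
  qed
  have disj: "disjoint_family_on A {..k}"
    unfolding disjoint_family_on_def
  proof (intro ballI impI)
    fix m n :: nat assume "m \<noteq> n"
    then consider "m < n" | "n < m" by linarith
    then show "A m \<inter> A n = {}" by cases (auto simp: A_def)
  qed
  have ev: "{\<omega>\<in>space M. \<exists>j\<le>k. a \<le> (\<Sum>i<j. X i \<omega>)} = (\<Union>j\<le>k. A j)"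
  proof (intro equalityI subsetI)
    fix \<omega> assume "\<omega> \<in> {\<omega>\<in>space M. \<exists>j\<le>k. a \<le> (\<Sum>i<j. X i \<omega>)}"
    then obtain j where \<omega>: "\<omega> \<in> space M" and j: "j \<le> k" "a \<le> S j \<omega>" by (auto simp: S_def)
    define i where "i = (LEAST i. a \<le> S i \<omega>)"
    have "a \<le> S i \<omega>" "i \<le> j" unfolding i_def using j(2) by (auto intro: LeastI Least_le)
    moreover have "S m \<omega> < a" if "m < i" for m using not_less_Least[of m "\<lambda>i. a \<le> S i \<omega>"] that unfolding i_def by auto
    ultimately show "\<omega> \<in> (\<Union>j\<le>k. A j)" using \<omega> j by (auto simp: A_def intro!: bexI[of _ i])
  qed (auto simp: A_def S_def)
  have "ennreal (exp a) * emeasure M (\<Union>j\<le>k. A j) = (\<Sum>j\<le>k. ennreal (exp a) * emeasure M (A j))"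
    unfolding sum_distrib_left[symmetric]
    using disj by (subst sum_emeasure) auto
  also have "\<dots> \<le> (\<Sum>j\<le>k. \<integral>\<^sup>+\<omega>. ennreal (exp (S k \<omega>)) * indicator (A j) \<omega> \<partial>M)"
    by (intro sum_mono step) auto
  also have "\<dots> = (\<integral>\<^sup>+\<omega>. (\<Sum>j\<le>k. ennreal (exp (S k \<omega>)) * indicator (A j) \<omega>) \<partial>M)"
    by (rule nn_integral_sum[symmetric]) auto
  also have "\<dots> \<le> (\<integral>\<^sup>+\<omega>. ennreal (exp (S k \<omega>)) \<partial>M)"
  proof (rule nn_integral_mono)
    fix \<omega>
    have "(\<Sum>j\<le>k. indicator (A j) \<omega> :: ennreal) = indicator (\<Union>j\<le>k. A j) \<omega>"
      using disj by (subst indicator_UN_disjoint) auto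
    then have "(\<Sum>j\<le>k. ennreal (exp (S k \<omega>)) * indicator (A j) \<omega>) = ennreal (exp (S k \<omega>)) * indicator (\<Union>j\<le>k. A j) \<omega>"
      by (simp add: sum_distrib_left[symmetric])
    also have "\<dots> \<le> ennreal (exp (S k \<omega>))" by (simp add: indicator_def)
    finally show "(\<Sum>j\<le>k. ennreal (exp (S k \<omega>)) * indicator (A j) \<omega>) \<le> ennreal (exp (S k \<omega>))" .
  qed
  also have "\<dots> = (\<integral>\<^sup>+\<omega>. (\<Prod>i<k. ennreal (exp (X i \<omega>))) \<partial>M)"
    unfolding S_def by (simp add: exp_sum prod_ennreal)
  also have "\<dots> = (\<Prod>i<k. \<integral>\<^sup>+\<omega>. ennreal (exp (X i \<omega>)) \<partial>M)"
    by (rule indep_vars_nn_integral) (auto intro!: indep_vars_compose2[OF ind])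
  also have "\<dots> = 1" using one by simp
  finally have "ennreal (exp a * prob (\<Union>j\<le>k. A j)) \<le> 1" by (simp add: emeasure_eq_measure ennreal_mult')
  then have "exp a * prob (\<Union>j\<le>k. A j) \<le> 1" by (simp add: ennreal_le_1)
  then show ?thesis unfolding ev by (simp add: exp_minus field_simps)
qed

text \<open>A bounded profile gives exponential moments of either sign, so l is an arbitrary real in
  the second claim. Independence follows from the factorised joint transform.\<close>

lemma M_proc_indep:
  assumes f: "adm K f" and bd: "\<And>u. \<bar>f u\<bar> \<le> B" and ts: "0 \<le> ts 0" "\<And>j. j < k \<Longrightarrow> ts j < ts (Suc j)"
  shows "prob_space.indep_vars prm (\<lambda>_. borel) (\<lambda>j \<omega>. M_proc K f (ts (Suc j)) \<omega> - M_proc K f (ts j) \<omega>) {..<k}"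
    and "0 \<le> s \<Longrightarrow> s < t \<Longrightarrow> (\<integral>\<^sup>+\<omega>. ennreal (exp (- l * (M_proc K f t \<omega> - M_proc K f s \<omega>))) \<partial>prm) = ennreal (exp ((t - s) * kap f l))"
proof -
  interpret prob_space prm by (rule prob_space_prm)
  have B: "0 \<le> B" using bd[of 0] by (rule order_trans[OF abs_ge_zero])
  have bl: "- l * f u \<le> \<bar>l\<bar> * B" for l u
  proof -
    have "- l * f u \<le> \<bar>l\<bar> * \<bar>f u\<bar>" using abs_ge_self[of "- l * f u"] by (simp add: abs_mult)
    also have "\<dots> \<le> \<bar>l\<bar> * B" using bd by (intro mult_left_mono) auto
    finally show ?thesis .
  qed
  have single: "(\<integral>\<^sup>+\<omega>. ennreal (exp (- l * (M_proc K f t \<omega> - M_proc K f s \<omega>))) \<partial>prm) = ennreal (exp ((t - s) * kap f l))"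
    if "0 \<le> s" "s < t" for s t l
    using laplace_M_proc[OF f, of "\<lambda>i. if i = 0 then s else t" 1 "\<lambda>_. l" "\<bar>l\<bar> * B"] that bl by simp
  then show "0 \<le> s \<Longrightarrow> s < t \<Longrightarrow> (\<integral>\<^sup>+\<omega>. ennreal (exp (- l * (M_proc K f t \<omega> - M_proc K f s \<omega>))) \<partial>prm) = ennreal (exp ((t - s) * kap f l))" .
  have ts0: "0 \<le> ts j" if "j \<le> k" for j
    using that
  proof (induction j)
    case (Suc j) then show ?case using ts(2)[of j] by simp
  qed (simp add: ts)
  show "indep_vars (\<lambda>_. borel) (\<lambda>j \<omega>. M_proc K f (ts (Suc j)) \<omega> - M_proc K f (ts j) \<omega>) {..<k}"
  proof (rule indep_vars_laplace)
    fix l :: "nat \<Rightarrow> real"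
    define L where "L = Max (insert 0 ((\<lambda>j. \<bar>l j\<bar>) ` {..<k}))"
    have L: "\<bar>l j\<bar> \<le> L" if "j < k" for j unfolding L_def using that by (intro Max_ge) auto
    have "(\<integral>\<^sup>+\<omega>. ennreal (exp (- (\<Sum>j<k. l j * (M_proc K f (ts (Suc j)) \<omega> - M_proc K f (ts j) \<omega>)))) \<partial>prm)
      = (\<Prod>j<k. ennreal (exp ((ts (Suc j) - ts j) * kap f (l j))))"
      by (rule laplace_M_proc[OF f ts, where B="L * B"]) (use bl L B in \<open>auto intro: order_trans[OF _ mult_right_mono]\<close>)
    also have "\<dots> = (\<Prod>j<k. \<integral>\<^sup>+\<omega>. ennreal (exp (- l j * (M_proc K f (ts (Suc j)) \<omega> - M_proc K f (ts j) \<omega>))) \<partial>prm)"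
      by (intro prod.cong refl) (subst single, use ts0 ts(2) in auto)
    finally show "(\<integral>\<^sup>+\<omega>. ennreal (exp (- (\<Sum>j<k. l j * (M_proc K f (ts (Suc j)) \<omega> - M_proc K f (ts j) \<omega>)))) \<partial>prm)
      = (\<Prod>j<k. \<integral>\<^sup>+\<omega>. ennreal (exp (- l j * (M_proc K f (ts (Suc j)) \<omega> - M_proc K f (ts j) \<omega>))) \<partial>prm)" .
  next
    fix j and l :: real assume "j \<in> {..<k}"
    then show "(\<integral>\<^sup>+\<omega>. ennreal (exp (- l * (M_proc K f (ts (Suc j)) \<omega> - M_proc K f (ts j) \<omega>))) \<partial>prm) < \<infinity>"
      by (subst single) (use ts0 ts(2) in auto)
  qed (auto intro!: borel_measurable_diff borel_measurable_M_proc f)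
qed

lemma exp_quadratic_bound:
  fixes y :: real assumes "\<bar>y\<bar> \<le> 1" shows "exp y \<le> 1 + y + y\<^sup>2"
proof (cases "0 \<le> y")
  case True
  then show ?thesis using exp_bound[of y] assms by simp
next
  case False
  have "1 - y \<le> exp (- y)" using exp_ge_add_one_self[of "- y"] by simp
  then have "exp y \<le> 1 / (1 - y)" using False by (simp add: exp_minus field_simps)
  also have "\<dots> \<le> 1 + y + y\<^sup>2"
  proof -
    have "(1 + y + y\<^sup>2) * (1 - y) = 1 + y\<^sup>2 * (- y)" by (simp add: algebra_simps power2_eq_square)
    also have "\<dots> \<ge> 1" using False by (simp add: mult_nonneg_nonneg mult_nonneg_nonpos)
    finally show ?thesis using False by (simp add: divide_le_eq)
  qed
  finally show ?thesis .
qed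

lemma kap_le:
  assumes f: "adm K f" and bd: "\<And>u. \<bar>l * f u\<bar> \<le> 1" and l: "0 < l"
  shows "integrable lborel (\<lambda>u. (f u)\<^sup>2)" and "kap f l \<le> l\<^sup>2 * (\<integral>u. (f u)\<^sup>2 \<partial>lborel)" and "0 \<le> kap f l"
proof -
  have [measurable]: "f \<in> borel_measurable borel" and intf: "integrable lborel f" using f by (simp_all add: adm_def)
  have int1: "integrable lborel (\<lambda>u. \<bar>f u\<bar> / l)" using intf by simp
  show int2: "integrable lborel (\<lambda>u. (f u)\<^sup>2)"
  proof (rule Bochner_Integration.integrable_bound[OF int1])
    show "AE u in lborel. norm ((f u)\<^sup>2) \<le> norm (\<bar>f u\<bar> / l)"
    proof (rule AE_I2)
      fix u
      have "l * (f u)\<^sup>2 = \<bar>l * f u\<bar> * \<bar>f u\<bar>" using l by (simp add: abs_mult power2_eq_square)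
      also have "\<dots> \<le> 1 * \<bar>f u\<bar>" using bd by (intro mult_right_mono) auto
      finally show "norm ((f u)\<^sup>2) \<le> norm (\<bar>f u\<bar> / l)" using l by (simp add: field_simps)
    qed
  qed measurable
  have "integrable lborel (\<lambda>u. exp (- l * f u) - 1)"
    by (rule integrable_exp_adm[OF f, where B=1]) (use bd in \<open>auto simp: abs_le_iff\<close>)
  then have int3: "integrable lborel (\<lambda>u. exp (- l * f u) - 1 + l * f u)" using intf by simp
  have "kap f l \<le> (\<integral>u. l\<^sup>2 * (f u)\<^sup>2 \<partial>lborel)"
    unfolding kap_def
  proof (rule integral_mono[OF int3])
    fix u
    have "exp (- l * f u) \<le> 1 + - l * f u + (- l * f u)\<^sup>2" by (rule exp_quadratic_bound) (use bd in simp)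
    then show "exp (- l * f u) - 1 + l * f u \<le> l\<^sup>2 * (f u)\<^sup>2" by (simp add: power_mult_distrib)
  qed (use int2 in simp)
  then show "kap f l \<le> l\<^sup>2 * (\<integral>u. (f u)\<^sup>2 \<partial>lborel)" by simp
  show "0 \<le> kap f l" unfolding kap_def
  proof (intro integral_nonneg_AE AE_I2)
    fix u show "0 \<le> exp (- l * f u) - 1 + l * f u" using exp_ge_add_one_self[of "- l * f u"] by simp
  qed
qed

section \<open>Uniform estimates on compact time intervals\<close>

definition dyadic :: "real \<Rightarrow> nat \<Rightarrow> nat \<Rightarrow> real" where "dyadic T m j = T * real j / 2 ^ m"

text \<open>A countable substitute for the event that the supremum over [0,T] exceeds \<epsilon>.
  The strict inequality matters: right-continuity transports it from an arbitrary time to a later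
  dyadic one.\<close>

definition sup_exceeds :: "real \<Rightarrow> real \<Rightarrow> (real \<Rightarrow> real) \<Rightarrow> bool" where
  "sup_exceeds T \<epsilon> x \<longleftrightarrow> (\<exists>m. \<exists>j\<le>2 ^ m. \<epsilon> < \<bar>x (dyadic T m j)\<bar>)"

lemma sup_exceedsI:
  assumes x: "cadlag x" and t: "0 \<le> t" "t \<le> T" "\<epsilon> < \<bar>x t\<bar>"
  shows "sup_exceeds T \<epsilon> x"
proof (cases "t = T")
  case True
  then show ?thesis using t unfolding sup_exceeds_def dyadic_def by (intro exI[of _ 0] exI[of _ 1]) simp
next
  case False
  then have tT: "t < T" "0 < T" using t by auto
  have "((\<lambda>s. \<bar>x s\<bar>) \<longlongrightarrow> \<bar>x t\<bar>) (at_right t)" by (intro tendsto_rabs cadlag_right[OF x t(1)])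
  from order_tendstoD(1)[OF this t(3)] obtain b where b: "b > t" "\<And>s. t < s \<Longrightarrow> s < b \<Longrightarrow> \<epsilon> < \<bar>x s\<bar>"
    by (auto simp: eventually_at_right_field)
  define d where "d = min b T - t"
  have d: "0 < d" using b tT by (simp add: d_def)
  obtain m where m: "T / d < 2 ^ m" using real_arch_pow[of 2 "T / d"] by auto
  \<comment> \<open>The first dyadic index strictly after t; the level m is fine enough to stay
    below both T and the time b up to which the path remains above \<epsilon>.\<close>
  define j where "j = nat (\<lfloor>t * 2 ^ m / T\<rfloor> + 1)"
  have fl: "0 \<le> \<lfloor>t * 2 ^ m / T\<rfloor>" using t tT by simp
  have rj: "real j = real_of_int \<lfloor>t * 2 ^ m / T\<rfloor> + 1" using fl by (simp add: j_def)
  have "t * 2 ^ m / T < real j" "real j \<le> t * 2 ^ m / T + 1" unfolding rj by linarith+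
  then have 1: "t < dyadic T m j" and "dyadic T m j \<le> t + T / 2 ^ m" using tT by (auto simp: dyadic_def field_simps)
  moreover have "T / 2 ^ m < d" using m d by (simp add: field_simps)
  ultimately have 2: "dyadic T m j < min b T" unfolding d_def by linarith
  have "T * real j < T * 2 ^ m" using 2 by (simp add: dyadic_def field_simps)
  then have "real j < real (2 ^ m)" using tT by simp
  then have "j \<le> 2 ^ m" by (simp only: of_nat_less_iff)
  then show ?thesis using b(2)[OF 1] 2 unfolding sup_exceeds_def by auto
qed

lemma sup_exceeds_measurable:
  assumes "\<And>t. X t \<in> borel_measurable M"
  shows "{\<omega>\<in>space M. sup_exceeds T \<epsilon> (\<lambda>t. X t \<omega>)} \<in> sets M"
proof -
  have [measurable]: "X t \<in> borel_measurable M" for t by fact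
  show ?thesis unfolding sup_exceeds_def by measurable
qed

text \<open>Dyadic grids are nested, so the events increase with the level and continuity from below
  applies.\<close>

lemma (in prob_space) prob_sup_exceeds_le:
  assumes X[measurable]: "\<And>t. X t \<in> borel_measurable M" and T: "0 < T"
    and le: "\<And>m. prob {\<omega>\<in>space M. \<exists>j\<le>2 ^ m. \<epsilon> < \<bar>X (dyadic T m j) \<omega>\<bar>} \<le> B"
  shows "prob {\<omega>\<in>space M. sup_exceeds T \<epsilon> (\<lambda>t. X t \<omega>)} \<le> B"
proof -
  let ?A = "\<lambda>m. {\<omega>\<in>space M. \<exists>j\<le>2 ^ m. \<epsilon> < \<bar>X (dyadic T m j) \<omega>\<bar>}"
  have inc: "incseq ?A"
  proof (rule incseq_SucI, safe)
    fix m \<omega> j assume j: "j \<le> 2 ^ m" "\<epsilon> < \<bar>X (dyadic T m j) \<omega>\<bar>"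
    then show "\<exists>j\<le>2 ^ Suc m. \<epsilon> < \<bar>X (dyadic T (Suc m) j) \<omega>\<bar>"
      by (intro exI[of _ "2 * j"]) (simp add: dyadic_def)
  qed
  have "(\<lambda>m. prob (?A m)) \<longlonglongrightarrow> prob (\<Union>m. ?A m)"
    by (rule finite_Lim_measure_incseq[OF _ inc]) auto
  then have "prob (\<Union>m. ?A m) \<le> B" using le by (auto intro: LIMSEQ_le_const2)
  moreover have "(\<Union>m. ?A m) = {\<omega>\<in>space M. sup_exceeds T \<epsilon> (\<lambda>t. X t \<omega>)}" by (auto simp: sup_exceeds_def)
  ultimately show ?thesis by simp
qed

text \<open>The maximal inequality for the exponential martingale exp(-l M - t kap), applied to f
  and to -f, which explains the factor 2. For |l f| \<le> 1 the exponent is at most l^2 times the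
  integral of f^2.\<close>

lemma M_proc_sup_small_jumps:
  assumes f: "adm K f" and bd: "\<And>u. \<bar>l * f u\<bar> \<le> 1" and l: "0 < l" and T: "0 < T"
  shows "measure prm {\<omega>\<in>space prm. sup_exceeds T \<epsilon> (\<lambda>t. M_proc K f t \<omega>)} \<le> 2 * exp (- l * \<epsilon> + T * (l\<^sup>2 * (\<integral>u. (f u)\<^sup>2 \<partial>lborel)))"
proof -
  interpret prob_space prm by (rule prob_space_prm)
  define V where "V = l\<^sup>2 * (\<integral>u. (f u)\<^sup>2 \<partial>lborel)"
  \<comment> \<open>Stated for any g with the same square as f, so that it covers both signs at
    once.\<close>
  have one_sided: "prob {\<omega>\<in>space prm. \<exists>j\<le>2 ^ m. \<epsilon> \<le> - M_proc K g (dyadic T m j) \<omega>} \<le> exp (- l * \<epsilon> + T * V)"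
    if g: "adm K g" and g2: "\<And>u. (g u)\<^sup>2 = (f u)\<^sup>2" for g m
  proof -
    have bdg: "\<bar>l * g u\<bar> \<le> 1" for u using g2[of u] bd[of u] by (simp add: power2_eq_iff abs_mult) (metis abs_minus)
    then have bd': "\<bar>g u\<bar> \<le> 1 / l" for u using l by (simp add: field_simps abs_mult)
    have kV: "kap g l \<le> V" "0 \<le> kap g l" using kap_le[OF g bdg l] by (simp_all add: g2 V_def)
    let ?t = "dyadic T m"
    have ts: "0 \<le> ?t 0" "\<And>j. j < 2 ^ m \<Longrightarrow> ?t j < ?t (Suc j)" using T by (auto simp: dyadic_def field_simps)
    \<comment> \<open>Increments normalised to have exponential mean 1; their partial sums telescope
      to -l M minus a correction of at most T V.\<close>
    let ?X = "\<lambda>j \<omega>. - l * (M_proc K g (?t (Suc j)) \<omega> - M_proc K g (?t j) \<omega>) - (?t (Suc j) - ?t j) * kap g l"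
    have [measurable]: "M_proc K g t \<in> borel_measurable prm" for t by (rule borel_measurable_M_proc[OF g])
    have "prob {\<omega>\<in>space prm. \<exists>j\<le>2 ^ m. l * \<epsilon> - T * V \<le> (\<Sum>i<j. ?X i \<omega>)} \<le> exp (- (l * \<epsilon> - T * V))"
    proof (rule exp_maximal_inequality)
      show "indep_vars (\<lambda>_. borel) ?X {..<2 ^ m}"
        by (rule indep_vars_compose2[OF M_proc_indep(1)[OF g bd' ts]]) auto
      fix j :: nat assume j: "j < 2 ^ m"
      have "(\<integral>\<^sup>+\<omega>. ennreal (exp (?X j \<omega>)) \<partial>prm) = (\<integral>\<^sup>+\<omega>. ennreal (exp (- ((?t (Suc j) - ?t j) * kap g l))) * ennreal (exp (- l * (M_proc K g (?t (Suc j)) \<omega> - M_proc K g (?t j) \<omega>))) \<partial>prm)"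
        by (intro nn_integral_cong) (simp add: ennreal_mult'[symmetric] exp_add[symmetric] algebra_simps)
      also have "\<dots> = ennreal (exp (- ((?t (Suc j) - ?t j) * kap g l))) * ennreal (exp ((?t (Suc j) - ?t j) * kap g l))"
        using M_proc_indep(2)[OF g bd' ts, of 0 "?t j" "?t (Suc j)" l] ts(2)[OF j] T
        by (subst nn_integral_cmult) (auto simp: dyadic_def)
      also have "\<dots> = 1" by (simp add: ennreal_mult'[symmetric] exp_add[symmetric])
      finally show "(\<integral>\<^sup>+\<omega>. ennreal (exp (?X j \<omega>)) \<partial>prm) = 1" .
    qed
    moreover have "{\<omega>\<in>space prm. \<exists>j\<le>2 ^ m. \<epsilon> \<le> - M_proc K g (?t j) \<omega>} \<subseteq> {\<omega>\<in>space prm. \<exists>j\<le>2 ^ m. l * \<epsilon> - T * V \<le> (\<Sum>i<j. ?X i \<omega>)}"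
    proof safe
      fix \<omega> j assume j: "j \<le> 2 ^ m" "\<epsilon> \<le> - M_proc K g (?t j) \<omega>"
      have "(\<Sum>i<j. ?X i \<omega>) = - l * (M_proc K g (?t j) \<omega> - M_proc K g (?t 0) \<omega>) - (?t j - ?t 0) * kap g l"
        by (induction j) (simp_all add: algebra_simps)
      also have "\<dots> = l * (- M_proc K g (?t j) \<omega>) - ?t j * kap g l" by (simp add: M_proc_0 dyadic_def)
      also have "\<dots> \<ge> l * \<epsilon> - T * V"
      proof (intro diff_mono mult_left_mono mult_mono)
        have "real j \<le> 2 ^ m" using j(1) by (metis of_nat_le_iff of_nat_numeral of_nat_power)
        then show "?t j \<le> T" using T by (simp add: dyadic_def field_simps)
      qed (use j l kV T in \<open>auto simp: dyadic_def\<close>)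
      finally show "\<exists>j\<le>2 ^ m. l * \<epsilon> - T * V \<le> (\<Sum>i<j. ?X i \<omega>)" using j by blast
    qed
    then have "prob {\<omega>\<in>space prm. \<exists>j\<le>2 ^ m. \<epsilon> \<le> - M_proc K g (?t j) \<omega>} \<le> prob {\<omega>\<in>space prm. \<exists>j\<le>2 ^ m. l * \<epsilon> - T * V \<le> (\<Sum>i<j. ?X i \<omega>)}"
      by (rule finite_measure_mono) measurable
    ultimately show ?thesis by simp
  qed
  have [measurable]: "M_proc K f t \<in> borel_measurable prm" for t by (rule borel_measurable_M_proc[OF f])
  show ?thesis
  proof (rule prob_sup_exceeds_le[OF borel_measurable_M_proc[OF f] T])
    fix m
    let ?A = "\<lambda>g. {\<omega>\<in>space prm. \<exists>j\<le>2 ^ m. \<epsilon> \<le> - M_proc K g (dyadic T m j) \<omega>}"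
    have "prob {\<omega>\<in>space prm. \<exists>j\<le>2 ^ m. \<epsilon> < \<bar>M_proc K f (dyadic T m j) \<omega>\<bar>} \<le> prob (?A f \<union> ?A (\<lambda>u. - f u))"
    proof (rule finite_measure_mono)
      show "{\<omega>\<in>space prm. \<exists>j\<le>2 ^ m. \<epsilon> < \<bar>M_proc K f (dyadic T m j) \<omega>\<bar>} \<subseteq> ?A f \<union> ?A (\<lambda>u. - f u)"
        unfolding M_proc_uminus by (auto simp: abs_if split: if_splits)
      show "?A f \<union> ?A (\<lambda>u. - f u) \<in> events" unfolding M_proc_uminus by measurable
    qed
    also have "\<dots> \<le> prob (?A f) + prob (?A (\<lambda>u. - f u))"
      by (rule measure_Un_le) (unfold M_proc_uminus, measurable)
    also have "\<dots> \<le> exp (- l * \<epsilon> + T * V) + exp (- l * \<epsilon> + T * V)"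
      by (intro add_mono one_sided f adm_uminus) auto
    finally show "prob {\<omega>\<in>space prm. \<exists>j\<le>2 ^ m. \<epsilon> < \<bar>M_proc K f (dyadic T m j) \<omega>\<bar>} \<le> 2 * exp (- l * \<epsilon> + T * (l\<^sup>2 * (\<integral>u. (f u)\<^sup>2 \<partial>lborel)))"
      unfolding V_def by simp
  qed
qed

lemma S_proc_abs_le:
  assumes "0 \<le> t" "t \<le> T"
  shows "\<bar>S_proc K f t \<omega>\<bar> \<le> S_proc K (\<lambda>u. \<bar>f u\<bar>) T \<omega>"
proof -
  obtain n :: nat where n: "T < real n" using reals_Archimedean2 by blast
  have "\<bar>S_proc K f t \<omega>\<bar> \<le> (\<Sum>c\<in>{..<n} \<times> {..<K}. \<Sum>i<fst (\<omega> c). \<bar>jmp f c t (snd (\<omega> c) i)\<bar>)"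
    using assms n by (subst S_proc_eq[where n=n]) (auto simp: cell_sum_def intro!: order_trans[OF sum_abs] sum_mono)
  also have "\<dots> \<le> (\<Sum>c\<in>{..<n} \<times> {..<K}. \<Sum>i<fst (\<omega> c). jmp (\<lambda>u. \<bar>f u\<bar>) c T (snd (\<omega> c) i))"
    using assms by (intro sum_mono) (auto simp: jmp_def indicator_def)
  also have "\<dots> = S_proc K (\<lambda>u. \<bar>f u\<bar>) T \<omega>"
    using assms n by (subst S_proc_eq[where n=n]) (auto simp: cell_sum_def)
  finally show ?thesis .
qed

lemma adm_abs: "adm K f \<Longrightarrow> adm K (\<lambda>u. \<bar>f u\<bar>)"
  by (auto simp: adm_def)

text \<open>The uncompensated part is dominated on [0,T] by the total of the absolute jumps, and the
  compensator stays below \<epsilon>/2. Markov's inequality is applied to 1 - exp(-S), whose mean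
  the Laplace transform bounds by T times the integral of |f|.\<close>

lemma M_proc_sup_large_jumps:
  assumes f: "adm K f" and T: "0 < T" and \<epsilon>: "0 < \<epsilon>" and small: "T * (\<integral>u. \<bar>f u\<bar> \<partial>lborel) \<le> \<epsilon> / 2"
  shows "measure prm {\<omega>\<in>space prm. sup_exceeds T \<epsilon> (\<lambda>t. M_proc K f t \<omega>)} \<le> T * (\<integral>u. \<bar>f u\<bar> \<partial>lborel) / (1 - exp (- \<epsilon> / 2))"
proof -
  interpret prob_space prm by (rule prob_space_prm)
  let ?g = "\<lambda>u. \<bar>f u\<bar>"
  let ?S = "S_proc K ?g T"
  have g: "adm K ?g" by (rule adm_abs[OF f])
  have [measurable]: "f \<in> borel_measurable borel" and intf: "integrable lborel f" using f by (simp_all add: adm_def)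
  have [measurable]: "?S \<in> borel_measurable prm" by (rule borel_measurable_S_proc) measurable
  have [measurable]: "M_proc K f t \<in> borel_measurable prm" for t by (rule borel_measurable_M_proc[OF f])
  have S0: "0 \<le> ?S \<omega>" for \<omega> using S_proc_abs_le[of 0 T K f \<omega>] T by simp
  have S00: "S_proc K ?g 0 \<omega> = 0" for \<omega> using M_proc_0[of K ?g \<omega>] by (simp add: M_proc_def)
  have "(\<integral>\<^sup>+\<omega>. ennreal (exp (- ?S \<omega>)) \<partial>prm) = ennreal (exp (T * (\<integral>u. exp (- \<bar>f u\<bar>) - 1 \<partial>lborel)))"
    using laplace_S_proc[OF g, of "\<lambda>i. if i = 0 then 0 else T" 1 "\<lambda>_. 1" 0] T by (simp add: S00)
  then have E: "expectation (\<lambda>\<omega>. exp (- ?S \<omega>)) = exp (T * (\<integral>u. exp (- \<bar>f u\<bar>) - 1 \<partial>lborel))"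
    by (subst integral_eq_nn_integral) auto
  have int: "integrable prm (\<lambda>\<omega>. exp (- ?S \<omega>))"
    by (rule integrable_const_bound[where B=1]) (use S0 in auto)
  have int1: "integrable lborel (\<lambda>u. exp (- \<bar>f u\<bar>) - 1)"
    using integrable_exp_adm[OF g, of 1 0] by simp
  have low: "1 - T * (\<integral>u. \<bar>f u\<bar> \<partial>lborel) \<le> expectation (\<lambda>\<omega>. exp (- ?S \<omega>))"
  proof -
    have "- (\<integral>u. \<bar>f u\<bar> \<partial>lborel) = (\<integral>u. - \<bar>f u\<bar> \<partial>lborel)" by simp
    also have "\<dots> \<le> (\<integral>u. exp (- \<bar>f u\<bar>) - 1 \<partial>lborel)"
    proof (rule integral_mono)
      show "- \<bar>f u\<bar> \<le> exp (- \<bar>f u\<bar>) - 1" for u using exp_ge_add_one_self[of "- \<bar>f u\<bar>"] by simp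
    qed (use intf int1 in auto)
    finally have "- (T * (\<integral>u. \<bar>f u\<bar> \<partial>lborel)) \<le> T * (\<integral>u. exp (- \<bar>f u\<bar>) - 1 \<partial>lborel)"
      using T by (metis mult_left_mono less_imp_le mult_minus_right)
    also have "\<dots> \<le> exp (T * (\<integral>u. exp (- \<bar>f u\<bar>) - 1 \<partial>lborel)) - 1" using exp_ge_add_one_self by (simp add: algebra_simps)
    finally show ?thesis unfolding E by simp
  qed
  have sub: "{\<omega>\<in>space prm. sup_exceeds T \<epsilon> (\<lambda>t. M_proc K f t \<omega>)} \<subseteq> {\<omega>\<in>space prm. \<epsilon> / 2 \<le> ?S \<omega>}"
  proof safe
    fix \<omega> assume "sup_exceeds T \<epsilon> (\<lambda>t. M_proc K f t \<omega>)"
    then obtain m j where mj: "j \<le> 2 ^ m" "\<epsilon> < \<bar>M_proc K f (dyadic T m j) \<omega>\<bar>" by (auto simp: sup_exceeds_def)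
    define t where "t = dyadic T m j"
    have "real j \<le> 2 ^ m" using mj(1) by (metis of_nat_le_iff of_nat_numeral of_nat_power)
    then have t: "0 \<le> t" "t \<le> T" using T by (simp_all add: t_def dyadic_def field_simps)
    have "\<bar>t * (\<integral>u. f u \<partial>lborel)\<bar> = t * \<bar>\<integral>u. f u \<partial>lborel\<bar>" using t by (simp add: abs_mult)
    also have "\<dots> \<le> T * (\<integral>u. \<bar>f u\<bar> \<partial>lborel)" using t by (intro mult_mono integral_abs_bound) auto
    finally have "\<bar>t * (\<integral>u. f u \<partial>lborel)\<bar> \<le> \<epsilon> / 2" using small by simp
    moreover have "\<epsilon> < \<bar>S_proc K f t \<omega> - t * (\<integral>u. f u \<partial>lborel)\<bar>" using mj(2) by (simp add: t_def M_proc_def)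
    moreover have "\<bar>S_proc K f t \<omega>\<bar> \<le> ?S \<omega>" by (rule S_proc_abs_le[OF t])
    ultimately show "\<epsilon> / 2 \<le> ?S \<omega>" by (simp add: abs_if split: if_splits)
  qed
  \<comment> \<open>The smallest value of 1 - exp(-S) on the event S \<ge> \<epsilon>/2.\<close>
  define q where "q = 1 - exp (- \<epsilon> / 2)"
  have q: "0 < q" using \<epsilon> by (simp add: q_def)
  have "q * prob {\<omega>\<in>space prm. \<epsilon> / 2 \<le> ?S \<omega>} = expectation (\<lambda>\<omega>. q * indicator {\<omega>\<in>space prm. \<epsilon> / 2 \<le> ?S \<omega>} \<omega>)"
    by simp
  also have "\<dots> \<le> expectation (\<lambda>\<omega>. 1 - exp (- ?S \<omega>))"
  proof (rule integral_mono)
    show "integrable prm (\<lambda>\<omega>. q * indicator {\<omega>\<in>space prm. \<epsilon> / 2 \<le> ?S \<omega>} \<omega>)"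
      by (intro integrable_mult_right integrable_real_indicator) (auto simp: emeasure_eq_measure)
    fix \<omega> assume "\<omega> \<in> space prm"
    then show "q * indicator {\<omega>\<in>space prm. \<epsilon> / 2 \<le> ?S \<omega>} \<omega> \<le> 1 - exp (- ?S \<omega>)"
      using S0[of \<omega>] by (auto simp: indicator_def q_def)
  qed (use int in auto)
  also have "\<dots> = 1 - expectation (\<lambda>\<omega>. exp (- ?S \<omega>))" using int by (simp add: prob_space)
  also have "\<dots> \<le> T * (\<integral>u. \<bar>f u\<bar> \<partial>lborel)" using low by simp
  finally have "prob {\<omega>\<in>space prm. \<epsilon> / 2 \<le> ?S \<omega>} \<le> T * (\<integral>u. \<bar>f u\<bar> \<partial>lborel) / q"
    using q by (simp add: field_simps)
  moreover have "prob {\<omega>\<in>space prm. sup_exceeds T \<epsilon> (\<lambda>t. M_proc K f t \<omega>)} \<le> prob {\<omega>\<in>space prm. \<epsilon> / 2 \<le> ?S \<omega>}"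
    by (rule finite_measure_mono[OF sub]) measurable
  ultimately show ?thesis by (simp add: q_def)
qed

text \<open>Quadratic for small differences and linear for large ones: the stable jumps have neither
  finite total size near 0 nor finite variance, so neither the L1 nor the L2 distance alone would
  do.\<close>

definition jump_dist :: "(real \<Rightarrow> real) \<Rightarrow> real" where
  "jump_dist f = (\<integral>u. min \<bar>f u\<bar> ((f u)\<^sup>2) \<partial>lborel)"

lemma jump_dist_integrable: "adm K f \<Longrightarrow> integrable lborel (\<lambda>u. min \<bar>f u\<bar> ((f u)\<^sup>2))"
  by (rule Bochner_Integration.integrable_bound[of _ f]) (auto simp: adm_def)

lemma jump_dist_nonneg: "0 \<le> jump_dist f"
  unfolding jump_dist_def by (intro integral_nonneg_AE AE_I2) auto

text \<open>The profile is cut at the level |f| = 1/l: the small part is controlled in L2 by the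
  exponential bound, the large part in L1. The parameter l is fixed from \<epsilon> and \<eta>
  alone, so \<delta> is uniform in K and f.\<close>

lemma M_proc_close:
  assumes \<epsilon>: "0 < \<epsilon>" and \<eta>: "0 < \<eta>" and T: "0 < T"
  shows "\<exists>\<delta>>0. \<forall>K f. adm K f \<longrightarrow> jump_dist f < \<delta> \<longrightarrow>
     measure prm {\<omega>\<in>space prm. sup_exceeds T \<epsilon> (\<lambda>t. M_proc K f t \<omega>)} < \<eta>"
proof -
  interpret prob_space prm by (rule prob_space_prm)
  have "((\<lambda>l. 4 * exp (- l * (\<epsilon> / 2))) \<longlongrightarrow> 0) at_top" using \<epsilon> by real_asymp
  then have "eventually (\<lambda>l. 4 * exp (- l * (\<epsilon> / 2)) < \<eta> / 2) at_top" using \<eta> by (intro order_tendstoD) auto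
  moreover have "eventually (\<lambda>l::real. 1 \<le> l) at_top" by (rule eventually_ge_at_top)
  ultimately have "\<exists>l::real. 4 * exp (- l * (\<epsilon> / 2)) < \<eta> / 2 \<and> 1 \<le> l"
    by (intro eventually_happens'[OF trivial_limit_at_top_linorder]) (rule eventually_conj)
  then obtain l :: real where l: "4 * exp (- l * (\<epsilon> / 2)) < \<eta> / 2" "1 \<le> l" by blast
  define q where "q = 1 - exp (- (\<epsilon> / 2) / 2)"
  have q: "0 < q" using \<epsilon> by (simp add: q_def)
  \<comment> \<open>The three bounds serve, in order: variance term at most 1/2 for the small jumps,
    compensator at most \<epsilon>/4 for the large jumps, and probability below \<eta>/2 for the
    large jumps.\<close>
  define \<delta> where "\<delta> = min (1 / (2 * T * l\<^sup>2)) (min (\<epsilon> / (4 * T * l)) (q * \<eta> / (2 * T * l)))"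
  have \<delta>: "0 < \<delta>" using \<epsilon> \<eta> T l q by (simp add: \<delta>_def)
  have "prob {\<omega>\<in>space prm. sup_exceeds T \<epsilon> (\<lambda>t. M_proc K f t \<omega>)} < \<eta>" if f: "adm K f" and d: "jump_dist f < \<delta>" for K f
  proof -
    have [measurable]: "f \<in> borel_measurable borel" and intf: "integrable lborel f" using f by (simp_all add: adm_def)
    define f1 where "f1 u = (if l * \<bar>f u\<bar> \<le> 1 then f u else 0)" for u
    define f2 where "f2 u = (if l * \<bar>f u\<bar> \<le> 1 then 0 else f u)" for u
    have [measurable]: "f1 \<in> borel_measurable borel" "f2 \<in> borel_measurable borel" unfolding f1_def f2_def by measurable
    have a1: "adm K f1" and a2: "adm K f2"
      unfolding adm_def using f
      by (auto simp: f1_def f2_def adm_def intro!: Bochner_Integration.integrable_bound[OF intf])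
    have f12: "f = (\<lambda>u. f1 u + f2 u)" by (auto simp: f1_def f2_def fun_eq_iff)
    have M12: "M_proc K f t \<omega> = M_proc K f1 t \<omega> + M_proc K f2 t \<omega>" for t \<omega>
      unfolding f12 by (rule M_proc_add[OF a1 a2])
    have [measurable]: "M_proc K f1 t \<in> borel_measurable prm" "M_proc K f2 t \<in> borel_measurable prm" for t
      by (intro borel_measurable_M_proc a1 a2)+
    let ?E = "\<lambda>f \<epsilon>. {\<omega>\<in>space prm. sup_exceeds T \<epsilon> (\<lambda>t. M_proc K f t \<omega>)}"
    have Em: "?E f1 \<epsilon>' \<in> events" "?E f2 \<epsilon>' \<in> events" for \<epsilon>' by (intro sup_exceeds_measurable; measurable)+
    have "?E f \<epsilon> \<subseteq> ?E f1 (\<epsilon> / 2) \<union> ?E f2 (\<epsilon> / 2)"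
    proof safe
      fix \<omega> assume "sup_exceeds T \<epsilon> (\<lambda>t. M_proc K f t \<omega>)" and n2: "\<not> sup_exceeds T (\<epsilon> / 2) (\<lambda>t. M_proc K f2 t \<omega>)"
      then obtain m j where mj: "j \<le> 2 ^ m" "\<epsilon> < \<bar>M_proc K f1 (dyadic T m j) \<omega> + M_proc K f2 (dyadic T m j) \<omega>\<bar>"
        unfolding sup_exceeds_def M12 by auto
      have "\<bar>M_proc K f2 (dyadic T m j) \<omega>\<bar> \<le> \<epsilon> / 2" using n2 mj(1) unfolding sup_exceeds_def by (meson not_le)
      then have "\<epsilon> / 2 < \<bar>M_proc K f1 (dyadic T m j) \<omega>\<bar>" using mj(2) by (simp add: abs_if split: if_splits)
      then show "sup_exceeds T (\<epsilon> / 2) (\<lambda>t. M_proc K f1 t \<omega>)" using mj(1) unfolding sup_exceeds_def by blast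
    qed
    then have "prob (?E f \<epsilon>) \<le> prob (?E f1 (\<epsilon> / 2) \<union> ?E f2 (\<epsilon> / 2))" using Em by (intro finite_measure_mono) auto
    also have "\<dots> \<le> prob (?E f1 (\<epsilon> / 2)) + prob (?E f2 (\<epsilon> / 2))" by (intro measure_Un_le Em)
    also have "\<dots> < \<eta> / 2 + \<eta> / 2"
    proof (rule add_strict_mono)
      have bd: "\<bar>l * f1 u\<bar> \<le> 1" for u using l by (auto simp: f1_def abs_mult)
      have l0: "0 < l" using l by simp
      have "(\<integral>u. (f1 u)\<^sup>2 \<partial>lborel) \<le> jump_dist f"
        unfolding jump_dist_def
      proof (rule integral_mono[OF kap_le(1)[OF a1 bd l0] jump_dist_integrable[OF f]])
        fix u
        show "(f1 u)\<^sup>2 \<le> min \<bar>f u\<bar> ((f u)\<^sup>2)"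
        proof (cases "l * \<bar>f u\<bar> \<le> 1")
          case True
          have "1 * \<bar>f u\<bar> \<le> l * \<bar>f u\<bar>" using l by (intro mult_right_mono) auto
          then have "\<bar>f u\<bar> * \<bar>f u\<bar> \<le> 1 * \<bar>f u\<bar>" using True by (intro mult_right_mono) auto
          then show ?thesis using True by (simp add: f1_def power2_eq_square)
        qed (simp add: f1_def)
      qed
      also have "\<dots> \<le> 1 / (2 * T * l\<^sup>2)" using d by (simp add: \<delta>_def)
      finally have "T * (l\<^sup>2 * (\<integral>u. (f1 u)\<^sup>2 \<partial>lborel)) \<le> T * (l\<^sup>2 * (1 / (2 * T * l\<^sup>2)))"
        using T by (intro mult_left_mono) auto
      also have "\<dots> = 1 / 2" using T l by (simp add: field_simps)
      finally have "exp (T * (l\<^sup>2 * (\<integral>u. (f1 u)\<^sup>2 \<partial>lborel))) \<le> exp (1/2)" by simp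
      also have "\<dots> \<le> (2::real)" using exp_quadratic_bound[of "1/2"] by (simp add: power2_eq_square)
      finally have e2: "exp (T * (l\<^sup>2 * (\<integral>u. (f1 u)\<^sup>2 \<partial>lborel))) \<le> 2" .
      have "prob (?E f1 (\<epsilon> / 2)) \<le> 2 * exp (- l * (\<epsilon> / 2) + T * (l\<^sup>2 * (\<integral>u. (f1 u)\<^sup>2 \<partial>lborel)))"
        by (rule M_proc_sup_small_jumps[OF a1 bd l0 T])
      also have "\<dots> = 2 * exp (- l * (\<epsilon> / 2)) * exp (T * (l\<^sup>2 * (\<integral>u. (f1 u)\<^sup>2 \<partial>lborel)))" by (simp only: exp_add mult.assoc)
      also have "\<dots> \<le> 2 * exp (- l * (\<epsilon> / 2)) * 2" using e2 by (intro mult_left_mono) auto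
      also have "\<dots> < \<eta> / 2" using l(1) by simp
      finally show "prob (?E f1 (\<epsilon> / 2)) < \<eta> / 2" .
      have int2: "integrable lborel f2" using a2 by (simp add: adm_def)
      have "(\<integral>u. \<bar>f2 u\<bar> \<partial>lborel) \<le> (\<integral>u. l * min \<bar>f u\<bar> ((f u)\<^sup>2) \<partial>lborel)"
      proof (rule integral_mono)
        fix u
        show "\<bar>f2 u\<bar> \<le> l * min \<bar>f u\<bar> ((f u)\<^sup>2)"
        proof (cases "l * \<bar>f u\<bar> \<le> 1")
          case False
          have "1 * \<bar>f u\<bar> \<le> (l * \<bar>f u\<bar>) * \<bar>f u\<bar>" using False by (intro mult_right_mono) auto
          moreover have "1 * \<bar>f u\<bar> \<le> l * \<bar>f u\<bar>" using l by (intro mult_right_mono) auto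
          ultimately show ?thesis using False by (auto simp: f2_def min_def power2_eq_square)
        qed (use l in \<open>simp add: f2_def\<close>)
      qed (use int2 jump_dist_integrable[OF f] in auto)
      also have "\<dots> = l * jump_dist f" by (simp add: jump_dist_def)
      finally have i2: "(\<integral>u. \<bar>f2 u\<bar> \<partial>lborel) \<le> l * jump_dist f" .
      have "T * (\<integral>u. \<bar>f2 u\<bar> \<partial>lborel) \<le> T * (l * jump_dist f)" using i2 T by (intro mult_left_mono) auto
      also have "\<dots> \<le> T * (l * (\<epsilon> / (4 * T * l)))" using d T l by (intro mult_left_mono) (auto simp: \<delta>_def)
      also have "\<dots> = (\<epsilon> / 2) / 2" using T l by (simp add: field_simps)
      finally have "T * (\<integral>u. \<bar>f2 u\<bar> \<partial>lborel) \<le> (\<epsilon> / 2) / 2" .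
      then have "prob (?E f2 (\<epsilon> / 2)) \<le> T * (\<integral>u. \<bar>f2 u\<bar> \<partial>lborel) / q"
        unfolding q_def using \<epsilon> by (intro M_proc_sup_large_jumps[OF a2 T]) auto
      also have "\<dots> \<le> T * (l * jump_dist f) / q" using i2 T q by (intro divide_right_mono mult_left_mono) auto
      also have "\<dots> < T * (l * (q * \<eta> / (2 * T * l))) / q"
        using d T l q by (intro divide_strict_right_mono mult_strict_left_mono) (auto simp: \<delta>_def)
      also have "\<dots> = \<eta> / 2" using T l q by (simp add: field_simps)
      finally show "prob (?E f2 (\<epsilon> / 2)) < \<eta> / 2" .
    qed
    finally show ?thesis by simp
  qed
  then show ?thesis using \<delta> by blast
qed

text \<open>A subsequence along which consecutive differences exceed 2^-j on [0, j+1] with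
  probability at most 2^-j; Borel-Cantelli makes it almost surely uniformly Cauchy on
  compacts.\<close>

lemma M_proc_subseq_limit:
  assumes f: "\<And>n. adm (K n) (f n)"
    and cauchy: "\<And>\<delta>. 0 < \<delta> \<Longrightarrow> \<exists>N. \<forall>m\<ge>N. \<forall>n\<ge>N. jump_dist (\<lambda>u. f m u - f n u) < \<delta>"
  shows "\<exists>s Y. strict_mono (s :: nat \<Rightarrow> nat) \<and> (\<forall>t. Y t \<in> borel_measurable prm) \<and> (\<forall>\<omega>. cadlag (\<lambda>t. Y t \<omega>)) \<and> (\<forall>\<omega>. Y 0 \<omega> = 0) \<and>
    (AE \<omega> in prm. \<forall>T\<ge>0. \<forall>e>0. eventually (\<lambda>j. \<forall>t\<in>{0..T}. \<bar>M_proc (K (s j)) (f (s j)) t \<omega> - Y t \<omega>\<bar> \<le> e) sequentially)"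
proof -
  interpret prob_space prm by (rule prob_space_prm)
  define V where "V n t \<omega> = M_proc (K n) (f n) t \<omega>" for n t \<omega>
  have Vm[measurable]: "V n t \<in> borel_measurable prm" for n t unfolding V_def[abs_def] by (rule borel_measurable_M_proc[OF f])
  have Vc: "cadlag (\<lambda>t. V n t \<omega>)" for n \<omega> unfolding V_def by (rule cadlag_M_proc)
  have V0: "V n 0 \<omega> = 0" for n \<omega> by (simp add: V_def M_proc_0)
  have diff: "\<exists>N. \<forall>m\<ge>N. \<forall>n\<ge>N. prob {\<omega>\<in>space prm. sup_exceeds T \<epsilon> (\<lambda>t. V m t \<omega> - V n t \<omega>)} < \<eta>"
    if "0 < \<epsilon>" "0 < \<eta>" "0 < T" for \<epsilon> \<eta> T
  proof -
    obtain \<delta> where \<delta>: "0 < \<delta>" "\<And>K f. adm K f \<Longrightarrow> jump_dist f < \<delta> \<Longrightarrow> prob {\<omega>\<in>space prm. sup_exceeds T \<epsilon> (\<lambda>t. M_proc K f t \<omega>)} < \<eta>"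
      using M_proc_close[OF \<open>0 < \<epsilon>\<close> \<open>0 < \<eta>\<close> \<open>0 < T\<close>] by blast
    obtain N where N: "\<And>m n. N \<le> m \<Longrightarrow> N \<le> n \<Longrightarrow> jump_dist (\<lambda>u. f m u - f n u) < \<delta>" using cauchy[OF \<delta>(1)] by blast
    have "prob {\<omega>\<in>space prm. sup_exceeds T \<epsilon> (\<lambda>t. V m t \<omega> - V n t \<omega>)} < \<eta>" if "N \<le> m" "N \<le> n" for m n
    proof -
      \<comment> \<open>A common cutoff turns the difference of two processes into the process of
        the difference profile.\<close>
      define L where "L = max (K m) (K n)"
      have a: "adm L (f m)" "adm L (f n)" unfolding L_def by (intro adm_mono[OF f]; simp)+
      have "V m t \<omega> - V n t \<omega> = M_proc L (\<lambda>u. f m u - f n u) t \<omega>" for t \<omega>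
        unfolding V_def M_proc_diff[OF a] using M_proc_cutoff[OF f[of m], of L] M_proc_cutoff[OF f[of n], of L] by (simp add: L_def)
      then show ?thesis using \<delta>(2)[OF adm_diff[OF a] N[OF that]] by simp
    qed
    then show ?thesis by blast
  qed
  have "\<exists>N. \<forall>j. \<forall>m\<ge>N j. \<forall>n\<ge>N j. prob {\<omega>\<in>space prm. sup_exceeds (real (Suc j)) ((1/2) ^ j) (\<lambda>t. V m t \<omega> - V n t \<omega>)} < (1/2) ^ j"
    by (intro choice allI diff) auto
  then obtain N where N: "\<And>j m n. N j \<le> m \<Longrightarrow> N j \<le> n \<Longrightarrow>
     prob {\<omega>\<in>space prm. sup_exceeds (real (Suc j)) ((1/2) ^ j) (\<lambda>t. V m t \<omega> - V n t \<omega>)} < (1/2) ^ j" by blast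
  have "\<exists>s :: nat \<Rightarrow> nat. \<forall>j. N j \<le> s j \<and> s j < s (Suc j)"
  proof (rule dependent_nat_choice[where P="\<lambda>j x. N j \<le> x" and Q="\<lambda>j x y. x < y"])
    show "\<exists>x. N 0 \<le> x" by blast
    show "\<exists>y. N (Suc n) \<le> y \<and> x < y" for x n by (intro exI[of _ "max (N (Suc n)) (Suc x)"]) auto
  qed
  then obtain s where s: "\<And>j. N j \<le> s j" "\<And>j. s j < s (Suc j)" by blast
  have smono: "strict_mono s" using s(2) by (simp add: strict_mono_Suc_iff)
  define A where "A j = {\<omega>\<in>space prm. sup_exceeds (real (Suc j)) ((1/2) ^ j) (\<lambda>t. V (s j) t \<omega> - V (s (Suc j)) t \<omega>)}" for j
  have Am[measurable]: "A j \<in> events" for j unfolding A_def by (rule sup_exceeds_measurable) measurable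
  have pA: "prob (A j) \<le> (1/2) ^ j" for j
    unfolding A_def using N[of j "s j" "s (Suc j)"] s(1)[of j] s(2)[of j] by simp
  have "summable (\<lambda>j. prob (A j))"
    by (rule summable_comparison_test'[of "\<lambda>j. (1/2::real) ^ j" 0]) (use pA in \<open>auto simp: summable_geometric\<close>)
  then have "AE \<omega> in prm. eventually (\<lambda>j. \<omega> \<in> space prm - A j) sequentially"
    by (intro borel_cantelli_AE1) (auto simp: emeasure_eq_measure)
  define good where "good \<omega> \<longleftrightarrow> eventually (\<lambda>j. \<omega> \<in> space prm - A j) sequentially" for \<omega>
  have AEgood: "AE \<omega> in prm. good \<omega>" unfolding good_def by fact
  have [measurable]: "Measurable.pred prm good" unfolding good_def[abs_def] eventually_sequentially by measurable
  \<comment> \<open>The value 0 off the good event makes every path of Y cadlag and started at 0,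
    not only almost every one.\<close>
  define Y where "Y t \<omega> = (if good \<omega> then lim (\<lambda>j. V (s j) t \<omega>) else 0)" for t \<omega>
  have Ym: "Y t \<in> borel_measurable prm" for t
    unfolding Y_def[abs_def] by (intro measurable_If borel_measurable_lim_metric) auto
  have conv: "eventually (\<lambda>j. \<forall>t\<in>{0..T}. \<bar>V (s j) t \<omega> - Y t \<omega>\<bar> \<le> e) sequentially" if g: "good \<omega>" and T: "0 \<le> T" and e: "0 < e" for \<omega> T e
  proof -
    obtain J where J: "\<And>j. J \<le> j \<Longrightarrow> \<omega> \<in> space prm - A j" using g unfolding good_def eventually_sequentially by blast
    have close: "\<bar>V (s j) t \<omega> - V (s (Suc j)) t \<omega>\<bar> \<le> (1/2) ^ j" if "J \<le> j" "0 \<le> t" "t \<le> real (Suc j)" for j t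
    proof (rule ccontr)
      assume "\<not> ?thesis"
      moreover have "cadlag (\<lambda>t. V (s j) t \<omega> + - V (s (Suc j)) t \<omega>)"
        unfolding V_def M_proc_uminus[symmetric] by (intro cadlag_add cadlag_M_proc)
      ultimately have "sup_exceeds (real (Suc j)) ((1/2) ^ j) (\<lambda>t. V (s j) t \<omega> - V (s (Suc j)) t \<omega>)"
        using that by (intro sup_exceedsI) auto
      then show False using J[OF that(1)] unfolding A_def by blast
    qed
    \<comment> \<open>The right-hand side is the geometric sum of 2^-k over j \<le> k < j + i. The
      horizons grow with the index, so a time below j + 1 stays admissible for all later
      differences.\<close>
    have tele: "\<bar>V (s j) t \<omega> - V (s (j + i)) t \<omega>\<bar> \<le> 2 * (1/2) ^ j - 2 * (1/2) ^ (j + i)" if "J \<le> j" "0 \<le> t" "t \<le> real (Suc j)" for j t i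
    proof (induction i)
      case (Suc i)
      have "\<bar>V (s (j + i)) t \<omega> - V (s (Suc (j + i))) t \<omega>\<bar> \<le> (1/2) ^ (j + i)" using that by (intro close) auto
      then show ?case using Suc by (simp add: abs_le_iff)
    qed simp
    have tele': "\<bar>V (s j) t \<omega> - V (s i) t \<omega>\<bar> \<le> 2 * (1/2) ^ j" if "J \<le> j" "0 \<le> t" "t \<le> real (Suc j)" "j \<le> i" for j t i
      using tele[OF that(1-3), of "i - j"] that(4) zero_le_power[of "1/2::real" i] by (simp del: zero_le_power)
    have lim0: "(\<lambda>j. 2 * (1/2::real) ^ j) \<longlonglongrightarrow> 0" by real_asymp
    have lim: "(\<lambda>j. V (s j) t \<omega>) \<longlonglongrightarrow> Y t \<omega>" if t: "0 \<le> t" for t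
    proof -
      have "Cauchy (\<lambda>j. V (s j) t \<omega>)"
      proof (rule metric_CauchyI)
        fix r :: real assume "0 < r"
        then have "eventually (\<lambda>j. 2 * (1/2::real) ^ j < r / 2) sequentially" using order_tendstoD(2)[OF lim0, of "r / 2"] by simp
        moreover have "eventually (\<lambda>j. J \<le> j \<and> nat \<lceil>t\<rceil> \<le> j) sequentially" by (intro eventually_conj eventually_ge_at_top)
        ultimately have "eventually (\<lambda>j. 2 * (1/2::real) ^ j < r / 2 \<and> (J \<le> j \<and> nat \<lceil>t\<rceil> \<le> j)) sequentially"
          by (rule eventually_conj)
        then obtain j where j: "2 * (1/2::real) ^ j < r / 2" "J \<le> j" "nat \<lceil>t\<rceil> \<le> j"
          using eventually_happens'[OF sequentially_bot] by blast
        have tj: "t \<le> real (Suc j)" using j(3) by linarith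
        have "\<bar>V (s m) t \<omega> - V (s n) t \<omega>\<bar> < r" if "j \<le> m" "j \<le> n" for m n
          using tele'[OF j(2) t tj that(1)] tele'[OF j(2) t tj that(2)] j(1) by linarith
        then show "\<exists>M. \<forall>m\<ge>M. \<forall>n\<ge>M. dist (V (s m) t \<omega>) (V (s n) t \<omega>) < r" by (auto simp: dist_real_def)
      qed
      then have "convergent (\<lambda>j. V (s j) t \<omega>)" by (simp add: real_Cauchy_convergent)
      then show ?thesis using g by (simp add: Y_def convergent_LIMSEQ_iff)
    qed
    have "eventually (\<lambda>j. 2 * (1/2::real) ^ j < e) sequentially" by (rule order_tendstoD(2)[OF lim0 e])
    moreover have "eventually (\<lambda>j. J \<le> j \<and> nat \<lceil>T\<rceil> \<le> j) sequentially" by (intro eventually_conj eventually_ge_at_top)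
    ultimately show ?thesis
    proof eventually_elim
      case (elim j)
      show ?case
      proof
        fix t assume t: "t \<in> {0..T}"
        have tj: "t \<le> real (Suc j)" using elim t by simp
        have "(\<lambda>i. \<bar>V (s j) t \<omega> - V (s i) t \<omega>\<bar>) \<longlonglongrightarrow> \<bar>V (s j) t \<omega> - Y t \<omega>\<bar>"
          using t by (intro tendsto_intros lim) auto
        then have "\<bar>V (s j) t \<omega> - Y t \<omega>\<bar> \<le> 2 * (1/2) ^ j"
          by (rule LIMSEQ_le_const2) (use tele'[of j t] elim t tj in auto)
        then show "\<bar>V (s j) t \<omega> - Y t \<omega>\<bar> \<le> e" using elim by simp
      qed
    qed
  qed
  have Yc: "cadlag (\<lambda>t. Y t \<omega>)" for \<omega>
  proof (cases "good \<omega>")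
    case True
    show ?thesis by (rule cadlag_uniform_limit[OF Vc conv[OF True]])
  next
    case False
    then show ?thesis by (simp add: Y_def cadlag_continuous)
  qed
  have Y0: "Y 0 \<omega> = 0" for \<omega> by (simp add: Y_def V0)
  have "AE \<omega> in prm. \<forall>T\<ge>0. \<forall>e>0. eventually (\<lambda>j. \<forall>t\<in>{0..T}. \<bar>M_proc (K (s j)) (f (s j)) t \<omega> - Y t \<omega>\<bar> \<le> e) sequentially"
    using AEgood
  proof eventually_elim
    case (elim \<omega>)
    then show ?case using conv unfolding V_def by blast
  qed
  then show ?thesis using smono Ym Yc Y0 by blast
qed

text \<open>Bounded second moments give uniform integrability. Truncation at R costs at most C/R,
  since W \<le> W^2 / R where W exceeds R; the truncated integrals converge by domination. The other
  inequality is Fatou's.\<close>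

lemma (in prob_space) nn_integral_limit_L2:
  assumes W[measurable]: "\<And>j. W j \<in> borel_measurable M" "W' \<in> borel_measurable M"
    and nn: "\<And>j \<omega>. 0 \<le> W j \<omega>" "\<And>\<omega>. 0 \<le> W' \<omega>"
    and conv: "AE \<omega> in M. (\<lambda>j. W j \<omega>) \<longlonglongrightarrow> W' \<omega>"
    and int: "\<And>j. (\<integral>\<^sup>+\<omega>. ennreal (W j \<omega>) \<partial>M) = ennreal (w j)" "\<And>j. 0 \<le> w j" and lim: "w \<longlonglongrightarrow> w'"
    and L2: "\<And>j. (\<integral>\<^sup>+\<omega>. ennreal ((W j \<omega>)\<^sup>2) \<partial>M) \<le> ennreal C" and C: "0 \<le> C"
  shows "(\<integral>\<^sup>+\<omega>. ennreal (W' \<omega>) \<partial>M) = ennreal w'"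
proof (rule antisym)
  have w': "0 \<le> w'" by (rule LIMSEQ_le_const[OF lim]) (use int(2) in auto)
  have wlim: "(\<lambda>j. ennreal (w j)) \<longlonglongrightarrow> ennreal w'" by (intro tendsto_ennrealI lim)
  have "(\<integral>\<^sup>+\<omega>. ennreal (W' \<omega>) \<partial>M) = (\<integral>\<^sup>+\<omega>. liminf (\<lambda>j. ennreal (W j \<omega>)) \<partial>M)"
    using conv by (intro nn_integral_cong_AE) (auto elim!: eventually_mono intro!: lim_imp_Liminf[symmetric] tendsto_ennrealI)
  also have "\<dots> \<le> liminf (\<lambda>j. \<integral>\<^sup>+\<omega>. ennreal (W j \<omega>) \<partial>M)" by (rule nn_integral_liminf) measurable
  also have "\<dots> = ennreal w'" unfolding int by (rule lim_imp_Liminf[OF _ wlim]) simp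
  finally show "(\<integral>\<^sup>+\<omega>. ennreal (W' \<omega>) \<partial>M) \<le> ennreal w'" .
  have bd: "ennreal (w j) \<le> (\<integral>\<^sup>+\<omega>. ennreal (min (W j \<omega>) R) \<partial>M) + ennreal (C / R)" if R: "0 < R" for j R
  proof -
    have "ennreal (w j) \<le> (\<integral>\<^sup>+\<omega>. ennreal (min (W j \<omega>) R) + ennreal (1 / R) * ennreal ((W j \<omega>)\<^sup>2) \<partial>M)"
      unfolding int(1)[symmetric]
    proof (rule nn_integral_mono)
      fix \<omega>
      have "W j \<omega> \<le> min (W j \<omega>) R + 1 / R * (W j \<omega>)\<^sup>2"
      proof (cases "W j \<omega> \<le> R")
        case False
        then have "R * W j \<omega> \<le> (W j \<omega>)\<^sup>2" using nn(1)[of j \<omega>] by (simp add: power2_eq_square mult_right_mono)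
        then have "W j \<omega> \<le> 1 / R * (W j \<omega>)\<^sup>2" using R by (simp add: field_simps)
        then show ?thesis using False R by simp
      qed (use R in simp)
      then show "ennreal (W j \<omega>) \<le> ennreal (min (W j \<omega>) R) + ennreal (1 / R) * ennreal ((W j \<omega>)\<^sup>2)"
        using nn(1)[of j \<omega>] R by (simp add: ennreal_mult'[symmetric] ennreal_plus[symmetric] ennreal_leI del: ennreal_plus)
    qed
    also have "\<dots> = (\<integral>\<^sup>+\<omega>. ennreal (min (W j \<omega>) R) \<partial>M) + ennreal (1 / R) * (\<integral>\<^sup>+\<omega>. ennreal ((W j \<omega>)\<^sup>2) \<partial>M)"
      by (subst nn_integral_add) (auto simp: nn_integral_cmult)
    also have "\<dots> \<le> (\<integral>\<^sup>+\<omega>. ennreal (min (W j \<omega>) R) \<partial>M) + ennreal (1 / R) * ennreal C"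
      by (intro add_left_mono mult_left_mono L2) auto
    also have "ennreal (1 / R) * ennreal C = ennreal (C / R)" using R C by (simp add: ennreal_mult'[symmetric])
    finally show ?thesis .
  qed
  have bd': "ennreal w' \<le> (\<integral>\<^sup>+\<omega>. ennreal (W' \<omega>) \<partial>M) + ennreal (C / R)" if R: "0 < R" for R
  proof -
    have "(\<lambda>j. \<integral>\<^sup>+\<omega>. ennreal (min (W j \<omega>) R) \<partial>M) \<longlonglongrightarrow> (\<integral>\<^sup>+\<omega>. ennreal (min (W' \<omega>) R) \<partial>M)"
    proof (rule nn_integral_dominated_convergence[where w="\<lambda>_. ennreal R"])
      show "AE \<omega> in M. (\<lambda>j. ennreal (min (W j \<omega>) R)) \<longlonglongrightarrow> ennreal (min (W' \<omega>) R)"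
        using conv by eventually_elim (intro tendsto_ennrealI tendsto_min tendsto_const)
    qed (auto simp: emeasure_space_1 intro!: ennreal_leI)
    then have "(\<lambda>j. (\<integral>\<^sup>+\<omega>. ennreal (min (W j \<omega>) R) \<partial>M) + ennreal (C / R)) \<longlonglongrightarrow> (\<integral>\<^sup>+\<omega>. ennreal (min (W' \<omega>) R) \<partial>M) + ennreal (C / R)"
      by (intro tendsto_add tendsto_const)
    then have "ennreal w' \<le> (\<integral>\<^sup>+\<omega>. ennreal (min (W' \<omega>) R) \<partial>M) + ennreal (C / R)"
      using wlim bd[OF R] by (intro LIMSEQ_le) auto
    also have "\<dots> \<le> (\<integral>\<^sup>+\<omega>. ennreal (W' \<omega>) \<partial>M) + ennreal (C / R)"
      by (intro add_right_mono nn_integral_mono ennreal_leI) auto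
    finally show ?thesis .
  qed
  show "ennreal w' \<le> (\<integral>\<^sup>+\<omega>. ennreal (W' \<omega>) \<partial>M)"
  proof (rule ennreal_le_epsilon)
    fix e :: real assume e: "0 < e"
    \<comment> \<open>The truncation level R = (C+1)/e makes the error C/R at most e.\<close>
    have "ennreal w' \<le> (\<integral>\<^sup>+\<omega>. ennreal (W' \<omega>) \<partial>M) + ennreal (C / ((C + 1) / e))" using e C by (intro bd') simp
    also have "C / ((C + 1) / e) \<le> e" using e C by (simp add: field_simps)
    finally show "ennreal w' \<le> (\<integral>\<^sup>+\<omega>. ennreal (W' \<omega>) \<partial>M) + ennreal e"
      by (auto intro: add_left_mono ennreal_leI)
  qed
qed

text \<open>The exponents converge at 2 l as well as at l, so the exponential functionals have
  bounded second moments and their means pass to the limit. Nonnegative jumps keep the transforms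
  finite for all l \<ge> 0.\<close>

lemma laplace_limit_proc:
  assumes f: "\<And>n. adm (K n) (f n)" "\<And>n u. 0 \<le> f n u"
    and kap: "\<And>l. 0 \<le> l \<Longrightarrow> (\<lambda>n. kap (f n) l) \<longlonglongrightarrow> \<psi> l"
    and Y[measurable]: "\<And>t. Y t \<in> borel_measurable prm"
    and conv: "AE \<omega> in prm. \<forall>T\<ge>0. \<forall>e>0. eventually (\<lambda>j. \<forall>t\<in>{0..T}. \<bar>M_proc (K j) (f j) t \<omega> - Y t \<omega>\<bar> \<le> e) sequentially"
    and ts: "0 \<le> ts 0" "\<And>j. j < k \<Longrightarrow> ts j < ts (Suc j)" and l: "\<And>j. j < k \<Longrightarrow> 0 \<le> l j"
  shows "(\<integral>\<^sup>+\<omega>. ennreal (exp (- (\<Sum>j<k. l j * (Y (ts (Suc j)) \<omega> - Y (ts j) \<omega>)))) \<partial>prm)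
    = (\<Prod>j<k. ennreal (exp ((ts (Suc j) - ts j) * \<psi> (l j))))"
proof -
  interpret prob_space prm by (rule prob_space_prm)
  have ts0: "0 \<le> ts j" if "j \<le> k" for j
    using that
  proof (induction j)
    case (Suc j) then show ?case using ts(2)[of j] by simp
  qed (simp add: ts)
  define V where "V n t \<omega> = M_proc (K n) (f n) t \<omega>" for n t \<omega>
  have [measurable]: "V n t \<in> borel_measurable prm" for n t unfolding V_def[abs_def] by (rule borel_measurable_M_proc[OF f(1)])
  define W where "W c n \<omega> = exp (- (\<Sum>j<k. c * l j * (V n (ts (Suc j)) \<omega> - V n (ts j) \<omega>)))" for c n \<omega>
  have [measurable]: "W c n \<in> borel_measurable prm" for c n unfolding W_def[abs_def] by measurable
  define w where "w c n = (\<Prod>j<k. exp ((ts (Suc j) - ts j) * kap (f n) (c * l j)))" for c n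
  define w' where "w' c = (\<Prod>j<k. exp ((ts (Suc j) - ts j) * \<psi> (c * l j)))" for c
  have Ww: "(\<integral>\<^sup>+\<omega>. ennreal (W c n \<omega>) \<partial>prm) = ennreal (w c n)" if "0 \<le> c" for c n
    unfolding W_def V_def w_def
    by (subst laplace_M_proc[OF f(1) ts, where B=0]) (use that l f(2) in \<open>auto simp: prod_ennreal\<close>)
  have wlim: "w c \<longlonglongrightarrow> w' c" if "0 \<le> c" for c
    unfolding w_def[abs_def] w'_def using that l by (intro tendsto_prod tendsto_exp tendsto_mult tendsto_const kap) auto
  have "Bseq (w 2)" using wlim[of 2] by (intro convergent_imp_Bseq) (auto simp: convergent_def)
  then obtain C where C: "0 < C" "\<And>n. \<bar>w 2 n\<bar> \<le> C" unfolding Bseq_def by auto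
  \<comment> \<open>Squaring the functional doubles the weights, so the second moment is again an
    instance of the transform formula.\<close>
  have sq: "(W 1 n \<omega>)\<^sup>2 = W 2 n \<omega>" for n \<omega>
    unfolding W_def power2_eq_square exp_add[symmetric] by (simp add: sum_distrib_left algebra_simps sum_negf[symmetric])
  have "(\<integral>\<^sup>+\<omega>. ennreal (exp (- (\<Sum>j<k. l j * (Y (ts (Suc j)) \<omega> - Y (ts j) \<omega>)))) \<partial>prm) = ennreal (w' 1)"
  proof (rule nn_integral_limit_L2[where W="W 1" and w="w 1" and C=C])
    show "(\<integral>\<^sup>+\<omega>. ennreal (W 1 j \<omega>) \<partial>prm) = ennreal (w 1 j)" for j by (rule Ww) simp
    show "w 1 \<longlonglongrightarrow> w' 1" by (rule wlim) simp
    show "0 \<le> w 1 j" for j unfolding w_def by (intro prod_nonneg) auto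
    show "(\<integral>\<^sup>+\<omega>. ennreal ((W 1 j \<omega>)\<^sup>2) \<partial>prm) \<le> ennreal C" for j
      unfolding sq Ww[of 2, simplified] using C(2)[of j] by (intro ennreal_leI) auto
    show "AE \<omega> in prm. (\<lambda>j. W 1 j \<omega>) \<longlonglongrightarrow> exp (- (\<Sum>j<k. l j * (Y (ts (Suc j)) \<omega> - Y (ts j) \<omega>)))"
      using conv
    proof eventually_elim
      case (elim \<omega>)
      have lim: "(\<lambda>n. V n t \<omega>) \<longlonglongrightarrow> Y t \<omega>" if "0 \<le> t" for t
      proof (rule tendstoI)
        fix e :: real assume e: "0 < e"
        have "eventually (\<lambda>j. \<forall>s\<in>{0..t}. \<bar>M_proc (K j) (f j) s \<omega> - Y s \<omega>\<bar> \<le> e / 2) sequentially"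
          using elim[rule_format, OF that, of "e / 2"] e by (simp only: half_gt_zero)
        then show "eventually (\<lambda>n. dist (V n t \<omega>) (Y t \<omega>) < e) sequentially"
        proof eventually_elim
          case (elim n)
          then have "\<bar>V n t \<omega> - Y t \<omega>\<bar> \<le> e / 2" using that by (auto simp: V_def)
          then show ?case using e by (simp add: dist_real_def)
        qed
      qed
      show ?case unfolding W_def mult_1 using ts0 by (intro tendsto_intros lim) auto
    qed
  qed (use C in \<open>auto simp: W_def\<close>)
  then show ?thesis by (simp add: w'_def prod_ennreal)
qed

section \<open>Convergence of decreasing jump profiles\<close>

definition kfun :: "real \<Rightarrow> real" where "kfun x = exp (- x) - 1 + x"

lemma kfun_nonneg: "0 \<le> kfun x"
  using exp_ge_add_one_self[of "- x"] by (simp add: kfun_def)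

lemma kfun_0[simp]: "kfun 0 = 0" by (simp add: kfun_def)

lemma kfun_deriv: "(kfun has_real_derivative 1 - exp (- x)) (at x)"
  unfolding kfun_def by (auto intro!: derivative_eq_intros)

lemma borel_measurable_kfun[measurable]: "kfun \<in> borel_measurable borel"
  unfolding kfun_def[abs_def] by measurable

lemma isCont_kfun: "isCont kfun x" by (rule DERIV_isCont[OF kfun_deriv])

lemma kap_eq: "kap f l = (\<integral>u. kfun (l * f u) \<partial>lborel)"
  by (simp add: kap_def kfun_def)

text \<open>The function \<open>kfun\<close> is quadratic near 0 and linear at infinity. The
  constant 4 lets the derivatives be compared on either side of 1, starting from 4 exp(-1) \<ge> 1
  at the point 1.\<close>

lemma min_le_kfun:
  assumes x: "0 \<le> x" shows "min x (x\<^sup>2) \<le> 4 * kfun x"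
proof (cases "x \<le> 1")
  case True
  define h where "h x = 4 * kfun x - x\<^sup>2" for x
  have "h 0 \<le> h x"
  proof (rule DERIV_nonneg_imp_nondecreasing[OF x])
    fix y assume y: "0 \<le> y" "y \<le> x"
    have "(h has_real_derivative 4 * (1 - exp (- y)) - 2 * y) (at y)"
      unfolding h_def by (auto intro!: derivative_eq_intros kfun_deriv)
    moreover have "0 \<le> 4 * (1 - exp (- y)) - 2 * y"
    proof -
      have "exp (- y) \<le> 1 - y / 2"
      proof -
        have "1 + y \<le> exp y" by (rule exp_ge_add_one_self)
        then have "exp (- y) \<le> 1 / (1 + y)" using y by (simp add: exp_minus field_simps)
        also have "\<dots> \<le> 1 - y / 2" using y True by (simp add: field_simps mult_left_le)
        finally show ?thesis .
      qed
      then show ?thesis by simp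
    qed
    ultimately show "\<exists>d. (h has_real_derivative d) (at y) \<and> 0 \<le> d" by blast
  qed
  then show ?thesis by (simp add: h_def)
next
  case False
  define h where "h x = 4 * kfun x - x" for x
  have "h 1 \<le> h x"
  proof (rule DERIV_nonneg_imp_nondecreasing[of 1 x h])
    show "1 \<le> x" using False by simp
    fix y assume y: "1 \<le> y" "y \<le> x"
    have "(h has_real_derivative 4 * (1 - exp (- y)) - 1) (at y)"
      unfolding h_def by (auto intro!: derivative_eq_intros kfun_deriv)
    moreover have "0 \<le> 4 * (1 - exp (- y)) - 1"
    proof -
      have "1 + y \<le> exp y" by (rule exp_ge_add_one_self)
      then have "exp (- y) \<le> 1 / (1 + y)" using y by (simp add: exp_minus field_simps)
      also have "\<dots> \<le> 1 / 2" using y by (simp add: field_simps)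
      finally show ?thesis by simp
    qed
    ultimately show "\<exists>d. (h has_real_derivative d) (at y) \<and> 0 \<le> d" by blast
  qed
  moreover have "0 \<le> h 1"
  proof -
    have "kfun 1 = exp (- 1)" by (simp add: kfun_def)
    moreover have "exp (1::real) \<le> 4" using exp_le by simp
    then have "1 / 4 \<le> exp (- (1::real))" by (simp add: exp_minus field_simps)
    ultimately show ?thesis by (simp add: h_def)
  qed
  ultimately show ?thesis by (simp add: h_def)
qed

definition mfun :: "real \<Rightarrow> real" where "mfun x = min \<bar>x\<bar> (x\<^sup>2)"

lemma jump_dist_eq: "jump_dist f = (\<integral>u. mfun (f u) \<partial>lborel)"
  by (simp add: jump_dist_def mfun_def)

lemma mfun_nonneg: "0 \<le> mfun x" by (simp add: mfun_def)

lemma borel_measurable_mfun[measurable]: "mfun \<in> borel_measurable borel"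
  unfolding mfun_def[abs_def] by measurable

lemma isCont_mfun: "isCont mfun x" unfolding mfun_def[abs_def] by (intro continuous_intros)

lemma mfun_mono: "\<bar>x\<bar> \<le> \<bar>y\<bar> \<Longrightarrow> mfun x \<le> mfun y"
  unfolding mfun_def by (intro min.mono) (auto simp: abs_le_square_iff)

lemma mfun_double: "mfun (2 * x) \<le> 4 * mfun x"
  unfolding mfun_def by (auto simp: min_def abs_mult power_mult_distrib)

text \<open>A substitute for the triangle inequality: |x - y| is at most twice the larger modulus,
  and doubling costs a factor 4.\<close>

lemma mfun_diff_le: "mfun (x - y) \<le> 4 * mfun x + 4 * mfun y"
proof -
  have "mfun (x - y) \<le> mfun (2 * max \<bar>x\<bar> \<bar>y\<bar>)" by (rule mfun_mono) auto
  also have "\<dots> \<le> 4 * mfun (max \<bar>x\<bar> \<bar>y\<bar>)" by (rule mfun_double)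
  also have "mfun (max \<bar>x\<bar> \<bar>y\<bar>) \<le> mfun x + mfun y"
    using mfun_nonneg[of x] mfun_nonneg[of y] by (cases "\<bar>x\<bar> \<le> \<bar>y\<bar>") (auto simp: mfun_def max_def)
  finally show ?thesis by simp
qed

lemma mfun_le_kfun: "0 \<le> x \<Longrightarrow> mfun x \<le> 4 * kfun x"
  using min_le_kfun[of x] by (simp add: mfun_def)

text \<open>A continuous version of the indicator of low y. At y = exp(-h) it is 1 where h is at
  least x2, 0 where h is at most x1, for the levels y1 = exp(-x1) and y2 = exp(-x2).\<close>

definition level_cut :: "real \<Rightarrow> real \<Rightarrow> real \<Rightarrow> real" where
  "level_cut y1 y2 y = max 0 (min 1 ((y1 - y) / (y1 - y2)))"

text \<open>A decreasing function is determined by the lengths of its level sets, and these are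
  determined by the exponents. Strict decrease and surjectivity of the limit g rule out flat pieces
  and jumps, where pointwise convergence could fail.\<close>

locale decreasing_profiles =
  fixes gs :: "nat \<Rightarrow> real \<Rightarrow> real" and g :: "real \<Rightarrow> real"
  assumes meas[measurable]: "\<And>n. gs n \<in> borel_measurable borel" "g \<in> borel_measurable borel"
    and nonneg: "\<And>n u. 0 \<le> gs n u" "\<And>u. 0 \<le> g u"
    and zero: "\<And>n u. u \<le> 0 \<Longrightarrow> gs n u = 0" "\<And>u. u \<le> 0 \<Longrightarrow> g u = 0"
    and dec: "\<And>n u v. 0 < u \<Longrightarrow> u \<le> v \<Longrightarrow> gs n v \<le> gs n u"
    and sdec: "\<And>u v. 0 < u \<Longrightarrow> u < v \<Longrightarrow> g v < g u"
    and onto: "\<And>x. 0 < x \<Longrightarrow> \<exists>v>0. g v = x"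
    and int: "\<And>n l. 0 \<le> l \<Longrightarrow> integrable lborel (\<lambda>u. kfun (l * gs n u))" "\<And>l. 0 \<le> l \<Longrightarrow> integrable lborel (\<lambda>u. kfun (l * g u))"
    and conv: "\<And>l. 0 \<le> l \<Longrightarrow> (\<lambda>n. kap (gs n) l) \<longlonglongrightarrow> kap g l"
begin

text \<open>The second difference of k(jx) in j is (1 - exp(-x))^2 exp(-jx), so polynomials in exp(-x)
  times (1 - exp(-x))^2 are linear combinations of the functions whose integrals converge.\<close>

lemma second_difference:
  "exp (- x) ^ j * (1 - exp (- x))\<^sup>2 = kfun (real j * x) - 2 * kfun (real (j + 1) * x) + kfun (real (j + 2) * x)"
proof -
  have k: "kfun (real m * x) = exp (- x) ^ m - 1 + real m * x" for m
    using exp_of_nat_mult[of m "- x"] by (simp add: kfun_def)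
  show ?thesis unfolding k by (simp add: power2_eq_square algebra_simps power_add)
qed

lemma int_diff:
  assumes "h \<in> insert g (range gs)"
  shows "integrable lborel (\<lambda>u. exp (- h u) ^ j * (1 - exp (- h u))\<^sup>2)"
    and "(\<integral>u. exp (- h u) ^ j * (1 - exp (- h u))\<^sup>2 \<partial>lborel) = kap h (real j) - 2 * kap h (real (j + 1)) + kap h (real (j + 2))"
  unfolding second_difference kap_eq using assms int by auto

lemma poly_conv:
  "(\<lambda>n. \<integral>u. (\<Sum>i\<le>N. a i * exp (- gs n u) ^ i) * (1 - exp (- gs n u))\<^sup>2 \<partial>lborel)
    \<longlonglongrightarrow> (\<integral>u. (\<Sum>i\<le>N. a i * exp (- g u) ^ i) * (1 - exp (- g u))\<^sup>2 \<partial>lborel)"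
proof -
  have eq: "(\<integral>u. (\<Sum>i\<le>N. a i * exp (- h u) ^ i) * (1 - exp (- h u))\<^sup>2 \<partial>lborel)
      = (\<Sum>i\<le>N. a i * (kap h (real i) - 2 * kap h (real (i + 1)) + kap h (real (i + 2))))" if "h \<in> insert g (range gs)" for h
  proof -
    have "(\<integral>u. (\<Sum>i\<le>N. a i * exp (- h u) ^ i) * (1 - exp (- h u))\<^sup>2 \<partial>lborel)
       = (\<integral>u. (\<Sum>i\<le>N. a i * (exp (- h u) ^ i * (1 - exp (- h u))\<^sup>2)) \<partial>lborel)"
      by (simp add: sum_distrib_right mult.assoc)
    also have "\<dots> = (\<Sum>i\<le>N. a i * (\<integral>u. exp (- h u) ^ i * (1 - exp (- h u))\<^sup>2 \<partial>lborel))"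
      using int_diff(1)[OF that] by (subst Bochner_Integration.integral_sum) auto
    finally show ?thesis using int_diff(2)[OF that] by simp
  qed
  show ?thesis
    by (subst (1 2) eq) (auto intro!: tendsto_intros conv)
qed

text \<open>By Stone-Weierstrass f is uniformly close to a polynomial on [0,1]. The weights (1 -
  exp(-h))^2 have bounded total mass along the sequence, so the error is uniform in n.\<close>

lemma cont_conv:
  assumes f: "continuous_on {0..1} f"
  shows "(\<lambda>n. \<integral>u. f (exp (- gs n u)) * (1 - exp (- gs n u))\<^sup>2 \<partial>lborel)
    \<longlonglongrightarrow> (\<integral>u. f (exp (- g u)) * (1 - exp (- g u))\<^sup>2 \<partial>lborel)"
proof (rule tendstoI)
  fix e :: real assume e: "0 < e"
  define w where "w h u = (1 - exp (- h u))\<^sup>2" for h :: "real \<Rightarrow> real" and u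
  have wint: "integrable lborel (w h)" if "h \<in> insert g (range gs)" for h
    using int_diff(1)[OF that, of 0] by (simp add: w_def[abs_def])
  have w0: "0 \<le> w h u" for h u by (simp add: w_def)
  have wconv: "(\<lambda>n. integral\<^sup>L lborel (w (gs n))) \<longlonglongrightarrow> integral\<^sup>L lborel (w g)"
    using poly_conv[where N=0 and a="\<lambda>_. 1"] by (simp add: w_def[abs_def])
  then have "Bseq (\<lambda>n. integral\<^sup>L lborel (w (gs n)))" by (intro convergent_imp_Bseq) (auto simp: convergent_def)
  then obtain C0 where C0: "0 < C0" "\<And>n. \<bar>integral\<^sup>L lborel (w (gs n))\<bar> \<le> C0" unfolding Bseq_def by auto
  \<comment> \<open>Bounds the masses of all weights, that of the limit included, so the tolerance
    e/(4C) costs e/4 on either side.\<close>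
  define C where "C = C0 + \<bar>integral\<^sup>L lborel (w g)\<bar>"
  have C: "0 < C" "\<bar>integral\<^sup>L lborel (w h)\<bar> \<le> C" if "h \<in> insert g (range gs)" for h
    using C0 that unfolding C_def by (auto intro: add_increasing2)
  have Cpos: "0 < C" using C(1)[of g] by simp
  define \<delta> where "\<delta> = e / (4 * C)"
  have \<delta>: "0 < \<delta>" using e Cpos by (simp add: \<delta>_def)
  obtain p where "real_polynomial_function p" and p: "\<And>x. x \<in> {0..1} \<Longrightarrow> \<bar>f x - p x\<bar> < \<delta>"
    using Stone_Weierstrass_real_polynomial_function[OF _ f \<delta>] by auto
  then obtain a N where pa: "p = (\<lambda>x. \<Sum>i\<le>N. a i * x ^ i)" unfolding real_polynomial_function_iff_sum by blast
  have y01: "exp (- h u) \<in> {0..1}" if "h \<in> insert g (range gs)" for h u using that nonneg by auto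
  obtain B where B: "\<And>x. x \<in> {0..1} \<Longrightarrow> \<bar>f x\<bar> \<le> B"
    using compact_imp_bounded[OF compact_continuous_image[OF f compact_Icc]] unfolding bounded_iff
    by (metis image_eqI real_norm_def)
  have fm: "(\<lambda>u. f (exp (- h u))) \<in> borel_measurable borel" if h: "h \<in> insert g (range gs)" for h
  proof -
    have [measurable]: "h \<in> borel_measurable borel" using h by auto
    have "(\<lambda>y. indicator {0..1} y *\<^sub>R f y) \<in> borel_measurable borel"
      by (rule borel_measurable_continuous_on_indicator[OF _ f]) simp
    then have "(\<lambda>u. indicator {0..1} (exp (- h u)) *\<^sub>R f (exp (- h u))) \<in> borel_measurable borel"
      by (rule measurable_compose[rotated]) measurable
    moreover have "(\<lambda>u. indicator {0..1} (exp (- h u)) *\<^sub>R f (exp (- h u))) = (\<lambda>u. f (exp (- h u)))"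
      using y01[OF h] by (intro ext) (simp only: indicator_simps scaleR_one)
    ultimately show ?thesis by simp
  qed
  have fint: "integrable lborel (\<lambda>u. f (exp (- h u)) * w h u)" if h: "h \<in> insert g (range gs)" for h
  proof (rule Bochner_Integration.integrable_bound)
    show "integrable lborel (\<lambda>u. B * w h u)" using wint[OF h] by simp
    have [measurable]: "h \<in> borel_measurable borel" using h by auto
    show "(\<lambda>u. f (exp (- h u)) * w h u) \<in> borel_measurable lborel" using fm[OF h] unfolding w_def by measurable
    show "AE u in lborel. norm (f (exp (- h u)) * w h u) \<le> norm (B * w h u)"
    proof (rule AE_I2)
      fix u
      have "\<bar>f (exp (- h u))\<bar> \<le> \<bar>B\<bar>" using B[OF y01[OF h, of u]] by simp
      then show "norm (f (exp (- h u)) * w h u) \<le> norm (B * w h u)"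
        using w0[of h u] by (simp add: abs_mult mult_right_mono)
    qed
  qed
  have pint: "integrable lborel (\<lambda>u. p (exp (- h u)) * w h u)" if h: "h \<in> insert g (range gs)" for h
    unfolding pa w_def sum_distrib_right mult.assoc using int_diff(1)[OF h] by auto
  have near: "\<bar>(\<integral>u. f (exp (- h u)) * w h u \<partial>lborel) - (\<integral>u. p (exp (- h u)) * w h u \<partial>lborel)\<bar> \<le> e / 4" if h: "h \<in> insert g (range gs)" for h
  proof -
    have "\<bar>(\<integral>u. f (exp (- h u)) * w h u \<partial>lborel) - (\<integral>u. p (exp (- h u)) * w h u \<partial>lborel)\<bar>
       = \<bar>\<integral>u. f (exp (- h u)) * w h u - p (exp (- h u)) * w h u \<partial>lborel\<bar>"
      using fint[OF h] pint[OF h] by simp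
    also have "\<dots> \<le> (\<integral>u. \<bar>f (exp (- h u)) * w h u - p (exp (- h u)) * w h u\<bar> \<partial>lborel)" by (rule integral_abs_bound)
    also have "\<dots> \<le> (\<integral>u. \<delta> * w h u \<partial>lborel)"
    proof (rule integral_mono)
      fix u
      have "\<bar>f (exp (- h u)) - p (exp (- h u))\<bar> * w h u \<le> \<delta> * w h u"
        using p[OF y01[OF h, of u]] w0 by (intro mult_right_mono) auto
      then show "\<bar>f (exp (- h u)) * w h u - p (exp (- h u)) * w h u\<bar> \<le> \<delta> * w h u"
        using w0[of h u] by (simp add: left_diff_distrib[symmetric] abs_mult)
    qed (use fint[OF h] pint[OF h] wint[OF h] in auto)
    also have "\<dots> = \<delta> * integral\<^sup>L lborel (w h)" by simp
    also have "\<dots> \<le> \<delta> * C" using C(2)[OF h] \<delta> by (intro mult_left_mono) auto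
    also have "\<dots> = e / 4" using Cpos by (simp add: \<delta>_def)
    finally show ?thesis .
  qed
  have "(\<lambda>n. \<integral>u. p (exp (- gs n u)) * w (gs n) u \<partial>lborel) \<longlonglongrightarrow> (\<integral>u. p (exp (- g u)) * w g u \<partial>lborel)"
    unfolding pa w_def by (rule poly_conv)
  then have "eventually (\<lambda>n. dist (\<integral>u. p (exp (- gs n u)) * w (gs n) u \<partial>lborel) (\<integral>u. p (exp (- g u)) * w g u \<partial>lborel) < e / 4) sequentially"
    using e by (intro tendstoD) auto
  then have "eventually (\<lambda>n. dist (\<integral>u. f (exp (- gs n u)) * w (gs n) u \<partial>lborel) (\<integral>u. f (exp (- g u)) * w g u \<partial>lborel) < e) sequentially"
  proof eventually_elim
    case (elim n)
    have n1: "gs n \<in> insert g (range gs)" and n2: "g \<in> insert g (range gs)" by auto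
    show ?case using near[OF n1] near[OF n2] elim e unfolding dist_real_def abs_le_iff abs_less_iff by linarith
  qed
  then show "eventually (\<lambda>n. dist (\<integral>u. f (exp (- gs n u)) * (1 - exp (- gs n u))\<^sup>2 \<partial>lborel) (\<integral>u. f (exp (- g u)) * (1 - exp (- g u))\<^sup>2 \<partial>lborel) < e) sequentially"
    by (simp add: w_def)
qed

text \<open>The cut vanishes for y near 1, where the weight (1 - y)^2 degenerates, so the weight can
  be divided out and continuity is preserved.\<close>

lemma cut_conv:
  assumes x: "0 < x1" "x1 < x2"
  shows "(\<lambda>n. \<integral>u. level_cut (exp (- x1)) (exp (- x2)) (exp (- gs n u)) \<partial>lborel)
    \<longlonglongrightarrow> (\<integral>u. level_cut (exp (- x1)) (exp (- x2)) (exp (- g u)) \<partial>lborel)"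
    and "h \<in> insert g (range gs) \<Longrightarrow> integrable lborel (\<lambda>u. level_cut (exp (- x1)) (exp (- x2)) (exp (- h u)))"
proof -
  define y1 where "y1 = exp (- x1)"
  define y2 where "y2 = exp (- x2)"
  have y: "0 < y2" "y2 < y1" "y1 < 1" using x by (auto simp: y1_def y2_def)
  \<comment> \<open>The maximum keeps the denominator away from 0; it differs from 1 - y only for y
    > y1, where the numerator is 0.\<close>
  define f where "f y = level_cut y1 y2 y / (max (1 - y) (1 - y1))\<^sup>2" for y
  have ne: "max (1 - t) (1 - y1) \<noteq> 0" for t using y by (auto simp: max_def)
  have cf: "continuous_on {0..1} f"
    unfolding f_def[abs_def] level_cut_def using y ne by (intro continuous_intros) auto
  have eq: "f t * (1 - t)\<^sup>2 = level_cut y1 y2 t" for t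
  proof (cases "t \<le> y1")
    case True
    then have "max (1 - t) (1 - y1) = 1 - t" "1 - t \<noteq> 0" using y by auto
    then show ?thesis by (simp add: f_def)
  next
    case False
    then have "(y1 - t) / (y1 - y2) \<le> 0" using y by (intro divide_nonpos_pos) auto
    then have "level_cut y1 y2 t = 0" by (simp add: level_cut_def)
    then show ?thesis by (simp add: f_def)
  qed
  show "(\<lambda>n. \<integral>u. level_cut (exp (- x1)) (exp (- x2)) (exp (- gs n u)) \<partial>lborel)
    \<longlonglongrightarrow> (\<integral>u. level_cut (exp (- x1)) (exp (- x2)) (exp (- g u)) \<partial>lborel)"
    using cont_conv[OF cf] unfolding eq y1_def[symmetric] y2_def[symmetric] .
  assume h: "h \<in> insert g (range gs)"
  have [measurable]: "h \<in> borel_measurable borel" using h by auto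
  have "integrable lborel (\<lambda>u. (1 - exp (- h u))\<^sup>2 / (1 - y1)\<^sup>2)" using int_diff(1)[OF h, of 0] by simp
  then have "integrable lborel (\<lambda>u. level_cut y1 y2 (exp (- h u)))"
  proof (rule Bochner_Integration.integrable_bound)
    show "(\<lambda>u. level_cut y1 y2 (exp (- h u))) \<in> borel_measurable lborel" unfolding level_cut_def by measurable
    show "AE u in lborel. norm (level_cut y1 y2 (exp (- h u))) \<le> norm ((1 - exp (- h u))\<^sup>2 / (1 - y1)\<^sup>2)"
    proof (rule AE_I2)
      fix u
      define t where "t = exp (- h u)"
      have l01: "0 \<le> level_cut y1 y2 t" "level_cut y1 y2 t \<le> 1" by (auto simp: level_cut_def)
      have "level_cut y1 y2 t \<le> (1 - t)\<^sup>2 / (1 - y1)\<^sup>2"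
      proof (cases "t \<le> y1")
        case True
        then have "(1 - y1)\<^sup>2 \<le> (1 - t)\<^sup>2" using y by (intro power_mono) auto
        then have "1 \<le> (1 - t)\<^sup>2 / (1 - y1)\<^sup>2" using y by simp
        then show ?thesis using l01 by linarith
      next
        case False
        then have "(y1 - t) / (y1 - y2) \<le> 0" using y by (intro divide_nonpos_pos) auto
    then have "level_cut y1 y2 t = 0" by (simp add: level_cut_def)
        then show ?thesis by simp
      qed
      then show "norm (level_cut y1 y2 (exp (- h u))) \<le> norm ((1 - exp (- h u))\<^sup>2 / (1 - y1)\<^sup>2)"
        using l01 by (simp add: t_def)
    qed
  qed
  then show "integrable lborel (\<lambda>u. level_cut (exp (- x1)) (exp (- x2)) (exp (- h u)))" by (simp add: y1_def y2_def)
qed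

lemma level_cut_bounds:
  assumes "x1 < x2"
  shows "0 \<le> level_cut (exp (- x1)) (exp (- x2)) (exp (- z))" "level_cut (exp (- x1)) (exp (- x2)) (exp (- z)) \<le> 1"
    "x2 \<le> z \<Longrightarrow> level_cut (exp (- x1)) (exp (- x2)) (exp (- z)) = 1"
    "z \<le> x1 \<Longrightarrow> level_cut (exp (- x1)) (exp (- x2)) (exp (- z)) = 0"
proof -
  have lt: "exp (- x2) < exp (- x1)" using assms by simp
  show "x2 \<le> z \<Longrightarrow> level_cut (exp (- x1)) (exp (- x2)) (exp (- z)) = 1"
    using lt by (simp add: level_cut_def)
  assume "z \<le> x1"
  then have "(exp (- x1) - exp (- z)) / (exp (- x1) - exp (- x2)) \<le> 0" using lt by (intro divide_nonpos_pos) auto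
  then show "level_cut (exp (- x1)) (exp (- x2)) (exp (- z)) = 0" by (simp add: level_cut_def)
qed (auto simp: level_cut_def)

text \<open>L x1 x2 h lies between the lengths of {h \<ge> x2} and {h > x1}. If gs n u stayed above,
  or below, a level separated from g u, monotonicity would push this length to the wrong side of
  u.\<close>

lemma pointwise_conv: "(\<lambda>n. gs n u) \<longlonglongrightarrow> g u"
proof (cases "u \<le> 0")
  case True
  then show ?thesis by (simp add: zero)
next
  case False
  then have u: "0 < u" by simp
  define L where "L x1 x2 h = (\<integral>u. level_cut (exp (- x1)) (exp (- x2)) (exp (- h u)) \<partial>lborel)" for x1 x2 :: real and h :: "real \<Rightarrow> real"
  have ge: "v \<le> L x1 x2 h" if "0 < x1" "x1 < x2" "0 \<le> v" "\<And>t. 0 < t \<Longrightarrow> t < v \<Longrightarrow> x2 \<le> h t" "h \<in> insert g (range gs)" for v x1 x2 h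
  proof -
    have "v = (\<integral>t. indicator {0<..<v} t \<partial>lborel)" using that by simp
    also have "\<dots> \<le> L x1 x2 h" unfolding L_def
    proof (rule integral_mono[OF _ cut_conv(2)[OF that(1,2,5)]])
      show "integrable lborel (indicator {0<..<v} :: real \<Rightarrow> real)" by (rule integrable_real_indicator) (use that(3) in auto)
      show "indicator {0<..<v} t \<le> level_cut (exp (- x1)) (exp (- x2)) (exp (- h t))" for t
        using level_cut_bounds[OF that(2)] that(4)[of t] by (auto simp: indicator_def)
    qed
    finally show ?thesis .
  qed
  have le: "L x1 x2 h \<le> v" if "0 < x1" "x1 < x2" "0 \<le> v" "\<And>t. v \<le> t \<Longrightarrow> h t \<le> x1" "\<And>t. t \<le> 0 \<Longrightarrow> h t = 0" "h \<in> insert g (range gs)" for v x1 x2 h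
  proof -
    have "L x1 x2 h \<le> (\<integral>t. indicator {0..v} t \<partial>lborel)" unfolding L_def
    proof (rule integral_mono[OF cut_conv(2)[OF that(1,2,6)]])
      show "integrable lborel (indicator {0..v} :: real \<Rightarrow> real)" by (rule integrable_real_indicator) (use that(3) in auto)
      fix t :: real
      have "level_cut (exp (- x1)) (exp (- x2)) (exp (- h t)) = 0" if "t \<notin> {0..v}"
        using that \<open>\<And>t. v \<le> t \<Longrightarrow> h t \<le> x1\<close>[of t] \<open>\<And>t. t \<le> 0 \<Longrightarrow> h t = 0\<close>[of t] \<open>0 < x1\<close>
        by (intro level_cut_bounds(4)[OF \<open>x1 < x2\<close>]) force
      then show "level_cut (exp (- x1)) (exp (- x2)) (exp (- h t)) \<le> indicator {0..v} t"
        using level_cut_bounds(2)[OF that(2), of "h t"] by (cases "t \<in> {0..v}") auto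
    qed
    also have "\<dots> = v" using that by simp
    finally show ?thesis .
  qed
  have Lconv: "(\<lambda>n. L x1 x2 (gs n)) \<longlonglongrightarrow> L x1 x2 g" if "0 < x1" "x1 < x2" for x1 x2
    unfolding L_def by (rule cut_conv(1)[OF that])
  have gpos: "0 < g u" using sdec[OF u, of "u + 1"] nonneg(2)[of "u + 1"] by simp
  show ?thesis
  proof (rule order_tendstoI)
    fix x assume x: "g u < x"
    \<comment> \<open>A level strictly between g u and x; g takes it at some v < u, so the limiting
      length is at most v, while gs n u \<ge> x would force length at least u.\<close>
    define x1 where "x1 = (g u + x) / 2"
    have x1: "g u < x1" "x1 < x" "0 < x1" using x gpos by (auto simp: x1_def)
    obtain v where v: "0 < v" "g v = x1" using onto[OF x1(3)] by blast
    have vu: "v < u" using sdec[OF u, of v] v x1 by (metis linorder_neqE_linordered_idom order_less_asym)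
    have "g t \<le> x1" if "v \<le> t" for t using sdec[OF v(1), of t] v(2) that by (cases "v = t") auto
    then have "L x1 x g \<le> v" using x1 v zero by (intro le) auto
    then have "eventually (\<lambda>n. L x1 x (gs n) < u) sequentially"
      using vu by (intro order_tendstoD(2)[OF Lconv]) (use x1 in auto)
    then show "eventually (\<lambda>n. gs n u < x) sequentially"
    proof eventually_elim
      case (elim n)
      show ?case
      proof (rule ccontr)
        assume "\<not> gs n u < x"
        then have "x \<le> gs n t" if "0 < t" "t < u" for t using dec[of t u n] that by linarith
        then have "u \<le> L x1 x (gs n)" using x1 u by (intro ge) auto
        then show False using elim by simp
      qed
    qed
  next
    fix x assume x: "x < g u"
    \<comment> \<open>The maximum with 0 keeps the levels positive, as x may be negative. Here g
      takes the level x2 at some v > u.\<close>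
    define x1 where "x1 = (max x 0 + g u) / 2"
    define x2 where "x2 = (x1 + g u) / 2"
    have x12: "x < x1" "0 < x1" "x1 < x2" "x2 < g u" using x gpos by (auto simp: x1_def x2_def max_def)
    obtain v where v: "0 < v" "g v = x2" using onto[of x2] x12 by auto
    have vu: "u < v" using sdec[OF v(1), of u] v x12 by (metis linorder_neqE_linordered_idom order_less_asym)
    have "x2 \<le> g t" if "0 < t" "t < v" for t using sdec[OF that] v by simp
    then have "v \<le> L x1 x2 g" using x12 v by (intro ge) auto
    then have "eventually (\<lambda>n. u < L x1 x2 (gs n)) sequentially"
      using vu by (intro order_tendstoD(1)[OF Lconv]) (use x12 in auto)
    then show "eventually (\<lambda>n. x < gs n u) sequentially"
    proof eventually_elim
      case (elim n)
      show ?case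
      proof (rule ccontr)
        assume "\<not> x < gs n u"
        then have "gs n t \<le> x1" if "u \<le> t" for t using dec[of u t n] that u x12 by linarith
        then have "L x1 x2 (gs n) \<le> u" using x12 u zero by (intro le) auto
        then show False using elim by simp
      qed
    qed
  qed
qed

lemma mfun_diff_integrable: "integrable lborel (\<lambda>u. mfun (gs n u - g u))"
proof -
  have "integrable lborel (\<lambda>u. 16 * kfun (1 * gs n u) + 16 * kfun (1 * g u))" using int[of 1] by simp
  then show ?thesis
  proof (rule Bochner_Integration.integrable_bound)
    show "AE u in lborel. norm (mfun (gs n u - g u)) \<le> norm (16 * kfun (1 * gs n u) + 16 * kfun (1 * g u))"
    proof (rule AE_I2)
      fix u
      have "mfun (gs n u - g u) \<le> 16 * kfun (gs n u) + 16 * kfun (g u)"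
        using mfun_diff_le[of "gs n u" "g u"] mfun_le_kfun[OF nonneg(1)[of n u]] mfun_le_kfun[OF nonneg(2)[of u]] by linarith
      then show "norm (mfun (gs n u - g u)) \<le> norm (16 * kfun (1 * gs n u) + 16 * kfun (1 * g u))"
        using mfun_nonneg by simp
    qed
  qed measurable
qed

text \<open>Scheffe's lemma for the nonnegative functions k(gs n), whose integrals converge to that
  of k(g), gives L1 convergence. The distance integrand is bounded by 16 |F - f| + 32 f; the part
  below 32 f is treated by dominated convergence.\<close>

lemma jump_dist_conv: "(\<lambda>n. jump_dist (\<lambda>u. gs n u - g u)) \<longlonglongrightarrow> 0"
proof -
  define F where "F n u = kfun (gs n u)" for n u
  define f where "f u = kfun (g u)" for u
  have i: "integrable lborel (F n)" "integrable lborel f" for n using int[of 1] by (simp_all add: F_def[abs_def] f_def[abs_def])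
  have "(\<lambda>n. \<integral>\<^sup>+u. norm (F n u - f u) \<partial>lborel) \<longlonglongrightarrow> 0"
  proof (rule Scheffe_lemma1[OF i])
    have "(\<lambda>n. F n u) \<longlonglongrightarrow> f u" for u
      unfolding F_def f_def by (rule isCont_tendsto_compose[OF isCont_kfun pointwise_conv])
    then show "AE u in lborel. (\<lambda>n. F n u) \<longlonglongrightarrow> f u" by simp
    have n1: "(\<integral>\<^sup>+u. norm (F n u) \<partial>lborel) = ennreal (kap (gs n) 1)" for n
    proof -
      have "(\<integral>\<^sup>+u. norm (F n u) \<partial>lborel) = (\<integral>\<^sup>+u. ennreal (F n u) \<partial>lborel)" by (simp add: F_def kfun_nonneg)
      also have "\<dots> = ennreal (integral\<^sup>L lborel (F n))" by (rule nn_integral_eq_integral[OF i(1)]) (simp add: F_def kfun_nonneg)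
      finally show ?thesis by (simp add: kap_eq F_def[abs_def])
    qed
    have n2: "(\<integral>\<^sup>+u. norm (f u) \<partial>lborel) = ennreal (kap g 1)"
    proof -
      have "(\<integral>\<^sup>+u. norm (f u) \<partial>lborel) = (\<integral>\<^sup>+u. ennreal (f u) \<partial>lborel)" by (simp add: f_def kfun_nonneg)
      also have "\<dots> = ennreal (integral\<^sup>L lborel f)" by (rule nn_integral_eq_integral[OF i(2)]) (simp add: f_def kfun_nonneg)
      finally show ?thesis by (simp add: kap_eq f_def[abs_def])
    qed
    have "(\<lambda>n. ennreal (kap (gs n) 1)) \<longlonglongrightarrow> ennreal (kap g 1)" by (intro tendsto_ennrealI conv) simp
    then show "limsup (\<lambda>n. \<integral>\<^sup>+u. norm (F n u) \<partial>lborel) \<le> (\<integral>\<^sup>+u. norm (f u) \<partial>lborel)"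
      unfolding n1 n2 using lim_imp_Limsup[OF sequentially_bot] by (metis order_refl)
  qed
  then have "(\<lambda>n. enn2real (\<integral>\<^sup>+u. norm (F n u - f u) \<partial>lborel)) \<longlonglongrightarrow> 0"
    by (intro tendsto_enn2real) simp_all
  moreover have "enn2real (\<integral>\<^sup>+u. norm (F n u - f u) \<partial>lborel) = (\<integral>u. \<bar>F n u - f u\<bar> \<partial>lborel)" for n
    using i by (subst nn_integral_eq_integral) auto
  ultimately have L1: "(\<lambda>n. 16 * (\<integral>u. \<bar>F n u - f u\<bar> \<partial>lborel)) \<longlonglongrightarrow> 0" by (simp add: tendsto_mult_right_zero)
  \<comment> \<open>Truncation at 32 f supplies the integrable majorant; what exceeds it is absorbed
    by 16 |F - f|.\<close>
  define H where "H n u = min (mfun (gs n u - g u)) (32 * f u)" for n u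
  have f32: "integrable lborel (\<lambda>u. 32 * f u)" using i by simp
  have Hint: "integrable lborel (H n)" for n
    unfolding H_def by (intro Bochner_Integration.integrable_min mfun_diff_integrable f32)
  have L2: "(\<lambda>n. \<integral>u. H n u \<partial>lborel) \<longlonglongrightarrow> (\<integral>u. 0 \<partial>(lborel :: real measure))"
  proof (rule integral_dominated_convergence[OF _ _ f32])
    have "(\<lambda>n. H n u) \<longlonglongrightarrow> 0" for u
    proof -
      have "(\<lambda>n. gs n u - g u) \<longlonglongrightarrow> 0" using tendsto_diff[OF pointwise_conv[of u] tendsto_const[of "g u"]] by simp
      then have "(\<lambda>n. mfun (gs n u - g u)) \<longlonglongrightarrow> mfun 0" by (rule isCont_tendsto_compose[OF isCont_mfun])
      then have "(\<lambda>n. H n u) \<longlonglongrightarrow> min (mfun 0) (32 * f u)" unfolding H_def by (intro tendsto_min tendsto_const)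
      then show ?thesis by (simp add: mfun_def f_def kfun_nonneg)
    qed
    then show "AE u in lborel. (\<lambda>n. H n u) \<longlonglongrightarrow> 0" by simp
    show "AE u in lborel. norm (H n u) \<le> 32 * f u" for n
      by (intro AE_I2) (auto simp: H_def f_def kfun_nonneg mfun_nonneg min_def)
    show "H n \<in> borel_measurable lborel" for n using Hint by auto
  qed simp
  have bound: "jump_dist (\<lambda>u. gs n u - g u) \<le> 16 * (\<integral>u. \<bar>F n u - f u\<bar> \<partial>lborel) + (\<integral>u. H n u \<partial>lborel)" for n
  proof -
    have "jump_dist (\<lambda>u. gs n u - g u) \<le> (\<integral>u. 16 * \<bar>F n u - f u\<bar> + H n u \<partial>lborel)"
      unfolding jump_dist_eq
    proof (rule integral_mono[OF mfun_diff_integrable])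
      show "integrable lborel (\<lambda>u. 16 * \<bar>F n u - f u\<bar> + H n u)" using i Hint by auto
      fix u
      have "mfun (gs n u - g u) \<le> 16 * F n u + 16 * f u"
        using mfun_diff_le[of "gs n u" "g u"] mfun_le_kfun[OF nonneg(1)[of n u]] mfun_le_kfun[OF nonneg(2)[of u]]
        unfolding F_def f_def by linarith
      also have "\<dots> \<le> 16 * \<bar>F n u - f u\<bar> + 32 * f u"
      proof -
        define z where "z = \<bar>F n u - f u\<bar>"
        have "F n u - f u \<le> z" by (simp add: z_def)
        then show ?thesis unfolding z_def[symmetric] by linarith
      qed
      finally show "mfun (gs n u - g u) \<le> 16 * \<bar>F n u - f u\<bar> + H n u"
        unfolding H_def by (simp add: min_def)
    qed
    also have "\<dots> = 16 * (\<integral>u. \<bar>F n u - f u\<bar> \<partial>lborel) + (\<integral>u. H n u \<partial>lborel)" using i Hint by simp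
    finally show ?thesis .
  qed
  have "(\<lambda>n. 16 * (\<integral>u. \<bar>F n u - f u\<bar> \<partial>lborel) + (\<integral>u. H n u \<partial>lborel)) \<longlonglongrightarrow> 0" using tendsto_add[OF L1 L2] by simp
  then show ?thesis
    by (rule tendsto_sandwich[OF _ _ tendsto_const, rotated 2]) (auto intro!: always_eventually jump_dist_nonneg bound)
qed

lemma jump_dist_cauchy:
  assumes "0 < \<delta>"
  shows "\<exists>N. \<forall>m\<ge>N. \<forall>n\<ge>N. jump_dist (\<lambda>u. gs m u - gs n u) < \<delta>"
proof -
  \<comment> \<open>An eighth, because the quasi-triangle inequality multiplies each of the two
    distances by 4.\<close>
  have "eventually (\<lambda>n. jump_dist (\<lambda>u. gs n u - g u) < \<delta> / 8) sequentially"
    using order_tendstoD(2)[OF jump_dist_conv, of "\<delta> / 8"] assms by simp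
  then obtain N where N: "\<And>n. N \<le> n \<Longrightarrow> jump_dist (\<lambda>u. gs n u - g u) < \<delta> / 8" unfolding eventually_sequentially by blast
  have "jump_dist (\<lambda>u. gs m u - gs n u) < \<delta>" if "N \<le> m" "N \<le> n" for m n
  proof -
    have i: "integrable lborel (\<lambda>u. 4 * mfun (gs m u - g u) + 4 * mfun (gs n u - g u))"
      using mfun_diff_integrable by auto
    have le: "mfun (gs m u - gs n u) \<le> 4 * mfun (gs m u - g u) + 4 * mfun (gs n u - g u)" for u
      using mfun_diff_le[of "gs m u - g u" "gs n u - g u"] by simp
    have "jump_dist (\<lambda>u. gs m u - gs n u) \<le> (\<integral>u. 4 * mfun (gs m u - g u) + 4 * mfun (gs n u - g u) \<partial>lborel)"
      unfolding jump_dist_eq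
      by (intro integral_mono Bochner_Integration.integrable_bound[OF i] i le)
         (use le mfun_nonneg in \<open>auto intro!: AE_I2 intro: order_trans[OF _ abs_ge_self]\<close>)
    also have "\<dots> = 4 * jump_dist (\<lambda>u. gs m u - g u) + 4 * jump_dist (\<lambda>u. gs n u - g u)"
      unfolding jump_dist_eq using mfun_diff_integrable by simp
    also have "\<dots> < \<delta>" using N[OF that(1)] N[OF that(2)] by simp
    finally show ?thesis .
  qed
  then show ?thesis by blast
qed

end

section \<open>The stable scaling limit\<close>

text \<open>From t^\<alpha> \<le> (1+t)^\<alpha> \<le> t^\<alpha> + 1; after the substitution s = l
  t the transform of t^\<alpha> is a Gamma integral.\<close>

lemma Lap_powr_bounds:
  assumes \<alpha>: "0 < \<alpha>" "\<alpha> < 1" and l: "0 < l"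
  shows "Gamma (1 + \<alpha>) / l powr (1 + \<alpha>) \<le> Lap l (\<lambda>t. (1 + t) powr \<alpha>)"
    and "Lap l (\<lambda>t. (1 + t) powr \<alpha>) \<le> Gamma (1 + \<alpha>) / l powr (1 + \<alpha>) + 1 / l"
proof -
  have c1: "continuous_on {0..} (\<lambda>t::real. (1 + t) powr \<alpha>)" by (intro continuous_intros) auto
  have c2: "continuous_on {0..} (\<lambda>t::real. t powr \<alpha>)" using \<alpha> by (intro continuous_on_powr' continuous_intros) auto
  have le1: "t powr \<alpha> \<le> (1 + t) powr \<alpha>" if "0 \<le> t" for t :: real using that \<alpha> by (intro powr_mono2) auto
  have le2: "(1 + t) powr \<alpha> \<le> t powr \<alpha> + 1" if t: "0 \<le> t" for t :: real
  proof -
    have a: "x \<le> x powr \<alpha>" if "0 \<le> x" "x \<le> 1" for x :: real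
      using powr_mono'[of \<alpha> 1 x] that \<alpha> by simp
    \<comment> \<open>Subadditivity of the power: both fractions lie in [0,1], where x \<le>
      x^\<alpha>.\<close>
    have "1 = t / (1 + t) + 1 / (1 + t)" using t by (simp add: field_simps)
    also have "\<dots> \<le> (t / (1 + t)) powr \<alpha> + (1 / (1 + t)) powr \<alpha>"
      using t by (intro add_mono a) (auto simp: field_simps)
    also have "\<dots> = (t powr \<alpha> + 1) / (1 + t) powr \<alpha>" using t by (simp add: powr_divide add_divide_distrib)
    finally show ?thesis using t by (simp add: field_simps)
  qed
  have b1: "\<bar>(1 + t) powr \<alpha>\<bar> \<le> 1 * (1 + t)" if "0 \<le> t" for t
    using bernstein_fun_bounds[OF \<alpha> that, of 0] by (simp add: bernstein_fun_def)
  have b2: "\<bar>t powr \<alpha>\<bar> \<le> 1 * (1 + t)" if "0 \<le> t" for t using le1[OF that] b1[OF that] by simp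
  have int: "integrable lborel (\<lambda>t. indicator {0..} t * (exp (- l * t) * t powr \<alpha>))" by (rule Lap_integrable[OF l c2 b2])
  have "ennreal (Lap l (\<lambda>t. t powr \<alpha>)) = (\<integral>\<^sup>+t. ennreal (indicator {0..} t * (exp (- l * t) * t powr \<alpha>)) \<partial>lborel)"
    unfolding Lap_def by (rule nn_integral_eq_integral[symmetric, OF int]) (auto simp: indicator_def)
  also have "\<dots> = ennreal \<bar>1 / l\<bar> * (\<integral>\<^sup>+s. ennreal (indicator {0..} (0 + 1 / l * s) * (exp (- l * (0 + 1 / l * s)) * (0 + 1 / l * s) powr \<alpha>)) \<partial>lborel)"
    using l by (intro nn_integral_real_affine) auto
  also have "\<dots> = ennreal (1 / l) * (\<integral>\<^sup>+s. ennreal (1 / l powr \<alpha>) * ennreal (indicator {0..} s * s powr ((1 + \<alpha>) - 1) / exp s) \<partial>lborel)"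
  proof -
    have "indicator {0..} (0 + 1 / l * s) * (exp (- l * (0 + 1 / l * s)) * (0 + 1 / l * s) powr \<alpha>)
       = 1 / l powr \<alpha> * (indicator {0..} s * s powr ((1 + \<alpha>) - 1) / exp s)" for s
      using l by (auto simp: indicator_def powr_divide exp_minus field_simps zero_le_divide_iff)
    then show ?thesis using l by (simp add: ennreal_mult'[symmetric])
  qed
  also have "\<dots> = ennreal (1 / l) * (ennreal (1 / l powr \<alpha>) * ennreal (Gamma (1 + \<alpha>)))"
    using \<alpha> by (subst nn_integral_cmult) (auto simp: Gamma_conv_nn_integral_real)
  also have "\<dots> = ennreal (Gamma (1 + \<alpha>) / l powr (1 + \<alpha>))"
    using l \<alpha> by (simp add: ennreal_mult'[symmetric] powr_add field_simps)
  finally have "ennreal (Lap l (\<lambda>t. t powr \<alpha>)) = ennreal (Gamma (1 + \<alpha>) / l powr (1 + \<alpha>))" .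
  moreover have "0 \<le> Lap l (\<lambda>t. t powr \<alpha>)" by (rule Lap_nonneg) simp
  moreover have "0 \<le> Gamma (1 + \<alpha>) / l powr (1 + \<alpha>)" using \<alpha> by (intro divide_nonneg_nonneg less_imp_le[OF Gamma_real_pos]) auto
  ultimately have G: "Lap l (\<lambda>t. t powr \<alpha>) = Gamma (1 + \<alpha>) / l powr (1 + \<alpha>)" by (simp add: ennreal_inj)
  have "Lap l (\<lambda>t. t powr \<alpha>) \<le> Lap l (\<lambda>t. (1 + t) powr \<alpha>)" by (rule Lap_mono[OF l c2 c1 b2 b1 le1])
  then show "Gamma (1 + \<alpha>) / l powr (1 + \<alpha>) \<le> Lap l (\<lambda>t. (1 + t) powr \<alpha>)" using G by simp
  \<comment> \<open>The upper bound is padded with a zero term so that the three-term linearity rule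
    applies.\<close>
  have "Lap l (\<lambda>t. (1 + t) powr \<alpha>) \<le> Lap l (\<lambda>t. 1 * t powr \<alpha> + 1 * 1 + 0 * 0)"
  proof (rule Lap_mono[OF l c1 _ b1, where D=2])
    show "continuous_on {0..} (\<lambda>t::real. 1 * t powr \<alpha> + 1 * 1 + 0 * 0)"
      using continuous_on_add[OF c2 continuous_on_const[of _ 1]] by simp
    show "\<bar>1 * t powr \<alpha> + 1 * 1 + 0 * 0\<bar> \<le> 2 * (1 + t)" if "0 \<le> t" for t using b2[OF that] that by simp
    show "(1 + t) powr \<alpha> \<le> 1 * t powr \<alpha> + 1 * 1 + 0 * 0" if "0 \<le> t" for t using le2[OF that] by simp
  qed
  also have "\<dots> = 1 * Lap l (\<lambda>t. t powr \<alpha>) + 1 * Lap l (\<lambda>_. 1) + 0 * Lap l (\<lambda>_. 0)"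
    by (rule Lap_lincomb3[OF l c2]) (use b2 in auto)
  finally show "Lap l (\<lambda>t. (1 + t) powr \<alpha>) \<le> Gamma (1 + \<alpha>) / l powr (1 + \<alpha>) + 1 / l" using G Lap_const[OF l] by simp
qed

lemma psi_X_scaling:
  assumes \<alpha>: "0 < \<alpha>" "\<alpha> < 1"
  shows "((\<lambda>l. psi_X \<alpha> l / l powr (1 + \<alpha>)) \<longlongrightarrow> 1 / Gamma (1 + \<alpha>)) (at_right 0)"
proof -
  define G where "G = Gamma (1 + \<alpha>)"
  have G: "0 < G" using \<alpha> by (simp add: G_def Gamma_real_pos)
  have eq: "psi_X \<alpha> l / l powr (1 + \<alpha>) = 1 / (l powr (1 + \<alpha>) * Lap l (\<lambda>t. (1 + t) powr \<alpha>))" for l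
    by (simp add: psi_X_def mult.commute)
  have "((\<lambda>l. l powr (1 + \<alpha>) * Lap l (\<lambda>t. (1 + t) powr \<alpha>)) \<longlongrightarrow> G) (at_right 0)"
  proof (rule tendsto_sandwich[of "\<lambda>_. G" _ _ "\<lambda>l. G + l powr \<alpha>"])
    show "eventually (\<lambda>l. G \<le> l powr (1 + \<alpha>) * Lap l (\<lambda>t. (1 + t) powr \<alpha>)) (at_right 0)"
      using eventually_at_right_less[of "0::real"]
    proof eventually_elim
      case (elim l)
      then show ?case using Lap_powr_bounds(1)[OF \<alpha> elim] by (simp add: G_def field_simps)
    qed
    show "eventually (\<lambda>l. l powr (1 + \<alpha>) * Lap l (\<lambda>t. (1 + t) powr \<alpha>) \<le> G + l powr \<alpha>) (at_right 0)"
      using eventually_at_right_less[of "0::real"]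
    proof eventually_elim
      case (elim l)
      have "l powr (1 + \<alpha>) * Lap l (\<lambda>t. (1 + t) powr \<alpha>) \<le> l powr (1 + \<alpha>) * (G / l powr (1 + \<alpha>) + 1 / l)"
        using Lap_powr_bounds(2)[OF \<alpha> elim] elim by (intro mult_left_mono) (auto simp: G_def)
      also have "\<dots> = G + l powr \<alpha>" using elim by (simp add: field_simps powr_add)
      finally show ?case .
    qed
    have "((\<lambda>l. l powr \<alpha>) \<longlongrightarrow> 0) (at_right 0)" using \<alpha> by real_asymp
    then show "((\<lambda>l. G + l powr \<alpha>) \<longlongrightarrow> G) (at_right 0)" using tendsto_add[OF tendsto_const[of G]] by fastforce
  qed simp
  then have "((\<lambda>l. 1 / (l powr (1 + \<alpha>) * Lap l (\<lambda>t. (1 + t) powr \<alpha>))) \<longlongrightarrow> 1 / G) (at_right 0)"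
    using G by (intro tendsto_divide tendsto_const) auto
  then show ?thesis unfolding eq G_def .
qed

text \<open>The powers of n cancel in 2 n^(1+\<alpha>) (l/(2n))^(1+\<alpha>) = l^(1+\<alpha>) /
  2^\<alpha>, which is where the factor 2^\<alpha> of the stable exponent comes from.\<close>

lemma psi0_scaling_limit:
  assumes \<alpha>: "0 < \<alpha>" "\<alpha> < 1" and l: "0 \<le> l"
  shows "(\<lambda>n. 2 * real n powr (1 + \<alpha>) * psi0 \<alpha> (l / (2 * real n))) \<longlonglongrightarrow> stable_psi \<alpha> l"
proof (cases "l = 0")
  case True
  then show ?thesis by (simp add: psi0_def stable_psi_def)
next
  case False
  then have l: "0 < l" using l by simp
  have "filterlim (\<lambda>n. l / (2 * real n)) (at_right 0) sequentially" using l by real_asymp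
  from filterlim_compose[OF psi_X_scaling[OF \<alpha>] this]
  have "(\<lambda>n. psi_X \<alpha> (l / (2 * real n)) / (l / (2 * real n)) powr (1 + \<alpha>)) \<longlonglongrightarrow> 1 / Gamma (1 + \<alpha>)" .
  then have "(\<lambda>n. (l powr (1 + \<alpha>) / 2 powr \<alpha>) * (psi_X \<alpha> (l / (2 * real n)) / (l / (2 * real n)) powr (1 + \<alpha>)))
     \<longlonglongrightarrow> (l powr (1 + \<alpha>) / 2 powr \<alpha>) * (1 / Gamma (1 + \<alpha>))" by (intro tendsto_mult tendsto_const)
  also have "(l powr (1 + \<alpha>) / 2 powr \<alpha>) * (1 / Gamma (1 + \<alpha>)) = stable_psi \<alpha> l" by (simp add: stable_psi_def)
  finally show ?thesis
  proof (rule Lim_transform_eventually)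
    show "eventually (\<lambda>n. (l powr (1 + \<alpha>) / 2 powr \<alpha>) * (psi_X \<alpha> (l / (2 * real n)) / (l / (2 * real n)) powr (1 + \<alpha>))
      = 2 * real n powr (1 + \<alpha>) * psi0 \<alpha> (l / (2 * real n))) sequentially"
      using eventually_gt_at_top[of 0]
    proof eventually_elim
      case (elim n)
      have "(2::real) powr (1 + \<alpha>) = 2 * 2 powr \<alpha>" by (simp add: powr_add)
      then show ?case using elim l by (simp add: psi0_def powr_divide powr_mult field_simps)
    qed
  qed
qed

text \<open>The exponent has derivative 0 at 0: the increments of X are centred, which yields the
  mean lifetime 1/\<alpha>.\<close>

lemma psi_X_div_tendsto_0:
  assumes \<alpha>: "0 < \<alpha>" "\<alpha> < 1"
  shows "((\<lambda>l. psi_X \<alpha> l / l) \<longlongrightarrow> 0) (at_right 0)"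
proof -
  have "((\<lambda>l. l powr \<alpha>) \<longlongrightarrow> 0) (at_right 0)" using \<alpha> by real_asymp
  from tendsto_mult[OF psi_X_scaling[OF \<alpha>] this]
  have "((\<lambda>l. psi_X \<alpha> l / l powr (1 + \<alpha>) * l powr \<alpha>) \<longlongrightarrow> 0) (at_right 0)" by simp
  then show ?thesis
    by (rule Lim_transform_eventually) (auto simp: eventually_at_right_field powr_add intro!: exI[of _ 1])
qed

text \<open>The inverse of the Levy tail x^-(1+\<alpha>): jumps larger than x correspond to u <
  x^-(1+\<alpha>).\<close>

definition stable_profile0 :: "real \<Rightarrow> real \<Rightarrow> real" where
  "stable_profile0 \<alpha> u = (if 0 < u then u powr (- (1 / (1 + \<alpha>))) else 0)"

text \<open>With p = 1/(1+\<alpha>), k(x) \<le> x gives the integrable singularity u^(-p) at 0 as p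
  < 1, and k(x) \<le> x^2 gives the integrable tail u^(-2p) as 2p > 1. Both ends use the range of
  \<alpha>.\<close>

lemma stable_profile0_integrable:
  assumes \<alpha>: "0 < \<alpha>" "\<alpha> < 1"
  shows "integrable lborel (\<lambda>u. kfun (stable_profile0 \<alpha> u))"
proof -
  define p where "p = 1 / (1 + \<alpha>)"
  have p: "0 < p" "p < 1" "1 < 2 * p" using \<alpha> by (auto simp: p_def field_simps)
  let ?h = "\<lambda>u. indicator {0<..<1} u * u powr (- p) + indicator {1..} u * u powr (- 2 * p)"
  have k1: "kfun x \<le> x" if "0 \<le> x" for x using that by (simp add: kfun_def)
  have k2: "kfun x \<le> x\<^sup>2" if "0 \<le> x" for x
  proof (cases "x \<le> 1")
    case True
    then show ?thesis using exp_quadratic_bound[of "- x"] that by (simp add: kfun_def)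
  next
    case False
    then have "x * 1 \<le> x * x" by (intro mult_left_mono) auto
    then show ?thesis using k1[OF that] by (simp add: power2_eq_square)
  qed
  have i1: "integrable lborel (\<lambda>u. indicator {0<..<1} u * u powr (- p))"
  proof (rule integrableI_nonneg)
    have "(\<integral>\<^sup>+u. ennreal (indicator {0<..<1} u * u powr (- p)) \<partial>lborel) \<le> (\<integral>\<^sup>+u. ennreal (u powr (- p)) * indicator {0..1} u \<partial>lborel)"
      by (intro nn_integral_mono) (auto simp: indicator_def)
    also have "\<dots> < \<infinity>"
    proof -
      have "(\<lambda>u. u powr (- p)) absolutely_integrable_on {0..1}"
        using integrable_on_powr_from_0[of "- p" 1] p by (intro nonnegative_absolutely_integrable_1) auto
      then have "set_integrable lborel {0..1} (\<lambda>u. u powr (- p))"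
        unfolding absolutely_integrable_on_def set_integrable_def
        by (subst (asm) integrable_completion) (auto intro!: measurable_If)
      then show ?thesis unfolding set_integrable_def integrable_iff_bounded
        by (auto elim!: order.strict_trans1[rotated] intro!: nn_integral_mono simp: indicator_def)
    qed
    finally show "(\<integral>\<^sup>+u. ennreal (indicator {0<..<1} u * u powr (- p)) \<partial>lborel) < \<infinity>" .
  qed (auto simp: indicator_def)
  have i2: "integrable lborel (\<lambda>u. indicator {1..} u * u powr (- 2 * p))"
  proof (rule integrableI_nonneg)
    have "(\<integral>\<^sup>+u. ennreal (u powr (- 2 * p)) * indicator {1..} u \<partial>lborel) = 0 - 1 powr (1 - 2 * p) / (1 - 2 * p)"
    proof (rule nn_integral_FTC_atLeast[where F="\<lambda>u. u powr (1 - 2 * p) / (1 - 2 * p)"])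
      show "((\<lambda>u. u powr (1 - 2 * p) / (1 - 2 * p)) \<longlongrightarrow> 0) at_top" using p by real_asymp
      fix x :: real assume "1 \<le> x"
      then have "DERIV (\<lambda>u. u powr (1 - 2 * p) / (1 - 2 * p)) x :> (1 - 2 * p) * x powr (1 - 2 * p - 1) / (1 - 2 * p)"
        by (intro DERIV_cdivide has_real_derivative_powr) simp
      then show "DERIV (\<lambda>u. u powr (1 - 2 * p) / (1 - 2 * p)) x :> x powr (- 2 * p)"
        using p by simp
    qed auto
    then show "(\<integral>\<^sup>+u. ennreal (indicator {1..} u * u powr (- 2 * p)) \<partial>lborel) < \<infinity>"
      by (subst nn_integral_cong[of _ _ "\<lambda>u. ennreal (u powr (- 2 * p)) * indicator {1..} u"]) (auto simp: indicator_def)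
  qed (auto simp: indicator_def)
  have "integrable lborel ?h" using i1 i2 by simp
  then show ?thesis
  proof (rule Bochner_Integration.integrable_bound)
    show "(\<lambda>u. kfun (stable_profile0 \<alpha> u)) \<in> borel_measurable lborel" unfolding stable_profile0_def by measurable
    show "AE u in lborel. norm (kfun (stable_profile0 \<alpha> u)) \<le> norm (?h u)"
    proof (rule AE_I2)
      fix u :: real
      consider "u \<le> 0" | "0 < u" "u < 1" | "1 \<le> u" by linarith
      then show "norm (kfun (stable_profile0 \<alpha> u)) \<le> norm (?h u)"
      proof cases
        case 1 then show ?thesis by (simp add: stable_profile0_def)
      next
        case 2
        then show ?thesis using k1[of "u powr (- p)"] kfun_nonneg[of "u powr (- p)"] by (simp add: stable_profile0_def p_def)
      next
        case 3
        have "(u powr (- p))\<^sup>2 = u powr (- 2 * p)" by (simp add: power2_eq_square powr_add[symmetric])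
        then show ?thesis using 3 k2[of "u powr (- p)"] kfun_nonneg[of "u powr (- p)"] by (simp add: stable_profile0_def p_def)
      qed
    qed
  qed
qed

text \<open>Multiplying the profile by c multiplies the exponent by c^(1+\<alpha>); this factor
  makes the exponent at 1 equal to the stable one, so it is never evaluated explicitly.\<close>

definition stable_profile :: "real \<Rightarrow> real \<Rightarrow> real" where
  "stable_profile \<alpha> u = (stable_psi \<alpha> 1 / kap (stable_profile0 \<alpha>) 1) powr (1 / (1 + \<alpha>)) * stable_profile0 \<alpha> u"

text \<open>The substitution u = c^(1+\<alpha>) v absorbs the factor c by self-similarity of the
  power function.\<close>

lemma stable_profile_scaling:
  assumes \<alpha>: "0 < \<alpha>" "\<alpha> < 1" and c: "0 \<le> c"
  shows "integrable lborel (\<lambda>u. kfun (c * stable_profile0 \<alpha> u))" and "kap (stable_profile0 \<alpha>) c = c powr (1 + \<alpha>) * kap (stable_profile0 \<alpha>) 1"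
proof -
  have "integrable lborel (\<lambda>u. kfun (c * stable_profile0 \<alpha> u)) \<and> (\<integral>u. kfun (c * stable_profile0 \<alpha> u) \<partial>lborel) = c powr (1 + \<alpha>) * (\<integral>u. kfun (stable_profile0 \<alpha> u) \<partial>lborel)"
  proof (cases "c = 0")
    case True then show ?thesis by simp
  next
    case False
    then have c: "0 < c" using c by simp
    define d where "d = c powr (1 + \<alpha>)"
    have d: "0 < d" using c by (simp add: d_def)
    have eq: "c * stable_profile0 \<alpha> (0 + d * u) = stable_profile0 \<alpha> u" for u
    proof (cases "0 < u")
      case True
      have "(d * u) powr (- (1 / (1 + \<alpha>))) = c powr (- 1) * u powr (- (1 / (1 + \<alpha>)))"
        using d True \<alpha> by (simp add: powr_mult d_def powr_powr)
      then show ?thesis using True d c by (simp add: stable_profile0_def powr_minus)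
    next
      case False
      then show ?thesis using d by (simp add: stable_profile0_def zero_less_mult_iff)
    qed
    have "integrable lborel (\<lambda>u. kfun (c * stable_profile0 \<alpha> (0 + d * u)))"
      unfolding eq by (rule stable_profile0_integrable[OF \<alpha>])
    then have "integrable lborel (\<lambda>u. kfun (c * stable_profile0 \<alpha> u))"
      using lborel_integrable_real_affine_iff[of d "\<lambda>u. kfun (c * stable_profile0 \<alpha> u)" 0] d by simp
    moreover have "(\<integral>u. kfun (c * stable_profile0 \<alpha> u) \<partial>lborel) = \<bar>d\<bar> *\<^sub>R (\<integral>u. kfun (c * stable_profile0 \<alpha> (0 + d * u)) \<partial>lborel)"
      using d by (intro lborel_integral_real_affine) simp
    moreover have "\<bar>d\<bar> *\<^sub>R (\<integral>u. kfun (c * stable_profile0 \<alpha> (0 + d * u)) \<partial>lborel) = d * (\<integral>u. kfun (stable_profile0 \<alpha> u) \<partial>lborel)"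
      using d unfolding eq by simp
    ultimately show ?thesis unfolding d_def by simp
  qed
  then show "integrable lborel (\<lambda>u. kfun (c * stable_profile0 \<alpha> u))" "kap (stable_profile0 \<alpha>) c = c powr (1 + \<alpha>) * kap (stable_profile0 \<alpha>) 1"
    by (simp_all add: kap_eq)
qed

lemma kap_stable_profile0_pos:
  assumes \<alpha>: "0 < \<alpha>" "\<alpha> < 1"
  shows "0 < kap (stable_profile0 \<alpha>) 1"
proof -
  have "0 \<noteq> (\<integral>u. kfun (stable_profile0 \<alpha> u) \<partial>lborel)"
  proof
    assume "0 = (\<integral>u. kfun (stable_profile0 \<alpha> u) \<partial>lborel)"
    then have "AE u in lborel. kfun (stable_profile0 \<alpha> u) = 0"
      using integral_nonneg_eq_0_iff_AE[OF stable_profile0_integrable[OF \<alpha>]] kfun_nonneg by simp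
    moreover have "kfun x \<noteq> 0" if "0 < x" for x
      using min_le_kfun[of x] that by (auto simp: min_def split: if_splits)
    ultimately have "AE u in lborel. u \<le> (0::real)"
      by (auto elim!: eventually_mono simp: stable_profile0_def split: if_splits)
    then have "AE u in lborel. \<not> (u \<in> {0<..<1::real})" by eventually_elim auto
    then have "emeasure lborel {u \<in> space lborel. u \<in> {0<..<1::real}} = 0" by (rule emeasure_eq_0_AE)
    moreover have "{u \<in> space lborel. u \<in> {0<..<1::real}} = {0<..<1}" by auto
    ultimately have "emeasure lborel {0<..<1::real} = 0" by (simp only:)
    then show False by simp
  qed
  moreover have "0 \<le> (\<integral>u. kfun (stable_profile0 \<alpha> u) \<partial>lborel)" by (intro integral_nonneg_AE AE_I2 kfun_nonneg)
  ultimately show ?thesis by (simp add: kap_eq)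
qed

lemma stable_profile_props:
  assumes \<alpha>: "0 < \<alpha>" "\<alpha> < 1"
  shows "stable_profile \<alpha> \<in> borel_measurable borel" "0 \<le> stable_profile \<alpha> u" "u \<le> 0 \<Longrightarrow> stable_profile \<alpha> u = 0"
    "0 < u \<Longrightarrow> u < v \<Longrightarrow> stable_profile \<alpha> v < stable_profile \<alpha> u"
    "0 < x \<Longrightarrow> \<exists>v>0. stable_profile \<alpha> v = x"
    "0 \<le> l \<Longrightarrow> integrable lborel (\<lambda>u. kfun (l * stable_profile \<alpha> u))"
    "0 \<le> l \<Longrightarrow> kap (stable_profile \<alpha>) l = stable_psi \<alpha> l"
proof -
  define q where "q = stable_psi \<alpha> 1 / kap (stable_profile0 \<alpha>) 1"
  define b where "b = q powr (1 / (1 + \<alpha>))"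
  have "0 < stable_psi \<alpha> 1" using \<alpha> by (simp add: stable_psi_def Gamma_real_pos)
  then have q: "0 < q" using kap_stable_profile0_pos[OF \<alpha>] by (simp add: q_def)
  have b: "0 < b" "b powr (1 + \<alpha>) = q" using q \<alpha> by (simp_all add: b_def powr_powr)
  have sp: "stable_profile \<alpha> u = b * stable_profile0 \<alpha> u" for u by (simp add: stable_profile_def b_def q_def)
  show "stable_profile \<alpha> \<in> borel_measurable borel" unfolding sp[abs_def] stable_profile0_def by measurable
  show "0 \<le> stable_profile \<alpha> u" using b by (simp add: sp stable_profile0_def)
  show "u \<le> 0 \<Longrightarrow> stable_profile \<alpha> u = 0" by (simp add: sp stable_profile0_def)
  show "0 < u \<Longrightarrow> u < v \<Longrightarrow> stable_profile \<alpha> v < stable_profile \<alpha> u"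
    using b \<alpha> by (auto simp: sp stable_profile0_def intro!: powr_less_mono2_neg)
  show "\<exists>v>0. stable_profile \<alpha> v = x" if "0 < x"
  proof -
    have e: "- (1 + \<alpha>) * - (1 / (1 + \<alpha>)) = 1" using \<alpha> by (simp add: field_simps)
    have "((x / b) powr (- (1 + \<alpha>))) powr (- (1 / (1 + \<alpha>))) = x / b"
      unfolding powr_powr e using b that by simp
    then show ?thesis using b that
      by (intro exI[of _ "(x / b) powr (- (1 + \<alpha>))"]) (simp add: sp stable_profile0_def)
  qed
  assume l: "0 \<le> l"
  have c: "0 \<le> l * b" using l b by simp
  show "integrable lborel (\<lambda>u. kfun (l * stable_profile \<alpha> u))"
    using stable_profile_scaling(1)[OF \<alpha> c] by (simp add: sp mult.assoc)
  have "kap (stable_profile \<alpha>) l = kap (stable_profile0 \<alpha>) (l * b)" by (simp add: kap_eq sp mult.assoc)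
  also have "\<dots> = (l * b) powr (1 + \<alpha>) * kap (stable_profile0 \<alpha>) 1" by (rule stable_profile_scaling(2)[OF \<alpha> c])
  also have "\<dots> = l powr (1 + \<alpha>) * (q * kap (stable_profile0 \<alpha>) 1)" using l b by (simp add: powr_mult)
  also have "q * kap (stable_profile0 \<alpha>) 1 = stable_psi \<alpha> 1" using kap_stable_profile0_pos[OF \<alpha>] by (simp add: q_def)
  finally show "kap (stable_profile \<alpha>) l = stable_psi \<alpha> l" by (simp add: stable_psi_def)
qed

text \<open>The law of a lifetime as a measure on the line. The parent locale supplies the quantile
  function I, which maps the uniform law on (0,1) to M.\<close>

locale zeta_law = cdf_distribution M for M :: "real measure" +
  fixes \<alpha> :: real
  assumes \<alpha>: "0 < \<alpha>" "\<alpha> < 1"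
    and nonneg: "AE x in M. 0 \<le> x"
    and laplace: "\<And>l. 0 < l \<Longrightarrow> (\<integral>\<^sup>+x. ennreal (exp (- l * x)) \<partial>M) = ennreal (1 - (l - psi_X \<alpha> l) / \<alpha>)"
begin

lemma prob_UNIV: "prob UNIV = 1"
  using prob_space by simp

lemma exp_integrable: "0 \<le> l \<Longrightarrow> integrable M (\<lambda>x. exp (- l * x))"
  by (rule integrable_const_bound[where B=1]) (use nonneg in \<open>auto elim!: eventually_mono\<close>)

lemma expectation_exp: "0 \<le> l \<Longrightarrow> expectation (\<lambda>x. exp (- l * x)) = 1 - (l - psi0 \<alpha> l) / \<alpha>"
proof (cases "l = 0")
  case True then show ?thesis by (simp add: psi0_def prob_UNIV)
next
  case False
  assume "0 \<le> l"
  then have l: "0 < l" using False by simp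
  have "(l - psi_X \<alpha> l) / \<alpha> \<le> 1"
  proof (rule ccontr)
    assume "\<not> ?thesis"
    then have "(\<integral>\<^sup>+x. ennreal (exp (- l * x)) \<partial>M) = 0" using laplace[OF l] by (simp add: ennreal_neg)
    then have "AE x in M. False" by (subst (asm) nn_integral_0_iff_AE) auto
    then show False using prob_space by (simp add: AE_False)
  qed
  then show ?thesis using laplace[OF l] l by (simp add: integral_eq_nn_integral psi0_def)
qed

text \<open>The mean is minus the derivative of the transform at 0. Fatou's lemma first gives
  integrability, dominated convergence then the value. This value makes drift and compensator
  cancel.\<close>

lemma mean: "integrable M (\<lambda>x. x)" "expectation (\<lambda>x. x) = 1 / \<alpha>"
proof -
  \<comment> \<open>Difference quotients of the transform at 0 along l = 1/(m+1), taken under the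
    integral: they lie below x and converge to x.\<close>
  define h where "h m x = real (Suc m) * (1 - exp (- (1 / real (Suc m)) * x))" for m x
  have hint: "integrable M (h m)" for m unfolding h_def using exp_integrable[of "1 / real (Suc m)"] by auto
  have Eh: "expectation (h m) = (1 - psi_X \<alpha> (1 / real (Suc m)) / (1 / real (Suc m))) / \<alpha>" for m
  proof -
    have "expectation (h m) = real (Suc m) * (1 - (1 - (1 / real (Suc m) - psi0 \<alpha> (1 / real (Suc m))) / \<alpha>))"
      unfolding h_def using exp_integrable[of "1 / real (Suc m)"] expectation_exp[of "1 / real (Suc m)"] by (simp add: prob_UNIV)
    moreover have "r * (1 - (1 - (1 / r - q) / \<alpha>)) = (1 - q / (1 / r)) / \<alpha>" if "r \<noteq> 0" for r q :: real
      using that \<alpha> by (simp add: field_simps)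
    moreover have "psi0 \<alpha> (1 / real (Suc m)) = psi_X \<alpha> (1 / real (Suc m))" by (simp add: psi0_def)
    ultimately show ?thesis by (metis nat.simps(3) of_nat_eq_0_iff)
  qed
  have "filterlim (\<lambda>m. 1 / real (Suc m)) (at_right 0) sequentially" by real_asymp
  from filterlim_compose[OF psi_X_div_tendsto_0[OF \<alpha>] this]
  have "(\<lambda>m. (1 - psi_X \<alpha> (1 / real (Suc m)) / (1 / real (Suc m))) / \<alpha>) \<longlonglongrightarrow> (1 - 0) / \<alpha>"
    using \<alpha> by (intro tendsto_divide tendsto_diff tendsto_const) auto
  then have Elim: "(\<lambda>m. expectation (h m)) \<longlonglongrightarrow> 1 / \<alpha>" unfolding Eh by simp
  have hlim: "(\<lambda>m. h m x) \<longlonglongrightarrow> x" for x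
  proof (cases "x = 0")
    case False
    have "((\<lambda>y::real. 1 - exp (- y)) has_real_derivative 1) (at 0)" by (auto intro!: derivative_eq_intros)
    then have "((\<lambda>y::real. (1 - exp (- y)) / y) \<longlongrightarrow> 1) (at 0)" by (simp add: DERIV_def)
    moreover have "filterlim (\<lambda>m. x / real (Suc m)) (at 0) sequentially"
    proof -
      have "(\<lambda>m. x / real (Suc m)) \<longlonglongrightarrow> 0" by real_asymp
      then show ?thesis using False by (simp add: filterlim_at)
    qed
    ultimately have "(\<lambda>m. (1 - exp (- (x / real (Suc m)))) / (x / real (Suc m))) \<longlonglongrightarrow> 1" by (rule filterlim_compose)
    then have "(\<lambda>m. x * ((1 - exp (- (x / real (Suc m)))) / (x / real (Suc m)))) \<longlonglongrightarrow> x * 1" by (intro tendsto_mult tendsto_const)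
    then show ?thesis using False by (simp add: h_def mult.commute)
  qed (simp add: h_def)
  have h_le: "h m x \<le> x" for m x
  proof -
    have "1 - exp (- (1 / real (Suc m)) * x) \<le> (1 / real (Suc m)) * x" using exp_ge_add_one_self[of "- (1 / real (Suc m)) * x"] by simp
    then have "h m x \<le> real (Suc m) * ((1 / real (Suc m)) * x)" unfolding h_def by (intro mult_left_mono) auto
    then show ?thesis by simp
  qed
  have h_nn: "AE x in M. 0 \<le> h m x" for m
    using nonneg by eventually_elim (simp add: h_def)
  have "(\<integral>\<^sup>+x. ennreal x \<partial>M) = (\<integral>\<^sup>+x. liminf (\<lambda>m. ennreal (h m x)) \<partial>M)"
    by (intro nn_integral_cong lim_imp_Liminf[symmetric] tendsto_ennrealI hlim) simp
  also have "\<dots> \<le> liminf (\<lambda>m. \<integral>\<^sup>+x. ennreal (h m x) \<partial>M)"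
    by (rule nn_integral_liminf) (use hint in auto)
  also have "\<dots> = liminf (\<lambda>m. ennreal (expectation (h m)))"
    using hint h_nn by (simp add: nn_integral_eq_integral)
  also have "\<dots> = ennreal (1 / \<alpha>)" by (intro lim_imp_Liminf tendsto_ennrealI Elim) simp
  finally have fin: "(\<integral>\<^sup>+x. ennreal x \<partial>M) < \<infinity>" by (rule order.strict_trans1) simp
  show int: "integrable M (\<lambda>x. x)" by (rule integrableI_nonneg) (use nonneg fin in auto)
  have "(\<lambda>m. expectation (h m)) \<longlonglongrightarrow> expectation (\<lambda>x. x)"
  proof (rule integral_dominated_convergence[where w="\<lambda>x. x"])
    show "AE x in M. norm (h m x) \<le> x" for m using h_nn[of m] by eventually_elim (use h_le in auto)
    show "integrable M (\<lambda>x. x)" by (rule int)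
    show "h m \<in> borel_measurable M" for m by (rule borel_measurable_integrable[OF hint])
    show "AE x in M. (\<lambda>m. h m x) \<longlonglongrightarrow> x" by (intro AE_I2 hlim)
  qed simp
  then show "expectation (\<lambda>x. x) = 1 / \<alpha>" by (rule LIMSEQ_unique) (rule Elim)
qed

text \<open>With c = 2 alpha n^(1+alpha) jumps per unit of rescaled time, the profile n is the decreasing rearrangement of
  zeta / (2 n) on (0, c); I is the quantile function of the lifetime.\<close>

definition cn :: "nat \<Rightarrow> real" where "cn n = 2 * \<alpha> * real n powr (1 + \<alpha>)"

definition prof :: "nat \<Rightarrow> real \<Rightarrow> real" where
  "prof n u = (if 0 < u \<and> u < cn n then I (1 - u / cn n) / (2 * real n) else 0)"

definition Kn :: "nat \<Rightarrow> nat" where "Kn n = nat \<lceil>cn n\<rceil>"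

lemma cn_pos: "0 < n \<Longrightarrow> 0 < cn n" using \<alpha> by (simp add: cn_def)

lemma cn_0[simp]: "cn 0 = 0" by (simp add: cn_def)

lemma I_nonneg: assumes "0 < w" "w < 1" shows "0 \<le> I w"
proof (rule ccontr)
  assume "\<not> 0 \<le> I w"
  then have lt: "I w < 0" by simp
  have "w \<le> cdf M (I w)" using pseudoinverse[OF assms, of "I w"] by simp
  also have "cdf M (I w) = 0"
  proof -
    have "AE x in M. \<not> x \<le> I w" using nonneg by eventually_elim (use lt in linarith)
    then have "prob {x\<in>space M. x \<le> I w} = 0" by (subst prob_Collect_eq_0) auto
    then show ?thesis by (simp add: cdf_def atMost_def)
  qed
  finally show False using assms by simp
qed

lemma prof_nonneg: "0 \<le> prof n u"
proof (cases "0 < u \<and> u < cn n")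
  case True
  then have "0 \<le> I (1 - u / cn n)" by (intro I_nonneg) (auto simp: field_simps)
  then show ?thesis using True by (simp add: prof_def)
next
  case False
  then have "prof n u = 0" unfolding prof_def by (rule if_not_P)
  then show ?thesis by simp
qed

lemma prof_dec: assumes "0 < u" "u \<le> v" shows "prof n v \<le> prof n u"
proof (cases "v < cn n")
  case True
  then have "I (1 - v / cn n) \<le> I (1 - u / cn n)" using assms
    by (intro mono_onD[OF mono_I]) (auto simp: field_simps)
  then show ?thesis using assms True by (simp add: prof_def divide_right_mono)
next
  case False
  then have "prof n v = 0" by (simp add: prof_def)
  then show ?thesis using prof_nonneg by simp
qed

lemma borel_measurable_prof[measurable]: "prof n \<in> borel_measurable borel"
proof -
  have "(\<lambda>w. if w \<in> {0<..<1} then I w else 0) \<in> borel_measurable borel"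
  proof -
    have "(\<lambda>w. if w \<in> {0<..<1} then I w else 0) = (\<lambda>w. indicator {0<..<1} w * I w)" by (auto simp: indicator_def fun_eq_iff)
    then show ?thesis using measurable_CI by (simp add: borel_measurable_restrict_space_iff)
  qed
  then have [measurable]: "(\<lambda>u. if 1 - u / cn n \<in> {0<..<1} then I (1 - u / cn n) else 0) \<in> borel_measurable borel"
    by (rule measurable_compose[rotated]) measurable
  have "prof n = (\<lambda>u. if 0 < u \<and> u < cn n then (if 1 - u / cn n \<in> {0<..<1} then I (1 - u / cn n) else 0) / (2 * real n) else 0)"
    by (auto simp: prof_def fun_eq_iff field_simps)
  also have "\<dots> \<in> borel_measurable borel" by measurable
  finally show ?thesis .
qed

text \<open>The substitution u = cn (1 - w) turns the decreasing profile into the quantile function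
  on (0,1), whose image law is M. The condition on \<Psi> 0 discards the u outside (0, cn).\<close>

lemma nn_integral_prof:
  assumes [measurable]: "\<Psi> \<in> borel_measurable borel" and "\<Psi> 0 = 0" and n: "0 < n"
  shows "(\<integral>\<^sup>+u. \<Psi> (prof n u) \<partial>lborel) = ennreal (cn n) * (\<integral>\<^sup>+x. \<Psi> (x / (2 * real n)) \<partial>M)"
proof -
  have c: "0 < cn n" by (rule cn_pos[OF n])
  have "(\<integral>\<^sup>+u. \<Psi> (prof n u) \<partial>lborel) = ennreal \<bar>- cn n\<bar> * (\<integral>\<^sup>+w. \<Psi> (prof n (cn n + - cn n * w)) \<partial>lborel)"
    by (rule nn_integral_real_affine) (use c in auto)
  also have "(\<integral>\<^sup>+w. \<Psi> (prof n (cn n + - cn n * w)) \<partial>lborel) = (\<integral>\<^sup>+w. \<Psi> (I w / (2 * real n)) * indicator {0<..<1} w \<partial>lborel)"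
  proof (rule nn_integral_cong)
    fix w
    have "0 < cn n + - cn n * w \<longleftrightarrow> w < 1" "cn n + - cn n * w < cn n \<longleftrightarrow> 0 < w" "1 - (cn n + - cn n * w) / cn n = w"
      using c by (auto simp: field_simps zero_less_mult_iff)
    then show "\<Psi> (prof n (cn n + - cn n * w)) = \<Psi> (I w / (2 * real n)) * indicator {0<..<1} w"
      using assms(2) by (auto simp: prof_def indicator_def)
  qed
  also have "\<dots> = (\<integral>\<^sup>+w. \<Psi> (I w / (2 * real n)) \<partial>restrict_space lborel {0<..<1})"
    by (subst nn_integral_restrict_space) auto
  also have "\<dots> = (\<integral>\<^sup>+x. \<Psi> (x / (2 * real n)) \<partial>distr (restrict_space lborel {0<..<1}) borel I)"
  proof (rule nn_integral_distr[symmetric])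
    show "I \<in> measurable (restrict_space lborel {0<..<1}) borel"
      using measurable_CI by (subst measurable_cong_sets[OF sets_restrict_space_cong refl]) auto
  qed measurable
  also have "\<dots> = (\<integral>\<^sup>+x. \<Psi> (x / (2 * real n)) \<partial>M)" by (simp only: distr_I_eq_M)
  finally show ?thesis using c by simp
qed

text \<open>With s = l/(2n), the mean 1/\<alpha> cancels the linear terms and leaves E k(s zeta) =
  psi0 s / \<alpha>; the factor cn turns this into the exponent of the rescaled X.\<close>

lemma prof_kfun:
  assumes n: "0 < n" and l: "0 \<le> l"
  shows "integrable lborel (\<lambda>u. kfun (l * prof n u))" and "kap (prof n) l = 2 * real n powr (1 + \<alpha>) * psi0 \<alpha> (l / (2 * real n))"
proof -
  define s where "s = l / (2 * real n)"
  have s: "0 \<le> s" using l n by (simp add: s_def)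
  have intk: "integrable M (\<lambda>x. kfun (s * x))"
    unfolding kfun_def using exp_integrable[OF s] mean(1) by auto
  have "expectation (\<lambda>x. kfun (s * x)) = expectation (\<lambda>x. exp (- s * x) - 1 + s * x)" by (simp add: kfun_def)
  also have "\<dots> = (1 - (s - psi0 \<alpha> s) / \<alpha>) - 1 + s * (1 / \<alpha>)"
    using exp_integrable[OF s] mean expectation_exp[OF s] by (simp add: prob_UNIV)
  also have "\<dots> = psi0 \<alpha> s / \<alpha>" by (simp add: field_simps diff_divide_distrib)
  finally have Ek: "expectation (\<lambda>x. kfun (s * x)) = psi0 \<alpha> s / \<alpha>" .
  have psi: "0 \<le> psi0 \<alpha> s" using psi_X_bounds(1)[OF \<alpha>, of s] s by (cases "s = 0") (auto simp: psi0_def)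
  have "(\<integral>\<^sup>+u. ennreal (kfun (l * prof n u)) \<partial>lborel) = ennreal (cn n) * (\<integral>\<^sup>+x. ennreal (kfun (l * (x / (2 * real n)))) \<partial>M)"
    by (rule nn_integral_prof[where \<Psi>="\<lambda>y. ennreal (kfun (l * y))"]) (use n in auto)
  also have "\<dots> = ennreal (cn n) * ennreal (psi0 \<alpha> s / \<alpha>)"
  proof -
    have "l * (x / (2 * real n)) = s * x" for x by (simp add: s_def)
    then show ?thesis using nn_integral_eq_integral[OF intk] by (simp only: kfun_nonneg Ek AE_I2 simp_thms)
  qed
  also have "\<dots> = ennreal (2 * real n powr (1 + \<alpha>) * psi0 \<alpha> s)"
    using cn_pos[OF n] psi \<alpha> by (simp add: ennreal_mult'[symmetric] cn_def)
  finally have nn: "(\<integral>\<^sup>+u. ennreal (kfun (l * prof n u)) \<partial>lborel) = ennreal (2 * real n powr (1 + \<alpha>) * psi0 \<alpha> s)" .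
  show "integrable lborel (\<lambda>u. kfun (l * prof n u))"
    by (rule integrableI_nonneg) (auto simp: kfun_nonneg nn)
  show "kap (prof n) l = 2 * real n powr (1 + \<alpha>) * psi0 \<alpha> (l / (2 * real n))"
    unfolding kap_eq by (subst integral_eq_nn_integral) (use psi in \<open>auto simp: kfun_nonneg nn s_def\<close>)
qed

lemma prof_0: "prof 0 u = 0" by (simp add: prof_def)

lemma adm_prof: "adm (Kn n) (prof n)"
proof (cases "n = 0")
  case True
  then show ?thesis by (auto simp: adm_def prof_0 simp del: One_nat_def) (simp add: prof_0[abs_def])+
next
  case False
  then have n: "0 < n" by simp
  have "(\<integral>\<^sup>+u. ennreal (prof n u) \<partial>lborel) = ennreal (cn n) * (\<integral>\<^sup>+x. ennreal (x / (2 * real n)) \<partial>M)"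
    by (rule nn_integral_prof[where \<Psi>="\<lambda>y. ennreal y"]) (use n in auto)
  moreover have "(\<integral>\<^sup>+x. ennreal (x / (2 * real n)) \<partial>M) < \<infinity>"
    using mean(1) nonneg by (subst nn_integral_eq_integral) (auto elim!: eventually_mono)
  ultimately have "(\<integral>\<^sup>+u. ennreal (prof n u) \<partial>lborel) < \<infinity>" by (simp add: ennreal_mult_less_top)
  then have "integrable lborel (prof n)" by (intro integrableI_nonneg) (auto simp: prof_nonneg)
  moreover have "prof n u = 0" if "u < 0 \<or> real (Kn n) \<le> u" for u
  proof -
    have "cn n \<le> real (Kn n)" unfolding Kn_def by (rule real_nat_ceiling_ge)
    then show ?thesis using that by (auto simp: prof_def)
  qed
  ultimately show ?thesis by (auto simp: adm_def)
qed

end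

section \<open>Identification of laws through joint Laplace transforms\<close>

lemma tendsto_if_subseq:
  fixes a :: "nat \<Rightarrow> real"
  assumes "\<And>r :: nat \<Rightarrow> nat. strict_mono r \<Longrightarrow> \<exists>s. strict_mono (s :: nat \<Rightarrow> nat) \<and> (\<lambda>j. a (r (s j))) \<longlonglongrightarrow> L"
  shows "a \<longlonglongrightarrow> L"
proof (rule tendstoI, rule ccontr)
  fix e :: real assume "0 < e" and "\<not> eventually (\<lambda>n. dist (a n) L < e) sequentially"
  then obtain r :: "nat \<Rightarrow> nat" where r: "strict_mono r" "\<And>n. \<not> dist (a (r n)) L < e"
    using not_eventually_sequentiallyD by blast
  from assms[OF r(1)] obtain s where "(\<lambda>j. a (r (s j))) \<longlonglongrightarrow> L" by blast
  from tendstoD[OF this \<open>0 < e\<close>] show False using r(2) by simp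
qed

text \<open>A nonzero Bochner integral can only come from an integrable function, because the
  default value is 0; this recovers finiteness from the stated transform.\<close>

lemma nn_laplace_eq_integral:
  assumes "f \<in> borel_measurable M" "0 < w" "(\<integral>\<omega>. exp (f \<omega>) \<partial>M) = w"
  shows "(\<integral>\<^sup>+\<omega>. ennreal (exp (f \<omega>)) \<partial>M) = ennreal w"
proof -
  have "integrable M (\<lambda>\<omega>. exp (f \<omega>))" using assms(2,3) not_integrable_integral_eq[of M "\<lambda>\<omega>. exp (f \<omega>)"] by fastforce
  then show ?thesis using assms(3) by (simp add: nn_integral_eq_integral)
qed

text \<open>The joint transform of the increments contains all the distributional requirements: it
  factorises, which gives independence, and each factor depends only on the length of the interval,
  which gives stationarity.\<close>

lemma stable_levyI:
  fixes N :: "'b measure"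
  assumes N: "prob_space N" and Y[measurable]: "\<And>t. Y t \<in> borel_measurable N"
    and c: "\<And>\<omega>. cadlag (\<lambda>t. Y t \<omega>)" and Y0: "\<And>\<omega>. Y 0 \<omega> = 0"
    and lap: "\<And>(k::nat) (ts::nat \<Rightarrow> real) (l :: nat \<Rightarrow> real). 0 \<le> ts 0 \<Longrightarrow> (\<And>j. j < k \<Longrightarrow> ts j < ts (Suc j)) \<Longrightarrow> (\<And>j. j < k \<Longrightarrow> 0 \<le> l j) \<Longrightarrow>
       (\<integral>\<^sup>+\<omega>. ennreal (exp (- (\<Sum>j<k. l j * (Y (ts (Suc j)) \<omega> - Y (ts j) \<omega>)))) \<partial>N)
         = (\<Prod>j<k. ennreal (exp ((ts (Suc j) - ts j) * stable_psi \<alpha> (l j))))"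
  shows "stable_levy \<alpha> N Y"
proof -
  interpret prob_space N by fact
  have single: "(\<integral>\<^sup>+\<omega>. ennreal (exp (- l * (Y t \<omega> - Y s \<omega>))) \<partial>N) = ennreal (exp ((t - s) * stable_psi \<alpha> l))"
    if "0 \<le> s" "s < t" "0 \<le> l" for s t l
    using lap[of "\<lambda>i. if i = 0 then s else t" 1 "\<lambda>_. l"] that by simp
  have ind: "indep_vars (\<lambda>_. borel) (\<lambda>i \<omega>. Y (ts (Suc i)) \<omega> - Y (ts i) \<omega>) {..<k}"
    if ts: "0 \<le> ts 0" "\<forall>i<k. ts i < ts (Suc i)" for k and ts :: "nat \<Rightarrow> real"
  proof -
    have ts0: "0 \<le> ts j" if "j \<le> k" for j
      using that
    proof (induction j)
      case (Suc j) then show ?case using ts(2) by (metis Suc_le_lessD less_imp_le order_trans Suc_leD)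
    qed (simp add: ts)
    show ?thesis
    proof (rule indep_vars_laplace)
      fix l :: "nat \<Rightarrow> real" assume l: "\<And>i. i \<in> {..<k} \<Longrightarrow> 0 \<le> l i"
      have "(\<integral>\<^sup>+\<omega>. ennreal (exp (- (\<Sum>j<k. l j * (Y (ts (Suc j)) \<omega> - Y (ts j) \<omega>)))) \<partial>N)
        = (\<Prod>j<k. ennreal (exp ((ts (Suc j) - ts j) * stable_psi \<alpha> (l j))))"
        by (rule lap) (use ts l in auto)
      also have "\<dots> = (\<Prod>j<k. \<integral>\<^sup>+\<omega>. ennreal (exp (- l j * (Y (ts (Suc j)) \<omega> - Y (ts j) \<omega>))) \<partial>N)"
        by (intro prod.cong refl single[symmetric]) (use ts0 ts l in auto)
      finally show "(\<integral>\<^sup>+\<omega>. ennreal (exp (- (\<Sum>j<k. l j * (Y (ts (Suc j)) \<omega> - Y (ts j) \<omega>)))) \<partial>N)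
        = (\<Prod>j<k. \<integral>\<^sup>+\<omega>. ennreal (exp (- l j * (Y (ts (Suc j)) \<omega> - Y (ts j) \<omega>))) \<partial>N)" .
    next
      fix j and l :: real assume "j \<in> {..<k}" "0 \<le> l"
      then show "(\<integral>\<^sup>+\<omega>. ennreal (exp (- l * (Y (ts (Suc j)) \<omega> - Y (ts j) \<omega>))) \<partial>N) < \<infinity>"
        by (subst single) (use ts0 ts in auto)
    qed (auto intro!: borel_measurable_diff)
  qed
  have stat: "distr N borel (\<lambda>\<omega>. Y t \<omega> - Y s \<omega>) = distr N borel (Y (t - s))" if st: "0 \<le> s" "s \<le> t" for s t
  proof (cases "s = t")
    case True
    then show ?thesis by (intro distr_cong) (auto simp: Y0)
  next
    case False
    then have lt: "s < t" using st by simp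
    show ?thesis
    proof (rule laplace_uniqueness)
      fix l :: real assume l: "0 \<le> l"
      have 1: "(\<integral>\<^sup>+x. ennreal (exp (- l * x)) \<partial>distr N borel (\<lambda>\<omega>. Y t \<omega> - Y s \<omega>)) = ennreal (exp ((t - s) * stable_psi \<alpha> l))"
        using single[OF st(1) lt l] by (subst nn_integral_distr) auto
      have 2: "(\<integral>\<^sup>+x. ennreal (exp (- l * x)) \<partial>distr N borel (Y (t - s))) = ennreal (exp ((t - s) * stable_psi \<alpha> l))"
        using single[of 0 "t - s" l] lt l by (subst nn_integral_distr) (auto simp: Y0)
      show "(\<integral>\<^sup>+x. ennreal (exp (- l * x)) \<partial>distr N borel (\<lambda>\<omega>. Y t \<omega> - Y s \<omega>)) = (\<integral>\<^sup>+x. ennreal (exp (- l * x)) \<partial>distr N borel (Y (t - s)))"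
        unfolding 1 2 ..
      show "(\<integral>\<^sup>+x. ennreal (exp (- l * x)) \<partial>distr N borel (\<lambda>\<omega>. Y t \<omega> - Y s \<omega>)) < \<infinity>" unfolding 1 by simp
    qed auto
  qed
  have lapt: "(\<integral>\<omega>. exp (- l * Y t \<omega>) \<partial>N) = exp (t * stable_psi \<alpha> l)" if "0 \<le> t" "0 \<le> l" for t l
  proof (cases "t = 0")
    case True then show ?thesis using prob_space by (simp add: Y0)
  next
    case False
    then have "(\<integral>\<^sup>+\<omega>. ennreal (exp (- l * Y t \<omega>)) \<partial>N) = ennreal (exp (t * stable_psi \<alpha> l))"
      using single[of 0 t l] that by (simp add: Y0)
    then show ?thesis by (subst integral_eq_nn_integral) auto
  qed
  show ?thesis
    unfolding stable_levy_def using N Y c Y0 ind stat lapt by auto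
qed

lemma stable_levy_laplace:
  assumes X: "stable_levy \<alpha> N Xb" and ts: "0 \<le> ts 0" "\<And>j. j < k \<Longrightarrow> ts j < ts (Suc j)" and l: "\<And>j. j < k \<Longrightarrow> 0 \<le> l j"
  shows "(\<integral>\<^sup>+\<omega>. ennreal (exp (- (\<Sum>j<k. l j * (Xb (ts (Suc j)) \<omega> - Xb (ts j) \<omega>)))) \<partial>N)
    = (\<Prod>j<k. ennreal (exp ((ts (Suc j) - ts j) * stable_psi \<alpha> (l j))))"
proof -
  interpret prob_space N using X by (simp add: stable_levy_def)
  have [measurable]: "Xb t \<in> borel_measurable N" for t using X by (simp add: stable_levy_def)
  have ts0: "0 \<le> ts j" if "j \<le> k" for j
    using that
  proof (induction j)
    case (Suc j) then show ?case using ts(2)[of j] by simp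
  qed (simp add: ts)
  have "indep_vars (\<lambda>_. borel) (\<lambda>j \<omega>. Xb (ts (Suc j)) \<omega> - Xb (ts j) \<omega>) {..<k}"
    using X ts unfolding stable_levy_def by blast
  then have "indep_vars (\<lambda>_. borel) (\<lambda>j \<omega>. ennreal (exp (- l j * (Xb (ts (Suc j)) \<omega> - Xb (ts j) \<omega>)))) {..<k}"
    by (rule indep_vars_compose2) auto
  then have "(\<integral>\<^sup>+\<omega>. (\<Prod>j<k. ennreal (exp (- l j * (Xb (ts (Suc j)) \<omega> - Xb (ts j) \<omega>)))) \<partial>N)
    = (\<Prod>j<k. \<integral>\<^sup>+\<omega>. ennreal (exp (- l j * (Xb (ts (Suc j)) \<omega> - Xb (ts j) \<omega>))) \<partial>N)"
    by (intro indep_vars_nn_integral) auto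
  also have "\<dots> = (\<Prod>j<k. ennreal (exp ((ts (Suc j) - ts j) * stable_psi \<alpha> (l j))))"
  proof (rule prod.cong[OF refl])
    fix j assume j: "j \<in> {..<k}"
    let ?d = "ts (Suc j) - ts j"
    have eq: "distr N borel (\<lambda>\<omega>. Xb (ts (Suc j)) \<omega> - Xb (ts j) \<omega>) = distr N borel (Xb ?d)"
      using X j ts0[of j] ts(2)[of j] unfolding stable_levy_def by (auto simp: less_imp_le)
    have "(\<integral>\<^sup>+\<omega>. ennreal (exp (- l j * (Xb (ts (Suc j)) \<omega> - Xb (ts j) \<omega>))) \<partial>N)
       = (\<integral>\<^sup>+x. ennreal (exp (- l j * x)) \<partial>distr N borel (\<lambda>\<omega>. Xb (ts (Suc j)) \<omega> - Xb (ts j) \<omega>))"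
      by (subst nn_integral_distr) auto
    also have "\<dots> = (\<integral>\<^sup>+\<omega>. ennreal (exp (- l j * Xb ?d \<omega>)) \<partial>N)" unfolding eq by (subst nn_integral_distr) auto
    also have "\<dots> = ennreal (exp (?d * stable_psi \<alpha> (l j)))"
      by (rule nn_laplace_eq_integral) (use X j l[of j] ts(2)[of j] in \<open>auto simp: stable_levy_def\<close>)
    finally show "(\<integral>\<^sup>+\<omega>. ennreal (exp (- l j * (Xb (ts (Suc j)) \<omega> - Xb (ts j) \<omega>))) \<partial>N) = ennreal (exp (?d * stable_psi \<alpha> (l j)))" .
  qed
  finally show ?thesis by (simp add: prod_ennreal exp_sum[symmetric] sum_negf)
qed

text \<open>V stands for the common joint transform. Its finiteness feeds the uniqueness theorem,
  and an equality of transforms on all grids suffices for bounded continuous functionals.\<close>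

lemma integral_skorokhod_eq_laplace:
  fixes M :: "'a measure" and N :: "'b measure"
  assumes F: "skorokhod_continuous F" "\<And>x. \<bar>F x\<bar> \<le> B"
    and M: "prob_space M" and N: "prob_space N"
    and X: "\<And>t. X t \<in> borel_measurable M" "\<And>\<omega>. cadlag (\<lambda>t. X t \<omega>)"
    and Y: "\<And>t. Y t \<in> borel_measurable N" "\<And>\<omega>. cadlag (\<lambda>t. Y t \<omega>)"
    and lapX: "\<And>(k::nat) (ts::nat \<Rightarrow> real) (l :: nat \<Rightarrow> real). ts 0 = 0 \<Longrightarrow> (\<And>j. j < k \<Longrightarrow> ts j < ts (Suc j)) \<Longrightarrow> (\<And>j. j \<le> k \<Longrightarrow> 0 \<le> l j) \<Longrightarrow>
       (\<integral>\<^sup>+\<omega>. ennreal (exp (- (l k * X 0 \<omega> + (\<Sum>j<k. l j * (X (ts (Suc j)) \<omega> - X (ts j) \<omega>))))) \<partial>M) = V k ts l \<and> V k ts l < \<infinity>"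
    and lapY: "\<And>(k::nat) (ts::nat \<Rightarrow> real) (l :: nat \<Rightarrow> real). ts 0 = 0 \<Longrightarrow> (\<And>j. j < k \<Longrightarrow> ts j < ts (Suc j)) \<Longrightarrow> (\<And>j. j \<le> k \<Longrightarrow> 0 \<le> l j) \<Longrightarrow>
       (\<integral>\<^sup>+\<omega>. ennreal (exp (- (l k * Y 0 \<omega> + (\<Sum>j<k. l j * (Y (ts (Suc j)) \<omega> - Y (ts j) \<omega>))))) \<partial>N) = V k ts l"
  shows "(\<integral>\<omega>. F (\<lambda>t. X t \<omega>) \<partial>M) = (\<integral>\<omega>. F (\<lambda>t. Y t \<omega>) \<partial>N)"
proof (rule integral_skorokhod_eq[OF F M N X Y])
  fix m
  define k where "k = (Suc m)\<^sup>2"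
  define ts where "ts j = real j / real (Suc m)" for j
  have ts: "ts 0 = 0" "\<And>j. j < k \<Longrightarrow> ts j < ts (Suc j)" by (auto simp: ts_def divide_strict_right_mono)
  have conv: "(\<Sum>i\<le>k. l i * grid_vec m x i) = l 0 * x 0 + (\<Sum>j<k. l (Suc j) * (x (ts (Suc j)) - x (ts j)))" for l :: "nat \<Rightarrow> real" and x
    unfolding sum.atMost_shift by (simp add: grid_vec_def ts_def)
  \<comment> \<open>Re-indexing: the increment vector starts with the initial value, whereas the
    transform formula keeps the weight of the initial value at index k.\<close>
  let ?l = "\<lambda>l j. if j < k then l (Suc j) else l 0 :: real"
  show "distr M (PiM {..(Suc m)\<^sup>2} (\<lambda>_. borel)) (\<lambda>\<omega>. \<lambda>i\<in>{..(Suc m)\<^sup>2}. grid_vec m (\<lambda>t. X t \<omega>) i)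
      = distr N (PiM {..(Suc m)\<^sup>2} (\<lambda>_. borel)) (\<lambda>\<omega>. \<lambda>i\<in>{..(Suc m)\<^sup>2}. grid_vec m (\<lambda>t. Y t \<omega>) i)"
    unfolding k_def[symmetric]
  proof (rule laplace_uniqueness_PiM)
    show "(\<lambda>\<omega>. grid_vec m (\<lambda>t. X t \<omega>) i) \<in> borel_measurable M" for i
      unfolding grid_vec_def using X(1) by (cases i) (auto intro!: borel_measurable_diff)
    show "(\<lambda>\<omega>. grid_vec m (\<lambda>t. Y t \<omega>) i) \<in> borel_measurable N" for i
      unfolding grid_vec_def using Y(1) by (cases i) (auto intro!: borel_measurable_diff)
    fix l :: "nat \<Rightarrow> real" assume "\<And>i. i \<in> {..k} \<Longrightarrow> 0 \<le> l i"
    then have l: "0 \<le> ?l l j" if "j \<le> k" for j using that by auto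
    have 1: "(\<integral>\<^sup>+\<omega>. ennreal (exp (- (\<Sum>i\<le>k. l i * grid_vec m (\<lambda>t. X t \<omega>) i))) \<partial>M) = V k ts (?l l)" and fin: "V k ts (?l l) < \<infinity>"
      using lapX[of ts k "?l l", OF ts l] unfolding conv by auto
    have 2: "(\<integral>\<^sup>+\<omega>. ennreal (exp (- (\<Sum>i\<le>k. l i * grid_vec m (\<lambda>t. Y t \<omega>) i))) \<partial>N) = V k ts (?l l)"
      using lapY[of ts k "?l l", OF ts l] unfolding conv by auto
    show "(\<integral>\<^sup>+\<omega>. ennreal (exp (- (\<Sum>i\<le>k. l i * grid_vec m (\<lambda>t. X t \<omega>) i))) \<partial>M)
      = (\<integral>\<^sup>+\<omega>. ennreal (exp (- (\<Sum>i\<le>k. l i * grid_vec m (\<lambda>t. Y t \<omega>) i))) \<partial>N)" unfolding 1 2 ..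
    show "(\<integral>\<^sup>+\<omega>. ennreal (exp (- (\<Sum>i\<le>k. l i * grid_vec m (\<lambda>t. X t \<omega>) i))) \<partial>M) < \<infinity>" unfolding 1 by (rule fin)
  qed simp
qed

text \<open>The existence claim requires a stable process on the sample space of real functions, so the
  sample space of the Poisson random measure is encoded there.\<close>

definition path_code :: "(nat \<times> nat \<Rightarrow> nat \<times> (nat \<Rightarrow> real \<times> real)) \<Rightarrow> real \<Rightarrow> real" where
  "path_code \<omega> x = (case prod_decode (nat \<lfloor>x\<rfloor>) of (a, b) \<Rightarrow>
     (case b of 0 \<Rightarrow> real (fst (\<omega> (prod_decode a)))
      | Suc j \<Rightarrow> (if even j then fst else snd) (snd (\<omega> (prod_decode a)) (j div 2))))"

lemma inj_path_code: "inj path_code"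
proof (rule injI, rule ext)
  fix \<omega> \<omega>' c assume eq: "path_code \<omega> = path_code \<omega>'"
  have at: "(case b of 0 \<Rightarrow> real (fst (\<omega> c)) | Suc j \<Rightarrow> (if even j then fst else snd) (snd (\<omega> c) (j div 2)))
    = (case b of 0 \<Rightarrow> real (fst (\<omega>' c)) | Suc j \<Rightarrow> (if even j then fst else snd) (snd (\<omega>' c) (j div 2)))" for b
    using fun_cong[OF eq, of "real (prod_encode (prod_encode c, b))"] by (simp add: path_code_def)
  have "fst (\<omega> c) = fst (\<omega>' c)" using at[of 0] by simp
  moreover have "snd (\<omega> c) j = snd (\<omega>' c) j" for j
    using at[of "Suc (2 * j)"] at[of "Suc (Suc (2 * j))"] by (simp add: prod_eq_iff)
  ultimately show "\<omega> c = \<omega>' c" by (simp add: prod_eq_iff fun_eq_iff)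
qed

text \<open>A deterministic lower bound that holds also on paths without a rational zero; it makes
  the transform of the initial value of X finite.\<close>

lemma hit_time_lower: "- \<bar>Inf {}\<bar> \<le> hit_time z"
proof (cases "\<exists>q\<in>\<rat>. 0 \<le> q \<and> z q = 0")
  case True
  then have "0 \<le> hit_time z" unfolding hit_time_def by (intro cInf_greatest) auto
  then show ?thesis by (rule order_trans[rotated]) simp
next
  case False
  then have "{s. s \<in> \<rat> \<and> 0 \<le> s \<and> z s = 0} = {}" by blast
  then have "hit_time z = Inf {}" unfolding hit_time_def by (rule arg_cong)
  then show ?thesis by (simp only: abs_ge_minus_self abs_minus_le_zero minus_le_iff)
qed

context zeta_law
begin

lemma decreasing_profiles_prof: "decreasing_profiles prof (stable_profile \<alpha>)"
proof
  show "prof n \<in> borel_measurable borel" for n by measurable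
  show "0 \<le> prof n u" for n u by (rule prof_nonneg)
  show "u \<le> 0 \<Longrightarrow> prof n u = 0" for n u by (simp add: prof_def)
  show "0 < u \<Longrightarrow> u \<le> v \<Longrightarrow> prof n v \<le> prof n u" for n u v by (rule prof_dec)
  show "integrable lborel (\<lambda>u. kfun (l * prof n u))" if "0 \<le> l" for n l
    using prof_kfun(1)[OF _ that] by (cases "n = 0") (auto simp: prof_0)
  show "(\<lambda>n. kap (prof n) l) \<longlonglongrightarrow> kap (stable_profile \<alpha>) l" if l: "0 \<le> l" for l
    unfolding stable_profile_props(7)[OF \<alpha> l]
  proof (rule Lim_transform_eventually[OF psi0_scaling_limit[OF \<alpha> l]])
    show "eventually (\<lambda>n. 2 * real n powr (1 + \<alpha>) * psi0 \<alpha> (l / (2 * real n)) = kap (prof n) l) sequentially"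
      using eventually_gt_at_top[of 0] by eventually_elim (simp add: prof_kfun(2) l)
  qed
qed (use stable_profile_props[OF \<alpha>] in auto)

text \<open>Every subsequence of the compensated processes has a further one converging almost
  surely, locally uniformly, and convergence of the exponents identifies each limit as stable. With
  the full sequence this also yields a stable process to start from.\<close>

lemma subseq_stable_limit:
  fixes r :: "nat \<Rightarrow> nat"
  assumes r: "strict_mono r"
  shows "\<exists>s Y. strict_mono (s :: nat \<Rightarrow> nat) \<and> stable_levy \<alpha> prm Y \<and> (\<forall>\<omega>. Y 0 \<omega> = 0) \<and>
    (AE \<omega> in prm. \<forall>T\<ge>0. \<forall>e>0. eventually (\<lambda>j. \<forall>t\<in>{0..T}.
       \<bar>M_proc (Kn (r (s j))) (prof (r (s j))) t \<omega> - Y t \<omega>\<bar> \<le> e) sequentially)"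
proof -
  interpret decreasing_profiles prof "stable_profile \<alpha>" by (rule decreasing_profiles_prof)
  have cauchy: "\<exists>N. \<forall>m\<ge>N. \<forall>n\<ge>N. jump_dist (\<lambda>u. prof (r m) u - prof (r n) u) < \<delta>" if "0 < \<delta>" for \<delta>
    using jump_dist_cauchy[OF that] seq_suble[OF r] by (meson order_trans)
  obtain s Y where s: "strict_mono (s :: nat \<Rightarrow> nat)" and Y: "\<And>t. Y t \<in> borel_measurable prm" "\<And>\<omega>. cadlag (\<lambda>t. Y t \<omega>)" "\<And>\<omega>. Y 0 \<omega> = 0"
    and AEc: "AE \<omega> in prm. \<forall>T\<ge>0. \<forall>e>0. eventually (\<lambda>j. \<forall>t\<in>{0..T}. \<bar>M_proc (Kn (r (s j))) (prof (r (s j))) t \<omega> - Y t \<omega>\<bar> \<le> e) sequentially"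
    using M_proc_subseq_limit[of "\<lambda>n. Kn (r n)" "\<lambda>n. prof (r n)", OF adm_prof cauchy] by blast
  have "stable_levy \<alpha> prm Y"
  proof (rule stable_levyI[OF prob_space_prm Y])
    fix k :: nat and ts l :: "nat \<Rightarrow> real"
    assume *: "0 \<le> ts 0" "\<And>j. j < k \<Longrightarrow> ts j < ts (Suc j)" "\<And>j. j < k \<Longrightarrow> 0 \<le> l j"
    show "(\<integral>\<^sup>+\<omega>. ennreal (exp (- (\<Sum>j<k. l j * (Y (ts (Suc j)) \<omega> - Y (ts j) \<omega>)))) \<partial>prm)
         = (\<Prod>j<k. ennreal (exp ((ts (Suc j) - ts j) * stable_psi \<alpha> (l j))))"
    proof (rule laplace_limit_proc[OF adm_prof prof_nonneg _ Y(1) AEc *])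
      fix l :: real assume l: "0 \<le> l"
      have "strict_mono (\<lambda>j. r (s j))" using r s by (simp add: strict_mono_def)
      from LIMSEQ_subseq_LIMSEQ[OF conv[OF l] this]
      show "(\<lambda>j. kap (prof (r (s j))) l) \<longlonglongrightarrow> stable_psi \<alpha> l"
        unfolding stable_profile_props(7)[OF \<alpha> l] comp_def .
    qed
  qed
  then show ?thesis using s Y(3) AEc by blast
qed

lemma stable_levy_exists: "\<exists>(N :: (real \<Rightarrow> real) measure) Xb. stable_levy \<alpha> N Xb"
proof -
  obtain Y where Y: "stable_levy \<alpha> prm Y" and Y0: "\<And>\<omega>. Y 0 \<omega> = 0" using subseq_stable_limit[of "\<lambda>n. n"] by (auto simp: strict_mono_def)
  have Ym: "Y t \<in> borel_measurable prm" for t using Y by (simp add: stable_levy_def)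
  define N where "N = embed_measure prm path_code"
  \<comment> \<open>The inverse is a total function, so points outside the range of the code are
    also assigned paths of Y, which are cadlag and start at 0.\<close>
  define Xb where "Xb t x = Y t (inv path_code x)" for t x
  have inv: "Xb t (path_code \<omega>) = Y t \<omega>" for t \<omega> by (simp add: Xb_def inv_f_f[OF inj_path_code])
  have Xm: "Xb t \<in> borel_measurable N" for t
    unfolding N_def by (rule measurable_embed_measure1) (use Ym inv in simp)
  have "prob_space N"
  proof (rule prob_spaceI)
    have "emeasure N (space N) = (\<integral>\<^sup>+x. 1 \<partial>N)" by simp
    also have "\<dots> = (\<integral>\<^sup>+\<omega>. 1 \<partial>prm)" unfolding N_def by (rule nn_integral_embed_measure[OF inj_path_code]) simp
    also have "\<dots> = 1" using prob_space.emeasure_space_1[OF prob_space_prm] by simp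
    finally show "emeasure N (space N) = 1" .
  qed
  have "stable_levy \<alpha> N Xb"
  proof (rule stable_levyI[OF \<open>prob_space N\<close> Xm])
    show "cadlag (\<lambda>t. Xb t x)" for x using Y by (simp add: Xb_def stable_levy_def)
    show "Xb 0 x = 0" for x by (simp add: Xb_def Y0)
    fix k :: nat and ts l :: "nat \<Rightarrow> real"
    assume *: "0 \<le> ts 0" "\<And>j. j < k \<Longrightarrow> ts j < ts (Suc j)" "\<And>j. j < k \<Longrightarrow> 0 \<le> l j"
    have "(\<integral>\<^sup>+x. ennreal (exp (- (\<Sum>j<k. l j * (Xb (ts (Suc j)) x - Xb (ts j) x)))) \<partial>N)
      = (\<integral>\<^sup>+\<omega>. ennreal (exp (- (\<Sum>j<k. l j * (Y (ts (Suc j)) \<omega> - Y (ts j) \<omega>)))) \<partial>prm)"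
      using Xm unfolding N_def by (subst nn_integral_embed_measure[OF inj_path_code]) (auto simp: inv intro!: borel_measurable_sum)
    also have "\<dots> = (\<Prod>j<k. ennreal (exp ((ts (Suc j) - ts j) * stable_psi \<alpha> (l j))))"
      by (rule stable_levy_laplace[OF Y *])
    finally show "(\<integral>\<^sup>+x. ennreal (exp (- (\<Sum>j<k. l j * (Xb (ts (Suc j)) x - Xb (ts j) x)))) \<partial>N)
      = (\<Prod>j<k. ennreal (exp ((ts (Suc j) - ts j) * stable_psi \<alpha> (l j))))" .
  qed
  then show ?thesis by blast
qed

end

text \<open>A monotone integer-valued path is constant to the right of each time by right-continuity
  and just before each positive time because it is bounded there.\<close>

lemma cadlag_poisson_sum:
  assumes J: "poisson_process M r J" and c: "0 < c"
  shows "cadlag (\<lambda>t. (- (c * t) + (\<Sum>i\<in>{0..J (c * t) \<omega>}. z i)) / b)"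
proof -
  have mono: "J s \<omega> \<le> J t \<omega>" if "0 \<le> s" "s \<le> t" for s t
    using J that by (auto simp: poisson_process_def mono_on_def)
  have rc: "continuous (at_right t) (\<lambda>s. real (J s \<omega>))" if "0 \<le> t" for t
    using J that by (auto simp: poisson_process_def)
  have step: "cadlag (\<lambda>t. \<Sum>i\<in>{0..J (c * t) \<omega>}. z i)"
  proof (rule cadlagI)
    fix t :: real assume t: "0 \<le> t"
    obtain b where b: "b > c * t" "\<And>s. c * t \<le> s \<Longrightarrow> s < b \<Longrightarrow> J s \<omega> = J (c * t) \<omega>"
      using nat_right_continuousD[of "c * t" "\<lambda>s. J s \<omega>"] rc[of "c * t"] t c by auto
    have "eventually (\<lambda>s. (\<Sum>i\<in>{0..J (c * s) \<omega>}. z i) = (\<Sum>i\<in>{0..J (c * t) \<omega>}. z i)) (at_right t)"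
      unfolding eventually_at_right_field
    proof (intro exI[of _ "b / c"] conjI allI impI)
      show "t < b / c" using b(1) c by (simp add: field_simps)
      fix s assume "t < s" "s < b / c"
      then have "c * t < c * s" "c * s < b" using c by (simp_all add: pos_less_divide_eq mult.commute)
      then have "J (c * s) \<omega> = J (c * t) \<omega>" by (intro b(2)) auto
      then show "(\<Sum>i\<in>{0..J (c * s) \<omega>}. z i) = (\<Sum>i\<in>{0..J (c * t) \<omega>}. z i)" by simp
    qed
    then show "((\<lambda>t. \<Sum>i\<in>{0..J (c * t) \<omega>}. z i) \<longlongrightarrow> (\<Sum>i\<in>{0..J (c * t) \<omega>}. z i)) (at_right t)"
      by (rule tendsto_eventually)
  next
    fix t :: real assume t: "0 < t"
    \<comment> \<open>Finitely many values are taken before time c t; the largest one is attained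
      and kept from then on by monotonicity.\<close>
    define S where "S = (\<lambda>s. J s \<omega>) ` {0..<c * t}"
    have ct: "0 < c * t" using c t by simp
    have "finite S" unfolding S_def by (rule finite_subset[of _ "{..J (c * t) \<omega>}"]) (use mono in auto)
    moreover have "J 0 \<omega> \<in> S" unfolding S_def using ct by auto
    ultimately have "Max S \<in> S" by (intro Max_in) auto
    then obtain s0 where s0: "0 \<le> s0" "s0 < c * t" "J s0 \<omega> = Max S" unfolding S_def by auto
    have const: "J s \<omega> = Max S" if "s0 \<le> s" "s < c * t" for s
    proof (rule antisym)
      show "J s \<omega> \<le> Max S" using that s0 \<open>finite S\<close> by (intro Max_ge) (auto simp: S_def)
      show "Max S \<le> J s \<omega>" unfolding s0(3)[symmetric] using that s0 by (intro mono) auto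
    qed
    have "eventually (\<lambda>s. (\<Sum>i\<in>{0..J (c * s) \<omega>}. z i) = (\<Sum>i\<in>{0..Max S}. z i)) (at_left t)"
      unfolding eventually_at_left_field
    proof (intro exI[of _ "s0 / c"] conjI allI impI)
      show "s0 / c < t" using s0(2) c by (simp add: field_simps)
      fix s assume "s0 / c < s" "s < t"
      then have "s0 < c * s" "c * s < c * t" using c by (simp_all add: pos_divide_less_eq mult.commute)
      then have "J (c * s) \<omega> = Max S" by (intro const) auto
      then show "(\<Sum>i\<in>{0..J (c * s) \<omega>}. z i) = (\<Sum>i\<in>{0..Max S}. z i)" by simp
    qed
    then show "\<exists>l. ((\<lambda>t. \<Sum>i\<in>{0..J (c * t) \<omega>}. z i) \<longlongrightarrow> l) (at_left t)"
      by (intro exI tendsto_eventually)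
  qed
  have lin: "cadlag (\<lambda>t. - (c * t))" by (intro cadlag_continuous continuous_intros)
  have add: "cadlag (\<lambda>t. - (c * t) + (\<Sum>i\<in>{0..J (c * t) \<omega>}. z i))" (is "cadlag ?y") by (rule cadlag_add[OF lin step])
  show ?thesis
  proof (rule cadlagI)
    fix t :: real assume t: "0 \<le> t"
    show "((\<lambda>t. ?y t / b) \<longlongrightarrow> ?y t / b) (at_right t)"
      unfolding divide_inverse by (intro tendsto_mult_right cadlag_right[OF add t])
  next
    fix t :: real assume "0 < t"
    then obtain l where "(?y \<longlongrightarrow> l) (at_left t)" using cadlag_left[OF add] by blast
    then have "((\<lambda>t. ?y t / b) \<longlongrightarrow> l / b) (at_left t)" unfolding divide_inverse by (rule tendsto_mult_right)
    then show "\<exists>l. ((\<lambda>t. ?y t / b) \<longlongrightarrow> l) (at_left t)" ..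
  qed
qed

lemma nn_integral_pair_prod:
  assumes "prob_space M" "prob_space N" and f: "f \<in> borel_measurable M" and g: "g \<in> borel_measurable N"
  shows "(\<integral>\<^sup>+p. f (fst p) * g (snd p) \<partial>(M \<Otimes>\<^sub>M N)) = (\<integral>\<^sup>+x. f x \<partial>M) * (\<integral>\<^sup>+y. g y \<partial>N)"
proof -
  interpret M: prob_space M by fact
  interpret N: prob_space N by fact
  note [measurable] = f g
  have "(\<integral>\<^sup>+p. f (fst p) * g (snd p) \<partial>(M \<Otimes>\<^sub>M N)) = (\<integral>\<^sup>+x. \<integral>\<^sup>+y. f x * g y \<partial>N \<partial>M)"
    by (subst N.nn_integral_fst[symmetric]) auto
  also have "\<dots> = (\<integral>\<^sup>+x. f x * (\<integral>\<^sup>+y. g y \<partial>N) \<partial>M)" by (simp add: nn_integral_cmult)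
  also have "\<dots> = (\<integral>\<^sup>+x. f x \<partial>M) * (\<integral>\<^sup>+y. g y \<partial>N)" by (simp add: nn_integral_multc)
  finally show ?thesis .
qed

theorem theorem1p5:
  fixes \<alpha> :: real and n0 :: nat and M :: "'a measure"
    and Z :: "nat \<Rightarrow> real \<Rightarrow> 'a \<Rightarrow> nat" and J :: "real \<Rightarrow> 'a \<Rightarrow> nat"
  assumes "0 < \<alpha>" "\<alpha> < 1" "1 \<le> n0"
    and "prob_space M"
    and "Qa_chain \<alpha> M n0 (Z 0)"
    and "\<And>i. 1 \<le> i \<Longrightarrow> Qa_chain \<alpha> M 1 (Z i)"
    and "poisson_process M \<alpha> J"
    and "prob_space.indep_vars M (\<lambda>_. Pi\<^sub>M UNIV (\<lambda>_. count_space UNIV))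
           (\<lambda>i \<omega> t. case i of Some k \<Rightarrow> Z k t \<omega> | None \<Rightarrow> J t \<omega>) (UNIV :: nat option set)"
  defines "X \<equiv> \<lambda>t \<omega>. - t + (\<Sum>i\<in>{0..J t \<omega>}. Inf {s::real. 0 \<le> s \<and> Z i s \<omega> = 0})"
  shows "(\<exists>(N :: (real \<Rightarrow> real) measure) Xb. stable_levy \<alpha> N Xb) \<and>
         (\<forall>(N :: 'b measure) Xb. stable_levy \<alpha> N Xb \<longrightarrow>
            (\<forall>F. skorokhod_continuous F \<longrightarrow> (\<exists>B. \<forall>x. \<bar>F x\<bar> \<le> B) \<longrightarrow>
               (\<lambda>n::nat. \<integral>\<omega>. F (\<lambda>t. X (2 * real n powr (1 + \<alpha>) * t) \<omega> / (2 * real n)) \<partial>M)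
                 \<longlonglongrightarrow> (\<integral>\<omega>. F (\<lambda>t. Xb t \<omega>) \<partial>N)))"
proof -
  interpret prob_space M by fact
  note \<alpha> = assms(1,2)
  have Zm: "Z i t \<in> measurable M (count_space UNIV)" for i t
    using assms(5) assms(6)[of i] unfolding Qa_chain_def by (cases "i = 0") auto
  have Zrc: "continuous (at_right t) (\<lambda>s. real (Z i s \<omega>))" if "0 \<le> t" for i t \<omega>
    using assms(5) assms(6)[of i] that unfolding Qa_chain_def by (cases "i = 0") auto
  have Jm[measurable]: "J t \<in> measurable M (count_space UNIV)" for t using assms(7) by (simp add: poisson_process_def)
  have J0: "J 0 \<omega> = 0" for \<omega> using assms(7) by (simp add: poisson_process_def)
  have hm: "(\<lambda>\<omega>. hit_time (\<lambda>t. Z i t \<omega>)) \<in> borel_measurable M" for i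
    by (rule measurable_compose[OF _ borel_measurable_hit_time]) (auto intro: measurable_PiM_single' Zm)
  have X: "X t \<omega> = - t + (\<Sum>i\<in>{0..J t \<omega>}. hit_time (\<lambda>t. Z i t \<omega>))" for t \<omega>
    unfolding X_def by (simp add: hit_time_eq[OF Zrc])
  have Xm[measurable]: "X t \<in> borel_measurable M" for t
    unfolding X[abs_def] by (intro borel_measurable_add borel_measurable_sum_upto_rv hm) auto
  have X0: "X 0 \<omega> = hit_time (\<lambda>t. Z 0 t \<omega>)" for \<omega> by (simp add: X J0)
  \<comment> \<open>The common law of the lifetimes of the chains started at 1; its quantile
    function supplies the jump profiles.\<close>
  define D where "D = distr M borel (\<lambda>\<omega>. hit_time (\<lambda>t. Z 1 t \<omega>))"
  interpret zeta: zeta_law D \<alpha>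
  proof (intro zeta_law.intro zeta_law_axioms.intro cdf_distribution.intro real_distribution.intro real_distribution_axioms.intro)
    show "prob_space D" unfolding D_def by (rule prob_space_distr[OF hm])
    show "sets D = sets borel" by (simp add: D_def)
    show "AE x in D. 0 \<le> x" unfolding D_def using hit_time_law(1)[OF \<alpha> assms(6)[of 1]] hm by (subst AE_distr_iff) auto
    fix l :: real assume l: "0 < l"
    show "(\<integral>\<^sup>+x. ennreal (exp (- l * x)) \<partial>D) = ennreal (1 - (l - psi_X \<alpha> l) / \<alpha>)"
      unfolding D_def using hit_time_law(2)[OF \<alpha> assms(6)[of 1] l] hm by (subst nn_integral_distr) auto
  qed (use \<alpha> in auto)
  have conv: "(\<lambda>n. \<integral>\<omega>. F (\<lambda>t. X (2 * real n powr (1 + \<alpha>) * t) \<omega> / (2 * real n)) \<partial>M) \<longlonglongrightarrow> (\<integral>\<omega>. F (\<lambda>t. Xb t \<omega>) \<partial>N)"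
    if Xb: "stable_levy \<alpha> N Xb" and F: "skorokhod_continuous F" and B: "\<And>x. \<bar>F x\<bar> \<le> B" for N :: "'b measure" and Xb F B
  proof (rule tendsto_if_subseq)
    fix r :: "nat \<Rightarrow> nat" assume r: "strict_mono r"
    obtain s Y where s: "strict_mono (s :: nat \<Rightarrow> nat)" and Y: "stable_levy \<alpha> prm Y" and Y0: "\<And>\<omega>. Y 0 \<omega> = 0"
      and AEc: "AE \<omega> in prm. \<forall>T\<ge>0. \<forall>e>0. eventually (\<lambda>j. \<forall>t\<in>{0..T}.
        \<bar>M_proc (zeta.Kn (r (s j))) (zeta.prof (r (s j))) t \<omega> - Y t \<omega>\<bar> \<le> e) sequentially"
      using zeta.subseq_stable_limit[OF r] by blast
    interpret P: prob_space prm by (rule prob_space_prm)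
    interpret PP: pair_prob_space prm M ..
    let ?P = "prm \<Otimes>\<^sub>M M"
    have Ym[measurable]: "Y t \<in> borel_measurable prm" and Yc: "cadlag (\<lambda>t. Y t \<omega>)" for t \<omega> using Y by (simp_all add: stable_levy_def)
    \<comment> \<open>The coupled version of the rescaled X: the compensated Poisson sum on one
      factor and, independently, the original initial value divided by 2n on the other.\<close>
    define W where "W n t p = M_proc (zeta.Kn n) (zeta.prof n) t (fst p) + X 0 (snd p) / (2 * real n)" for n t p
    have Mm[measurable]: "M_proc (zeta.Kn n) (zeta.prof n) t \<in> borel_measurable prm" for n t
      by (rule borel_measurable_M_proc[OF zeta.adm_prof])
    have Wm: "W n t \<in> borel_measurable ?P" for n t unfolding W_def[abs_def] by measurable
    have Wc: "cadlag (\<lambda>t. W n t p)" for n p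
      unfolding W_def by (intro cadlag_add cadlag_M_proc cadlag_continuous continuous_intros)
    \<comment> \<open>Equality in law of the rescaled process and its coupled version for each fixed
      n, by comparison of joint transforms.\<close>
    have eq: "(\<integral>\<omega>. F (\<lambda>t. X (2 * real n powr (1 + \<alpha>) * t) \<omega> / (2 * real n)) \<partial>M) = (\<integral>p. F (\<lambda>t. W n t p) \<partial>?P)" if n: "0 < n" for n
    proof -
      define c where "c = 2 * real n powr (1 + \<alpha>)"
      define b where "b = 2 * real n"
      have cb: "0 < c" "0 < b" using n by (auto simp: c_def b_def)
      \<comment> \<open>The transform of the initial value is left as it is: it occurs identically
        for both processes and needs only to be finite.\<close>
      define V where "V k ts l = (\<integral>\<^sup>+\<omega>. ennreal (exp (- (l k / b * X 0 \<omega>))) \<partial>M) * (\<Prod>j<k. ennreal (exp ((ts (Suc j) - ts j) * (c * psi0 \<alpha> (l j / b)))))"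
        for k :: nat and ts l :: "nat \<Rightarrow> real"
      have "(\<integral>\<omega>. F (\<lambda>t. X (c * t) \<omega> / b) \<partial>M) = (\<integral>p. F (\<lambda>t. W n t p) \<partial>?P)"
      proof (rule integral_skorokhod_eq_laplace[where V=V and B=B, OF F B])
        show "prob_space M" "prob_space ?P" by unfold_locales
        show "(\<lambda>\<omega>. X (c * t) \<omega> / b) \<in> borel_measurable M" for t by measurable
        show "cadlag (\<lambda>t. X (c * t) \<omega> / b)" for \<omega>
          unfolding X_def by (rule cadlag_poisson_sum[OF assms(7) cb(1)])
        show "W n t \<in> borel_measurable ?P" for t by (rule Wm)
        show "cadlag (\<lambda>t. W n t p)" for p by (rule Wc)
        fix k :: nat and ts l :: "nat \<Rightarrow> real"
        assume ts: "ts 0 = 0" "\<And>j. j < k \<Longrightarrow> ts j < ts (Suc j)" and l: "\<And>j. j \<le> k \<Longrightarrow> 0 \<le> l j"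
        have "(\<integral>\<^sup>+\<omega>. ennreal (exp (- (l k * (X (c * 0) \<omega> / b) + (\<Sum>j<k. l j * (X (c * ts (Suc j)) \<omega> / b - X (c * ts j) \<omega> / b))))) \<partial>M)
          = (\<integral>\<^sup>+\<omega>. ennreal (exp (- (l k / b * X 0 \<omega> + (\<Sum>j<k. l j / b * (X (c * ts (Suc j)) \<omega> - X (c * ts j) \<omega>))))) \<partial>M)"
          by (simp add: diff_divide_distrib right_diff_distrib)
        also have "\<dots> = (\<integral>\<^sup>+\<omega>. ennreal (exp (- (l k / b * X 0 \<omega>))) \<partial>M) * (\<Prod>j<k. ennreal (exp ((c * ts (Suc j) - c * ts j) * psi0 \<alpha> (l j / b))))"
          by (rule laplace_compound[OF \<alpha> Zm assms(6,7,8) X, of "\<lambda>j. c * ts j" k "\<lambda>j. l j / b"]) (use ts l cb in auto)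
        also have "\<dots> = V k ts l" unfolding V_def by (simp add: algebra_simps)
        finally have 1: "(\<integral>\<^sup>+\<omega>. ennreal (exp (- (l k * (X (c * 0) \<omega> / b) + (\<Sum>j<k. l j * (X (c * ts (Suc j)) \<omega> / b - X (c * ts j) \<omega> / b))))) \<partial>M) = V k ts l" .
        have "(\<integral>\<^sup>+\<omega>. ennreal (exp (- (l k / b * X 0 \<omega>))) \<partial>M) \<le> (\<integral>\<^sup>+\<omega>. ennreal (exp (l k / b * \<bar>Inf {}\<bar>)) \<partial>M)"
        proof (intro nn_integral_mono ennreal_leI)
          fix \<omega>
          have "l k / b * - \<bar>Inf {}\<bar> \<le> l k / b * X 0 \<omega>"
            unfolding X0 using l[of k] cb by (intro mult_left_mono hit_time_lower) auto
          then show "exp (- (l k / b * X 0 \<omega>)) \<le> exp (l k / b * \<bar>Inf {}\<bar>)" by simp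
        qed
        also have "\<dots> < \<infinity>" by (simp add: emeasure_space_1)
        finally have "V k ts l < \<infinity>"
          unfolding V_def by (simp add: ennreal_mult_less_top prod_ennreal)
        with 1 show "(\<integral>\<^sup>+\<omega>. ennreal (exp (- (l k * (X (c * 0) \<omega> / b) + (\<Sum>j<k. l j * (X (c * ts (Suc j)) \<omega> / b - X (c * ts j) \<omega> / b))))) \<partial>M) = V k ts l \<and> V k ts l < \<infinity>" by blast
        let ?M = "M_proc (zeta.Kn n) (zeta.prof n)"
        have "(\<integral>\<^sup>+p. ennreal (exp (- (l k * W n 0 p + (\<Sum>j<k. l j * (W n (ts (Suc j)) p - W n (ts j) p))))) \<partial>?P)
          = (\<integral>\<^sup>+p. ennreal (exp (- (\<Sum>j<k. l j * (?M (ts (Suc j)) (fst p) - ?M (ts j) (fst p))))) * ennreal (exp (- (l k / b * X 0 (snd p)))) \<partial>?P)"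
          by (intro nn_integral_cong) (simp add: W_def M_proc_0 b_def ennreal_mult'[symmetric] exp_add[symmetric])
        also have "\<dots> = (\<integral>\<^sup>+\<omega>. ennreal (exp (- (\<Sum>j<k. l j * (?M (ts (Suc j)) \<omega> - ?M (ts j) \<omega>)))) \<partial>prm) * (\<integral>\<^sup>+\<omega>. ennreal (exp (- (l k / b * X 0 \<omega>))) \<partial>M)"
          by (rule nn_integral_pair_prod) (unfold_locales, measurable)
        also have "(\<integral>\<^sup>+\<omega>. ennreal (exp (- (\<Sum>j<k. l j * (?M (ts (Suc j)) \<omega> - ?M (ts j) \<omega>)))) \<partial>prm)
           = (\<Prod>j<k. ennreal (exp ((ts (Suc j) - ts j) * kap (zeta.prof n) (l j))))"
          by (rule laplace_M_proc[OF zeta.adm_prof, where B=0]) (use ts l zeta.prof_nonneg in auto)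
        also have "\<dots> = (\<Prod>j<k. ennreal (exp ((ts (Suc j) - ts j) * (c * psi0 \<alpha> (l j / b)))))"
          by (intro prod.cong refl) (use zeta.prof_kfun(2)[OF n] l in \<open>simp add: c_def b_def\<close>)
        finally show "(\<integral>\<^sup>+p. ennreal (exp (- (l k * W n 0 p + (\<Sum>j<k. l j * (W n (ts (Suc j)) p - W n (ts j) p))))) \<partial>?P) = V k ts l"
          unfolding V_def by (simp only: mult.commute)
      qed
      then show ?thesis by (simp add: c_def b_def)
    qed
    \<comment> \<open>The given stable process and the constructed one live on different spaces but
      share their joint transform; both start at 0 almost surely, so the weight of the initial value
      disappears.\<close>
    have lim: "(\<integral>p. F (\<lambda>t. Y t (fst p)) \<partial>?P) = (\<integral>\<omega>. F (\<lambda>t. Xb t \<omega>) \<partial>N)"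
    proof (rule integral_skorokhod_eq_laplace[where B=B and V="\<lambda>k ts l. \<Prod>j<k. ennreal (exp ((ts (Suc j) - ts j) * stable_psi \<alpha> (l j)))", OF F B])
      show "prob_space ?P" by unfold_locales
      show "prob_space N" using Xb by (simp add: stable_levy_def)
      show "(\<lambda>p. Y t (fst p)) \<in> borel_measurable ?P" for t by measurable
      show "cadlag (\<lambda>t. Y t (fst p))" for p :: "(nat \<times> nat \<Rightarrow> nat \<times> (nat \<Rightarrow> real \<times> real)) \<times> 'a" by (rule Yc)
      show Xbm: "Xb t \<in> borel_measurable N" for t using Xb by (simp add: stable_levy_def)
      show "cadlag (\<lambda>t. Xb t \<omega>)" for \<omega> using Xb by (simp add: stable_levy_def)
      fix k :: nat and ts l :: "nat \<Rightarrow> real"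
      assume ts: "ts 0 = 0" "\<And>j. j < k \<Longrightarrow> ts j < ts (Suc j)" and l: "\<And>j. j \<le> k \<Longrightarrow> 0 \<le> l j"
      have "(\<integral>\<^sup>+p. ennreal (exp (- (l k * Y 0 (fst p) + (\<Sum>j<k. l j * (Y (ts (Suc j)) (fst p) - Y (ts j) (fst p)))))) \<partial>?P)
        = (\<integral>\<^sup>+p. ennreal (exp (- (\<Sum>j<k. l j * (Y (ts (Suc j)) (fst p) - Y (ts j) (fst p))))) * 1 \<partial>?P)" by (simp add: Y0)
      also have "\<dots> = (\<integral>\<^sup>+\<omega>. ennreal (exp (- (\<Sum>j<k. l j * (Y (ts (Suc j)) \<omega> - Y (ts j) \<omega>)))) \<partial>prm) * (\<integral>\<^sup>+\<omega>. 1 \<partial>M)"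
        by (rule nn_integral_pair_prod[where g="\<lambda>_. 1"]) (unfold_locales, measurable)
      also have "\<dots> = (\<Prod>j<k. ennreal (exp ((ts (Suc j) - ts j) * stable_psi \<alpha> (l j))))"
        using stable_levy_laplace[OF Y, of ts k l] ts l by (simp add: emeasure_space_1)
      finally show "(\<integral>\<^sup>+p. ennreal (exp (- (l k * Y 0 (fst p) + (\<Sum>j<k. l j * (Y (ts (Suc j)) (fst p) - Y (ts j) (fst p)))))) \<partial>?P)
        = (\<Prod>j<k. ennreal (exp ((ts (Suc j) - ts j) * stable_psi \<alpha> (l j)))) \<and> (\<Prod>j<k. ennreal (exp ((ts (Suc j) - ts j) * stable_psi \<alpha> (l j)))) < \<infinity>"
        by (simp add: prod_ennreal)
      have "AE \<omega> in N. Xb 0 \<omega> = 0" using Xb by (simp add: stable_levy_def)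
      then have "(\<integral>\<^sup>+\<omega>. ennreal (exp (- (l k * Xb 0 \<omega> + (\<Sum>j<k. l j * (Xb (ts (Suc j)) \<omega> - Xb (ts j) \<omega>))))) \<partial>N)
        = (\<integral>\<^sup>+\<omega>. ennreal (exp (- (\<Sum>j<k. l j * (Xb (ts (Suc j)) \<omega> - Xb (ts j) \<omega>)))) \<partial>N)"
        by (intro nn_integral_cong_AE) (auto elim!: eventually_mono)
      also have "\<dots> = (\<Prod>j<k. ennreal (exp ((ts (Suc j) - ts j) * stable_psi \<alpha> (l j))))"
        by (rule stable_levy_laplace[OF Xb]) (use ts l in auto)
      finally show "(\<integral>\<^sup>+\<omega>. ennreal (exp (- (l k * Xb 0 \<omega> + (\<Sum>j<k. l j * (Xb (ts (Suc j)) \<omega> - Xb (ts j) \<omega>))))) \<partial>N)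
        = (\<Prod>j<k. ennreal (exp ((ts (Suc j) - ts j) * stable_psi \<alpha> (l j))))" .
    qed
    have rs: "strict_mono (\<lambda>j. r (s j))" using r s by (simp add: strict_mono_def)
    have rs_top: "filterlim (\<lambda>j. real (r (s j))) at_top sequentially"
      using filterlim_compose[OF filterlim_real_sequentially filterlim_subseq[OF rs]] .
    have "(\<lambda>j. \<integral>p. F (\<lambda>t. W (r (s j)) t p) \<partial>?P) \<longlonglongrightarrow> (\<integral>p. F (\<lambda>t. Y t (fst p)) \<partial>?P)"
    proof (rule integral_dominated_convergence[where w="\<lambda>_. B"])
      show "(\<lambda>p. F (\<lambda>t. Y t (fst p))) \<in> borel_measurable ?P"
        by (rule borel_measurable_skorokhod[OF F]) (use Yc in auto)
      show "(\<lambda>p. F (\<lambda>t. W (r (s j)) t p)) \<in> borel_measurable ?P" for j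
        by (rule borel_measurable_skorokhod[OF F Wm Wc])
      show "integrable ?P (\<lambda>_. B)" by simp
      show "AE p in ?P. norm (F (\<lambda>t. W (r (s j)) t p)) \<le> B" for j using B by simp
      have "AE p in ?P. \<forall>T\<ge>0. \<forall>e>0. eventually (\<lambda>j. \<forall>t\<in>{0..T}.
        \<bar>M_proc (zeta.Kn (r (s j))) (zeta.prof (r (s j))) t (fst p) - Y t (fst p)\<bar> \<le> e) sequentially"
      proof -
        \<comment> \<open>The first marginal of the product space is the law of the random measure,
          so the almost sure statement lifts to pairs.\<close>
        have "AE \<omega> in distr ?P prm fst. \<forall>T\<ge>0. \<forall>e>0. eventually (\<lambda>j. \<forall>t\<in>{0..T}.
          \<bar>M_proc (zeta.Kn (r (s j))) (zeta.prof (r (s j))) t \<omega> - Y t \<omega>\<bar> \<le> e) sequentially"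
          unfolding distr_pair_fst by (rule AEc)
        then show ?thesis by (rule AE_distrD[rotated]) measurable
      qed
      then show "AE p in ?P. (\<lambda>j. F (\<lambda>t. W (r (s j)) t p)) \<longlonglongrightarrow> F (\<lambda>t. Y t (fst p))"
      proof eventually_elim
        case (elim p)
        have "skorokhod_conv (\<lambda>j t. W (r (s j)) t p) (\<lambda>t. Y t (fst p))"
        proof (rule skorokhod_conv_uniform)
          fix T e :: real assume T: "0 \<le> T" and e: "0 < e"
          have "eventually (\<lambda>j. \<forall>t\<in>{0..T}. \<bar>M_proc (zeta.Kn (r (s j))) (zeta.prof (r (s j))) t (fst p) - Y t (fst p)\<bar> \<le> e / 2) sequentially"
            using elim[rule_format, OF T, of "e / 2"] e by (simp only: half_gt_zero)
          \<comment> \<open>The initial value is one fixed real for each sample, so division by 2n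
            removes it in the limit, uniformly in t.\<close>
          moreover have "(\<lambda>j. X 0 (snd p) / (2 * real (r (s j)))) \<longlonglongrightarrow> 0"
            by (intro tendsto_divide_0[OF tendsto_const] filterlim_at_top_imp_at_infinity
                filterlim_tendsto_pos_mult_at_top[OF tendsto_const _ rs_top]) simp
          then have "eventually (\<lambda>j. dist (X 0 (snd p) / (2 * real (r (s j)))) 0 < e / 2) sequentially"
            using e by (intro tendstoD) auto
          ultimately show "eventually (\<lambda>j. \<forall>t\<in>{0..T}. \<bar>W (r (s j)) t p - Y t (fst p)\<bar> \<le> e) sequentially"
          proof eventually_elim
            case (elim j)
            show ?case
            proof
              fix t assume t: "t \<in> {0..T}"
              define x where "x = X 0 (snd p) / (2 * real (r (s j)))"
              define y where "y = M_proc (zeta.Kn (r (s j))) (zeta.prof (r (s j))) t (fst p) - Y t (fst p)"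
              have "\<bar>x\<bar> < e / 2" "\<bar>y\<bar> \<le> e / 2" using elim t by (auto simp: x_def y_def dist_real_def)
              then have "\<bar>x + y\<bar> \<le> e" unfolding abs_le_iff abs_less_iff by linarith
              then show "\<bar>W (r (s j)) t p - Y t (fst p)\<bar> \<le> e" by (simp add: W_def x_def y_def algebra_simps)
            qed
          qed
        qed
        then show ?case
          using F[unfolded skorokhod_continuous_def, rule_format, of "\<lambda>j t. W (r (s j)) t p" "\<lambda>t. Y t (fst p)"] Wc Yc by simp
      qed
    qed
    then have "(\<lambda>j. \<integral>p. F (\<lambda>t. W (r (s j)) t p) \<partial>?P) \<longlonglongrightarrow> (\<integral>\<omega>. F (\<lambda>t. Xb t \<omega>) \<partial>N)" unfolding lim .
    then have "(\<lambda>j. \<integral>\<omega>. F (\<lambda>t. X (2 * real (r (s j)) powr (1 + \<alpha>) * t) \<omega> / (2 * real (r (s j)))) \<partial>M) \<longlonglongrightarrow> (\<integral>\<omega>. F (\<lambda>t. Xb t \<omega>) \<partial>N)"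
    proof (rule Lim_transform_eventually)
      show "eventually (\<lambda>j. (\<integral>p. F (\<lambda>t. W (r (s j)) t p) \<partial>?P)
        = (\<integral>\<omega>. F (\<lambda>t. X (2 * real (r (s j)) powr (1 + \<alpha>) * t) \<omega> / (2 * real (r (s j)))) \<partial>M)) sequentially"
        using eventually_gt_at_top[of 0]
      proof eventually_elim
        case (elim j)
        \<comment> \<open>The equality in law is available for positive n only; a strictly
          increasing index sequence satisfies this from j = 1 on.\<close>
        then have "0 < r (s j)" using seq_suble[OF rs, of j] by simp
        then show ?case by (rule eq[symmetric])
      qed
    qed
    then show "\<exists>s. strict_mono (s :: nat \<Rightarrow> nat) \<and>
      (\<lambda>j. \<integral>\<omega>. F (\<lambda>t. X (2 * real (r (s j)) powr (1 + \<alpha>) * t) \<omega> / (2 * real (r (s j)))) \<partial>M) \<longlonglongrightarrow> (\<integral>\<omega>. F (\<lambda>t. Xb t \<omega>) \<partial>N)"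
      using s by blast
  qed
  show ?thesis using zeta.stable_levy_exists conv by blast
qed

end
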